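(* Let $n\to\infty$ and $p=p_n\to\infty$, and let $\kappa_n=\tau_n p^{3/4}/\sqrt n$ with $\tau_n\to\tau\in(0,\infty)$. For each $n$, let $X_1,\dots,X_n$ be i.i.d. from an FvML distribution on $\mathbb{S}^{p-1}$ with concentration parameter $\kappa_n$. Then $$\sqrt{\frac{n(n-1)}{2}}\,T_n\xrightarrow{d}\sup_{t\in[0,1]}\Big|B_t-\frac{\tau^2}{\sqrt2}\,\phi\big(\Phi^{-1}(t)\big)\Big| ,$$ where $(B_t)_{0\le t\le1}$ is a standard Brownian bridge.
   Context: $\mathbb{S}^{p-1}=\{x\in\mathbb{R}^p:\|x\|_2=1\}$ and $\mu_0$ is the uniform distribution on it. The FvML distribution with concentration $\kappa>0$ and (arbitrary) location $\theta\in\mathbb{S}^{p-1}$ has density proportional to $x\mapsto\exp(\kappa\,x^\top\theta)$ with respect to $\mu_0$. The statistic is $$T_n=\sup_{t\in[-1,1]}\Big|\frac{2}{n(n-1)}\sum_{1\le i<j\le n}\mathbf 1_{\{X_i^\top X_j\le t\}}-m(t)\Big|,$$ where $m(t)=\mathbb{P}(X^\top Y\le t)$ for $X,Y$ i.i.d. uniform on $\mathbb{S}^{p-1}$. $\Phi$ and $\phi(x)=(2\pi)^{-1/2}e^{-x^2/2}$ are the CDF and density of the standard normal, and $\phi(\Phi^{-1}(t))$ is understood as $0$ at $t=0,1$. *)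

theory Defs
  imports "HOL-Probability.Probability"
begin

text \<open>The dimension varies along the sequence, so vectors of \<open>\<real>\<^sup>p\<close> are extensional functions on
  \<open>{..<p}\<close>, i.e. points of the product space \<open>rvec p\<close>.\<close>

definition rvec :: "nat \<Rightarrow> (nat \<Rightarrow> real) measure" where
  "rvec p = (\<Pi>\<^sub>M k\<in>{..<p}. borel)"

definition dot :: "nat \<Rightarrow> (nat \<Rightarrow> real) \<Rightarrow> (nat \<Rightarrow> real) \<Rightarrow> real" where
  "dot p x y = (\<Sum>k<p. x k * y k)"

definition norm2 :: "nat \<Rightarrow> (nat \<Rightarrow> real) \<Rightarrow> real" where
  "norm2 p x = sqrt (\<Sum>k<p. (x k)\<^sup>2)"

definition unit_sphere :: "nat \<Rightarrow> (nat \<Rightarrow> real) set" where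
  "unit_sphere p = {x \<in> space (rvec p). norm2 p x = 1}"

definition unit_ball :: "nat \<Rightarrow> (nat \<Rightarrow> real) set" where
  "unit_ball p = {x \<in> space (rvec p). norm2 p x \<le> 1}"

definition normalise :: "nat \<Rightarrow> (nat \<Rightarrow> real) \<Rightarrow> nat \<Rightarrow> real" where
  "normalise p x = (\<lambda>k\<in>{..<p}. x k / norm2 p x)"

text \<open>Normalised surface measure in its cone form: a Borel set \<open>A\<close> of the sphere gets the share of
  the volume of the unit ball that is taken by the cone \<open>{r x | 0 < r \<le> 1, x \<in> A}\<close>.
  It is a measure on \<open>rvec p\<close>, concentrated on \<open>unit_sphere p\<close> (see
  \<open>AE_unif_sphere\<close>).\<close>

definition unif_sphere :: "nat \<Rightarrow> (nat \<Rightarrow> real) measure" where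
  "unif_sphere p =
     distr (uniform_measure (\<Pi>\<^sub>M k\<in>{..<p}. lborel) (unit_ball p)) (rvec p) (normalise p)"

definition FvML :: "nat \<Rightarrow> real \<Rightarrow> (nat \<Rightarrow> real) \<Rightarrow> (nat \<Rightarrow> real) measure" where
  "FvML p \<kappa> \<theta> = density (unif_sphere p)
     (\<lambda>x. ennreal (exp (\<kappa> * dot p x \<theta>) / (\<integral>y. exp (\<kappa> * dot p y \<theta>) \<partial>unif_sphere p)))"

definition m_unif :: "nat \<Rightarrow> real \<Rightarrow> real" where
  "m_unif p t = measure (unif_sphere p \<Otimes>\<^sub>M unif_sphere p)
     {(x, y) \<in> space (rvec p \<Otimes>\<^sub>M rvec p). dot p x y \<le> t}"

definition T_stat :: "nat \<Rightarrow> nat \<Rightarrow> (nat \<Rightarrow> nat \<Rightarrow> real) \<Rightarrow> real" where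
  "T_stat p n x = (SUP t\<in>{-1..1}.
     \<bar>2 / (real n * (real n - 1)) * (\<Sum>(i, j)\<in>{(i, j). 1 \<le> i \<and> i < j \<and> j \<le> n}. of_bool (dot p (x i) (x j) \<le> t))
       - m_unif p t\<bar>)"

definition std_normal_cdf :: "real \<Rightarrow> real" where
  "std_normal_cdf = cdf std_normal_distribution"

definition phi_quantile :: "real \<Rightarrow> real" where
  "phi_quantile t =
     (if 0 < t \<and> t < 1 then std_normal_density (inv std_normal_cdf t) else 0)"

text \<open>Centred normal law with variance \<open>v \<ge> 0\<close>; \<open>v = 0\<close> is the point mass at 0.\<close>

definition centred_normal :: "real \<Rightarrow> real measure" where
  "centred_normal v =
     (if v = 0 then return borel 0 else density lborel (normal_density 0 (sqrt v)))"

text \<open>Continuous centred Gaussian process on \<open>[0,1]\<close> with covariance \<open>min s t - s t\<close>; joint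
  Gaussianity is expressed through all finite linear combinations.\<close>

definition brownian_bridge :: "'b measure \<Rightarrow> (real \<Rightarrow> 'b \<Rightarrow> real) \<Rightarrow> bool" where
  "brownian_bridge P B \<longleftrightarrow>
     prob_space P \<and>
     (\<forall>t\<in>{0..1}. B t \<in> borel_measurable P) \<and>
     (\<forall>S a. finite S \<and> S \<subseteq> {0..1} \<longrightarrow>
        distr P borel (\<lambda>\<omega>. \<Sum>t\<in>S. a t * B t \<omega>) =
          centred_normal (\<Sum>s\<in>S. \<Sum>t\<in>S. a s * a t * (min s t - s * t))) \<and>
     (\<forall>\<omega>\<in>space P. continuous_on {0..1} (\<lambda>t. B t \<omega>))"

lemma rvec_eq_lborel: "sets (\<Pi>\<^sub>M k\<in>{..<p}. lborel) = sets (rvec p)"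
  unfolding rvec_def by (intro sets_PiM_cong) auto

lemma measurable_norm2 [measurable]: "norm2 p \<in> borel_measurable (rvec p)"
  unfolding norm2_def rvec_def by measurable

lemma measurable_normalise [measurable]: "normalise p \<in> rvec p \<rightarrow>\<^sub>M rvec p"
proof -
  have [measurable]: "norm2 p \<in> borel_measurable (\<Pi>\<^sub>M k\<in>{..<p}. borel)"
    using measurable_norm2[of p] by (simp add: rvec_def)
  show ?thesis
    unfolding normalise_def rvec_def by measurable
qed

lemma unit_ball_sets [measurable]: "unit_ball p \<in> sets (rvec p)"
  unfolding unit_ball_def by measurable

lemma unit_sphere_sets [measurable]: "unit_sphere p \<in> sets (rvec p)"
  unfolding unit_sphere_def by measurable

lemma emeasure_unit_ball:
  "emeasure (\<Pi>\<^sub>M k\<in>{..<p}. lborel) (unit_ball p) \<noteq> 0"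
  "emeasure (\<Pi>\<^sub>M k\<in>{..<p}. lborel) (unit_ball p) \<noteq> \<infinity>"
proof -
  interpret product_sigma_finite "\<lambda>_::nat. lborel :: real measure"
    by unfold_locales
  define r where "r = 1 / sqrt (real (Suc p))"
  have r: "r > 0" "r\<^sup>2 * real p \<le> 1" by (auto simp: r_def power_divide)
  have sub1: "(\<Pi>\<^sub>E k\<in>{..<p}. {-r..r}) \<subseteq> unit_ball p"
  proof
    fix x assume x: "x \<in> (\<Pi>\<^sub>E k\<in>{..<p}. {-r..r})"
    have "(\<Sum>k<p. (x k)\<^sup>2) \<le> (\<Sum>k<p. r\<^sup>2)"
    proof (intro sum_mono)
      fix k assume "k \<in> {..<p}"
      then have "x k \<in> {-r..r}" using x by (auto simp: PiE_iff)
      then show "(x k)\<^sup>2 \<le> r\<^sup>2" using r(1) by (simp add: power2_le_iff_abs_le abs_le_iff)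
    qed
    also have "\<dots> \<le> 1" using r by (simp add: mult.commute)
    finally show "x \<in> unit_ball p"
      using x by (auto simp: unit_ball_def norm2_def rvec_def space_PiM PiE_iff)
  qed
  have sub2: "unit_ball p \<subseteq> (\<Pi>\<^sub>E k\<in>{..<p}. {-1..1})"
  proof
    fix x assume x: "x \<in> unit_ball p"
    have le: "(\<Sum>k<p. (x k)\<^sup>2) \<le> 1" using x by (auto simp: unit_ball_def norm2_def)
    have "x k \<in> {-1..1}" if "k < p" for k
    proof -
      have "(x k)\<^sup>2 \<le> (\<Sum>k<p. (x k)\<^sup>2)"
        by (rule member_le_sum) (use that in auto)
      with le have "(x k)\<^sup>2 \<le> 1" by simp
      then have "\<bar>x k\<bar> \<le> 1" by (simp add: abs_square_le_1)
      then show ?thesis by auto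
    qed
    then show "x \<in> (\<Pi>\<^sub>E k\<in>{..<p}. {-1..1})"
      using x by (auto simp: unit_ball_def rvec_def space_PiM PiE_iff)
  qed
  have box: "emeasure (\<Pi>\<^sub>M k\<in>{..<p}. lborel) (\<Pi>\<^sub>E k\<in>{..<p}. {-c..c}) = ennreal (2 * c) ^ p"
    if "c > 0" for c :: real
    using that by (subst emeasure_PiM) auto
  have bs: "unit_ball p \<in> sets (\<Pi>\<^sub>M k\<in>{..<p}. lborel)"
    by (simp add: rvec_eq_lborel)
  have "0 < ennreal (2 * r) ^ p" using r by (simp add: ennreal_power)
  also have "\<dots> \<le> emeasure (\<Pi>\<^sub>M k\<in>{..<p}. lborel) (unit_ball p)"
    using emeasure_mono[OF sub1 bs] box[OF r(1)] by simp
  finally show "emeasure (\<Pi>\<^sub>M k\<in>{..<p}. lborel) (unit_ball p) \<noteq> 0" by simp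
  have "emeasure (\<Pi>\<^sub>M k\<in>{..<p}. lborel) (unit_ball p) \<le>
      emeasure (\<Pi>\<^sub>M k\<in>{..<p}. lborel) (\<Pi>\<^sub>E k\<in>{..<p}. {-1..1::real})"
    by (rule emeasure_mono[OF sub2], rule sets_PiM_I_finite) auto
  also have "\<dots> = ennreal (2 * 1) ^ p" using box[of 1] by simp
  also have "\<dots> < \<infinity>" by (simp add: power_less_top_ennreal)
  finally show "emeasure (\<Pi>\<^sub>M k\<in>{..<p}. lborel) (unit_ball p) \<noteq> \<infinity>" by simp
qed

lemma prob_space_unif_sphere: "prob_space (unif_sphere p)"
proof -
  interpret prob_space "uniform_measure (\<Pi>\<^sub>M k\<in>{..<p}. lborel) (unit_ball p)"
    by (rule prob_space_uniform_measure[OF emeasure_unit_ball])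
  have "normalise p \<in> uniform_measure (\<Pi>\<^sub>M k\<in>{..<p}. lborel) (unit_ball p) \<rightarrow>\<^sub>M rvec p"
    using measurable_normalise[of p] measurable_cong_sets[OF rvec_eq_lborel refl]
    by (simp add: measurable_def rvec_eq_lborel space_PiM rvec_def)
  then show ?thesis unfolding unif_sphere_def by (rule prob_space_distr)
qed

lemma AE_unif_sphere:
  assumes "p > 0"
  shows "AE x in unif_sphere p. x \<in> unit_sphere p"
proof -
  interpret product_sigma_finite "\<lambda>_::nat. lborel :: real measure"
    by unfold_locales
  let ?L = "\<Pi>\<^sub>M k\<in>{..<p}. (lborel :: real measure)"
  have meas: "normalise p \<in> uniform_measure ?L (unit_ball p) \<rightarrow>\<^sub>M rvec p"
    using measurable_normalise[of p] measurable_cong_sets[OF rvec_eq_lborel refl]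
    by (simp add: measurable_def rvec_eq_lborel space_PiM rvec_def)
  have on: "normalise p x \<in> unit_sphere p" if "norm2 p x \<noteq> 0" for x
  proof -
    have ss: "(\<Sum>k<p. (x k)\<^sup>2) \<ge> 0" by (intro sum_nonneg) auto
    have "(\<Sum>k<p. (normalise p x k)\<^sup>2) = (\<Sum>k<p. (x k)\<^sup>2) / (norm2 p x)\<^sup>2"
      by (simp add: normalise_def power_divide sum_divide_distrib)
    also have "\<dots> = 1" using that ss by (auto simp: norm2_def)
    finally show ?thesis
      by (auto simp: unit_sphere_def norm2_def normalise_def rvec_def space_PiM)
  qed
  have "emeasure ?L (\<Pi>\<^sub>E k\<in>{..<p}. {0}) = 0"
    using assms by (subst emeasure_PiM) (auto simp: card_gt_0_iff)
  moreover have "(\<Pi>\<^sub>E k\<in>{..<p}. {0}) \<in> sets ?L" by (rule sets_PiM_I_finite) auto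
  ultimately have "(\<Pi>\<^sub>E k\<in>{..<p}. {0}) \<in> null_sets ?L" by auto
  then have "AE x in ?L. norm2 p x \<noteq> 0"
  proof (rule AE_I', intro subsetI)
    fix x assume x: "x \<in> {x \<in> space ?L. \<not> norm2 p x \<noteq> 0}"
    then have "\<forall>k<p. x k = 0"
      by (auto simp: norm2_def sum_nonneg_eq_0_iff)
    then show "x \<in> (\<Pi>\<^sub>E k\<in>{..<p}. {0})" using x
      by (auto simp: space_PiM PiE_iff PiE_singleton extensional_def restrict_def fun_eq_iff)
  qed
  then have "AE x in uniform_measure ?L (unit_ball p). norm2 p x \<noteq> 0"
    by (intro AE_uniform_measureI) (auto simp: rvec_eq_lborel)
  then have "AE x in uniform_measure ?L (unit_ball p). normalise p x \<in> unit_sphere p"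
    by (rule eventually_mono) (rule on)
  then show ?thesis
    unfolding unif_sphere_def
    by (subst AE_distr_iff[OF meas]) (auto simp: unit_sphere_def)
qed

end

theory Submission
  imports Defs "HOL-Real_Asymp.Real_Asymp"
begin

text \<open>The statistic is rotation invariant, so its law under the alternative has a density with respect
  to uniform sampling that may be averaged over the location. The averaged likelihood ratio depends on
  the sample only through the normalised sum \<open>R\<close> of the inner products \<open>X\<^sub>i \<cdot> X\<^sub>j\<close>, and it tends to
  \<open>exp (c R - c\<^sup>2 / 2)\<close> with \<open>c = \<tau>\<^sup>2 / sqrt 2\<close>, locally uniformly in \<open>R\<close>. Under uniform sampling the
  centred indicators and inner products are degenerate kernels, and their U-statistics obey a central
  limit theorem: jointly, the empirical process of the inner products tends to a Brownian bridge and
  \<open>R\<close> to a standard normal variable, with covariance \<open>- \<phi> (\<Phi>\<^sup>-\<^sup>1 t)\<close>. Le Cam's third lemma turns this covariance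
  into the drift. Fourth moments of the increments and chaining along dyadic quantiles control the
  supremum under uniform sampling, and contiguity carries this bound over to the alternative.\<close>

text \<open>The central limit theorem has to hold without any relation between \<open>n\<close> and
  \<open>p n\<close>. It is proved by peeling sample points off the characteristic function one at a
  time; conditional variances are constant up to a U-statistic of the squared kernel, whose size is
  an expectation over four-cycles x z y z' of points. In high dimension the inner products along
  such a cycle become independent, so it vanishes. Reflections are the only rotations used, since
  one reflection exchanges any two points of the sphere. The Bessel function in the normalising
  constant is an expectation over a Poisson variable: the exponential series in x = r^2/(2p), damped
  by coefficients close to exp(-k(k-1)/p). For the averaged likelihood x is about \<tau>^2 sqrt p /
  2, so x^2/p tends to \<tau>^4/4 = c^2/2. This is the correction in exp(cR - c^2/2) and the reason
  why p^(3/4)/sqrt n is the critical rate. The fourth moment of an increment, of order \<delta>^2 +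
  \<delta>/n, supports chaining only down to a mesh of order 1/n; below that, monotonicity of the
  empirical distribution function takes over.\<close>

declare One_nat_def [simp del]

type_synonym rseq = "nat \<Rightarrow> real"
type_synonym sample_pts = "nat \<Rightarrow> rseq"

lemmas lint_cong = Bochner_Integration.integral_cong and lint_nonneg = Bochner_Integration.integral_nonneg
  and lint_sum = Bochner_Integration.integral_sum and lintegrable_sum = Bochner_Integration.integrable_sum
  and lintegrable_bound = Bochner_Integration.integrable_bound

abbreviation \<mu> :: "nat \<Rightarrow> rseq measure" where "\<mu> \<equiv> unif_sphere"
abbreviation \<mu>2 :: "nat \<Rightarrow> (rseq \<times> rseq) measure" where "\<mu>2 p \<equiv> \<mu> p \<Otimes>\<^sub>M \<mu> p"
abbreviation hs :: "nat \<Rightarrow> real \<Rightarrow> real \<Rightarrow> real" where "hs p \<alpha> t \<equiv> indicat_real {..\<alpha>} (sqrt p * t)"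
abbreviation \<N> :: "real measure" where "\<N> \<equiv> std_normal_distribution"

interpretation U: prob_space "\<mu> p" for p by (rule prob_space_unif_sphere)
interpretation N: real_distribution \<N> by (rule real_dist_normal_dist)

section \<open>Degenerate U-statistics\<close>

lemma atLeastAtMost_Suc_insert: "{1..Suc m} = insert (Suc m) {1..m}" by auto

context prob_space
begin

lemma integrable_bounded:
  fixes f :: "'a \<Rightarrow> 'b::{banach,second_countable_topology}"
  assumes "f \<in> borel_measurable M" "\<And>x. x \<in> space M \<Longrightarrow> norm (f x) \<le> C"
  shows "integrable M f" using assms by (intro integrable_const_bound[of f C]) auto

lemma norm_integral_le_const:
  fixes f :: "'a \<Rightarrow> 'b::{banach,second_countable_topology}"
  assumes "f \<in> borel_measurable M" "\<And>x. x \<in> space M \<Longrightarrow> norm (f x) \<le> C"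
  shows "norm (LINT x|M. f x) \<le> C"
proof -
  have "norm (LINT x|M. f x) \<le> (LINT x|M. norm (f x))" by (rule integral_norm_bound)
  also have "... \<le> (LINT x|M. C)" using assms by (intro integral_mono integrable_norm integrable_bounded) auto
  finally show ?thesis by (simp add: prob_space)
qed

lemma cauchy_schwarz_bounded:
  fixes f g :: "'a \<Rightarrow> real"
  assumes [measurable]: "f \<in> borel_measurable M" "g \<in> borel_measurable M"
    and f: "\<And>x. x \<in> space M \<Longrightarrow> \<bar>f x\<bar> \<le> C" and g: "\<And>x. x \<in> space M \<Longrightarrow> \<bar>g x\<bar> \<le> D"
  shows "(LINT x|M. \<bar>f x * g x\<bar>) \<le> sqrt (LINT x|M. (f x)\<^sup>2) * sqrt (LINT x|M. (g x)\<^sup>2)"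
proof -
  have "integrable M (\<lambda>x. (f x)\<^sup>2)" "integrable M (\<lambda>x. (g x)\<^sup>2)"
    using power_mono[OF f abs_ge_zero, of _ 2] power_mono[OF g abs_ge_zero, of _ 2] by (auto intro!: integrable_bounded simp: power_abs[symmetric])
  note i = this
  have "(LINT x|M. \<bar>f x * g x\<bar>)\<^sup>2 \<le> (LINT x|M. (f x)\<^sup>2) * (LINT x|M. (g x)\<^sup>2)"
    using Cauchy_Schwarz_nn_integral[of "\<lambda>x. \<bar>f x\<bar>" M "\<lambda>x. \<bar>g x\<bar>"]
  proof -
    have I: "integrable M (\<lambda>x. \<bar>f x * g x\<bar>)"
      using mult_mono[OF f g] by (intro integrable_bounded[of _ "\<bar>C\<bar>*\<bar>D\<bar>"]) (auto simp: abs_mult intro!: mult_mono intro: order_trans[OF f] order_trans[OF g])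
    have "(\<integral>\<^sup>+x. ennreal \<bar>f x\<bar> * ennreal \<bar>g x\<bar> \<partial>M) = ennreal (LINT x|M. \<bar>f x * g x\<bar>)"
      using I by (subst nn_integral_eq_integral[symmetric]) (auto simp: abs_mult ennreal_mult')
    moreover have "(\<integral>\<^sup>+x. (ennreal \<bar>f x\<bar>)^2 \<partial>M) = ennreal (LINT x|M. (f x)\<^sup>2)"
      using i by (subst nn_integral_eq_integral[symmetric]) (auto simp: ennreal_power)
    moreover have "(\<integral>\<^sup>+x. (ennreal \<bar>g x\<bar>)^2 \<partial>M) = ennreal (LINT x|M. (g x)\<^sup>2)"
      using i by (subst nn_integral_eq_integral[symmetric]) (auto simp: ennreal_power)
    ultimately show ?thesis using Cauchy_Schwarz_nn_integral[of "\<lambda>x. ennreal \<bar>f x\<bar>" M "\<lambda>x. ennreal \<bar>g x\<bar>"]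
      by (simp add: ennreal_power ennreal_mult'[symmetric] integral_nonneg)
  qed
  then show ?thesis by (metis real_le_rsqrt real_sqrt_mult)
qed

abbreviation sample :: "nat \<Rightarrow> (nat \<Rightarrow> 'a) measure" where
  "sample m \<equiv> PiM {1..m} (\<lambda>_. M)"

lemma prob_space_sample: "prob_space (sample m)" by (intro prob_space_PiM prob_space_axioms)

lemma sample_upd_in_space:
  "x \<in> space (sample m) \<Longrightarrow> y \<in> space M \<Longrightarrow> x(Suc m := y) \<in> space (sample (Suc m))"
  unfolding atLeastAtMost_Suc_insert space_PiM by (intro PiE_fun_upd) auto

lemma sample_component: "x \<in> space (sample m) \<Longrightarrow> i \<in> {1..m} \<Longrightarrow> x i \<in> space M"
  by (auto simp: space_PiM PiE_iff)

lemma measurable_sample_upd [measurable]: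
  "(\<lambda>(x, y). x(Suc m := y)) \<in> sample m \<Otimes>\<^sub>M M \<rightarrow>\<^sub>M sample (Suc m)"
  unfolding atLeastAtMost_Suc_insert by (rule measurable_add_dim)

lemma integral_sample_Suc:
  fixes f :: "(nat \<Rightarrow> 'a) \<Rightarrow> 'b::{banach,second_countable_topology}"
  assumes f: "f \<in> borel_measurable (sample (Suc m))"
    and b: "\<And>x. x \<in> space (sample (Suc m)) \<Longrightarrow> norm (f x) \<le> C"
  shows "(LINT x|sample (Suc m). f x) = (LINT x|sample m. LINT y|M. f (x(Suc m := y)))"
proof -
  interpret product_sigma_finite "\<lambda>_::nat. M" ..
  interpret S: prob_space "sample (Suc m)" by (rule prob_space_sample)
  have "integrable (sample (Suc m)) f" using S.integrable_bounded[OF f b] .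
  then show ?thesis unfolding atLeastAtMost_Suc_insert by (subst product_integral_insert) auto
qed

text \<open>Induction on \<open>m\<close>, integrating out the last coordinate: terms linear in it
  vanish. In the fourth power the term with \<open>f ^ 3\<close> survives, but it carries the factor
  \<open>S m\<close>, whose mean is zero; the term with both squares produces the leading
  \<open>3 * m^2 * v^2\<close>.\<close>

lemma
  fixes f :: "'a \<Rightarrow> real"
  assumes [measurable]: "f \<in> borel_measurable M"
    and b: "\<And>x. x \<in> space M \<Longrightarrow> \<bar>f x\<bar> \<le> C"
    and 0: "(LINT x|M. f x) = 0" and v: "(LINT x|M. (f x)\<^sup>2) = v"
  shows iid_sum_mean: "(LINT x|sample m. (\<Sum>i\<in>{1..m}. f (x i))) = 0"
    and iid_sum_second_moment: "(LINT x|sample m. (\<Sum>i\<in>{1..m}. f (x i))\<^sup>2) = real m * v"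
    and iid_sum_fourth_moment: "(LINT x|M. (f x)^4) \<le> K \<Longrightarrow>
      (LINT x|sample m. (\<Sum>i\<in>{1..m}. f (x i))^4) \<le> real m * K + 3 * (real m)\<^sup>2 * v\<^sup>2"
proof -
  have "C \<ge> 0" using b not_empty by (metis abs_ge_zero ex_in_conv order_trans)
  define S where "S m x = (\<Sum>i\<in>{1..m}. f (x i))" for m :: nat and x
  have Sm [measurable]: "S m \<in> borel_measurable (sample m)" for m unfolding S_def by measurable
  have Sb: "\<bar>S m x\<bar> \<le> real m * C" if "x \<in> space (sample m)" for m x
  proof -
    have "\<bar>S m x\<bar> \<le> (\<Sum>i\<in>{1..m}. \<bar>f (x i)\<bar>)" unfolding S_def by (rule sum_abs)
    also have "... \<le> (\<Sum>i\<in>{1..m}. C)" by (intro sum_mono b sample_component[OF that])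
    finally show ?thesis by simp
  qed
  have Spb: "norm (S m x ^ k) \<le> (real m * C)^k" if "x \<in> space (sample m)" for m x k
    using power_mono[OF Sb[OF that] abs_ge_zero, of k] by (simp add: power_abs)
  have SI: "integrable (sample m) (\<lambda>x. S m x ^ k)" for m k by (rule prob_space.integrable_bounded[OF prob_space_sample _ Spb]) auto
  have fI: "integrable M (\<lambda>x. f x ^ k)" for k
    using power_mono[OF b abs_ge_zero, of _ k] by (intro integrable_bounded[of _ "C^k"]) (auto simp: power_abs)
  note fI' = fI[of 1, simplified] fI
  note SI' = SI[of _ 1, simplified] SI
  have SS: "S (Suc m) (x(Suc m := y)) = S m x + f y" for m x y
  proof -
    have "S (Suc m) (x(Suc m := y)) = f y + (\<Sum>i\<in>{1..m}. f ((x(Suc m := y)) i))"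
      unfolding S_def atLeastAtMost_Suc_insert by (subst sum.insert) auto
    also have "(\<Sum>i\<in>{1..m}. f ((x(Suc m := y)) i)) = S m x" unfolding S_def by (intro sum.cong) auto
    finally show ?thesis by (metis add.commute)
  qed
  have step: "(LINT x|sample (Suc m). S (Suc m) x ^ k) = (LINT x|sample m. LINT y|M. (S m x + f y)^k)" for m k
    by (subst integral_sample_Suc[OF _ Spb]) (auto simp: SS)
  have m1: "(LINT x|sample m. S m x) = 0" for m
  proof (induction m)
    case 0 then show ?case by (simp add: S_def)
  next
    case (Suc m)
    have "(LINT y|M. (S m x + f y)^1) = S m x" for x using fI' 0 by (simp add: prob_space)
    then show ?case using step[of m 1] Suc by simp
  qed
  show "(LINT x|sample m. (\<Sum>i\<in>{1..m}. f (x i))) = 0" using m1 by (simp add: S_def)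
  have m2: "(LINT x|sample m. S m x ^ 2) = real m * v" for m
  proof (induction m)
    case 0 then show ?case by (simp add: S_def)
  next
    case (Suc m)
    interpret S: prob_space "sample m" by (rule prob_space_sample)
    have "(LINT y|M. (S m x + f y)^2) = S m x^2 + v" for x using fI' 0 v by (simp add: power2_sum prob_space)
    then show ?case using step[of m 2] Suc SI' by (simp add: S.prob_space algebra_simps)
  qed
  show "(LINT x|sample m. (\<Sum>i\<in>{1..m}. f (x i))^2) = real m * v" using m2 by (simp add: S_def)
  assume K: "(LINT x|M. (f x)^4) \<le> K"
  have "(LINT x|sample m. S m x ^ 4) \<le> real m * K + 3 * (real m)\<^sup>2 * v\<^sup>2" for m
  proof (induction m)
    case 0 then show ?case by (simp add: S_def)
  next
    case (Suc m)
    interpret S: prob_space "sample m" by (rule prob_space_sample)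
    have e: "(a + c)^4 = a^4 + 4*a^3*c + 6 * a^2*c^2 + 4*a*c^3 + c^4" for a c :: real
      by (simp add: power4_eq_xxxx power3_eq_cube power2_eq_square algebra_simps)
    have "(LINT y|M. (S m x + f y)^4) = S m x^4 + 6 * S m x^2 * v + 4 * S m x * (LINT x|M. (f x)^3) + (LINT x|M. (f x)^4)" for x
      unfolding e using fI' 0 v by (simp add: prob_space)
    then have "(LINT x|sample (Suc m). S (Suc m) x ^ 4) = (LINT x|sample m. S m x ^ 4) + 6 * real m * v^2 + (LINT x|M. (f x)^4)"
      using step[of m 4] SI' m1[of m] m2[of m] by (simp add: S.prob_space power2_eq_square[of v])
    also have "... \<le> real m * K + 3 * (real m)\<^sup>2 * v\<^sup>2 + 6 * real m * v^2 + K" using Suc K by simp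
    also have "... \<le> real (Suc m) * K + 3 * (real (Suc m))\<^sup>2 * v\<^sup>2" by (simp add: power2_eq_square algebra_simps)
    finally show ?case .
  qed
  then show "(LINT x|sample m. (\<Sum>i\<in>{1..m}. f (x i))^4) \<le> real m * K + 3 * (real m)\<^sup>2 * v\<^sup>2" by (simp add: S_def)
qed

text \<open>Old points and new point are kept on one product space, so that Cauchy-Schwarz can be
  applied to products of the old statistic and its increment.\<close>

lemma integral_sample_Suc_pair:
  fixes f :: "(nat \<Rightarrow> 'a) \<Rightarrow> 'b::{banach,second_countable_topology}"
  assumes f [measurable]: "f \<in> borel_measurable (sample (Suc m))"
    and b: "\<And>x. x \<in> space (sample (Suc m)) \<Longrightarrow> norm (f x) \<le> C"
  shows "(LINT x|sample (Suc m). f x) = (LINT z|(sample m \<Otimes>\<^sub>M M). f ((fst z)(Suc m := snd z)))"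
proof -
  interpret S: prob_space "sample m" by (rule prob_space_sample)
  interpret P: pair_prob_space "sample m" M ..
  have "(\<lambda>(x, y). f (x(Suc m := y))) \<in> borel_measurable (sample m \<Otimes>\<^sub>M M)"
    using measurable_compose[OF measurable_sample_upd f] by (simp add: case_prod_beta')
  then have "integrable (sample m \<Otimes>\<^sub>M M) (\<lambda>z. f ((fst z)(Suc m := snd z)))" by (intro P.P.integrable_bounded[of _ C] b)
       (auto simp: case_prod_beta' space_pair_measure intro!: sample_upd_in_space)
  from P.integral_fst'[OF this] show ?thesis using integral_sample_Suc[OF f b] by simp
qed

end

definition usum :: "('a \<Rightarrow> 'a \<Rightarrow> real) \<Rightarrow> nat \<Rightarrow> (nat \<Rightarrow> 'a) \<Rightarrow> real" where
  "usum h m x = (\<Sum>j\<in>{1..m}. \<Sum>i\<in>{1..<j}. h (x i) (x j))"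

lemma usum_upd: "usum h (Suc m) (x(Suc m := y)) = usum h m x + (\<Sum>i\<in>{1..m}. h (x i) y)"
proof -
  have "usum h (Suc m) (x(Suc m := y)) =
      (\<Sum>i\<in>{1..<Suc m}. h ((x(Suc m := y)) i) y) +
      (\<Sum>j\<in>{1..m}. \<Sum>i\<in>{1..<j}. h ((x(Suc m := y)) i) ((x(Suc m := y)) j))"
    unfolding usum_def atLeastAtMost_Suc_insert by (subst sum.insert) auto
  also have "(\<Sum>i\<in>{1..<Suc m}. h ((x(Suc m := y)) i) y) = (\<Sum>i\<in>{1..m}. h (x i) y)" by (intro sum.cong) auto
  also have "(\<Sum>j\<in>{1..m}. \<Sum>i\<in>{1..<j}. h ((x(Suc m := y)) i) ((x(Suc m := y)) j)) = usum h m x"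
    unfolding usum_def by (intro sum.cong) auto
  finally show ?thesis by (metis add.commute)
qed

lemma double_sum_eq_usum:
  assumes "\<And>i j. i \<in> {1..m} \<Longrightarrow> j \<in> {1..m} \<Longrightarrow> h (x i) (x j) = h (x j) (x i)"
  shows "(\<Sum>i\<in>{1..m}. \<Sum>j\<in>{1..m}. h (x i) (x j)) = (\<Sum>i\<in>{1..m}. h (x i) (x i)) + 2 * usum h m x" using assms
proof (induction m)
  case (Suc m)
  have IH: "(\<Sum>i\<in>{1..m}. \<Sum>j\<in>{1..m}. h (x i) (x j)) = (\<Sum>i\<in>{1..m}. h (x i) (x i)) + 2 * usum h m x"
    by (rule Suc.IH) (use Suc.prems in auto)
  have s: "(\<Sum>i\<in>{1..m}. h (x (Suc m)) (x i)) = (\<Sum>i\<in>{1..m}. h (x i) (x (Suc m)))" by (intro sum.cong) (use Suc.prems in auto)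
  have u: "usum h (Suc m) x = usum h m x + (\<Sum>i\<in>{1..m}. h (x i) (x (Suc m)))" using usum_upd[of h m x "x (Suc m)"] by simp
  have "(\<Sum>i\<in>{1..Suc m}. \<Sum>j\<in>{1..Suc m}. h (x i) (x j)) =
     (\<Sum>i\<in>{1..m}. \<Sum>j\<in>{1..m}. h (x i) (x j)) + 2 * (\<Sum>i\<in>{1..m}. h (x i) (x (Suc m))) + h (x (Suc m)) (x (Suc m))"
    by (simp add: sum.distrib s)
  then show ?case using IH u by simp
qed (simp add: usum_def)

text \<open>The bound \<open>C\<close> secures integrability and may grow with the dimension, as it
  does for the kernel \<open>sqrt p * t\<close>; the limit theorems rely on moments of
  \<open>h\<close> instead.\<close>

locale degenerate_kernel = prob_space M for M :: "'a measure" +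
  fixes h :: "'a \<Rightarrow> 'a \<Rightarrow> real" and C :: real
  assumes meas: "(\<lambda>(x, y). h x y) \<in> borel_measurable (M \<Otimes>\<^sub>M M)"
    and bounded: "x \<in> space M \<Longrightarrow> y \<in> space M \<Longrightarrow> \<bar>h x y\<bar> \<le> C"
    and sym: "x \<in> space M \<Longrightarrow> y \<in> space M \<Longrightarrow> h x y = h y x"
    and deg: "x \<in> space M \<Longrightarrow> (LINT y|M. h x y) = 0"
begin

lemma C_nonneg: "C \<ge> 0" using bounded not_empty by (metis abs_ge_zero ex_in_conv order_trans)

lemma measurable_h [measurable (raw)]:
  assumes "f \<in> N \<rightarrow>\<^sub>M M" "g \<in> N \<rightarrow>\<^sub>M M"
  shows "(\<lambda>x. h (f x) (g x)) \<in> borel_measurable N" using measurable_compose[OF measurable_Pair[OF assms] meas] by simp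

lemma deg': "y \<in> space M \<Longrightarrow> (LINT x|M. h x y) = 0"
  using deg[of y] sym lint_cong[of M M "\<lambda>x. h x y" "\<lambda>x. h y x"] by auto

lemma measurable_usum [measurable]: "usum h m \<in> borel_measurable (sample m)"
proof -
  have "(\<lambda>x. h (x i) (x j)) \<in> borel_measurable (sample m)" if "j \<in> {1..m}" "i \<in> {1..<j}" for i j
  proof (rule measurable_h)
    show "(\<lambda>x. x i) \<in> sample m \<rightarrow>\<^sub>M M" "(\<lambda>x. x j) \<in> sample m \<rightarrow>\<^sub>M M"
      using that by (auto intro!: measurable_component_singleton)
  qed
  then show ?thesis unfolding usum_def by measurable
qed

text \<open>Increment of \<open>usum h\<close> when \<open>y\<close> joins the sample
  \<open>x\<close>, see \<open>usum_upd\<close>. Given \<open>x\<close> it has mean zero, so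
  \<open>usum\<close> is a martingale in the sample size.\<close>

definition inc :: "nat \<Rightarrow> (nat \<Rightarrow> 'a) \<Rightarrow> 'a \<Rightarrow> real" where
  "inc m x y = (\<Sum>i\<in>{1..m}. h (x i) y)"

lemma measurable_inc [measurable]: "(\<lambda>z. inc m (fst z) (snd z)) \<in> borel_measurable (sample m \<Otimes>\<^sub>M M)"
  unfolding inc_def by measurable

lemma measurable_inc1 [measurable]: "x \<in> space (sample m) \<Longrightarrow> (\<lambda>y. inc m x y) \<in> borel_measurable M" unfolding inc_def
  by (intro borel_measurable_sum measurable_h measurable_const measurable_ident_sets)
     (auto intro: sample_component)

lemma inc_bound: "x \<in> space (sample m) \<Longrightarrow> y \<in> space M \<Longrightarrow> \<bar>inc m x y\<bar> \<le> real m * C"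
proof -
  assume x: "x \<in> space (sample m)" and y: "y \<in> space M"
  have "\<bar>inc m x y\<bar> \<le> (\<Sum>i\<in>{1..m}. \<bar>h (x i) y\<bar>)" unfolding inc_def by (rule sum_abs)
  also have "... \<le> (\<Sum>i\<in>{1..m}. C)" by (intro sum_mono bounded sample_component[OF x] y)
  finally show ?thesis by simp
qed

lemma inc_power_bound:
  "x \<in> space (sample m) \<Longrightarrow> y \<in> space M \<Longrightarrow> \<bar>inc m x y ^ k\<bar> \<le> (real m * C) ^ k"
  using power_mono[OF inc_bound abs_ge_zero, of x m y k] by (simp add: power_abs)

lemma usum_bound: "x \<in> space (sample m) \<Longrightarrow> \<bar>usum h m x\<bar> \<le> (real m)\<^sup>2 * C"
proof -
  assume x: "x \<in> space (sample m)"
  have "\<bar>usum h m x\<bar> \<le> (\<Sum>j\<in>{1..m}. \<bar>\<Sum>i\<in>{1..<j}. h (x i) (x j)\<bar>)" unfolding usum_def by (rule sum_abs)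
  also have "... \<le> (\<Sum>j\<in>{1..m}. real m * C)"
  proof (rule sum_mono)
    fix j assume j: "j \<in> {1..m}"
    have "\<bar>\<Sum>i\<in>{1..<j}. h (x i) (x j)\<bar> \<le> (\<Sum>i\<in>{1..<j}. \<bar>h (x i) (x j)\<bar>)" by (rule sum_abs)
    also have "... \<le> (\<Sum>i\<in>{1..<j}. C)" using j by (intro sum_mono bounded sample_component[OF x]) auto
    also have "... \<le> real m * C" using j C_nonneg by (auto intro!: mult_right_mono)
    finally show "\<bar>\<Sum>i\<in>{1..<j}. h (x i) (x j)\<bar> \<le> real m * C" .
  qed
  finally show ?thesis by (simp add: power2_eq_square)
qed

lemma usum_power_bound: "x \<in> space (sample m) \<Longrightarrow> \<bar>usum h m x ^ k\<bar> \<le> ((real m)\<^sup>2 * C) ^ k"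
  using power_mono[OF usum_bound abs_ge_zero, of x m k] by (simp add: power_abs)

lemma inc_mean: "x \<in> space (sample m) \<Longrightarrow> (LINT y|M. inc m x y) = 0"
proof -
  assume x: "x \<in> space (sample m)"
  have i: "integrable M (\<lambda>y. h (x i) y)" if "i \<in> {1..m}" for i
  proof (rule integrable_bounded)
    show "h (x i) \<in> borel_measurable M" using sample_component[OF x that] by measurable
    show "norm (h (x i) y) \<le> C" if "y \<in> space M" for y using bounded[OF sample_component[OF x \<open>i \<in> {1..m}\<close>] that] by simp
  qed
  show ?thesis unfolding inc_def using x by (subst lint_sum[OF i]) (auto intro!: sum.neutral deg sample_component)
qed

text \<open>For fixed \<open>y\<close> the increment is a sum of i.i.d. terms in the old points,
  centred by symmetry and degeneracy. The moments of i.i.d. sums therefore apply before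
  \<open>y\<close> is integrated out.\<close>

lemma
  shows integral_pair_inc2: "(LINT z|(sample m \<Otimes>\<^sub>M M). inc m (fst z) (snd z) ^ 2) = real m * (LINT y|M. LINT x|M. h x y ^ 2)"
    and integral_pair_inc4: "(\<And>y. y \<in> space M \<Longrightarrow> (LINT x|M. h x y ^ 2) = v) \<Longrightarrow> (\<And>y. y \<in> space M \<Longrightarrow> (LINT x|M. h x y ^ 4) \<le> K) \<Longrightarrow>
     (LINT z|(sample m \<Otimes>\<^sub>M M). inc m (fst z) (snd z) ^ 4) \<le> real m * K + 3 * (real m)\<^sup>2 * v\<^sup>2"
proof -
  interpret S: prob_space "sample m" by (rule prob_space_sample)
  interpret P: pair_prob_space "sample m" M ..
  have I: "integrable (sample m \<Otimes>\<^sub>M M) (\<lambda>(x, y). inc m x y ^ k)" for k using measurable_inc[of m]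
    by (intro P.P.integrable_bounded[of _ "(real m * C) ^ k"])
       (auto simp: space_pair_measure case_prod_beta' simp del: power_abs intro!: inc_power_bound)
  have F: "(LINT z|(sample m \<Otimes>\<^sub>M M). inc m (fst z) (snd z) ^ k) = (LINT y|M. LINT x|sample m. inc m x y ^ k)" for k
    using P.integral_snd[OF I[of k]] by (simp add: case_prod_beta')
  have m: "(\<lambda>x. h x y) \<in> borel_measurable M" if "y \<in> space M" for y using that by measurable
  have m2: "(LINT x|sample m. inc m x y ^ 2) = real m * (LINT x|M. h x y ^ 2)" if "y \<in> space M" for y
    unfolding inc_def by (rule iid_sum_second_moment[OF m[OF that] bounded[OF _ that] deg'[OF that]]) auto
  have "(LINT y|M. LINT x|sample m. inc m x y ^ 2) = (LINT y|M. real m * (LINT x|M. h x y ^ 2))" by (rule lint_cong) (auto simp: m2)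
  then show "(LINT z|(sample m \<Otimes>\<^sub>M M). inc m (fst z) (snd z) ^ 2) = real m * (LINT y|M. LINT x|M. h x y ^ 2)" using F[of 2] by simp
  assume v: "\<And>y. y \<in> space M \<Longrightarrow> (LINT x|M. h x y ^ 2) = v"
    and K: "\<And>y. y \<in> space M \<Longrightarrow> (LINT x|M. h x y ^ 4) \<le> K"
  have m4: "(LINT x|sample m. inc m x y ^ 4) \<le> real m * K + 3 * (real m)\<^sup>2 * v\<^sup>2" if "y \<in> space M" for y
    unfolding inc_def by (rule iid_sum_fourth_moment[OF m[OF that] bounded[OF _ that] deg'[OF that] v[OF that] K[OF that]])
  have "(LINT y|M. LINT x|sample m. inc m x y ^ 4) \<le> (LINT y|M. real m * K + 3 * (real m)\<^sup>2 * v\<^sup>2)"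
  proof (rule integral_mono)
    show "integrable M (\<lambda>y. LINT x|sample m. inc m x y ^ 4)" using P.integrable_snd[OF I[of 4]] by simp
  qed (auto simp: m4)
  also have "... = real m * K + 3 * (real m)\<^sup>2 * v\<^sup>2" by (simp add: prob_space)
  finally show "(LINT z|(sample m \<Otimes>\<^sub>M M). inc m (fst z) (snd z) ^ 4) \<le> real m * K + 3 * (real m)\<^sup>2 * v\<^sup>2"
    using F[of 4] by simp
qed

text \<open>Orthogonality of martingale increments: the mixed term vanishes when the new point is
  integrated first. The increment at size \<open>m\<close> contributes \<open>m\<close> times the
  second moment of \<open>h\<close>, which adds up to the number of pairs.\<close>

lemma usum_second_moment:
  "(LINT x|sample m. usum h m x ^ 2) = real m * (real m - 1) / 2 * (LINT y|M. LINT x|M. h x y ^ 2)"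
proof (induction m)
  case 0 then show ?case by (simp add: usum_def)
next
  case (Suc m)
  interpret S: prob_space "sample m" by (rule prob_space_sample)
  interpret P: pair_prob_space "sample m" M ..
  let ?P = "sample m \<Otimes>\<^sub>M M"
  let ?S = "\<lambda>z. usum h m (fst z)" and ?Y = "\<lambda>z. inc m (fst z) (snd z)"
  have "integrable ?P (\<lambda>z. ?S z ^ 2)" "integrable ?P (\<lambda>z. ?Y z ^ 2)" using usum_power_bound[of _ m 2] inc_power_bound[of _ m _ 2]
    by (auto intro!: P.P.integrable_bounded simp: space_pair_measure)
  note I = this
  have I2: "integrable ?P (\<lambda>z. ?S z * ?Y z)" using C_nonneg by (intro P.P.integrable_bounded[of _ "((real m)\<^sup>2 * C) * (real m * C)"])
       (auto simp: space_pair_measure abs_mult intro!: mult_mono usum_bound inc_bound)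
  have "(LINT x|sample (Suc m). usum h (Suc m) x ^ 2) = (LINT z|?P. (?S z + ?Y z)^2)" using usum_power_bound[of _ "Suc m" 2]
    by (subst integral_sample_Suc_pair) (auto simp: usum_upd inc_def)
  also have "... = (LINT z|?P. ?S z ^ 2) + (LINT z|?P. ?Y z ^ 2) + 2 * (LINT z|?P. ?S z * ?Y z)" using I I2 by (simp add: power2_sum mult.assoc)
  also have "(LINT z|?P. ?S z ^ 2) = (LINT x|sample m. usum h m x ^ 2)" using P.integral_fst'[OF I(1)] by (simp add: prob_space)
  also have "(LINT z|?P. ?S z * ?Y z) = (LINT x|sample m. usum h m x * (LINT y|M. inc m x y))" using P.integral_fst'[OF I2] by simp
  also have "... = (LINT x|sample m. 0)" by (rule lint_cong) (auto simp: inc_mean)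
  finally show ?case unfolding Suc integral_pair_inc2 by (simp add: field_simps)
qed

text \<open>Kernel of the squared integral operator. At two old points it is the conditional
  covariance, over the next point, of the terms that they contribute to the increment.\<close>

definition sq_kernel :: "'a \<Rightarrow> 'a \<Rightarrow> real" where
  "sq_kernel x y = (LINT z|M. h x z * h y z)"

text \<open>Degeneracy of the squared kernel makes \<open>usum_second_moment\<close> available for
  the fluctuation of the conditional variance in \<open>integral_inc_square\<close>.\<close>

lemma sq_kernel_degenerate: "degenerate_kernel M sq_kernel (C\<^sup>2)"
proof
  interpret P: pair_prob_space M M ..
  have [measurable]: "(\<lambda>x. h (fst (fst x)) (snd x)) \<in> borel_measurable ((M \<Otimes>\<^sub>M M) \<Otimes>\<^sub>M M)"
    "(\<lambda>x. h (snd (fst x)) (snd x)) \<in> borel_measurable ((M \<Otimes>\<^sub>M M) \<Otimes>\<^sub>M M)" by measurable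
  show "(\<lambda>(x, y). sq_kernel x y) \<in> borel_measurable (M \<Otimes>\<^sub>M M)" unfolding sq_kernel_def case_prod_beta'
    by (rule borel_measurable_lebesgue_integral) (simp add: case_prod_beta')
  show "sq_kernel x y = sq_kernel y x" for x y unfolding sq_kernel_def by (simp add: mult.commute)
  fix x assume x: "x \<in> space M"
  have b: "\<bar>h x z * h y z\<bar> \<le> C\<^sup>2" if "y \<in> space M" "z \<in> space M" for y z
    using mult_mono[OF bounded[OF x that(2)] bounded[OF that] C_nonneg abs_ge_zero] by (simp add: abs_mult power2_eq_square)
  have [measurable]: "(\<lambda>z. h x z) \<in> borel_measurable M" using x by measurable
  have [measurable]: "(\<lambda>z. h z x) \<in> borel_measurable M" using x by measurable
  show "\<bar>sq_kernel x y\<bar> \<le> C\<^sup>2" if y: "y \<in> space M" for y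
  proof -
    have [measurable]: "(\<lambda>z. h y z) \<in> borel_measurable M" using y by measurable
    show ?thesis unfolding sq_kernel_def using norm_integral_le_const[of "\<lambda>z. h x z * h y z" "C\<^sup>2"] b[OF y] by simp
  qed
  have I: "integrable (M \<Otimes>\<^sub>M M) (\<lambda>(y, z). h x z * h y z)"
    using x b by (intro P.P.integrable_bounded[of _ "C\<^sup>2"]) (auto simp: space_pair_measure)
  have "(LINT y|M. sq_kernel x y) = (LINT z|M. LINT y|M. h x z * h y z)" unfolding sq_kernel_def using P.Fubini_integral[OF I] by simp
  also have "... = (LINT z|M. 0)" by (rule lint_cong) (auto simp: deg')
  finally show "(LINT y|M. sq_kernel x y) = 0" by simp
qed

lemma integral_inc_square:
  assumes "x \<in> space (sample m)"
  shows "(LINT y|M. inc m x y ^ 2) = (\<Sum>i\<in>{1..m}. sq_kernel (x i) (x i)) + 2 * usum sq_kernel m x"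
proof -
  have I: "integrable M (\<lambda>y. h (x i) y * h (x j) y)" if "i \<in> {1..m}" "j \<in> {1..m}" for i j
  proof (rule integrable_bounded[of _ "C * C"])
    show "(\<lambda>y. h (x i) y * h (x j) y) \<in> borel_measurable M"
      using sample_component[OF assms that(1)] sample_component[OF assms that(2)] by measurable
    show "norm (h (x i) y * h (x j) y) \<le> C * C" if "y \<in> space M" for y using mult_mono[OF bounded bounded C_nonneg abs_ge_zero] that
        sample_component[OF assms \<open>i \<in> _\<close>] sample_component[OF assms \<open>j \<in> _\<close>]
      by (simp add: abs_mult)
  qed
  have "(LINT y|M. inc m x y ^ 2) = (\<Sum>i\<in>{1..m}. \<Sum>j\<in>{1..m}. sq_kernel (x i) (x j))"
    unfolding inc_def power2_eq_square sum_product sq_kernel_def by (subst lint_sum)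
       (auto intro!: I sum.cong lint_sum lintegrable_sum)
  also have "... = (\<Sum>i\<in>{1..m}. sq_kernel (x i) (x i)) + 2 * usum sq_kernel m x"
    by (rule double_sum_eq_usum) (simp add: sq_kernel_def mult.commute)
  finally show ?thesis .
qed

end

text \<open>Error of peeling off one point at frequency \<open>a\<close>, where \<gamma> is the
  second moment of the squared kernel. The terms are the quadratic remainder of the exponential, the
  fluctuation of the conditional variance, and the third moment of the increment, bounded by its
  second and fourth moments.\<close>

definition clt_err :: "real \<Rightarrow> nat \<Rightarrow> real \<Rightarrow> real \<Rightarrow> real \<Rightarrow> real" where
  "clt_err a n v K \<gamma> = (a\<^sup>2 * real n * v)\<^sup>2 / 8 + a\<^sup>2 * (real n * sqrt \<gamma>)
      + \<bar>a\<bar> ^ 3 / 6 * (sqrt (real n * v) * sqrt (real n * K + 3 * (real n)\<^sup>2 * v\<^sup>2))"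

text \<open>Kernels that depend on the inner product have this form by rotation invariance. A
  constant \<open>v\<close> makes the diagonal part of the conditional variance
  deterministic.\<close>

locale homogeneous_kernel = degenerate_kernel M h C for M :: "'a measure" and h C +
  fixes v K :: real
  assumes var: "x \<in> space M \<Longrightarrow> (LINT y|M. h x y ^ 2) = v"
    and fourth: "x \<in> space M \<Longrightarrow> (LINT y|M. h x y ^ 4) \<le> K"
begin

lemma v_nonneg: "v \<ge> 0" using var not_empty by (metis ex_in_conv lint_nonneg zero_le_power2)

lemma K_nonneg: "K \<ge> 0"
proof -
  obtain x where "x \<in> space M" using not_empty by auto
  have "0 \<le> (LINT y|M. h x y ^ 4)" by (intro lint_nonneg) simp
  from this fourth[OF \<open>x \<in> space M\<close>] show ?thesis by (rule order_trans)
qed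

lemma var': "y \<in> space M \<Longrightarrow> (LINT x|M. h x y ^ 2) = v"
  using var[of y] sym lint_cong[of M M "\<lambda>x. h x y ^ 2" "\<lambda>x. h y x ^ 2"] by auto

lemma fourth': "y \<in> space M \<Longrightarrow> (LINT x|M. h x y ^ 4) \<le> K"
  using fourth[of y] sym lint_cong[of M M "\<lambda>x. h x y ^ 4" "\<lambda>x. h y x ^ 4"] by auto

lemma inc2: "(LINT z|(sample m \<Otimes>\<^sub>M M). inc m (fst z) (snd z) ^ 2) = real m * v"
proof -
  have "(LINT y|M. LINT x|M. h x y ^ 2) = (LINT y|M. v)" by (rule lint_cong) (auto simp: var')
  then show ?thesis by (simp add: integral_pair_inc2 prob_space)
qed

lemma inc4: "(LINT z|(sample m \<Otimes>\<^sub>M M). inc m (fst z) (snd z) ^ 4) \<le> real m * K + 3 * (real m)\<^sup>2 * v\<^sup>2"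
  by (rule integral_pair_inc4) (auto intro: var' fourth')

text \<open>Writing \<open>A\<^sub>m\<close> for the square root of the fourth moment of the statistic on \<open>m\<close> points, the
  degeneracy kills the term \<open>S\<^sup>3 Y\<close> in the expansion of \<open>(S + Y)\<^sup>4\<close> and Cauchy-Schwarz turns the rest
  into \<open>A\<^sub>m\<^sub>+\<^sub>1 \<le> A\<^sub>m + 4 b\<^sub>m\<close>, where \<open>b\<^sub>m\<close> is the same quantity for the increment \<open>Y\<close>.\<close>

lemma usum_fourth_moment:
  "(LINT x|sample m. usum h m x ^ 4) \<le> 16 * (real m)\<^sup>2 * (real m * K + 3 * (real m)\<^sup>2 * v\<^sup>2)"
proof -
  define b where "b m = sqrt (real m * K + 3 * (real m)\<^sup>2 * v\<^sup>2)" for m :: nat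
  define A where "A m = sqrt (LINT x|sample m. usum h m x ^ 4)" for m
  have b0: "b m \<ge> 0" for m using K_nonneg by (simp add: b_def)
  have b_mono: "b m \<le> b n" if "m \<le> n" for m n unfolding b_def using that K_nonneg
    by (intro real_sqrt_le_mono add_mono mult_mono mult_right_mono mult_left_mono power_mono) auto
  have A0: "A m \<ge> 0" for m by (auto simp: A_def intro!: lint_nonneg)
  have A2: "(LINT x|sample m. usum h m x ^ 4) = (A m)\<^sup>2" for m unfolding A_def by (subst real_sqrt_pow2) (auto intro!: lint_nonneg)
  have step: "A (Suc m) \<le> A m + 4 * b m" for m
  proof -
    interpret S: prob_space "sample m" by (rule prob_space_sample)
    interpret P: pair_prob_space "sample m" M ..
    let ?P = "sample m \<Otimes>\<^sub>M M"
    let ?S = "\<lambda>z. usum h m (fst z)" and ?Y = "\<lambda>z. inc m (fst z) (snd z)"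
    have SYb: "\<bar>?S z ^ k * ?Y z ^ l\<bar> \<le> ((real m)\<^sup>2 * C) ^ k * (real m * C) ^ l" if "z \<in> space ?P" for z k l
      unfolding abs_mult using that C_nonneg by (intro mult_mono usum_power_bound inc_power_bound) (auto simp: space_pair_measure)
    have I: "integrable ?P (\<lambda>z. ?S z ^ k * ?Y z ^ l)" for k l using SYb[of _ k l] by (intro P.P.integrable_bounded) auto
    have Y4: "(LINT z|?P. ?Y z ^ 4) \<le> (b m)\<^sup>2" using inc4[of m] K_nonneg by (simp add: b_def)
    have S4: "(LINT z|?P. ?S z ^ 4) = (A m)\<^sup>2" using P.integral_fst'[OF I[of 4 0]] by (simp add: prob_space A2)
    have Y4': "sqrt (LINT z|?P. ?Y z ^ 4) \<le> b m" using Y4 b0 by (intro real_le_lsqrt) auto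
    have SY2: "(LINT z|?P. \<bar>?S z ^ 2 * ?Y z ^ 2\<bar>) \<le> A m * b m"
    proof -
      have "(LINT z|?P. \<bar>?S z ^ 2 * ?Y z ^ 2\<bar>) \<le> sqrt (LINT z|?P. (?S z ^ 2)\<^sup>2) * sqrt (LINT z|?P. (?Y z ^ 2)\<^sup>2)"
        using SYb[of _ 2 0] SYb[of _ 0 2] by (intro P.P.cauchy_schwarz_bounded) auto
      also have "... \<le> A m * b m" using Y4' S4 A0 b0 by (auto simp: power_mult[symmetric] intro!: mult_mono)
      finally show ?thesis .
    qed
    have SY3: "(LINT z|?P. \<bar>?S z * ?Y z ^ 3\<bar>) \<le> sqrt (A m * b m) * b m"
    proof -
      have "(LINT z|?P. \<bar>?S z * ?Y z ^ 3\<bar>) = (LINT z|?P. \<bar>(?S z * ?Y z) * ?Y z ^ 2\<bar>)"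
        by (simp add: power3_eq_cube power2_eq_square mult.assoc)
      also have "... \<le> sqrt (LINT z|?P. (?S z * ?Y z)\<^sup>2) * sqrt (LINT z|?P. (?Y z ^ 2)\<^sup>2)"
        using SYb[of _ 1 1] SYb[of _ 0 2] by (intro P.P.cauchy_schwarz_bounded) auto
      also have "... \<le> sqrt (A m * b m) * b m" using Y4' SY2 A0 b0 by (auto simp: power_mult_distrib power_mult[symmetric] intro!: mult_mono)
      finally show ?thesis .
    qed
    have SY1: "(LINT z|?P. ?S z ^ 3 * ?Y z) = 0"
    proof -
      have "(LINT z|?P. ?S z ^ 3 * ?Y z) = (LINT x|sample m. usum h m x ^ 3 * (LINT y|M. inc m x y))" using P.integral_fst'[OF I[of 3 1]] by simp
      also have "... = (LINT x|sample m. 0)" by (rule lint_cong) (auto simp: inc_mean)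
      finally show ?thesis by simp
    qed
    have e: "(s + t)^4 = s^4 + 4*(s^3*t) + 6 * (s^2*t^2) + 4*(s*t^3) + t^4" for s t :: real
      by (simp add: power4_eq_xxxx power3_eq_cube power2_eq_square algebra_simps)
    have "(A (Suc m))\<^sup>2 = (LINT z|?P. (?S z + ?Y z)^4)" unfolding A2[symmetric] using usum_power_bound[of _ "Suc m" 4]
      by (subst integral_sample_Suc_pair) (auto simp: usum_upd inc_def)
    also have "... = (A m)\<^sup>2 + 6 * (LINT z|?P. ?S z ^ 2 * ?Y z ^ 2) + 4 * (LINT z|?P. ?S z * ?Y z ^ 3) + (LINT z|?P. ?Y z ^ 4)"
      unfolding e using I[of 4 0] I[of 3 1] I[of 2 2] I[of 1 3] I[of 0 4] by (simp add: SY1 S4)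
    also have "... \<le> (A m)\<^sup>2 + 6 * (A m * b m) + 4 * (sqrt (A m * b m) * b m) + (b m)\<^sup>2"
    proof -
      have "(LINT z|?P. ?S z * ?Y z ^ 3) \<le> sqrt (A m * b m) * b m" using integral_abs_bound[of ?P "\<lambda>z. ?S z * ?Y z ^ 3"] SY3 by linarith
      moreover have "(LINT z|?P. ?S z ^ 2 * ?Y z ^ 2) \<le> A m * b m" using SY2 by simp
      ultimately show ?thesis using Y4 by linarith
    qed
    finally have "(A (Suc m))\<^sup>2 \<le> (A m)\<^sup>2 + 6 * (A m * b m) + 4 * (sqrt (A m * b m) * b m) + (b m)\<^sup>2" .
    moreover have "sqrt (A m * b m) * b m \<le> (A m * b m + (b m)\<^sup>2) / 2"
      using arith_geo_mean_sqrt[of "A m * b m" "(b m)\<^sup>2"] A0 b0 by (simp add: real_sqrt_mult)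
    \<comment> \<open>The coefficients are 8 = 6 + 4/2 and 3 = 1 + 4/2; the square of
      \<open>A m + 4 * b m\<close> has 8 and 16.\<close>
    ultimately have "(A (Suc m))\<^sup>2 \<le> (A m)\<^sup>2 + 8 * (A m * b m) + 3 * (b m)\<^sup>2" by argo
    also have "... \<le> (A m + 4 * b m)\<^sup>2" by (simp add: power2_sum power_mult_distrib)
    finally show ?thesis by (rule power2_le_imp_le) (use A0 b0 in \<open>simp add: add_nonneg_nonneg\<close>)
  qed
  have "A m \<le> 4 * real m * b m" for m
  proof (induction m)
    case 0 then show ?case by (simp add: A_def usum_def)
  next
    case (Suc m)
    have "A (Suc m) \<le> 4 * real m * b m + 4 * b m" using step[of m] Suc by simp
    also have "... = 4 * real (Suc m) * b m" by (simp add: algebra_simps)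
    also have "... \<le> 4 * real (Suc m) * b (Suc m)" by (intro mult_left_mono b_mono) auto
    finally show ?case .
  qed
  from power_mono[OF this A0, of m 2] have "(A m)\<^sup>2 \<le> 16 * (real m)\<^sup>2 * (b m)\<^sup>2" by (simp add: power_mult_distrib)
  then show ?thesis using K_nonneg by (simp add: A2 b_def)
qed

section \<open>One step of the central limit theorem, and the sum over all steps\<close>

lemma iexp_second_order: "cmod (iexp x - (1 + \<i> * x - x\<^sup>2 / 2)) \<le> \<bar>x\<bar> ^ 3 / 6"
proof -
  have "(\<Sum>k \<le> 2. (\<i> * complex_of_real x)^k / fact k) = 1 + \<i> * x - x\<^sup>2 / 2"
    by (simp add: numeral_2_eq_2 power_mult_distrib One_nat_def)
  then have "cmod (iexp x - (1 + \<i> * x - x\<^sup>2 / 2)) \<le> \<bar>x\<bar>^(Suc 2) / fact (Suc 2)" using iexp_approx1[of x 2] by metis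
  then show ?thesis by (simp add: fact_numeral)
qed

lemma exp_minus_second_order: "y \<ge> 0 \<Longrightarrow> \<bar>1 - y - exp (- y)\<bar> \<le> y\<^sup>2 / (2::real)"
proof -
  assume y: "y \<ge> 0"
  have 1: "1 - y \<le> exp (- y)" using exp_ge_add_one_self[of "-y"] by simp
  have "exp (- y) \<le> 1 - y + y\<^sup>2 / 2"
  proof -
    have "(\<lambda>t::real. 1 - t + t\<^sup>2 / 2 - exp (- t)) 0 \<le> (\<lambda>t. 1 - t + t\<^sup>2 / 2 - exp (- t)) y"
    proof (rule DERIV_nonneg_imp_nondecreasing[OF y])
      fix t :: real
      show "\<exists>d. ((\<lambda>t. 1 - t + t\<^sup>2 / 2 - exp (- t)) has_real_derivative d) (at t) \<and> 0 \<le> d"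
        using exp_ge_add_one_self[of "-t"] by (intro exI[of _ "-1 + t + exp (- t)"] conjI) (auto intro!: derivative_eq_intros)
    qed
    then show ?thesis by simp
  qed
  with 1 show ?thesis by linarith
qed

lemma abs_cube: "\<bar>y * y\<^sup>2\<bar> = \<bar>y\<bar> ^ 3" for y :: real by (simp add: power3_eq_cube power2_eq_square abs_mult)

text \<open>Given the first \<open>m\<close> points, the increment has variance \<open>m v\<close> up to a U-statistic of \<open>sq_kernel\<close>.\<close>

lemma clt_step:
  fixes a :: real
  assumes m: "m \<le> n"
  shows "cmod ((LINT x|sample (Suc m). iexp (a * usum h (Suc m) x)) -
      exp (- (a\<^sup>2 * real m * v / 2)) * (LINT x|sample m. iexp (a * usum h m x))) \<le>
    clt_err a n v K (LINT y|M. LINT x|M. sq_kernel x y ^ 2)"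
proof -
  define \<phi> where "\<phi> m = (LINT x|sample m. iexp (a * usum h m x))" for m
  define \<gamma> where "\<gamma> = (LINT y|M. LINT x|M. sq_kernel x y ^ 2)"
  interpret S: prob_space "sample m" by (rule prob_space_sample)
  interpret P: pair_prob_space "sample m" M ..
  interpret G: degenerate_kernel M sq_kernel "C\<^sup>2" by (rule sq_kernel_degenerate)
  let ?P = "sample m \<Otimes>\<^sub>M M"
  let ?Y = "\<lambda>z. inc m (fst z) (snd z)"
  define \<psi> where "\<psi> x = (LINT y|M. iexp (a * inc m x y))" for x
  define q where "q = a\<^sup>2 * real m * v / 2"
  have q0: "q \<ge> 0" using v_nonneg by (simp add: q_def)
  have \<psi>m: "\<psi> \<in> borel_measurable (sample m)" unfolding \<psi>_def
    by (rule borel_measurable_lebesgue_integral) (use measurable_inc[of m] in \<open>simp add: case_prod_beta'\<close>)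
  have \<psi>b: "cmod (\<psi> x) \<le> 1" if "x \<in> space (sample m)" for x unfolding \<psi>_def by (rule norm_integral_le_const) (use that in auto)
  have \<phi>S: "\<phi> (Suc m) = (LINT x|sample m. iexp (a * usum h m x) * \<psi> x)"
  proof -
    have "\<phi> (Suc m) = (LINT x|sample m. LINT y|M. iexp (a * (usum h m x + inc m x y)))"
      unfolding \<phi>_def by (subst integral_sample_Suc[of _ _ 1]) (auto simp: usum_upd inc_def)
    also have "(\<lambda>x. LINT y|M. iexp (a * (usum h m x + inc m x y))) = (\<lambda>x. iexp (a * usum h m x) * \<psi> x)"
      by (auto simp: \<psi>_def distrib_left exp_add)
    finally show ?thesis .
  qed
  \<comment> \<open>Pointwise error: the Taylor remainder of third order, the deviation of the
    conditional variance from its mean, and the replacement of \<open>1 - q\<close> by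
    \<open>exp (- q)\<close>.\<close>
  define Z where "Z x = \<bar>a\<bar>^3 / 6 * (LINT y|M. \<bar>inc m x y\<bar> ^ 3) + a\<^sup>2 * \<bar>usum sq_kernel m x\<bar> + q\<^sup>2 / 2" for x
  have I3: "integrable ?P (\<lambda>z. \<bar>?Y z\<bar> ^ 3)" by (intro P.P.integrable_bounded[of _ "(real m * C) ^ 3"])
       (auto simp: space_pair_measure power_abs intro!: power_mono inc_bound)
  have I3': "integrable (sample m) (\<lambda>x. LINT y|M. \<bar>inc m x y\<bar> ^ 3)" using P.integrable_fst'[OF I3] by simp
  have Iu: "integrable (sample m) (\<lambda>x. \<bar>usum sq_kernel m x\<bar>)" using G.usum_bound by (intro S.integrable_bounded) auto
  have pw: "cmod (\<psi> x - exp (- q)) \<le> Z x" if x: "x \<in> space (sample m)" for x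
  proof -
    have Ik: "integrable M (\<lambda>y. inc m x y ^ k)" for k
      using x inc_power_bound[OF x, of _ k] by (intro integrable_bounded[of _ "(real m * C) ^ k"]) auto
    have Ia: "integrable M (\<lambda>y. \<bar>inc m x y\<bar> ^ 3)" using integrable_abs[OF Ik[of 3]] by (simp add: power_abs)
    have I1: "integrable M (\<lambda>y. inc m x y)" and I2: "integrable M (\<lambda>y. (inc m x y)\<^sup>2)" using Ik[of 1] Ik[of 2] by auto
    have Ie: "integrable M (\<lambda>y. iexp (a * inc m x y))" using x by (intro integrable_bounded[of _ 1]) auto
    have sq: "(LINT y|M. 1 + \<i> * (a * inc m x y) - (a * inc m x y)\<^sup>2 / 2) = 1 - a\<^sup>2 / 2 * (LINT y|M. (inc m x y)\<^sup>2)"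
    proof -
      have "(LINT y|M. 1 + \<i> * (a * inc m x y) - (a * inc m x y)\<^sup>2 / 2) =
         (LINT y|M. 1 + (\<i> * a) * complex_of_real (inc m x y) - (complex_of_real (a\<^sup>2 / 2)) * complex_of_real ((inc m x y)\<^sup>2))"
        by (intro lint_cong) (auto simp: power_mult_distrib)
      also have "... = 1 + (\<i> * a) * (LINT y|M. complex_of_real (inc m x y)) - complex_of_real (a\<^sup>2 / 2) * (LINT y|M. complex_of_real ((inc m x y)\<^sup>2))"
        using integrable_of_real[OF I1, where 'a=complex] integrable_of_real[OF I2, where 'a=complex]
        by (simp add: prob_space del: of_real_power of_real_divide)
      also have "... = 1 - a\<^sup>2 / 2 * (LINT y|M. (inc m x y)\<^sup>2)" by (simp add: inc_mean[OF x] del: of_real_power)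
      finally show ?thesis .
    qed
    have Isq: "integrable M (\<lambda>y. 1 + \<i> * (a * inc m x y) - (a * inc m x y)\<^sup>2 / 2 :: complex)"
      using integrable_of_real[OF I1, where 'a=complex] integrable_of_real[OF I2, where 'a=complex] by (simp add: power_mult_distrib)
    have "cmod (\<psi> x - (1 - a\<^sup>2 / 2 * (LINT y|M. (inc m x y)\<^sup>2))) =
       cmod (LINT y|M. iexp (a * inc m x y) - (1 + \<i> * (a * inc m x y) - (a * inc m x y)\<^sup>2 / 2))"
      unfolding \<psi>_def sq[symmetric] using Ie Isq by simp
    also have "... \<le> (LINT y|M. cmod (iexp (a * inc m x y) - (1 + \<i> * (a * inc m x y) - (a * inc m x y)\<^sup>2 / 2)))"
      by (rule integral_norm_bound)
    also have "... \<le> (LINT y|M. \<bar>a\<bar>^3 / 6 * \<bar>inc m x y\<bar> ^ 3)"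
    proof (rule integral_mono)
      show "integrable M (\<lambda>y. cmod (iexp (a * inc m x y) - (1 + \<i> * (a * inc m x y) - (a * inc m x y)\<^sup>2 / 2)))"
        using Ie Isq by (intro integrable_norm) auto
      show "integrable M (\<lambda>y. \<bar>a\<bar>^3 / 6 * \<bar>inc m x y\<bar> ^ 3)" using Ia by simp
      show "cmod (iexp (a * inc m x y) - (1 + \<i> * (a * inc m x y) - (a * inc m x y)\<^sup>2 / 2)) \<le> \<bar>a\<bar>^3 / 6 * \<bar>inc m x y\<bar> ^ 3" for y
        using iexp_second_order[of "a * inc m x y"] by (simp add: abs_mult power_mult_distrib)
    qed
    finally have 1: "cmod (\<psi> x - complex_of_real (1 - a\<^sup>2 / 2 * (LINT y|M. (inc m x y)\<^sup>2))) \<le> \<bar>a\<bar>^3 / 6 * (LINT y|M. \<bar>inc m x y\<bar> ^ 3)"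
      using Ia by simp
    \<comment> \<open>Homogeneity enters here: the diagonal of \<open>sq_kernel\<close> is the
      constant \<open>v\<close>.\<close>
    have "(\<Sum>i\<in>{1..m}. sq_kernel (x i) (x i)) = (\<Sum>i\<in>{1..m}. v)"
      by (intro sum.cong) (auto simp: sq_kernel_def var power2_eq_square[symmetric] intro!: var sample_component[OF x])
    then have "(LINT y|M. (inc m x y)\<^sup>2) = real m * v + 2 * usum sq_kernel m x" using integral_inc_square[OF x] by simp
    then have "1 - a\<^sup>2 / 2 * (LINT y|M. (inc m x y)\<^sup>2) = 1 - q - a\<^sup>2 * usum sq_kernel m x" by (simp add: q_def algebra_simps)
    moreover have "\<bar>a\<^sup>2 * usum sq_kernel m x\<bar> = a\<^sup>2 * \<bar>usum sq_kernel m x\<bar>" by (simp add: abs_mult)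
    ultimately have "\<bar>1 - a\<^sup>2 / 2 * (LINT y|M. (inc m x y)\<^sup>2) - exp (- q)\<bar> \<le> a\<^sup>2 * \<bar>usum sq_kernel m x\<bar> + q\<^sup>2 / 2"
      using exp_minus_second_order[OF q0] abs_triangle_ineq4[of "1 - q - exp (- q)" "a\<^sup>2 * usum sq_kernel m x"] by linarith
    then have 2: "cmod (complex_of_real (1 - a\<^sup>2 / 2 * (LINT y|M. (inc m x y)\<^sup>2)) - complex_of_real (exp (- q))) \<le> a\<^sup>2 * \<bar>usum sq_kernel m x\<bar> + q\<^sup>2 / 2"
      unfolding of_real_diff[symmetric] norm_of_real .
    have "cmod (\<psi> x - complex_of_real (exp (- q))) \<le> Z x" unfolding Z_def using norm_triangle_mono[OF 1 2] by (simp add: algebra_simps)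
    then show ?thesis by simp
  qed
  have Ie: "integrable (sample m) (\<lambda>x. iexp (a * usum h m x))" by (intro S.integrable_bounded[of _ 1]) auto
  have Ie\<psi>: "integrable (sample m) (\<lambda>x. iexp (a * usum h m x) * \<psi> x)"
    using \<psi>b \<psi>m by (intro S.integrable_bounded[of _ 1]) (auto simp: norm_mult)
  have "\<phi> (Suc m) - exp (- q) * \<phi> m = (LINT x|sample m. iexp (a * usum h m x) * (\<psi> x - exp (- q)))"
    unfolding \<phi>S unfolding \<phi>_def right_diff_distrib using Ie Ie\<psi>
    by (subst Bochner_Integration.integral_diff) (auto simp: mult.commute[of _ "complex_of_real (exp (- q))"])
  also have "cmod ... \<le> (LINT x|sample m. cmod (iexp (a * usum h m x) * (\<psi> x - exp (- q))))" by (rule integral_norm_bound)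
  also have "... \<le> (LINT x|sample m. Z x)"
  proof (rule integral_mono)
    show "integrable (sample m) (\<lambda>x. cmod (iexp (a * usum h m x) * (\<psi> x - exp (- q))))"
      using Ie Ie\<psi> by (intro integrable_norm) (simp add: right_diff_distrib)
    show "integrable (sample m) Z" unfolding Z_def using I3' Iu by simp
  qed (simp add: norm_mult pw)
  also have "... = \<bar>a\<bar>^3 / 6 * (LINT x|sample m. LINT y|M. \<bar>inc m x y\<bar> ^ 3) + a\<^sup>2 * (LINT x|sample m. \<bar>usum sq_kernel m x\<bar>) + q\<^sup>2 / 2"
    unfolding Z_def using I3' Iu by (simp add: S.prob_space)
  also have "... \<le> \<bar>a\<bar>^3 / 6 * (sqrt (real n * v) * sqrt (real n * K + 3 * (real n)\<^sup>2 * v\<^sup>2)) + a\<^sup>2 * (real n * sqrt \<gamma>) + (a\<^sup>2 * real n * v)\<^sup>2 / 8"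
  proof (intro add_mono mult_left_mono)
    have "(LINT x|sample m. LINT y|M. \<bar>inc m x y\<bar> ^ 3) = (LINT z|?P. \<bar>?Y z * ?Y z ^ 2\<bar>)"
      unfolding abs_cube using P.integral_fst'[OF I3] by (simp add: abs_cube)
    also have "... \<le> sqrt (LINT z|?P. (?Y z)\<^sup>2) * sqrt (LINT z|?P. (?Y z ^ 2)\<^sup>2)" using inc_bound inc_power_bound[of _ m _ 2]
      by (intro P.P.cauchy_schwarz_bounded) (auto simp: space_pair_measure)
    also have "... \<le> sqrt (real n * v) * sqrt (real n * K + 3 * (real n)\<^sup>2 * v\<^sup>2)"
    proof (intro mult_mono real_sqrt_le_mono)
      show "(LINT z|?P. (?Y z)\<^sup>2) \<le> real n * v" using inc2[of m] m v_nonneg by (auto intro!: mult_right_mono)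
      have "(LINT z|?P. (?Y z ^ 2)\<^sup>2) \<le> real m * K + 3 * (real m)\<^sup>2 * v\<^sup>2" using inc4[of m] by (simp add: power_mult[symmetric])
      also have "... \<le> real n * K + 3 * (real n)\<^sup>2 * v\<^sup>2"
        using m K_nonneg by (intro add_mono mult_mono mult_right_mono mult_left_mono power_mono) auto
      finally show "(LINT z|?P. (?Y z ^ 2)\<^sup>2) \<le> real n * K + 3 * (real n)\<^sup>2 * v\<^sup>2" .
    qed (use v_nonneg in \<open>auto intro!: lint_nonneg\<close>)
    finally show "(LINT x|sample m. LINT y|M. \<bar>inc m x y\<bar> ^ 3) \<le> sqrt (real n * v) * sqrt (real n * K + 3 * (real n)\<^sup>2 * v\<^sup>2)" .
    have \<gamma>0: "\<gamma> \<ge> 0" unfolding \<gamma>_def by (intro lint_nonneg) auto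
    have "(LINT x|sample m. \<bar>usum sq_kernel m x * 1\<bar>) \<le> sqrt (LINT x|sample m. (usum sq_kernel m x)\<^sup>2) * sqrt (LINT x|sample m. 1\<^sup>2)"
      using G.usum_bound by (intro S.cauchy_schwarz_bounded) auto
    also have "... = sqrt (real m * (real m - 1) / 2 * \<gamma>)" by (simp add: S.prob_space G.usum_second_moment \<gamma>_def)
    also have "... \<le> sqrt ((real n)\<^sup>2 * \<gamma>)"
    proof (intro real_sqrt_le_mono mult_right_mono)
      have "real m * (real m - 1) / 2 \<le> real m * real m" by (simp add: algebra_simps)
      also have "... \<le> (real n)\<^sup>2" unfolding power2_eq_square using m by (intro mult_mono) auto
      finally show "real m * (real m - 1) / 2 \<le> (real n)\<^sup>2" .
    qed (rule \<gamma>0)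
    also have "... = real n * sqrt \<gamma>" by (simp add: real_sqrt_mult)
    finally show "(LINT x|sample m. \<bar>usum sq_kernel m x\<bar>) \<le> real n * sqrt \<gamma>" by simp
    have "q\<^sup>2 / 2 = (a\<^sup>2 * real m * v)\<^sup>2 / 8" by (simp add: q_def power_divide)
    also have "... \<le> (a\<^sup>2 * real n * v)\<^sup>2 / 8"
      using m v_nonneg by (intro divide_right_mono power_mono mult_right_mono mult_left_mono) auto
    finally show "q\<^sup>2 / 2 \<le> (a\<^sup>2 * real n * v)\<^sup>2 / 8" .
  qed auto
  also have "... = clt_err a n v K \<gamma>" by (simp add: clt_err_def)
  finally show ?thesis unfolding q_def \<gamma>_def \<phi>_def .
qed

text \<open>Each factor \<open>exp (- (a^2 * m * v / 2))\<close> is at most 1, so the errors of the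
  steps just add up. The exponents sum to the stated one because the numbers below \<open>n\<close>
  sum to \<open>n * (n - 1) / 2\<close>.\<close>

lemma clt_bound:
  fixes a :: real
  shows "cmod ((LINT x|sample n. iexp (a * usum h n x)) - exp (- (a\<^sup>2 * (real n * (real n - 1)) * v / 4))) \<le>
    real n * clt_err a n v K (LINT y|M. LINT x|M. sq_kernel x y ^ 2)"
proof -
  define \<gamma> where "\<gamma> = (LINT y|M. LINT x|M. sq_kernel x y ^ 2)"
  define \<phi> where "\<phi> m = (LINT x|sample m. iexp (a * usum h m x))" for m
  define e where "e = clt_err a n v K \<gamma>"
  have "m \<le> n \<Longrightarrow> cmod (\<phi> m - exp (- (a\<^sup>2 * (real m * (real m - 1)) * v / 4))) \<le> real m * e" for m
  proof (induction m)
    case 0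
    interpret S: prob_space "sample 0" by (rule prob_space_sample)
    show ?case using S.prob_space by (simp add: \<phi>_def usum_def)
  next
    case (Suc m)
    define q where "q = exp (- (a\<^sup>2 * real m * v / 2))"
    define r where "r = exp (- (a\<^sup>2 * (real m * (real m - 1)) * v / 4))"
    have q1: "0 \<le> q" "q \<le> 1" using v_nonneg by (auto simp: q_def)
    have "exp (- (a\<^sup>2 * (real (Suc m) * (real (Suc m) - 1)) * v / 4)) = q * r" by (simp add: q_def r_def exp_add[symmetric] field_simps)
    then have "\<phi> (Suc m) - exp (- (a\<^sup>2 * (real (Suc m) * (real (Suc m) - 1)) * v / 4)) =
       (\<phi> (Suc m) - q * \<phi> m) + q * (\<phi> m - r)" by (simp add: algebra_simps)
    also have "cmod ... \<le> cmod (\<phi> (Suc m) - q * \<phi> m) + cmod (q * (\<phi> m - r))" by (rule norm_triangle_ineq)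
    also have "cmod (q * (\<phi> m - r)) \<le> 1 * (real m * e)" unfolding norm_mult using q1 Suc by (intro mult_mono) (auto simp: r_def)
    also have "cmod (\<phi> (Suc m) - q * \<phi> m) \<le> e" using clt_step[of m n a] Suc.prems unfolding \<phi>_def q_def e_def \<gamma>_def by simp
    finally have "cmod (\<phi> (Suc m) - exp (- (a\<^sup>2 * (real (Suc m) * (real (Suc m) - 1)) * v / 4))) \<le> e + 1 * (real m * e)" by simp
    also have "... = real (Suc m) * e" by (simp add: distrib_right)
    finally show ?case .
  qed
  from this[OF order_refl] show ?thesis unfolding \<phi>_def e_def \<gamma>_def .
qed

end

section \<open>Weak convergence from characteristic functions\<close>

lemma prob_space_density_normalised:
  fixes f :: "'a \<Rightarrow> real"
  assumes "\<And>x. x \<in> space N \<Longrightarrow> 0 \<le> f x" and f: "integrable N f" and d: "d = (LINT x|N. f x)" "d > 0"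
  shows "prob_space (density N (\<lambda>x. ennreal (f x / d)))"
proof (rule prob_spaceI)
  have [measurable]: "f \<in> borel_measurable N" using f by auto
  have "(\<integral>\<^sup>+x. ennreal (f x / d) \<partial>N) = ennreal (LINT x|N. f x / d)"
    using assms by (intro nn_integral_eq_integral) (auto intro!: AE_I2)
  also have "... = 1" using d by simp
  finally show "emeasure (density N (\<lambda>x. ennreal (f x / d))) (space (density N (\<lambda>x. ennreal (f x / d)))) = 1"
    by (subst emeasure_density) (auto cong: nn_integral_cong)
qed

lemma integral_distr_weighted:
  fixes f :: "real \<Rightarrow> 'c::{banach,second_countable_topology}"
  assumes [measurable]: "F \<in> borel_measurable N" "R \<in> borel_measurable N" "f \<in> borel_measurable borel"
    and "\<And>x. x \<in> space N \<Longrightarrow> 0 \<le> F x" "c > 0"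
  shows "integral\<^sup>L (distr (density N (\<lambda>x. ennreal (F x / c))) borel R) f = (LINT x|N. F x *\<^sub>R f (R x)) /\<^sub>R c"
proof -
  have "integral\<^sup>L (distr (density N (\<lambda>x. ennreal (F x / c))) borel R) f = (LINT x|N. (F x / c) *\<^sub>R f (R x))"
    using assms by (subst integral_distr, simp, simp, subst integral_density) (auto intro!: AE_I2)
  also have "... = (LINT x|N. (F x *\<^sub>R f (R x)) /\<^sub>R c)" by (simp add: divide_inverse mult.commute)
  also have "... = (LINT x|N. F x *\<^sub>R f (R x)) /\<^sub>R c" by (rule integral_scaleR_right)
  finally show ?thesis .
qed

lemma iexp_cis: "iexp t = cis t" by (simp add: cis_conv_exp)

lemma integral_weighted_iexp:
  fixes f w y :: "'a \<Rightarrow> real"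
  assumes "integrable N (\<lambda>x. f x * w x)" "integrable N (\<lambda>x. f x * (1 + cos (y x)) * w x)"
    "integrable N (\<lambda>x. f x * (1 + sin (y x)) * w x)"
  shows "(LINT x|N. (f x * w x) *\<^sub>R iexp (y x)) =
     complex_of_real (LINT x|N. f x * (1 + cos (y x)) * w x) - complex_of_real (LINT x|N. f x * w x)
     + \<i> * (complex_of_real (LINT x|N. f x * (1 + sin (y x)) * w x) - complex_of_real (LINT x|N. f x * w x))"
proof -
  have split: "(f * w) *\<^sub>R iexp y = complex_of_real ((f * (1 + cos y)) * w) - complex_of_real (f * w)
      + \<i> * (complex_of_real ((f * (1 + sin y)) * w) - complex_of_real (f * w))" for f w y :: real
    unfolding iexp_cis by (simp add: complex_eq_iff algebra_simps)
  show ?thesis unfolding split using assms[THEN integrable_of_real[where 'a=complex]]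
    by (simp add: integral_complex_of_real[symmetric] del: integral_complex_of_real of_real_mult of_real_add)
qed

text \<open>The masses of the weighted measures converge by the case \<open>b = 0\<close>; after
  division by them Levy's theorem applies. If the limit mass is zero there is nothing to divide by,
  and the integrals are squeezed by \<open>G * c n\<close> instead.\<close>

lemma weighted_levy_continuity:
  fixes M :: "nat \<Rightarrow> 'a measure" and P :: "'b measure" and g :: "real \<Rightarrow> real"
  assumes M: "\<And>n. prob_space (M n)" and P: "prob_space P"
    and R [measurable]: "\<And>n. R n \<in> borel_measurable (M n)" "R' \<in> borel_measurable P"
    and F [measurable]: "\<And>n. F n \<in> borel_measurable (M n)" "F' \<in> borel_measurable P"
    and F0: "\<And>n x. x \<in> space (M n) \<Longrightarrow> 0 \<le> F n x" "\<And>x. x \<in> space P \<Longrightarrow> 0 \<le> F' x"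
    and FC: "\<And>n x. x \<in> space (M n) \<Longrightarrow> F n x \<le> C" "\<And>x. x \<in> space P \<Longrightarrow> F' x \<le> C"
    and conv: "\<And>b. (\<lambda>n. LINT x|M n. F n x *\<^sub>R iexp (b * R n x)) \<longlonglongrightarrow> (LINT x|P. F' x *\<^sub>R iexp (b * R' x))"
    and g [measurable]: "g \<in> borel_measurable borel" and gb: "\<And>r. \<bar>g r\<bar> \<le> G"
    and gc: "AE x in P. isCont g (R' x)"
  shows "(\<lambda>n. LINT x|M n. F n x * g (R n x)) \<longlonglongrightarrow> (LINT x|P. F' x * g (R' x))"
proof -
  interpret P: prob_space P by fact
  interpret M: prob_space "M n" for n by (rule M)
  define c where "c n = (LINT x|M n. F n x)" for n
  define c' where "c' = (LINT x|P. F' x)"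
  have FI: "integrable (M n) (F n)" for n using F0 FC by (intro M.integrable_bounded[of _ n C]) auto
  have FI': "integrable P F'" using F0 FC by (intro P.integrable_bounded[of _ C]) auto
  have c0: "c n \<ge> 0" "c' \<ge> 0" for n unfolding c_def c'_def using F0 by (auto intro!: Bochner_Integration.integral_nonneg_AE)
  have "(\<lambda>n. complex_of_real (c n)) \<longlonglongrightarrow> complex_of_real c'"
    using conv[of 0] by (simp add: c_def c'_def scaleR_conv_of_real)
  then have cc: "c \<longlonglongrightarrow> c'" using tendsto_Re by force
  have gI: "integrable (M n) (\<lambda>x. F n x * g (R n x))" for n
    using FC F0 gb by (intro lintegrable_bound[OF integrable_mult_right[OF FI[of n], of G]])
      (auto simp: abs_mult mult.commute[of G] intro!: mult_mono order_trans[OF gb abs_ge_self] AE_I2)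
  have bn: "\<bar>LINT x|M n. F n x * g (R n x)\<bar> \<le> G * c n" for n
  proof -
    have "\<bar>LINT x|M n. F n x * g (R n x)\<bar> \<le> (LINT x|M n. \<bar>F n x * g (R n x)\<bar>)" by (rule integral_abs_bound)
    also have "... \<le> (LINT x|M n. G * F n x)"
    proof (intro integral_mono integrable_abs gI integrable_mult_right FI)
      show "\<bar>F n x * g (R n x)\<bar> \<le> G * F n x" if "x \<in> space (M n)" for x
        using mult_right_mono[OF gb F0(1)[OF that], of "R n x"] F0(1)[OF that] by (simp add: abs_mult mult.commute)
    qed
    finally show ?thesis using FI by (simp add: c_def)
  qed
  show ?thesis
  proof (cases "c' = 0")
    case True
    have "AE x in P. F' x = 0" using True FI' F0 unfolding c'_def by (subst (asm) integral_nonneg_eq_0_iff_AE) auto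
    then have "(LINT x|P. F' x * g (R' x)) = (LINT x|P. 0)" by (intro integral_cong_AE) (auto elim!: eventually_mono)
    moreover have "(\<lambda>n. G * c n) \<longlonglongrightarrow> 0" using tendsto_mult_right_zero[of c sequentially G] cc True by simp
    then have "(\<lambda>n. LINT x|M n. F n x * g (R n x)) \<longlonglongrightarrow> 0" by (rule Lim_null_comparison[rotated]) (use bn in simp)
    ultimately show ?thesis by simp
  next
    case False
    then have c': "c' > 0" using c0 by simp
    define \<nu>' where "\<nu>' = distr (density P (\<lambda>x. F' x / c')) borel R'"
    \<comment> \<open>Where the weight has no mass the limit law serves as a placeholder, so that
      every member of the sequence is a probability law.\<close>
    define \<nu> where "\<nu> n = (if c n > 0 then distr (density (M n) (\<lambda>x. F n x / c n)) borel (R n) else \<nu>')" for n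
    have rd': "real_distribution \<nu>'"
    proof -
      interpret D: prob_space "density P (\<lambda>x. F' x / c')" using F0 FI' c' by (intro prob_space_density_normalised) (auto simp: c'_def)
      show ?thesis unfolding \<nu>'_def by (intro real_distribution.intro real_distribution_axioms.intro D.prob_space_distr) auto
    qed
    have rd: "real_distribution (\<nu> n)" for n
    proof (cases "c n > 0")
      case True
      interpret D: prob_space "density (M n) (\<lambda>x. F n x / c n)" using F0 FI True by (intro prob_space_density_normalised) (auto simp: c_def)
      show ?thesis unfolding \<nu>_def using True by (auto intro!: real_distribution.intro real_distribution_axioms.intro D.prob_space_distr)
    qed (use rd' in \<open>simp add: \<nu>_def\<close>)
    have int': "integral\<^sup>L \<nu>' f = (LINT x|P. F' x * f (R' x)) / c'" "char \<nu>' t = (LINT x|P. F' x *\<^sub>R iexp (t * R' x)) /\<^sub>R c'"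
      if [measurable]: "f \<in> borel_measurable borel" for f t unfolding \<nu>'_def char_def using F0 c'
      by (subst integral_distr_weighted; simp add: divide_inverse mult.commute)+
    have int: "integral\<^sup>L (\<nu> n) f = (LINT x|M n. F n x * f (R n x)) / c n" "char (\<nu> n) t = (LINT x|M n. F n x *\<^sub>R iexp (t * R n x)) /\<^sub>R c n"
      if [measurable]: "f \<in> borel_measurable borel" and "c n > 0" for f n t unfolding \<nu>_def char_def using F0 that(2)
      by (simp, subst integral_distr_weighted; simp add: divide_inverse mult.commute)+
    have ev: "\<forall>\<^sub>F n in sequentially. c n > 0" using cc c' by (rule order_tendstoD)
    have wc: "weak_conv_m \<nu> \<nu>'"
    proof (rule levy_continuity[OF rd rd'])
      fix t
      have "(\<lambda>n. (LINT x|M n. F n x *\<^sub>R iexp (t * R n x)) /\<^sub>R c n) \<longlonglongrightarrow> (LINT x|P. F' x *\<^sub>R iexp (t * R' x)) /\<^sub>R c'"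
        by (intro tendsto_scaleR tendsto_inverse cc conv False)
      moreover have "\<forall>\<^sub>F n in sequentially. (LINT x|M n. F n x *\<^sub>R iexp (t * R n x)) /\<^sub>R c n = char (\<nu> n) t"
        using ev by (eventually_elim) (simp add: int(2)[OF g])
      ultimately show "(\<lambda>n. char (\<nu> n) t) \<longlonglongrightarrow> char \<nu>' t" by (simp add: int'(2)[OF g] Lim_transform_eventually)
    qed
    have "emeasure \<nu>' {x. \<not> isCont g x} = 0"
    proof -
      have [measurable]: "{x. isCont g x} \<in> sets borel" by (rule isCont_borel)
      then have [measurable]: "{x. \<not> isCont g x} \<in> sets borel"
        using sets.compl_sets[of "{x. isCont g x}" borel] by (simp add: Compl_eq_Diff_UNIV[symmetric] Collect_neg_eq)
      have "emeasure \<nu>' {x. \<not> isCont g x} = emeasure (density P (\<lambda>x. F' x / c')) (R' -` {x. \<not> isCont g x} \<inter> space P)"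
        unfolding \<nu>'_def by (subst emeasure_distr) auto
      also have "... = 0"
      proof -
        have "AE x in P. x \<notin> R' -` {x. \<not> isCont g x} \<inter> space P" using gc by (auto elim!: eventually_mono)
        then show ?thesis by (subst emeasure_density, simp, measurable, subst nn_integral_0_iff_AE)
             (auto elim!: eventually_mono simp: indicator_def)
      qed
      finally show ?thesis .
    qed
    from weak_conv_imp_bdd_ae_continuous_conv[OF rd rd' wc this _ g, of G] gb
    have "(\<lambda>n. integral\<^sup>L (\<nu> n) g) \<longlonglongrightarrow> integral\<^sup>L \<nu>' g" by simp
    then have "(\<lambda>n. c n * integral\<^sup>L (\<nu> n) g) \<longlonglongrightarrow> c' * integral\<^sup>L \<nu>' g" by (intro tendsto_mult cc)
    moreover have "\<forall>\<^sub>F n in sequentially. c n * integral\<^sup>L (\<nu> n) g = (LINT x|M n. F n x * g (R n x))"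
      using ev by eventually_elim (simp add: int)
    moreover have "c' * integral\<^sup>L \<nu>' g = (LINT x|P. F' x * g (R' x))" using c' by (simp add: int')
    ultimately show ?thesis by (simp add: Lim_transform_eventually)
  qed
qed

text \<open>A complex weight \<open>F e\<^sup>i\<^sup>Y\<close> is reduced to the nonnegative weights \<open>F (1 + cos Y)\<close>, \<open>F (1 + sin Y)\<close>
  and \<open>F\<close>.\<close>

lemma weighted_levy_continuity_iexp:
  fixes M :: "nat \<Rightarrow> 'a measure" and P :: "'b measure" and g :: "real \<Rightarrow> real"
  assumes M: "\<And>n. prob_space (M n)" and P: "prob_space P"
    and R [measurable]: "\<And>n. R n \<in> borel_measurable (M n)" "R' \<in> borel_measurable P"
    and Y [measurable]: "\<And>n. Y n \<in> borel_measurable (M n)" "Y' \<in> borel_measurable P"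
    and F [measurable]: "\<And>n. F n \<in> borel_measurable (M n)" "F' \<in> borel_measurable P"
    and F0: "\<And>n x. x \<in> space (M n) \<Longrightarrow> 0 \<le> F n x" "\<And>x. x \<in> space P \<Longrightarrow> 0 \<le> F' x"
    and FC: "\<And>n x. x \<in> space (M n) \<Longrightarrow> F n x \<le> C" "\<And>x. x \<in> space P \<Longrightarrow> F' x \<le> C"
    and conv: "\<And>a b. (\<lambda>n. LINT x|M n. F n x *\<^sub>R iexp (a * Y n x + b * R n x)) \<longlonglongrightarrow>
        (LINT x|P. F' x *\<^sub>R iexp (a * Y' x + b * R' x))"
    and g [measurable]: "g \<in> borel_measurable borel" and gb: "\<And>r. \<bar>g r\<bar> \<le> G"
    and gc: "AE x in P. isCont g (R' x)"
  shows "(\<lambda>n. LINT x|M n. (F n x * g (R n x)) *\<^sub>R iexp (Y n x)) \<longlonglongrightarrow>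
      (LINT x|P. (F' x * g (R' x)) *\<^sub>R iexp (Y' x))"
proof -
  interpret P: prob_space P by fact
  interpret M: prob_space "M n" for n by (rule M)
  have Fabs: "\<bar>F n x\<bar> \<le> C" if "x \<in> space (M n)" for n x using F0 FC that by auto
  have Fabs': "\<bar>F' x\<bar> \<le> C" if "x \<in> space P" for x using F0 FC that by auto
  have I: "integrable (M n) (\<lambda>x. F n x *\<^sub>R iexp (a * Y n x + b * R n x))" for n a b
    using Fabs by (intro M.integrable_bounded[of _ n C]) auto
  have I': "integrable P (\<lambda>x. F' x *\<^sub>R iexp (a * Y' x + b * R' x))" for a b using Fabs' by (intro P.integrable_bounded[of _ C]) auto
  define \<Psi> where "\<Psi> n a b = (LINT x|M n. F n x *\<^sub>R iexp (a * Y n x + b * R n x))" for n a b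
  define \<Psi>' where "\<Psi>' a b = (LINT x|P. F' x *\<^sub>R iexp (a * Y' x + b * R' x))" for a b
  have conv': "(\<lambda>n. \<Psi> n a b) \<longlonglongrightarrow> \<Psi>' a b" for a b using conv by (simp add: \<Psi>_def \<Psi>'_def)
  have cs: "(f * (1 + cos y)) *\<^sub>R iexp (b * r) = f *\<^sub>R iexp (0 * y + b * r) +
       ((1/2) *\<^sub>R (f *\<^sub>R iexp (1 * y + b * r)) + (1/2) *\<^sub>R (f *\<^sub>R iexp ((-1) * y + b * r)))" for f y b r :: real
    unfolding iexp_cis by (simp add: complex_eq_iff cos_add sin_add cos_diff sin_diff field_simps)
  have sn: "(f * (1 + sin y)) *\<^sub>R iexp (b * r) = f *\<^sub>R iexp (0 * y + b * r) +
       ((- \<i> / 2) * (f *\<^sub>R iexp (1 * y + b * r)) + (\<i> / 2) * (f *\<^sub>R iexp ((-1) * y + b * r)))" for f y b r :: real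
    unfolding iexp_cis by (simp add: complex_eq_iff cos_add sin_add cos_diff sin_diff field_simps)
  have c1: "0 \<le> 1 + cos y" "1 + cos y \<le> 2" "0 \<le> 1 + sin y" "1 + sin y \<le> 2" for y :: real
    using cos_ge_minus_one[of y] sin_ge_minus_one[of y] cos_le_one[of y] sin_le_one[of y] by linarith+
  have bd: "f * u \<le> C * 2" if "0 \<le> f" "f \<le> C" "0 \<le> u" "u \<le> 2" for f u :: real using that by (intro mult_mono) auto
  have L1: "(\<lambda>n. LINT x|M n. F n x * g (R n x)) \<longlonglongrightarrow> (LINT x|P. F' x * g (R' x))"
    using conv[of 0] by (intro weighted_levy_continuity[OF M P R F F0 FC _ g gb gc]) auto
  have L2: "(\<lambda>n. LINT x|M n. (F n x * (1 + cos (Y n x))) * g (R n x)) \<longlonglongrightarrow> (LINT x|P. (F' x * (1 + cos (Y' x))) * g (R' x))"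
  proof (rule weighted_levy_continuity[OF M P R _ _ _ _ _ _ _ g gb gc, where C = "C * 2"])
    fix b
    have 1: "(LINT x|M n. (F n x * (1 + cos (Y n x))) *\<^sub>R iexp (b * R n x)) = \<Psi> n 0 b + ((1/2) *\<^sub>R \<Psi> n 1 b + (1/2) *\<^sub>R \<Psi> n (-1) b)" for n
      unfolding cs \<Psi>_def by (intro trans[OF Bochner_Integration.integral_add] arg_cong2[of _ _ _ _ "(+)"] refl Bochner_Integration.integrable_add integrable_scaleR_right integral_scaleR_right I)
    have 2: "(LINT x|P. (F' x * (1 + cos (Y' x))) *\<^sub>R iexp (b * R' x)) = \<Psi>' 0 b + ((1/2) *\<^sub>R \<Psi>' 1 b + (1/2) *\<^sub>R \<Psi>' (-1) b)"
      unfolding cs \<Psi>'_def by (intro trans[OF Bochner_Integration.integral_add] arg_cong2[of _ _ _ _ "(+)"] refl Bochner_Integration.integrable_add integrable_scaleR_right integral_scaleR_right I')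
    show "(\<lambda>n. LINT x|M n. (F n x * (1 + cos (Y n x))) *\<^sub>R iexp (b * R n x)) \<longlonglongrightarrow> (LINT x|P. (F' x * (1 + cos (Y' x))) *\<^sub>R iexp (b * R' x))"
      unfolding 1 2 by (intro tendsto_intros conv')
  qed (use F0 FC c1 in \<open>auto intro!: mult_nonneg_nonneg bd\<close>)
  have L3: "(\<lambda>n. LINT x|M n. (F n x * (1 + sin (Y n x))) * g (R n x)) \<longlonglongrightarrow> (LINT x|P. (F' x * (1 + sin (Y' x))) * g (R' x))"
  proof (rule weighted_levy_continuity[OF M P R _ _ _ _ _ _ _ g gb gc, where C = "C * 2"])
    fix b
    have 1: "(LINT x|M n. (F n x * (1 + sin (Y n x))) *\<^sub>R iexp (b * R n x)) = \<Psi> n 0 b + ((- \<i> / 2) * \<Psi> n 1 b + (\<i> / 2) * \<Psi> n (-1) b)" for n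
      unfolding sn \<Psi>_def by (intro trans[OF Bochner_Integration.integral_add] arg_cong2[of _ _ _ _ "(+)"] refl Bochner_Integration.integrable_add integrable_mult_right integral_mult_right_zero I)
    have 2: "(LINT x|P. (F' x * (1 + sin (Y' x))) *\<^sub>R iexp (b * R' x)) = \<Psi>' 0 b + ((- \<i> / 2) * \<Psi>' 1 b + (\<i> / 2) * \<Psi>' (-1) b)"
      unfolding sn \<Psi>'_def by (intro trans[OF Bochner_Integration.integral_add] arg_cong2[of _ _ _ _ "(+)"] refl Bochner_Integration.integrable_add integrable_mult_right integral_mult_right_zero I')
    show "(\<lambda>n. LINT x|M n. (F n x * (1 + sin (Y n x))) *\<^sub>R iexp (b * R n x)) \<longlonglongrightarrow> (LINT x|P. (F' x * (1 + sin (Y' x))) *\<^sub>R iexp (b * R' x))"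
      unfolding 1 2 by (intro tendsto_intros conv')
  qed (use F0 FC c1 in \<open>auto intro!: mult_nonneg_nonneg bd\<close>)
  have Fg: "\<bar>f * u * w\<bar> \<le> C * 2 * G" if "0 \<le> f" "f \<le> C" "0 \<le> u" "u \<le> 2" "\<bar>w\<bar> \<le> G" for f u w :: real
    unfolding abs_mult using that by (intro mult_mono) auto
  have Fg1: "\<bar>f * w\<bar> \<le> C * G" if "0 \<le> f" "f \<le> C" "\<bar>w\<bar> \<le> G" for f w :: real
    unfolding abs_mult using that by (intro mult_mono) auto
  have i1: "integrable (M n) (\<lambda>x. F n x * g (R n x))" for n using F0 FC gb by (intro M.integrable_bounded[of _ n "C * G"]) (auto intro!: Fg1)
  have i2: "integrable (M n) (\<lambda>x. F n x * (1 + cos (Y n x)) * g (R n x))" for n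
    using F0 FC gb c1 by (intro M.integrable_bounded[of _ n "C * 2 * G"]) (auto simp del: power_abs intro!: Fg)
  have i3: "integrable (M n) (\<lambda>x. F n x * (1 + sin (Y n x)) * g (R n x))" for n
    using F0 FC gb c1 by (intro M.integrable_bounded[of _ n "C * 2 * G"]) (auto intro!: Fg)
  have i1': "integrable P (\<lambda>x. F' x * g (R' x))" using F0 FC gb by (intro P.integrable_bounded[of _ "C * G"]) (auto intro!: Fg1)
  have i2': "integrable P (\<lambda>x. F' x * (1 + cos (Y' x)) * g (R' x))"
    using F0 FC gb c1 by (intro P.integrable_bounded[of _ "C * 2 * G"]) (auto intro!: Fg)
  have i3': "integrable P (\<lambda>x. F' x * (1 + sin (Y' x)) * g (R' x))"
    using F0 FC gb c1 by (intro P.integrable_bounded[of _ "C * 2 * G"]) (auto intro!: Fg)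
  show ?thesis unfolding integral_weighted_iexp[OF i1 i2 i3] integral_weighted_iexp[OF i1' i2' i3'] by (intro tendsto_intros L1 L2 L3)
qed

text \<open>The exponential factors are exchanged for the functions \<open>f k\<close> one at a
  time; those already exchanged form the nonnegative weight of
  \<open>weighted_levy_continuity_iexp\<close>. Joint convergence thus follows from Levy continuity
  on the real line.\<close>

lemma joint_iexp_imp_prod:
  fixes M :: "nat \<Rightarrow> 'a measure" and P :: "'b measure" and f :: "nat \<Rightarrow> real \<Rightarrow> real"
  assumes M: "\<And>n. prob_space (M n)" and P: "prob_space P"
    and Z [measurable]: "\<And>n k. k < m \<Longrightarrow> Z n k \<in> borel_measurable (M n)" "\<And>k. k < m \<Longrightarrow> Z' k \<in> borel_measurable P"
    and conv: "\<And>a. (\<lambda>n. LINT x|M n. iexp (\<Sum>k<m. a k * Z n k x)) \<longlonglongrightarrow> (LINT x|P. iexp (\<Sum>k<m. a k * Z' k x))"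
    and f [measurable]: "\<And>k. k < m \<Longrightarrow> f k \<in> borel_measurable borel"
    and f01: "\<And>k r. k < m \<Longrightarrow> 0 \<le> f k r" "\<And>k r. k < m \<Longrightarrow> f k r \<le> 1"
    and fc: "\<And>k. k < m \<Longrightarrow> AE x in P. isCont (f k) (Z' k x)"
  shows "(\<lambda>n. LINT x|M n. (\<Prod>k<m. f k (Z n k x))) \<longlonglongrightarrow> (LINT x|P. (\<Prod>k<m. f k (Z' k x)))"
proof -
  have "j \<le> m \<Longrightarrow> (\<lambda>n. LINT x|M n. (\<Prod>k<j. f k (Z n k x)) *\<^sub>R iexp (\<Sum>k\<in>{j..<m}. a k * Z n k x)) \<longlonglongrightarrow>
    (LINT x|P. (\<Prod>k<j. f k (Z' k x)) *\<^sub>R iexp (\<Sum>k\<in>{j..<m}. a k * Z' k x))" for j a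
  proof (induction j arbitrary: a)
    case 0
    then show ?case using conv[of a] by (simp add: atLeast0LessThan)
  next
    case (Suc j)
    then have j: "j < m" by simp
    have *: "(\<Sum>k\<in>{j..<m}. (a(j := b, m := 0)) k * z k) = (\<Sum>k\<in>{Suc j..<m}. a k * z k) + b * z j" for a b and z :: rseq
    proof -
      have "{j..<m} = insert j {Suc j..<m}" using j by auto
      then have "(\<Sum>k\<in>{j..<m}. (a(j := b, m := 0)) k * z k) = b * z j + (\<Sum>k\<in>{Suc j..<m}. (a(j := b, m := 0)) k * z k)"
        using j by simp
      also have "(\<Sum>k\<in>{Suc j..<m}. (a(j := b, m := 0)) k * z k) = (\<Sum>k\<in>{Suc j..<m}. a k * z k)" by (intro sum.cong) auto
      finally show ?thesis by simp
    qed
    have "(\<lambda>n. LINT x|M n. ((\<Prod>k<j. f k (Z n k x)) * f j (Z n j x)) *\<^sub>R iexp (\<Sum>k\<in>{Suc j..<m}. a k * Z n k x)) \<longlonglongrightarrow>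
      (LINT x|P. ((\<Prod>k<j. f k (Z' k x)) * f j (Z' j x)) *\<^sub>R iexp (\<Sum>k\<in>{Suc j..<m}. a k * Z' k x))"
    proof (rule weighted_levy_continuity_iexp[OF M P _ _ _ _ _ _ _ _ _ _ _ _ _ fc[OF j], where C = 1 and G = 1])
      fix c b
      have **: "c * (\<Sum>k\<in>{Suc j..<m}. a k * z k) + b * z j = (\<Sum>k\<in>{j..<m}. ((\<lambda>k. c * a k)(j := b, m := 0)) k * z k)" for z
        unfolding * by (simp add: sum_distrib_left mult.assoc)
      show "(\<lambda>n. LINT x|M n. (\<Prod>k<j. f k (Z n k x)) *\<^sub>R iexp (c * (\<Sum>k\<in>{Suc j..<m}. a k * Z n k x) + b * Z n j x)) \<longlonglongrightarrow>
        (LINT x|P. (\<Prod>k<j. f k (Z' k x)) *\<^sub>R iexp (c * (\<Sum>k\<in>{Suc j..<m}. a k * Z' k x) + b * Z' j x))"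
        unfolding **[of "\<lambda>k. Z n k x" for n x] **[of "\<lambda>k. Z' k x" for x] by (rule Suc.IH) (use j in simp)
      have [measurable]: "k \<in> {..<j} \<Longrightarrow> f k \<in> borel_measurable borel"
        "k \<in> {..<j} \<Longrightarrow> Z n k \<in> borel_measurable (M n)" "k \<in> {..<j} \<Longrightarrow> Z' k \<in> borel_measurable P"
        "k \<in> {Suc j..<m} \<Longrightarrow> Z n k \<in> borel_measurable (M n)" "k \<in> {Suc j..<m} \<Longrightarrow> Z' k \<in> borel_measurable P" for k n
        using j f Z by auto
      show "(\<lambda>x. \<Prod>k<j. f k (Z n k x)) \<in> borel_measurable (M n)" for n by measurable
      show "(\<lambda>x. \<Prod>k<j. f k (Z' k x)) \<in> borel_measurable P" by measurable
      show "(\<lambda>x. \<Sum>k\<in>{Suc j..<m}. a k * Z n k x) \<in> borel_measurable (M n)" for n by measurable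
      show "(\<lambda>x. \<Sum>k\<in>{Suc j..<m}. a k * Z' k x) \<in> borel_measurable P" by measurable
    qed (use j f01 Z f in \<open>auto intro!: prod_nonneg prod_le_1 simp: abs_le_iff intro: order_trans[of _ 0]\<close>)
    then show ?case by (simp add: lessThan_Suc mult.commute)
  qed
  from this[of m] have "(\<lambda>n. complex_of_real (LINT x|M n. (\<Prod>k<m. f k (Z n k x)))) \<longlonglongrightarrow> complex_of_real (LINT x|P. (\<Prod>k<m. f k (Z' k x)))"
    by (simp add: scaleR_conv_of_real integral_complex_of_real[symmetric] del: of_real_prod integral_complex_of_real)
  then show ?thesis using tendsto_Re by force
qed

section \<open>Rotation invariance of the uniform distribution on the sphere\<close>

lemma space_rvec: "space (rvec p) = {..<p} \<rightarrow>\<^sub>E UNIV" by (simp add: rvec_def space_PiM)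

lemma space_PiM_lborel: "space (\<Pi>\<^sub>M k\<in>{..<p}. (lborel :: real measure)) = {..<p} \<rightarrow>\<^sub>E UNIV" by (simp add: space_PiM)

lemma measurable_rvec_component: "k < p \<Longrightarrow> (\<lambda>x. x k) \<in> borel_measurable (rvec p)"
  unfolding rvec_def by (intro measurable_component_singleton) auto

lemma measurable_rvecI:
  assumes "\<And>k. k < p \<Longrightarrow> (\<lambda>x. f x k) \<in> borel_measurable N"
    and "\<And>x. x \<in> space N \<Longrightarrow> f x \<in> extensional {..<p}"
  shows "f \<in> N \<rightarrow>\<^sub>M rvec p"
proof -
  have "(\<lambda>x. \<lambda>k\<in>{..<p}. f x k) \<in> N \<rightarrow>\<^sub>M rvec p"
    unfolding rvec_def using assms(1) by (intro measurable_restrict) auto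
  then show ?thesis by (subst measurable_cong[where g="\<lambda>x. \<lambda>k\<in>{..<p}. f x k"])
       (use assms(2) in \<open>auto simp: extensional_restrict\<close>)
qed

lemma measurable_dot [measurable (raw)]:
  assumes [measurable]: "f \<in> N \<rightarrow>\<^sub>M rvec p" "g \<in> N \<rightarrow>\<^sub>M rvec p"
  shows "(\<lambda>x. dot p (f x) (g x)) \<in> borel_measurable N"
proof -
  have "(\<lambda>x. f x k) \<in> borel_measurable N" "(\<lambda>x. g x k) \<in> borel_measurable N" if "k \<in> {..<p}" for k
    using measurable_compose[OF assms(1) measurable_rvec_component[of k p]]
      measurable_compose[OF assms(2) measurable_rvec_component[of k p]] that by auto
  then show ?thesis unfolding dot_def by measurable
qed

lemma sets_unif_sphere [measurable_cong, simp]: "sets (\<mu> p) = sets (rvec p)" by (simp add: unif_sphere_def)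

lemma space_unif_sphere [simp]: "space (\<mu> p) = space (rvec p)" by (simp add: unif_sphere_def)

lemma dot_commute: "dot p x y = dot p y x" by (simp add: dot_def mult.commute)

lemma dot_self: "dot p x x = (norm2 p x)\<^sup>2" by (simp add: dot_def norm2_def sum_nonneg power2_eq_square)

lemma norm2_nonneg [simp]: "norm2 p x \<ge> 0" by (simp add: norm2_def sum_nonneg)

lemma dot_self_sphere: "x \<in> unit_sphere p \<Longrightarrow> dot p x x = 1" by (simp add: dot_self unit_sphere_def)

lemma abs_dot_le: "\<bar>dot p x y\<bar> \<le> norm2 p x * norm2 p y"
proof -
  have "(dot p x y)\<^sup>2 \<le> dot p x x * dot p y y" using Cauchy_Schwarz_ineq_sum[of x y "{..<p}"] by (simp add: dot_def power2_eq_square)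
  then have "(dot p x y)\<^sup>2 \<le> (norm2 p x * norm2 p y)\<^sup>2" by (simp add: dot_self power_mult_distrib)
  then show ?thesis by (metis abs_le_square_iff abs_of_nonneg mult_nonneg_nonneg norm2_nonneg)
qed

lemma abs_dot_sphere_le: "x \<in> unit_sphere p \<Longrightarrow> y \<in> unit_sphere p \<Longrightarrow> \<bar>dot p x y\<bar> \<le> 1"
  using abs_dot_le[of p x y] by (simp add: unit_sphere_def)

definition vec_comb :: "nat \<Rightarrow> real \<Rightarrow> rseq \<Rightarrow> real \<Rightarrow> rseq \<Rightarrow> nat \<Rightarrow> real" where
  "vec_comb p a x b y = (\<lambda>k\<in>{..<p}. a * x k + b * y k)"

lemma vec_comb_space [simp]: "vec_comb p a x b y \<in> space (rvec p)" by (simp add: vec_comb_def space_rvec)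

lemma measurable_vec_comb [measurable (raw)]:
  assumes [measurable]: "f \<in> N \<rightarrow>\<^sub>M rvec p" "g \<in> N \<rightarrow>\<^sub>M rvec p" "a \<in> borel_measurable N" "b \<in> borel_measurable N"
  shows "(\<lambda>x. vec_comb p (a x) (f x) (b x) (g x)) \<in> N \<rightarrow>\<^sub>M rvec p"
proof (rule measurable_rvecI)
  fix k assume k: "k < p"
  have [measurable]: "(\<lambda>x. f x k) \<in> borel_measurable N" "(\<lambda>x. g x k) \<in> borel_measurable N"
    using measurable_compose[OF assms(1) measurable_rvec_component[OF k]]
      measurable_compose[OF assms(2) measurable_rvec_component[OF k]] by auto
  show "(\<lambda>x. vec_comb p (a x) (f x) (b x) (g x) k) \<in> borel_measurable N" using k by (simp add: vec_comb_def)
qed (auto simp: vec_comb_def)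

lemma dot_vec_comb: "dot p (vec_comb p a x b y) z = a * dot p x z + b * dot p y z"
  by (simp add: dot_def vec_comb_def sum.distrib sum_distrib_left algebra_simps)

lemma dot_vec_comb_right: "dot p z (vec_comb p a x b y) = a * dot p z x + b * dot p z y" using dot_vec_comb[of p a x b y z] by (simp add: dot_commute)

lemma norm2_vec_comb: "(norm2 p (vec_comb p a x b y))\<^sup>2 = a\<^sup>2 * dot p x x + b\<^sup>2 * dot p y y + 2 * a * b * dot p x y"
  unfolding dot_self[symmetric] dot_vec_comb dot_vec_comb_right by (simp add: dot_commute[of p y x] power2_eq_square algebra_simps)

text \<open>For a unit vector \<open>v\<close> this is the reflection in the hyperplane orthogonal
  to \<open>v\<close>.\<close>

definition hrefl :: "nat \<Rightarrow> rseq \<Rightarrow> rseq \<Rightarrow> nat \<Rightarrow> real" where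
  "hrefl p v x = vec_comb p 1 x (- 2 * dot p v x) v"

lemma hrefl_space [simp]: "hrefl p v x \<in> space (rvec p)" by (simp add: hrefl_def)

lemma unit_sphere_space: "x \<in> unit_sphere p \<Longrightarrow> x \<in> space (rvec p)" by (simp add: unit_sphere_def)

lemma rvec_eqI:
  "x \<in> space (rvec p) \<Longrightarrow> y \<in> space (rvec p) \<Longrightarrow> (\<And>k. k < p \<Longrightarrow> x k = y k) \<Longrightarrow> x = y"
  by (rule PiE_ext[of x "{..<p}" "\<lambda>_. UNIV" y]) (auto simp: space_rvec)

lemma measurable_hrefl [measurable]: "v \<in> space (rvec p) \<Longrightarrow> hrefl p v \<in> rvec p \<rightarrow>\<^sub>M rvec p"
  unfolding hrefl_def by measurable

lemma dot_hrefl: "dot p (hrefl p v x) y = dot p x y - 2 * dot p v x * dot p v y" by (simp add: hrefl_def dot_vec_comb)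

lemma dot_hrefl_adjoint: "dot p (hrefl p v x) y = dot p x (hrefl p v y)" using dot_hrefl[of p v x y] dot_hrefl[of p v y x] by (simp add: dot_commute)

lemma hrefl_hrefl:
  assumes v: "v \<in> unit_sphere p" and x: "x \<in> space (rvec p)"
  shows "hrefl p v (hrefl p v x) = x"
proof (rule rvec_eqI)
  have "dot p v (hrefl p v x) = - dot p v x" using dot_hrefl[of p v x v] dot_self_sphere[OF v] by (simp add: dot_commute)
  then show "hrefl p v (hrefl p v x) k = x k" if "k < p" for k
    using that by (simp add: hrefl_def[of p v "hrefl p v x"] vec_comb_def) (simp add: hrefl_def vec_comb_def)
qed (use x in auto)

lemma dot_hrefl_hrefl:
  "v \<in> unit_sphere p \<Longrightarrow> dot p (hrefl p v x) (hrefl p v y) = dot p x y" unfolding dot_hrefl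
  using dot_hrefl[of p v y x] dot_hrefl[of p v y v] dot_self_sphere[of v p] by (simp add: dot_commute algebra_simps)

lemma norm2_eq_sqrt_dot: "norm2 p x = sqrt (dot p x x)" by (simp add: dot_self)

lemma norm2_hrefl: "v \<in> unit_sphere p \<Longrightarrow> norm2 p (hrefl p v x) = norm2 p x" by (simp add: norm2_eq_sqrt_dot dot_hrefl_hrefl)

lemma hrefl_sphere: "v \<in> unit_sphere p \<Longrightarrow> x \<in> unit_sphere p \<Longrightarrow> hrefl p v x \<in> unit_sphere p"
  by (simp add: unit_sphere_def norm2_hrefl)

text \<open>The mirror is the perpendicular bisector. With \<open>d\<close> the difference of the
  two points, equal lengths make twice the inner product of \<open>d\<close> and \<open>x\<close>
  equal to the squared norm of \<open>d\<close>, so the reflection subtracts exactly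
  \<open>d\<close> from \<open>x\<close>.\<close>

lemma hrefl_swap:
  assumes x: "x \<in> unit_sphere p" and y: "y \<in> unit_sphere p" and ne: "x \<noteq> y"
  obtains v where "v \<in> unit_sphere p" "hrefl p v x = y"
proof -
  define d where "d = vec_comb p 1 x (-1) y"
  have d2: "(norm2 p d)\<^sup>2 = 2 - 2 * dot p x y" by (simp add: d_def norm2_vec_comb dot_self_sphere x y)
  have "norm2 p d \<noteq> 0"
  proof
    assume "norm2 p d = 0"
    then have "\<forall>k<p. d k = 0" by (auto simp: norm2_def sum_nonneg_eq_0_iff)
    then have "x = y" using x y by (intro rvec_eqI[of x p y]) (auto simp: d_def vec_comb_def unit_sphere_space)
    with ne show False by simp
  qed
  then have dpos: "norm2 p d > 0" using norm2_nonneg[of p d] by linarith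
  define v where "v = vec_comb p (1 / norm2 p d) d 0 d"
  have v: "v \<in> unit_sphere p"
  proof -
    have "(norm2 p v)\<^sup>2 = 1" unfolding v_def norm2_vec_comb dot_self using dpos by (simp add: power_divide)
    then have "norm2 p v = 1" using norm2_nonneg[of p v] by (simp add: power2_eq_1_iff)
    then show ?thesis by (simp add: unit_sphere_def v_def)
  qed
  have "hrefl p v x = y"
  proof (rule rvec_eqI)
    fix k assume k: "k < p"
    have dx: "dot p d x = (norm2 p d)\<^sup>2 / 2" proof -
      have "dot p d x = 1 - dot p x y" by (simp add: d_def dot_vec_comb dot_self_sphere[OF x] dot_commute[of p y x])
      then show ?thesis using d2 by simp
    qed
    have "2 * dot p v x * v k = d k" unfolding v_def dot_vec_comb dx using dpos k by (simp add: vec_comb_def power2_eq_square field_simps)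
    then show "hrefl p v x k = y k" using k by (simp add: hrefl_def vec_comb_def d_def)
  qed (use y in \<open>auto simp: unit_sphere_space\<close>)
  with v show ?thesis by (rule that)
qed

section \<open>Reflection invariance of Lebesgue measure\<close>

context
  fixes p :: nat
begin

abbreviation (input) Leb :: "rseq measure" where
  "Leb \<equiv> (\<Pi>\<^sub>M k\<in>{..<p}. lborel)"

lemma sets_Leb: "sets Leb = sets (rvec p)" by (rule rvec_eq_lborel)

lemma distr_Leb_componentwise:
  assumes T: "\<And>k. distr lborel borel (T k) = (lborel :: real measure)" "\<And>k. T k \<in> borel_measurable borel"
  shows "distr Leb Leb (\<lambda>x. \<lambda>k\<in>{..<p}. T k (x k)) = Leb"
proof -
  interpret product_sigma_finite "\<lambda>_::nat. lborel :: real measure" by unfold_locales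
  have m: "(\<lambda>x. \<lambda>k\<in>{..<p}. T k (x k)) \<in> Leb \<rightarrow>\<^sub>M Leb"
    using T(2) by (intro measurable_restrict measurable_compose[OF measurable_component_singleton]) auto
  show ?thesis
  proof (rule PiM_eqI)
    fix A :: "nat \<Rightarrow> real set" assume A: "\<And>i. i \<in> {..<p} \<Longrightarrow> A i \<in> sets lborel"
    have "(\<lambda>x. \<lambda>k\<in>{..<p}. T k (x k)) -` (\<Pi>\<^sub>E i\<in>{..<p}. A i) \<inter> space Leb = (\<Pi>\<^sub>E i\<in>{..<p}. T i -` A i)"
      by (auto simp: space_PiM PiE_iff)
    moreover have "emeasure lborel (T i -` A i) = emeasure lborel (A i)" if "i < p" for i
      using A[of i] T(2)[of i] that by (subst (2) T(1)[of i, symmetric]) (simp add: emeasure_distr)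
    moreover have "T i -` A i \<in> sets lborel" if "i < p" for i using A[of i] T(2)[of i] that measurable_sets[of "T i" borel borel "A i"] by simp
    moreover have "emeasure Leb (\<Pi>\<^sub>E i\<in>{..<p}. T i -` A i) = (\<Prod>i<p. emeasure lborel (T i -` A i))"
      using calculation(3) by (subst emeasure_PiM) auto
    ultimately show "emeasure (distr Leb Leb (\<lambda>x. \<lambda>k\<in>{..<p}. T k (x k))) (\<Pi>\<^sub>E i\<in>{..<p}. A i) = (\<Prod>i<p. emeasure lborel (A i))"
      using A by (subst emeasure_distr[OF m]) (auto intro!: sets_PiM_I_finite)
  qed auto
qed

lemma nn_integral_Leb_translate:
  assumes f: "f \<in> borel_measurable (rvec p)" and c: "c = 1 \<or> c = -1"
  shows "(\<integral>\<^sup>+x. f (vec_comb p 1 a c x) \<partial>Leb) = (\<integral>\<^sup>+x. f x \<partial>Leb)"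
proof -
  have "distr lborel borel (\<lambda>x. a k + c * x) = (lborel :: real measure)" for k
  proof -
    have "distr lborel borel (\<lambda>x. a k + c * x) = density lborel (\<lambda>_. 1)"
      using lborel_affine[of c "a k"] c by (subst (2) lborel_affine[of c "a k"]) (auto simp: density_density_eq density_1)
    then show ?thesis by (simp add: density_1)
  qed
  then have *: "distr Leb Leb (\<lambda>x. \<lambda>k\<in>{..<p}. a k + c * x k) = Leb" by (intro distr_Leb_componentwise) auto
  have eq: "vec_comb p 1 a c = (\<lambda>x. \<lambda>k\<in>{..<p}. a k + c * x k)" by (auto simp: vec_comb_def fun_eq_iff)
  have f': "f \<in> borel_measurable Leb" using f by (simp add: measurable_cong_sets[OF sets_Leb refl])
  have "(\<integral>\<^sup>+x. f x \<partial>Leb) = (\<integral>\<^sup>+x. f x \<partial>(distr Leb Leb (\<lambda>x. \<lambda>k\<in>{..<p}. a k + c * x k)))" by (simp only: *)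
  also have "... = (\<integral>\<^sup>+x. f (vec_comb p 1 a c x) \<partial>Leb)"
    unfolding eq using f' by (intro nn_integral_distr) (auto intro!: measurable_restrict)
  finally show ?thesis by simp
qed

text \<open>Uniqueness of Haar measure: both sides are the value of the integral of
  \<open>f (T x) g (T x + y)\<close> over all \<open>(x, y)\<close>, computed in the two possible orders.\<close>

lemma nn_integral_hrefl_symmetric:
  assumes v: "v \<in> unit_sphere p" and [measurable]: "f \<in> borel_measurable (rvec p)" "g \<in> borel_measurable (rvec p)"
  shows "(\<integral>\<^sup>+x. f (hrefl p v x) \<partial>Leb) * (\<integral>\<^sup>+y. g y \<partial>Leb) = (\<integral>\<^sup>+x. g (hrefl p v x) \<partial>Leb) * (\<integral>\<^sup>+y. f y \<partial>Leb)"
proof -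
  interpret product_sigma_finite "\<lambda>_::nat. lborel :: real measure" by unfold_locales
  interpret S: sigma_finite_measure Leb by (rule sigma_finite) simp
  interpret P: pair_sigma_finite Leb Leb ..
  let ?T = "hrefl p v"
  note sets_Leb[measurable_cong]
  have [measurable]: "v \<in> space (rvec p)" using v by (rule unit_sphere_space)
  have [simp]: "space Leb = space (rvec p)" by (simp add: space_rvec space_PiM)
  have 1: "(\<integral>\<^sup>+x. \<integral>\<^sup>+y. f (?T x) * g (vec_comb p 1 (?T x) 1 y) \<partial>Leb \<partial>Leb) = (\<integral>\<^sup>+x. f (?T x) \<partial>Leb) * (\<integral>\<^sup>+y. g y \<partial>Leb)"
  proof -
    have "(\<integral>\<^sup>+y. f (?T x) * g (vec_comb p 1 (?T x) 1 y) \<partial>Leb) = f (?T x) * (\<integral>\<^sup>+y. g y \<partial>Leb)" for x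
      by (subst nn_integral_cmult) (auto simp: nn_integral_Leb_translate)
    then show ?thesis by (simp add: nn_integral_multc)
  qed
  have 2: "(\<integral>\<^sup>+x. f (?T x) * g (vec_comb p 1 (?T x) 1 y) \<partial>Leb) = (\<integral>\<^sup>+x. f (vec_comb p 1 (?T x) (-1) y) * g (?T x) \<partial>Leb)"
    if y: "y \<in> space (rvec p)" for y
  proof -
    \<comment> \<open>The variable is shifted by - T y. As T is linear and an involution, T x
      becomes T x - y, and T x + y becomes T x.\<close>
    have "(\<integral>\<^sup>+x. f (?T x) * g (vec_comb p 1 (?T x) 1 y) \<partial>Leb) =
        (\<integral>\<^sup>+x. f (?T (vec_comb p 1 (vec_comb p (-1) (?T y) 0 y) 1 x)) * g (vec_comb p 1 (?T (vec_comb p 1 (vec_comb p (-1) (?T y) 0 y) 1 x)) 1 y) \<partial>Leb)"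
      using y by (intro nn_integral_Leb_translate[symmetric]) auto
    also have "... = (\<integral>\<^sup>+x. f (vec_comb p 1 (?T x) (-1) y) * g (?T x) \<partial>Leb)"
    proof (rule nn_integral_cong)
      fix x assume x: "x \<in> space Leb"
      have "?T (vec_comb p 1 (vec_comb p (-1) (?T y) 0 y) 1 x) = vec_comb p 1 (?T x) (-1) (?T (?T y))"
      proof (rule rvec_eqI[where p=p])
        have 1: "dot p v (vec_comb p 1 (vec_comb p (-1) (?T y) 0 y) 1 x) = dot p v x - dot p v (?T y)" by (simp add: dot_vec_comb_right)
        show "?T (vec_comb p 1 (vec_comb p (-1) (?T y) 0 y) 1 x) k = vec_comb p 1 (?T x) (-1) (?T (?T y)) k" if "k < p" for k
          using that unfolding hrefl_def[of p v "vec_comb p 1 (vec_comb p (-1) (?T y) 0 y) 1 x"] hrefl_def[of p v x] hrefl_def[of p v "?T y"] 1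
          by (simp add: vec_comb_def algebra_simps)
      qed auto
      then have a: "?T (vec_comb p 1 (vec_comb p (-1) (?T y) 0 y) 1 x) = vec_comb p 1 (?T x) (-1) y" using hrefl_hrefl[OF v y] by simp
      have b: "vec_comb p 1 (vec_comb p 1 (?T x) (-1) y) 1 y = ?T x"
      proof (rule rvec_eqI[where p=p])
        show "vec_comb p 1 (vec_comb p 1 (?T x) (-1) y) 1 y k = ?T x k" if "k < p" for k using that by (simp add: vec_comb_def)
      qed auto
      show "f (?T (vec_comb p 1 (vec_comb p (-1) (?T y) 0 y) 1 x)) * g (vec_comb p 1 (?T (vec_comb p 1 (vec_comb p (-1) (?T y) 0 y) 1 x)) 1 y) =
        f (vec_comb p 1 (?T x) (-1) y) * g (?T x)" unfolding a b ..
    qed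
    finally show ?thesis .
  qed
  have "(\<integral>\<^sup>+x. \<integral>\<^sup>+y. f (?T x) * g (vec_comb p 1 (?T x) 1 y) \<partial>Leb \<partial>Leb) =
      (\<integral>\<^sup>+y. \<integral>\<^sup>+x. f (?T x) * g (vec_comb p 1 (?T x) 1 y) \<partial>Leb \<partial>Leb)"
    by (rule P.Fubini'[symmetric]) measurable
  also have "... = (\<integral>\<^sup>+y. \<integral>\<^sup>+x. f (vec_comb p 1 (?T x) (-1) y) * g (?T x) \<partial>Leb \<partial>Leb)"
    by (rule nn_integral_cong) (simp add: 2)
  also have "... = (\<integral>\<^sup>+x. \<integral>\<^sup>+y. f (vec_comb p 1 (?T x) (-1) y) * g (?T x) \<partial>Leb \<partial>Leb)"
    by (rule P.Fubini') measurable
  also have "... = (\<integral>\<^sup>+x. g (?T x) * (\<integral>\<^sup>+y. f y \<partial>Leb) \<partial>Leb)"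
  proof (rule nn_integral_cong)
    fix x
    show "(\<integral>\<^sup>+y. f (vec_comb p 1 (?T x) (-1) y) * g (?T x) \<partial>Leb) = g (?T x) * (\<integral>\<^sup>+y. f y \<partial>Leb)"
      by (subst nn_integral_multc) (auto simp: nn_integral_Leb_translate mult.commute)
  qed
  also have "... = (\<integral>\<^sup>+x. g (?T x) \<partial>Leb) * (\<integral>\<^sup>+y. f y \<partial>Leb)" by (rule nn_integral_multc) measurable
  finally show ?thesis using 1 by simp
qed

text \<open>The unit ball serves as the second function of
  \<open>nn_integral_hrefl_symmetric\<close>: it is invariant, and its measure is positive and
  finite, so it cancels.\<close>

lemma nn_integral_Leb_hrefl:
  assumes v: "v \<in> unit_sphere p" and [measurable]: "f \<in> borel_measurable (rvec p)"
  shows "(\<integral>\<^sup>+x. f (hrefl p v x) \<partial>Leb) = (\<integral>\<^sup>+x. f x \<partial>Leb)"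
proof -
  let ?B = "indicator (unit_ball p) :: _ \<Rightarrow> ennreal"
  have "?B (hrefl p v x) = ?B x" if "x \<in> space Leb" for x
    using that[unfolded space_PiM_lborel space_rvec[symmetric]] by (auto simp: unit_ball_def norm2_hrefl[OF v] indicator_def)
  then have "(\<integral>\<^sup>+x. ?B (hrefl p v x) \<partial>Leb) = (\<integral>\<^sup>+x. ?B x \<partial>Leb)" by (rule nn_integral_cong)
  then have "(\<integral>\<^sup>+x. f (hrefl p v x) \<partial>Leb) * emeasure Leb (unit_ball p) = (\<integral>\<^sup>+x. f x \<partial>Leb) * emeasure Leb (unit_ball p)"
    using nn_integral_hrefl_symmetric[OF v assms(2), of ?B] by (simp add: sets_Leb mult.commute)
  then show ?thesis using emeasure_unit_ball[of p] by (simp add: mult.commute[of _ "emeasure Leb (unit_ball p)"] ennreal_mult_cancel_left)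
qed

end

text \<open>The cone construction is built from the ball and \<open>normalise\<close>. The
  reflection preserves the first and commutes with the second, so the invariance of Lebesgue measure
  carries over.\<close>

lemma distr_unif_sphere_hrefl:
  assumes v: "v \<in> unit_sphere p"
  shows "distr (\<mu> p) (rvec p) (hrefl p v) = \<mu> p"
proof (rule measure_eqI)
  fix A assume "A \<in> sets (distr (\<mu> p) (rvec p) (hrefl p v))"
  then have A [measurable]: "A \<in> sets (rvec p)" by simp
  let ?L = "\<Pi>\<^sub>M k\<in>{..<p}. (lborel :: real measure)"
  have vs [measurable]: "v \<in> space (rvec p)" using v by (rule unit_sphere_space)
  have sp: "space ?L = space (rvec p)" by (simp add: space_rvec space_PiM)
  have N: "normalise p \<in> ?L \<rightarrow>\<^sub>M rvec p" "normalise p \<in> uniform_measure ?L (unit_ball p) \<rightarrow>\<^sub>M rvec p"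
    by (auto simp: measurable_cong_sets[OF rvec_eq_lborel refl] measurable_def rvec_eq_lborel sp intro: measurable_space[OF measurable_normalise] measurable_sets[OF measurable_normalise])
  have em: "emeasure (\<mu> p) S = (\<integral>\<^sup>+x. indicator (unit_ball p) x * indicator S (normalise p x) \<partial>?L) / emeasure ?L (unit_ball p)"
    if S [measurable]: "S \<in> sets (rvec p)" for S
  proof -
    have "normalise p -` S \<inter> space ?L \<in> sets ?L" using N(1) S by (rule measurable_sets)
    moreover have "emeasure (\<mu> p) S = emeasure (uniform_measure ?L (unit_ball p)) (normalise p -` S \<inter> space ?L)"
      unfolding unif_sphere_def using N(2) S by (subst emeasure_distr) auto
    ultimately have "emeasure (\<mu> p) S = emeasure ?L (unit_ball p \<inter> (normalise p -` S \<inter> space ?L)) / emeasure ?L (unit_ball p)"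
      by (simp add: rvec_eq_lborel)
    also have "emeasure ?L (unit_ball p \<inter> (normalise p -` S \<inter> space ?L)) = (\<integral>\<^sup>+x. indicator (unit_ball p \<inter> (normalise p -` S \<inter> space ?L)) x \<partial>?L)"
      using \<open>normalise p -` S \<inter> space ?L \<in> sets ?L\<close> by (subst nn_integral_indicator) (auto simp: rvec_eq_lborel)
    also have "... = (\<integral>\<^sup>+x. indicator (unit_ball p) x * indicator S (normalise p x) \<partial>?L)"
      by (rule nn_integral_cong) (auto simp: indicator_def)
    finally show ?thesis .
  qed
  have comm: "normalise p (hrefl p v x) = hrefl p v (normalise p x)" if "x \<in> space (rvec p)" for x
  proof (rule rvec_eqI)
    have "dot p v (normalise p x) = dot p v x / norm2 p x" by (simp add: dot_def normalise_def sum_divide_distrib)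
    then show "normalise p (hrefl p v x) k = hrefl p v (normalise p x) k" if "k < p" for k
      using that by (simp add: normalise_def[of p "hrefl p v x"] norm2_hrefl[OF v])
        (simp add: hrefl_def vec_comb_def normalise_def diff_divide_distrib)
  qed (auto intro: measurable_space[OF measurable_normalise])
  have "emeasure (distr (\<mu> p) (rvec p) (hrefl p v)) A = emeasure (\<mu> p) (hrefl p v -` A \<inter> space (rvec p))"
    by (subst emeasure_distr) auto
  also have "... = (\<integral>\<^sup>+x. indicator (unit_ball p) x * indicator (hrefl p v -` A \<inter> space (rvec p)) (normalise p x) \<partial>?L) / emeasure ?L (unit_ball p)"
    by (rule em) measurable
  also have "(\<integral>\<^sup>+x. indicator (unit_ball p) x * indicator (hrefl p v -` A \<inter> space (rvec p)) (normalise p x) \<partial>?L) =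
     (\<integral>\<^sup>+x. indicator (unit_ball p) (hrefl p v x) * indicator A (normalise p (hrefl p v x)) \<partial>?L)" by (rule nn_integral_cong)
       (auto simp: indicator_def unit_ball_def norm2_hrefl[OF v] sp comm measurable_space[OF measurable_normalise])
  also have "... = (\<integral>\<^sup>+x. indicator (unit_ball p) x * indicator A (normalise p x) \<partial>?L)"
    by (rule nn_integral_Leb_hrefl[OF v]) measurable
  also have "... / emeasure ?L (unit_ball p) = emeasure (\<mu> p) A" by (rule em[symmetric]) (rule A)
  finally show "emeasure (distr (\<mu> p) (rvec p) (hrefl p v)) A = emeasure (\<mu> p) A" .
qed simp

section \<open>The normalising constant as a power series\<close>

text \<open>For a coordinate X of a uniform point on the sphere, the ratio of the moment of order
  \<open>2 * k\<close> of sqrt p X to that of a standard normal variable; see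
  \<open>smom_even\<close>.\<close>

definition bessel_coeff :: "nat \<Rightarrow> nat \<Rightarrow> real" where
  "bessel_coeff p k = (\<Prod>j<k. 1 / (1 + 2 * real j / real p))"

text \<open>\<open>bessel_series p (r\<^sup>2 / (2 p))\<close> is \<open>E exp (r X\<^sub>0)\<close> for \<open>X\<close> uniform on the sphere, see \<open>slaw_mgf\<close>.\<close>

definition bessel_series :: "nat \<Rightarrow> real \<Rightarrow> real" where
  "bessel_series p x = (\<Sum>k. x ^ k / fact k * bessel_coeff p k)"

lemma bessel_coeff_pos: "bessel_coeff p k > 0" unfolding bessel_coeff_def by (intro prod_pos) (auto intro!: divide_pos_pos add_pos_nonneg)

lemma bessel_coeff_nonneg [simp]: "0 \<le> bessel_coeff p k" using bessel_coeff_pos[of p k] by simp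

lemma bessel_coeff_le_1 [simp]: "bessel_coeff p k \<le> 1"
  unfolding bessel_coeff_def by (intro prod_le_1) (auto simp: divide_simps intro: add_pos_nonneg)

lemma sum_twice_lessThan: "(\<Sum>j<k. 2 * real j / q) = real k * (real k - 1) / q"
  by (induction k) (auto simp: add_divide_distrib[symmetric] algebra_simps)

lemma bessel_coeff_exp: "bessel_coeff p k = exp (- (\<Sum>j<k. ln (1 + 2 * real j / real p)))"
proof -
  have pos: "1 + 2 * real j / real p > 0" for j by (intro add_pos_nonneg) auto
  show ?thesis unfolding bessel_coeff_def sum_negf[symmetric] exp_sum[OF finite_lessThan]
    using pos by (intro prod.cong) (auto simp: exp_minus inverse_eq_divide)
qed

text \<open>Sums of \<open>y - y^2 / 2 \<le> ln (1 + y) \<le> y\<close> over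
  \<open>y = 2 * j / p\<close>. In the quadratic terms \<open>j\<close> is bounded by
  \<open>k\<close>, which gives the cubic error.\<close>

lemma bessel_coeff_log_bounds:
  shows "0 \<le> (\<Sum>j<k. ln (1 + 2 * real j / real p))"
    and "(\<Sum>j<k. ln (1 + 2 * real j / real p)) \<le> real k * (real k - 1) / real p"
    and "real k * (real k - 1) / real p - 2 * real k ^ 3 / (real p)\<^sup>2 \<le> (\<Sum>j<k. ln (1 + 2 * real j / real p))"
proof -
  show "0 \<le> (\<Sum>j<k. ln (1 + 2 * real j / real p))" by (intro sum_nonneg) auto
  have "(\<Sum>j<k. ln (1 + 2 * real j / real p)) \<le> (\<Sum>j<k. 2 * real j / real p)" by (intro sum_mono ln_add_one_self_le_self) auto
  then show "(\<Sum>j<k. ln (1 + 2 * real j / real p)) \<le> real k * (real k - 1) / real p" by (simp add: sum_twice_lessThan)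
  have ln_ge: "y - y\<^sup>2 / 2 \<le> ln (1 + y)" if "y \<ge> 0" for y :: real
  proof -
    have "(\<lambda>y. ln (1 + y) - (y - y\<^sup>2 / 2)) 0 \<le> (\<lambda>y. ln (1 + y) - (y - y\<^sup>2 / 2)) y"
    proof (rule DERIV_nonneg_imp_nondecreasing[OF that])
      fix t :: real assume t: "0 \<le> t" "t \<le> y"
      have "1 / (1 + t) - (1 - t) = t\<^sup>2 / (1 + t)" using t by (simp add: field_simps power2_eq_square)
      then have "1 / (1 + t) - (1 - t) \<ge> 0" using t by simp
      then show "\<exists>d. ((\<lambda>y. ln (1 + y) - (y - y\<^sup>2 / 2)) has_real_derivative d) (at t) \<and> 0 \<le> d"
        using t by (intro exI[of _ "1 / (1 + t) - (1 - t)"] conjI) (auto intro!: derivative_eq_intros simp: field_simps)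
    qed
    then show ?thesis by simp
  qed
  have "(\<Sum>j<k. 2 * real j / real p) - (\<Sum>j<k. (2 * real j / real p)\<^sup>2 / 2) \<le> (\<Sum>j<k. ln (1 + 2 * real j / real p))"
    unfolding sum_subtractf[symmetric] by (intro sum_mono ln_ge) auto
  moreover have "(\<Sum>j<k. (2 * real j / real p)\<^sup>2 / 2) \<le> (\<Sum>j<k. 2 * (real k)\<^sup>2 / (real p)\<^sup>2)"
  proof (rule sum_mono)
    fix j assume "j \<in> {..<k}"
    then have "(real j)\<^sup>2 \<le> (real k)\<^sup>2" by (intro power_mono) auto
    then show "(2 * real j / real p)\<^sup>2 / 2 \<le> 2 * (real k)\<^sup>2 / (real p)\<^sup>2"
      by (simp add: power_divide power_mult_distrib divide_right_mono)
  qed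
  ultimately show "real k * (real k - 1) / real p - 2 * real k ^ 3 / (real p)\<^sup>2 \<le> (\<Sum>j<k. ln (1 + 2 * real j / real p))"
    by (simp add: sum_twice_lessThan power3_eq_cube power2_eq_square mult.left_commute)
qed

lemma bessel_coeff_ge: "exp (- (real k * (real k - 1) / real p)) \<le> bessel_coeff p k"
  unfolding bessel_coeff_exp using bessel_coeff_log_bounds(2)[where k=k and p=p] by simp

section \<open>Factorial moments of the Poisson law and bounds for the series\<close>

lemma exp_series_sums: "(\<lambda>k. x ^ k / fact k) sums exp (x::real)"
  using exp_converges[of x] by (simp add: scaleR_conv_of_real divide_inverse mult.commute)

lemma bessel_series_summable: "summable (\<lambda>k. x ^ k / fact k * bessel_coeff p k)"
proof (rule summable_comparison_test)
  show "\<exists>N. \<forall>k\<ge>N. norm (x ^ k / fact k * bessel_coeff p k) \<le> \<bar>x\<bar> ^ k / fact k"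
    by (auto simp: abs_mult power_abs intro!: mult_left_le divide_right_mono)
  show "summable (\<lambda>k. \<bar>x\<bar> ^ k / fact k)" using exp_series_sums sums_summable by blast
qed

lemma bessel_series_sums: "(\<lambda>k. x ^ k / fact k * bessel_coeff p k) sums bessel_series p x"
  unfolding bessel_series_def by (rule summable_sums[OF bessel_series_summable])

text \<open>Multiplication by \<open>x\<close> shifts the index, because \<open>k / fact k\<close>
  is \<open>1 / fact (k - 1)\<close>. Iterated from the exponential series, this yields the
  factorial moments of the Poisson law with parameter \<open>x\<close>, up to the factor
  \<open>exp x\<close>.\<close>

lemma exp_series_shift_sums:
  assumes "(\<lambda>k. x ^ k / fact k * g k) sums S"
  shows "(\<lambda>k. x ^ k / fact k * (real k * g (k - 1))) sums (x * S)"
proof -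
  have "(\<lambda>k. x * (x ^ k / fact k * g k)) sums (x * S)" by (rule sums_mult[OF assms])
  moreover have "x * (x ^ k / fact k * g k) = x ^ Suc k / fact (Suc k) * (real (Suc k) * g (Suc k - 1))" for k
    by (simp add: fact_Suc field_simps del: of_nat_Suc)
  ultimately have "(\<lambda>k. x ^ Suc k / fact (Suc k) * (real (Suc k) * g (Suc k - 1))) sums (x * S)" by simp
  then show ?thesis by (subst (asm) sums_Suc_iff) simp
qed

lemma
  fixes x :: real
  shows poisson_1: "(\<lambda>k. x ^ k / fact k * real k) sums (x * exp x)"
    and poisson_2: "(\<lambda>k. x ^ k / fact k * (real k * (real k - 1))) sums (x\<^sup>2 * exp x)"
    and poisson_3: "(\<lambda>k. x ^ k / fact k * (real k * (real k - 1) * (real k - 2))) sums (x ^ 3 * exp x)"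
    and poisson_4: "(\<lambda>k. x ^ k / fact k * (real k * (real k - 1) * (real k - 2) * (real k - 3))) sums (x ^ 4 * exp x)"
proof -
  have e1: "real k * real (k - 1) = real k * (real k - 1)" for k by (cases k) auto
  have e2: "real k * (real (k - 1) * (real (k - 1) - 1)) = real k * (real k - 1) * (real k - 2)" for k by (cases k) auto
  have e3: "real k * (real (k - 1) * (real (k - 1) - 1) * (real (k - 1) - 2)) = real k * (real k - 1) * (real k - 2) * (real k - 3)" for k by (cases k) auto
  show 1: "(\<lambda>k. x ^ k / fact k * real k) sums (x * exp x)"
    using exp_series_shift_sums[of x "\<lambda>_. 1" "exp x"] exp_series_sums[of x] by simp
  show 2: "(\<lambda>k. x ^ k / fact k * (real k * (real k - 1))) sums (x\<^sup>2 * exp x)"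
    using exp_series_shift_sums[OF 1] unfolding e1 by (simp add: power2_eq_square mult.assoc)
  show 3: "(\<lambda>k. x ^ k / fact k * (real k * (real k - 1) * (real k - 2))) sums (x ^ 3 * exp x)"
    using exp_series_shift_sums[OF 2] unfolding e2 by (simp add: power2_eq_square power3_eq_cube mult.assoc)
  show "(\<lambda>k. x ^ k / fact k * (real k * (real k - 1) * (real k - 2) * (real k - 3))) sums (x ^ 4 * exp x)"
    using exp_series_shift_sums[OF 3] unfolding e3 by (simp add: power4_eq_xxxx power3_eq_cube mult.assoc)
qed

lemma bessel_series_le_exp: "x \<ge> 0 \<Longrightarrow> bessel_series p x \<le> exp x" by (rule sums_le[OF _ bessel_series_sums exp_series_sums])
     (auto intro!: mult_left_le divide_right_mono)

lemma bessel_series_ge_1: "x \<ge> 0 \<Longrightarrow> bessel_series p x \<ge> 1"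
proof -
  assume x: "x \<ge> 0"
  have "(\<Sum>k<1. x ^ k / fact k * bessel_coeff p k) \<le> bessel_series p x" unfolding bessel_series_def
    using x by (intro sum_le_suminf bessel_series_summable) auto
  then show ?thesis by (simp add: bessel_coeff_def)
qed

text \<open>The lower bound is Jensen's inequality for the Poisson law with parameter \<open>x\<close>, in the form of
  the tangent of \<open>exp (- y)\<close> at \<open>y = x\<^sup>2 / p\<close>.\<close>

lemma bessel_series_ge_exp:
  assumes "x \<ge> 0"
  shows "exp (x - x\<^sup>2 / real p) \<le> bessel_series p x"
proof -
  define m where "m = x\<^sup>2 / real p"
  have S: "(\<lambda>k. exp (- m) * (1 + m) * (x ^ k / fact k) - exp (- m) / real p * (x ^ k / fact k * (real k * (real k - 1))))
     sums (exp (- m) * (1 + m) * exp x - exp (- m) / real p * (x\<^sup>2 * exp x))" by (intro sums_diff sums_mult exp_series_sums poisson_2)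
  have E: "exp (- m) * (1 + m) * exp x - exp (- m) / real p * (x\<^sup>2 * exp x) = exp (x - x\<^sup>2 / real p)"
    by (simp add: m_def exp_diff exp_minus field_simps)
  have T: "exp (- m) * (1 + m) * (x ^ k / fact k) - exp (- m) / real p * (x ^ k / fact k * (real k * (real k - 1)))
      \<le> x ^ k / fact k * bessel_coeff p k" for k
  proof -
    define y where "y = real k * (real k - 1) / real p"
    have "exp (- m) * (1 + (m - y)) \<le> exp (- m) * exp (m - y)" by (intro mult_left_mono exp_ge_add_one_self) auto
    also have "... \<le> bessel_coeff p k" using bessel_coeff_ge[of k p] by (simp add: exp_add[symmetric] y_def)
    finally have "x ^ k / fact k * (exp (- m) * (1 + (m - y))) \<le> x ^ k / fact k * bessel_coeff p k" using assms by (intro mult_left_mono) auto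
    moreover have "e * (1 + m) * u - e / real p * (u * z) = u * (e * (1 + (m - z / real p)))" for e u z by (simp add: algebra_simps)
    ultimately show ?thesis by (simp only: y_def)
  qed
  from sums_le[OF T S bessel_series_sums] show ?thesis unfolding E .
qed

lemma bessel_series_minus_exp:
  "\<bar>bessel_series p x - exp x\<bar> \<le> x\<^sup>2 * exp \<bar>x\<bar> / real p"
proof -
  have s: "(\<lambda>k. x ^ k / fact k * bessel_coeff p k - x ^ k / fact k) sums (bessel_series p x - exp x)"
    by (intro sums_diff bessel_series_sums exp_series_sums)
  have "(\<lambda>k. \<bar>x\<bar> ^ k / fact k * (real k * (real k - 1)) / real p) sums (\<bar>x\<bar>\<^sup>2 * exp \<bar>x\<bar> / real p)"
    by (intro sums_divide poisson_2)
  then have s': "(\<lambda>k. \<bar>x\<bar> ^ k / fact k * (real k * (real k - 1)) / real p) sums (x\<^sup>2 * exp \<bar>x\<bar> / real p)" by simp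
  have b: "\<bar>x ^ k / fact k * bessel_coeff p k - x ^ k / fact k\<bar> \<le> \<bar>x\<bar> ^ k / fact k * (real k * (real k - 1)) / real p" for k
  proof -
    have "1 - real k * (real k - 1) / real p \<le> bessel_coeff p k"
      using exp_ge_add_one_self[of "- (real k * (real k - 1) / real p)"] bessel_coeff_ge[of k p] by linarith
    then have "\<bar>1 - bessel_coeff p k\<bar> \<le> real k * (real k - 1) / real p" using bessel_coeff_le_1[of p k] by simp
    then have "\<bar>x\<bar> ^ k / fact k * \<bar>1 - bessel_coeff p k\<bar> \<le> \<bar>x\<bar> ^ k / fact k * (real k * (real k - 1) / real p)"
      by (intro mult_left_mono) auto
    moreover have "\<bar>x ^ k / fact k * bessel_coeff p k - x ^ k / fact k\<bar> = \<bar>x\<bar> ^ k / fact k * \<bar>1 - bessel_coeff p k\<bar>"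
    proof -
      have *: "u * b - u = - (u * (1 - b))" for u b :: real by (simp add: algebra_simps)
      show ?thesis unfolding * by (simp add: abs_mult power_abs)
    qed
    ultimately show ?thesis by simp
  qed
  have 1: "summable (\<lambda>k. \<bar>x ^ k / fact k * bessel_coeff p k - x ^ k / fact k\<bar>)"
    by (rule summable_comparison_test[OF _ sums_summable[OF s']]) (use b in auto)
  have "\<bar>bessel_series p x - exp x\<bar> \<le> (\<Sum>k. \<bar>x ^ k / fact k * bessel_coeff p k - x ^ k / fact k\<bar>)"
    using summable_rabs[OF 1] s by (simp add: sums_iff)
  also have "... \<le> (\<Sum>k. \<bar>x\<bar> ^ k / fact k * (real k * (real k - 1)) / real p)" by (rule suminf_le[OF b 1 sums_summable[OF s']])
  finally show ?thesis using s' by (simp add: sums_iff)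
qed

lemma exp_minus_lipschitz:
  assumes "a \<ge> 0" "b \<ge> (0::real)"
  shows "\<bar>exp (- a) - exp (- b)\<bar> \<le> \<bar>a - b\<bar>"
proof -
  have *: "exp (- a) - exp (- b) \<le> b - a" if "0 \<le> a" "a \<le> b" for a b :: real
  proof -
    have "exp (- a) - exp (- b) = exp (- a) * (1 - exp (- (b - a)))" by (simp add: algebra_simps exp_add[symmetric])
    also have "... \<le> 1 * (b - a)"
    proof (rule mult_mono)
      show "1 - exp (- (b - a)) \<le> b - a" using exp_ge_add_one_self[of "- (b - a)"] by linarith
    qed (use that in auto)
    finally show ?thesis by simp
  qed
  show ?thesis using *[of a b] *[of b a] assms by (cases "a \<le> b") (auto simp: abs_if)
qed

text \<open>The expectation of \<open>bessel_coeff p K\<close> for a Poisson variable \<open>K\<close> with parameter \<open>x\<close>, which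
  concentrates at \<open>exp (- x\<^sup>2 / p)\<close> when \<open>x\<close> is of order \<open>sqrt p\<close>.\<close>

lemma bessel_series_poisson:
  assumes x: "x \<ge> 0" and \<epsilon>: "\<epsilon> > 0"
  shows "\<bar>bessel_series p x * exp (- x) - exp (- (x\<^sup>2 / real p))\<bar> \<le>
     \<epsilon> + (4 * x ^ 3 + 2 * x\<^sup>2) / ((real p)\<^sup>2 * \<epsilon>) + 2 * (x ^ 3 + 3 * x\<^sup>2 + x) / (real p)\<^sup>2"
proof -
  define m where "m = x\<^sup>2 / real p"
  define y where "y k = (\<Sum>j<k. ln (1 + 2 * real j / real p))" for k
  \<comment> \<open>Three sources of error: the free level \<epsilon>, the spread of
    \<open>k * (k - 1)\<close> about its Poisson mean \<open>x^2\<close>, and the remainder of the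
    logarithm.\<close>
  define d where "d k = \<epsilon> + (real k * (real k - 1) - x\<^sup>2)\<^sup>2 / ((real p)\<^sup>2 * \<epsilon>) + 2 * real k ^ 3 / (real p)\<^sup>2" for k :: nat
  have b: "\<bar>bessel_coeff p k - exp (- m)\<bar> \<le> d k" for k
  proof -
    have "\<bar>bessel_coeff p k - exp (- m)\<bar> \<le> \<bar>y k - m\<bar>" unfolding bessel_coeff_exp y_def using bessel_coeff_log_bounds(1)
      by (intro exp_minus_lipschitz) (auto simp: m_def)
    also have "... \<le> \<bar>(real k * (real k - 1) - x\<^sup>2) / real p\<bar> + 2 * real k ^ 3 / (real p)\<^sup>2"
      using bessel_coeff_log_bounds(2)[where k=k and p=p] bessel_coeff_log_bounds(3)[where k=k and p=p] by (simp add: y_def m_def diff_divide_distrib)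
    \<comment> \<open>A pointwise form of Chebyshev's inequality, which can be summed against the
      Poisson weights without splitting the series.\<close>
    also have "\<bar>(real k * (real k - 1) - x\<^sup>2) / real p\<bar> \<le> \<epsilon> + ((real k * (real k - 1) - x\<^sup>2) / real p)\<^sup>2 / \<epsilon>"
    proof -
      define z where "z = \<bar>(real k * (real k - 1) - x\<^sup>2) / real p\<bar>"
      have "0 \<le> (z - \<epsilon> / 2)\<^sup>2" by simp
      then have "z * \<epsilon> \<le> z\<^sup>2 + \<epsilon>\<^sup>2 / 4" by (simp add: power2_eq_square algebra_simps)
      then have "z * \<epsilon> \<le> z\<^sup>2 + \<epsilon>\<^sup>2" using zero_le_power2[of \<epsilon>] by linarith
      then have "z \<le> \<epsilon> + z\<^sup>2 / \<epsilon>" using \<epsilon> by (simp add: field_simps power2_eq_square)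
      then show ?thesis unfolding z_def power2_abs .
    qed
    finally show ?thesis unfolding d_def using \<epsilon> by (simp add: power_divide)
  qed
  have k3: "(\<lambda>k. x ^ k / fact k * real k ^ 3) sums ((x ^ 3 + 3 * x\<^sup>2 + x) * exp x)"
  proof -
    have "(\<lambda>k. x ^ k / fact k * (real k * (real k - 1) * (real k - 2)) + 3 * (x ^ k / fact k * (real k * (real k - 1))) + x ^ k / fact k * real k)
      sums (x ^ 3 * exp x + 3 * (x\<^sup>2 * exp x) + x * exp x)" by (intro sums_add sums_mult poisson_1 poisson_2 poisson_3)
    moreover have "x ^ k / fact k * (real k * (real k - 1) * (real k - 2)) + 3 * (x ^ k / fact k * (real k * (real k - 1))) + x ^ k / fact k * real k = x ^ k / fact k * real k ^ 3" for k
      by (simp add: power3_eq_cube algebra_simps)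
    moreover have "x ^ 3 * exp x + 3 * (x\<^sup>2 * exp x) + x * exp x = (x ^ 3 + 3 * x\<^sup>2 + x) * exp x" by (simp add: algebra_simps)
    ultimately show ?thesis by simp
  qed
  have k4: "(\<lambda>k. x ^ k / fact k * (real k * (real k - 1) - x\<^sup>2)\<^sup>2) sums ((4 * x ^ 3 + 2 * x\<^sup>2) * exp x)"
  proof -
    \<comment> \<open>Expansion in falling factorials: the square of \<open>k * (k - 1)\<close> has
      the coefficients 1, 4, 2 in degrees 4, 3, 2, and the mixed term adds \<open>- 2 * x^2\<close>
      in degree 2.\<close>
    have "(\<lambda>k. x ^ k / fact k * (real k * (real k - 1) * (real k - 2) * (real k - 3)) + 4 * (x ^ k / fact k * (real k * (real k - 1) * (real k - 2)))
        + (2 - 2 * x\<^sup>2) * (x ^ k / fact k * (real k * (real k - 1))) + x ^ 4 * (x ^ k / fact k))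
      sums (x ^ 4 * exp x + 4 * (x ^ 3 * exp x) + (2 - 2 * x\<^sup>2) * (x\<^sup>2 * exp x) + x ^ 4 * exp x)"
      by (intro sums_add sums_mult poisson_2 poisson_3 poisson_4 exp_series_sums)
    moreover have "x ^ k / fact k * (real k * (real k - 1) * (real k - 2) * (real k - 3)) + 4 * (x ^ k / fact k * (real k * (real k - 1) * (real k - 2)))
        + (2 - 2 * x\<^sup>2) * (x ^ k / fact k * (real k * (real k - 1))) + x ^ 4 * (x ^ k / fact k) = x ^ k / fact k * (real k * (real k - 1) - x\<^sup>2)\<^sup>2" for k
    proof -
      have *: "u * (r * (r - 1) * (r - 2) * (r - 3)) + 4 * (u * (r * (r - 1) * (r - 2))) + (2 - 2 * x\<^sup>2) * (u * (r * (r - 1))) + x ^ 4 * u = u * (r * (r - 1) - x\<^sup>2)\<^sup>2" for u r :: real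
        by algebra
      show ?thesis by (rule *)
    qed
    moreover have "x ^ 4 * exp x + 4 * (x ^ 3 * exp x) + (2 - 2 * x\<^sup>2) * (x\<^sup>2 * exp x) + x ^ 4 * exp x = (4 * x ^ 3 + 2 * x\<^sup>2) * exp x"
      by algebra
    ultimately show ?thesis by simp
  qed
  have D: "(\<lambda>k. x ^ k / fact k * d k) sums ((\<epsilon> + (4 * x ^ 3 + 2 * x\<^sup>2) / ((real p)\<^sup>2 * \<epsilon>) + 2 * (x ^ 3 + 3 * x\<^sup>2 + x) / (real p)\<^sup>2) * exp x)"
  proof -
    have "(\<lambda>k. \<epsilon> * (x ^ k / fact k) + (1 / ((real p)\<^sup>2 * \<epsilon>)) * (x ^ k / fact k * (real k * (real k - 1) - x\<^sup>2)\<^sup>2) + (2 / (real p)\<^sup>2) * (x ^ k / fact k * real k ^ 3))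
      sums (\<epsilon> * exp x + (1 / ((real p)\<^sup>2 * \<epsilon>)) * ((4 * x ^ 3 + 2 * x\<^sup>2) * exp x) + (2 / (real p)\<^sup>2) * ((x ^ 3 + 3 * x\<^sup>2 + x) * exp x))"
      by (intro sums_add sums_mult k3 k4 exp_series_sums)
    moreover have "\<epsilon> * u + (1 / (P * \<epsilon>)) * (u * q) + (2 / P) * (u * c) = u * (\<epsilon> + q / (P * \<epsilon>) + 2 * c / P)" for u P q c
      by (simp add: distrib_left)
    moreover have "\<epsilon> * E + (1 / (P * \<epsilon>)) * (a * E) + (2 / P) * (b * E) = (\<epsilon> + a / (P * \<epsilon>) + 2 * b / P) * E" for E P a b
      by (simp add: distrib_right)
    ultimately show ?thesis by (simp only: d_def)
  qed
  have s: "(\<lambda>k. x ^ k / fact k * bessel_coeff p k - exp (- m) * (x ^ k / fact k)) sums (bessel_series p x - exp (- m) * exp x)"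
    by (intro sums_diff sums_mult bessel_series_sums exp_series_sums)
  have b': "\<bar>x ^ k / fact k * bessel_coeff p k - exp (- m) * (x ^ k / fact k)\<bar> \<le> x ^ k / fact k * d k" for k
  proof -
    have "\<bar>x ^ k / fact k * bessel_coeff p k - exp (- m) * (x ^ k / fact k)\<bar> = x ^ k / fact k * \<bar>bessel_coeff p k - exp (- m)\<bar>"
    proof -
      have *: "u * b - e * u = u * (b - e)" for u b e :: real by (simp add: algebra_simps)
      show ?thesis unfolding * using x by (simp add: abs_mult)
    qed
    also have "... \<le> x ^ k / fact k * d k" using x b by (intro mult_left_mono) auto
    finally show ?thesis .
  qed
  have 1: "summable (\<lambda>k. \<bar>x ^ k / fact k * bessel_coeff p k - exp (- m) * (x ^ k / fact k)\<bar>)"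
    by (rule summable_comparison_test[OF _ sums_summable[OF D]]) (use b' in auto)
  have "\<bar>bessel_series p x - exp (- m) * exp x\<bar> \<le> (\<Sum>k. \<bar>x ^ k / fact k * bessel_coeff p k - exp (- m) * (x ^ k / fact k)\<bar>)"
    using summable_rabs[OF 1] s by (simp add: sums_iff)
  also have "... \<le> (\<Sum>k. x ^ k / fact k * d k)" by (rule suminf_le[OF b' 1 sums_summable[OF D]])
  also have "... = (\<epsilon> + (4 * x ^ 3 + 2 * x\<^sup>2) / ((real p)\<^sup>2 * \<epsilon>) + 2 * (x ^ 3 + 3 * x\<^sup>2 + x) / (real p)\<^sup>2) * exp x"
    using D by (simp add: sums_iff)
  finally have "\<bar>bessel_series p x - exp (- m) * exp x\<bar> * exp (- x) \<le> (\<epsilon> + (4 * x ^ 3 + 2 * x\<^sup>2) / ((real p)\<^sup>2 * \<epsilon>) + 2 * (x ^ 3 + 3 * x\<^sup>2 + x) / (real p)\<^sup>2) * exp x * exp (- x)"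
    by (rule mult_right_mono) simp
  moreover have "\<bar>bessel_series p x - exp (- m) * exp x\<bar> * exp (- x) = \<bar>bessel_series p x * exp (- x) - exp (- m)\<bar>"
  proof -
    have "bessel_series p x * exp (- x) - exp (- m) = (bessel_series p x - exp (- m) * exp x) * exp (- x)"
      by (simp add: left_diff_distrib mult.assoc exp_minus)
    then show ?thesis by (simp add: abs_mult)
  qed
  ultimately show ?thesis by (simp add: m_def mult.assoc exp_minus)
qed

lemma bessel_series_error_tendsto:
  "A > 0 \<Longrightarrow> \<epsilon> > 0 \<Longrightarrow> (\<lambda>p::nat. (4 * (A * sqrt p) ^ 3 + 2 * (A * sqrt p)\<^sup>2) / ((real p)\<^sup>2 * \<epsilon>) +
    2 * ((A * sqrt p) ^ 3 + 3 * (A * sqrt p)\<^sup>2 + (A * sqrt p)) / (real p)\<^sup>2) \<longlonglongrightarrow> (0::real)" by real_asymp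

text \<open>The error in \<open>bessel_series_poisson\<close> increases with \<open>x\<close>, so
  its value at \<open>A * sqrt p\<close> decides; there \<open>x ^ 3 / p^2\<close> is of order
  \<open>1 / sqrt p\<close>.\<close>

lemma bessel_series_asymp:
  assumes A: "A > 0" and \<delta>: "\<delta> > 0"
  shows "\<forall>\<^sub>F p in sequentially. \<forall>x. 0 \<le> x \<and> x \<le> A * sqrt p \<longrightarrow>
    \<bar>bessel_series p x * exp (- x) - exp (- (x\<^sup>2 / real p))\<bar> \<le> \<delta>"
proof -
  define \<epsilon> where "\<epsilon> = \<delta> / 2"
  have \<delta>2: "\<delta> = 2 * \<epsilon>" by (simp add: \<epsilon>_def)
  have \<epsilon>: "\<epsilon> > 0" using \<delta> by (simp add: \<epsilon>_def)
  define h where "h p = (let X = A * sqrt p in (4 * X ^ 3 + 2 * X\<^sup>2) / ((real p)\<^sup>2 * \<epsilon>) + 2 * (X ^ 3 + 3 * X\<^sup>2 + X) / (real p)\<^sup>2)" for p :: nat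
  have "h \<longlonglongrightarrow> 0" unfolding h_def Let_def using bessel_series_error_tendsto[OF A \<epsilon>] .
  then have "\<forall>\<^sub>F p in sequentially. h p < \<epsilon>" using \<epsilon> by (rule order_tendstoD)
  then show ?thesis
  proof eventually_elim
    fix p assume hp: "h p < \<epsilon>"
    show "\<forall>x. 0 \<le> x \<and> x \<le> A * sqrt p \<longrightarrow> \<bar>bessel_series p x * exp (- x) - exp (- (x\<^sup>2 / real p))\<bar> \<le> \<delta>"
    proof (intro allI impI; elim conjE)
      fix x assume x: "0 \<le> x" "x \<le> A * sqrt p"
      define X where "X = A * sqrt p"
      have p: "x ^ k \<le> X ^ k" for k using x by (auto simp: X_def intro!: power_mono)
      have 1: "4 * x ^ 3 + 2 * x\<^sup>2 \<le> 4 * X ^ 3 + 2 * X\<^sup>2" "2 * (x ^ 3 + 3 * x\<^sup>2 + x) \<le> 2 * (X ^ 3 + 3 * X\<^sup>2 + X)"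
        using p[of 3] p[of 2] p[of 1] by auto
      have "(4 * x ^ 3 + 2 * x\<^sup>2) / ((real p)\<^sup>2 * \<epsilon>) \<le> (4 * X ^ 3 + 2 * X\<^sup>2) / ((real p)\<^sup>2 * \<epsilon>)"
        using \<epsilon> by (intro divide_right_mono 1) auto
      moreover have "2 * (x ^ 3 + 3 * x\<^sup>2 + x) / (real p)\<^sup>2 \<le> 2 * (X ^ 3 + 3 * X\<^sup>2 + X) / (real p)\<^sup>2"
        by (intro divide_right_mono 1) auto
      ultimately have "(4 * x ^ 3 + 2 * x\<^sup>2) / ((real p)\<^sup>2 * \<epsilon>) + 2 * (x ^ 3 + 3 * x\<^sup>2 + x) / (real p)\<^sup>2 \<le> h p"
        unfolding h_def Let_def X_def by (rule add_mono)
      moreover have "a \<le> e + b + c \<Longrightarrow> b + c \<le> h \<Longrightarrow> h < e \<Longrightarrow> a \<le> 2 * e" for a b c e h :: real by linarith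
      ultimately show "\<bar>bessel_series p x * exp (- x) - exp (- (x\<^sup>2 / real p))\<bar> \<le> \<delta>"
        unfolding \<delta>2 using bessel_series_poisson[OF x(1) \<epsilon>, of p] hp by blast
    qed
  qed
qed

section \<open>The law of an inner product\<close>

definition unitv :: "nat \<Rightarrow> nat \<Rightarrow> nat \<Rightarrow> real" where
  "unitv p i = (\<lambda>k\<in>{..<p}. if k = i then 1 else 0)"

lemma unitv_space [simp]: "unitv p i \<in> space (rvec p)" by (simp add: unitv_def space_rvec)

lemma dot_unitv: "i < p \<Longrightarrow> dot p x (unitv p i) = x i"
  by (simp add: dot_def unitv_def if_distrib[of "\<lambda>t. x _ * t"] cong: if_cong)

lemma unitv_sphere: "i < p \<Longrightarrow> unitv p i \<in> unit_sphere p"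
  by (simp add: unit_sphere_def norm2_eq_sqrt_dot dot_unitv) (simp add: unitv_def)

lemma sphere_imp_pos: "u \<in> unit_sphere p \<Longrightarrow> p > 0" by (cases p) (auto simp: unit_sphere_def norm2_def)

lemma integral_hrefl:
  fixes f :: "rseq \<Rightarrow> 'b::{banach,second_countable_topology}"
  assumes v: "v \<in> unit_sphere p" and [measurable]: "f \<in> borel_measurable (rvec p)"
  shows "(LINT x|\<mu> p. f (hrefl p v x)) = (LINT x|\<mu> p. f x)"
proof -
  have [measurable]: "v \<in> space (rvec p)" using v by (rule unit_sphere_space)
  show ?thesis by (subst (2) distr_unif_sphere_hrefl[OF v, symmetric]) (simp add: integral_distr)
qed

definition slaw :: "nat \<Rightarrow> real measure" where
  "slaw p = distr (\<mu> p) borel (\<lambda>x. dot p x (unitv p 0))"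

text \<open>A reflection carries \<open>u\<close> to the first unit vector and preserves the uniform
  distribution.\<close>

lemma distr_dot_sphere:
  assumes u: "u \<in> unit_sphere p"
  shows "distr (\<mu> p) borel (\<lambda>x. dot p x u) = slaw p"
proof (cases "u = unitv p 0")
  case False
  from u have p: "p > 0" by (rule sphere_imp_pos)
  obtain v where v: "v \<in> unit_sphere p" "hrefl p v u = unitv p 0" using hrefl_swap[OF u unitv_sphere[OF p] False] by auto
  note [measurable] = unit_sphere_space[OF v(1)] unit_sphere_space[OF u]
  have "slaw p = distr (distr (\<mu> p) (rvec p) (hrefl p v)) borel (\<lambda>x. dot p x (unitv p 0))"
    by (simp only: distr_unif_sphere_hrefl[OF v(1)] slaw_def)
  also have "... = distr (\<mu> p) borel (\<lambda>x. dot p (hrefl p v x) (unitv p 0))" by (subst distr_distr) (auto simp: comp_def)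
  also have "(\<lambda>x. dot p (hrefl p v x) (unitv p 0)) = (\<lambda>x. dot p x (hrefl p v (hrefl p v u)))" by (simp add: dot_hrefl_adjoint v(2))
  finally show ?thesis by (simp add: hrefl_hrefl[OF v(1) unit_sphere_space[OF u]])
qed (simp add: slaw_def)

lemma prob_space_slaw: "prob_space (slaw p)" unfolding slaw_def by (rule prob_space.prob_space_distr[OF prob_space_unif_sphere]) measurable

lemma sets_slaw [measurable_cong, simp]: "sets (slaw p) = sets borel" by (simp add: slaw_def)

lemma space_slaw [simp]: "space (slaw p) = UNIV" by (simp add: slaw_def)

interpretation S: prob_space "slaw p" for p by (rule prob_space_slaw)

lemma real_distribution_slaw: "real_distribution (slaw p)" by (intro real_distribution.intro prob_space_slaw real_distribution_axioms.intro) simp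

lemma integral_dot_sphere:
  fixes f :: "real \<Rightarrow> 'b::{banach,second_countable_topology}"
  assumes u: "u \<in> unit_sphere p" and [measurable]: "f \<in> borel_measurable borel"
  shows "(LINT x|\<mu> p. f (dot p x u)) = (LINT t|slaw p. f t)"
proof -
  note [measurable] = unit_sphere_space[OF u]
  show ?thesis unfolding distr_dot_sphere[OF u, symmetric] by (subst integral_distr) auto
qed

lemma integral_dot:
  fixes f :: "real \<Rightarrow> 'b::{banach,second_countable_topology}"
  assumes p: "p > 0" and a: "a \<in> space (rvec p)" and [measurable]: "f \<in> borel_measurable borel"
  shows "(LINT x|\<mu> p. f (dot p x a)) = (LINT t|slaw p. f (norm2 p a * t))"
proof (cases "norm2 p a = 0")
  case True
  have "dot p x a = 0" for x using abs_dot_le[of p x a] True by simp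
  then show ?thesis using True U.prob_space S.prob_space by simp
next
  case False
  define u where "u = vec_comb p (1 / norm2 p a) a 0 a"
  have "(norm2 p u)\<^sup>2 = 1" using False unfolding u_def norm2_vec_comb dot_self by (simp add: power_divide)
  then have "norm2 p u = 1" using norm2_nonneg[of p u] by (simp add: power2_eq_1_iff)
  then have u: "u \<in> unit_sphere p" by (simp add: unit_sphere_def u_def)
  have "dot p x a = norm2 p a * dot p x u" for x using False by (simp add: u_def dot_vec_comb_right)
  then show ?thesis using integral_dot_sphere[OF u, of "\<lambda>t. f (norm2 p a * t)"] by simp
qed

lemma AE_slaw_le_1: "p > 0 \<Longrightarrow> AE t in slaw p. \<bar>t\<bar> \<le> 1" unfolding slaw_def
  using AE_unif_sphere[of p] by (subst AE_distr_iff) (auto intro: abs_dot_sphere_le unitv_sphere elim!: eventually_mono)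

lemma integrable_slaw_bounded:
  fixes f :: "real \<Rightarrow> 'b::{banach,second_countable_topology}"
  assumes "p > 0" and f [measurable]: "f \<in> borel_measurable borel" and "\<And>t. \<bar>t\<bar> \<le> 1 \<Longrightarrow> norm (f t) \<le> C"
  shows "integrable (slaw p) f"
proof -
  have "f \<in> borel_measurable (slaw p)" by measurable
  show ?thesis using AE_slaw_le_1[OF assms(1)] assms(3) \<open>f \<in> borel_measurable (slaw p)\<close>
    by (intro S.integrable_const_bound[where f=f and B=C]) (auto elim!: eventually_mono)
qed

lemma integrable_slaw_power [simp]: "p > 0 \<Longrightarrow> integrable (slaw p) (\<lambda>t. t ^ k)"
  by (rule integrable_slaw_bounded[where C=1]) (auto simp: power_abs power_le_one)

section \<open>Moments of one coordinate and their generating function\<close>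

definition smom :: "nat \<Rightarrow> nat \<Rightarrow> real" where
  "smom p k = (LINT t|slaw p. t ^ k)"

lemma smom_0: "smom p 0 = 1" using prob_space.prob_space[OF prob_space_slaw, of p] by (simp add: smom_def)

lemma smom_odd:
  assumes p: "p > 0" and k: "odd k"
  shows "smom p k = 0"
proof -
  have "smom p k = (LINT x|\<mu> p. (dot p x (unitv p 0)) ^ k)"
    unfolding smom_def by (rule integral_dot_sphere[OF unitv_sphere[OF p], symmetric]) measurable
  also have "... = (LINT x|\<mu> p. (dot p (hrefl p (unitv p 0) x) (unitv p 0)) ^ k)"
    by (rule integral_hrefl[OF unitv_sphere[OF p], symmetric]) measurable
  also have "... = (LINT x|\<mu> p. - ((dot p x (unitv p 0)) ^ k))"
  proof -
    have "dot p (hrefl p (unitv p 0) x) (unitv p 0) = - dot p x (unitv p 0)" for x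
      unfolding dot_hrefl dot_self_sphere[OF unitv_sphere[OF p]] dot_commute[of p "unitv p 0" x] by simp
    then show ?thesis using k by simp
  qed
  also have "... = - smom p k" unfolding smom_def using integral_dot_sphere[OF unitv_sphere[OF p], of "\<lambda>t. t ^ k"] by simp
  finally show ?thesis by simp
qed

lemma coeff_one_plus_square_power:
  "coeff ([:1, 0, 1:] ^ n :: real poly) 0 = 1" "coeff ([:1, 0, 1:] ^ n :: real poly) (Suc 0) = 0"
  "coeff ([:1, 0, 1:] ^ n :: real poly) (Suc (Suc 0)) = real n"
proof (induction n)
  case (Suc n)
  have e: "[:1, 0, 1:] * q = q + pCons 0 (pCons 0 q)" for q :: "real poly" by simp
  case 1 show ?case unfolding power_Suc e using Suc by simp
  case 2 show ?case unfolding power_Suc e using Suc by simp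
  case 3 show ?case unfolding power_Suc e using Suc by simp
qed auto

lemma integrable_unif_sphere_bounded:
  fixes f :: "rseq \<Rightarrow> 'b::{banach,second_countable_topology}"
  assumes "p > 0" "f \<in> borel_measurable (rvec p)" "\<And>x. x \<in> unit_sphere p \<Longrightarrow> norm (f x) \<le> C"
  shows "integrable (\<mu> p) f"
proof -
  show ?thesis using AE_unif_sphere[OF assms(1)] assms(2,3) by (intro U.integrable_const_bound[where f=f and B=C]) (auto elim!: eventually_mono)
qed

lemma abs_component_sphere_le: "x \<in> unit_sphere p \<Longrightarrow> i < p \<Longrightarrow> \<bar>x i\<bar> \<le> 1"
  using abs_dot_sphere_le[OF _ unitv_sphere, of x p i] by (simp add: dot_unitv)

lemma integrable_mixed_moment:
  assumes "i < p" "l < p"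
  shows "integrable (\<mu> p) (\<lambda>x. (x i) ^ j * (x l) ^ m)"
proof (rule integrable_unif_sphere_bounded[where C=1])
  note [measurable] = measurable_rvec_component[OF assms(1)] measurable_rvec_component[OF assms(2)]
  show "(\<lambda>x. (x i) ^ j * (x l) ^ m) \<in> borel_measurable (rvec p)" by measurable
  show "norm ((x i) ^ j * (x l) ^ m) \<le> 1" if "x \<in> unit_sphere p" for x
    using abs_component_sphere_le[OF that assms(1)] abs_component_sphere_le[OF that assms(2)]
    by (auto simp: abs_mult power_abs intro!: mult_le_one power_le_one)
qed (use assms in auto)

text \<open>The coefficient of \<open>b\<^sup>2\<close> in the identity \<open>E (x\<^sub>0 + b x\<^sub>i)\<^sup>N = (1 + b\<^sup>2)\<^sup>N\<^sup>/\<^sup>2 E x\<^sub>0\<^sup>N\<close>, \<open>N = 2 k + 2\<close>.\<close>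

lemma mixed_moment_sphere:
  assumes i: "0 < i" "i < p"
  shows "(2 * real k + 1) * (LINT x|\<mu> p. (x i)\<^sup>2 * (x 0) ^ (2 * k)) = smom p (2 * k + 2)"
proof -
  from i have p: "p > 0" by simp
  define N where "N = 2 * k + 2"
  define c where "c j = real (N choose j) * (LINT x|\<mu> p. (x i) ^ j * (x 0) ^ (N - j))" for j
  have I: "integrable (\<mu> p) (\<lambda>x. (x i) ^ j * (x 0) ^ l)" for j l using i(2) p by (rule integrable_mixed_moment)
  have "poly (\<Sum>j\<le>N. monom (c j) j) b = poly (smult (smom p N) ([:1, 0, 1:] ^ (k + 1))) b" for b
  proof -
    define a where "a = vec_comb p 1 (unitv p 0) b (unitv p i)"
    have a2: "(norm2 p a)\<^sup>2 = 1 + b\<^sup>2" using i p unfolding a_def norm2_vec_comb by (simp add: dot_unitv) (simp add: unitv_def)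
    have "(LINT x|\<mu> p. (dot p x a) ^ N) = (LINT t|slaw p. (norm2 p a * t) ^ N)" by (rule integral_dot[OF p]) (auto simp: a_def)
    also have "... = (norm2 p a) ^ N * smom p N" by (simp add: power_mult_distrib smom_def)
    also have "(norm2 p a) ^ N = ((norm2 p a)\<^sup>2) ^ (k + 1)" unfolding power_mult[symmetric] N_def by simp
    finally have 1: "(LINT x|\<mu> p. (dot p x a) ^ N) = (1 + b\<^sup>2) ^ (k + 1) * smom p N" by (simp add: a2)
    have "(dot p x a) ^ N = (\<Sum>j\<le>N. real (N choose j) * b ^ j * ((x i) ^ j * (x 0) ^ (N - j)))" for x
    proof -
      have "dot p x a = b * x i + x 0" using i p by (simp add: a_def dot_vec_comb_right dot_unitv)
      then show ?thesis by (simp add: binomial_ring power_mult_distrib mult.assoc)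
    qed
    then have "(LINT x|\<mu> p. (dot p x a) ^ N) = (\<Sum>j\<le>N. real (N choose j) * b ^ j * (LINT x|\<mu> p. (x i) ^ j * (x 0) ^ (N - j)))"
      using I by (simp add: lint_sum)
    also have "... = (\<Sum>j\<le>N. c j * b ^ j)" by (simp add: c_def mult.assoc mult.commute[of "b ^ _"])
    finally have 2: "(LINT x|\<mu> p. (dot p x a) ^ N) = (\<Sum>j\<le>N. c j * b ^ j)" .
    show ?thesis
    proof -
      have "poly [:1, 0, 1:] b = 1 + b\<^sup>2" by (simp add: power2_eq_square)
      then have "poly (smult (smom p N) ([:1, 0, 1:] ^ (k + 1))) b = smom p N * (1 + b\<^sup>2) ^ (k + 1)" unfolding poly_smult poly_power by simp
      moreover have "poly (\<Sum>j\<le>N. monom (c j) j) b = (\<Sum>j\<le>N. c j * b ^ j)" by (simp add: poly_sum poly_monom)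
      ultimately show ?thesis using 1 2 by (simp only: mult.commute)
    qed
  qed
  then have "(\<Sum>j\<le>N. monom (c j) j) = smult (smom p N) ([:1, 0, 1:] ^ (k + 1))" by (subst poly_eq_poly_eq_iff[symmetric]) auto
  then have "coeff (\<Sum>j\<le>N. monom (c j) j) 2 = coeff (smult (smom p N) ([:1, 0, 1:] ^ (k + 1))) 2" by simp
  moreover have "coeff (\<Sum>j\<le>N. monom (c j) j) 2 = c 2" by (simp add: coeff_sum N_def numeral_2_eq_2)
  ultimately have "c 2 = smom p N * real (k + 1)" using coeff_one_plus_square_power(3)[of "k + 1"] by (simp add: numeral_2_eq_2)
  moreover have "real (N choose 2) = (real k + 1) * (2 * real k + 1)" unfolding N_def choose_two by (simp add: real_of_nat_div algebra_simps)
  ultimately have "(real k + 1) * ((2 * real k + 1) * (LINT x|\<mu> p. (x i) ^ 2 * (x 0) ^ (2 * k))) = (real k + 1) * smom p N"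
    by (simp add: c_def N_def algebra_simps)
  then show ?thesis by (simp add: N_def)
qed

text \<open>The sum of the squared coordinates, which is 1, is inserted as a factor. Coordinate 0
  raises the power by two, and each of the other \<open>p - 1\<close> coordinates contributes the
  value from \<open>mixed_moment_sphere\<close>.\<close>

lemma smom_rec:
  assumes p: "p > 0"
  shows "(2 * real k + 1) * smom p (2 * k) = (real p + 2 * real k) * smom p (2 * k + 2)"
proof -
  have m: "smom p j = (LINT x|\<mu> p. (x 0) ^ j)" for j
    using integral_dot_sphere[OF unitv_sphere[OF p], of "\<lambda>t. t ^ j"] p by (simp add: smom_def dot_unitv)
  have I: "integrable (\<mu> p) (\<lambda>x. (x i)\<^sup>2 * (x 0) ^ (2 * k))" if "i < p" for i using that p by (rule integrable_mixed_moment)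
  have "smom p (2 * k) = (LINT x|\<mu> p. (\<Sum>i<p. (x i)\<^sup>2 * (x 0) ^ (2 * k)))" unfolding m
  proof (rule integral_cong_AE)
    show "AE x in \<mu> p. (x 0) ^ (2 * k) = (\<Sum>i<p. (x i)\<^sup>2 * (x 0) ^ (2 * k))" using AE_unif_sphere[OF p]
    proof eventually_elim
      fix x assume "x \<in> unit_sphere p"
      then have "(\<Sum>i<p. (x i)\<^sup>2) = 1" using dot_self_sphere[of x p] by (simp add: dot_def power2_eq_square)
      then show "(x 0) ^ (2 * k) = (\<Sum>i<p. (x i)\<^sup>2 * (x 0) ^ (2 * k))" by (simp add: sum_distrib_right[symmetric])
    qed
    have [measurable]: "i \<in> {..<p} \<Longrightarrow> (\<lambda>x. x i) \<in> borel_measurable (\<mu> p)" "(\<lambda>x. x 0) \<in> borel_measurable (\<mu> p)" for i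
      using p by (auto simp: measurable_cong_sets[OF sets_unif_sphere refl] intro: measurable_rvec_component)
    show "(\<lambda>x. (x 0) ^ (2 * k)) \<in> borel_measurable (\<mu> p)" by measurable
    show "(\<lambda>x. (\<Sum>i<p. (x i)\<^sup>2 * (x 0) ^ (2 * k))) \<in> borel_measurable (\<mu> p)" by measurable
  qed
  also have "... = (\<Sum>i<p. (LINT x|\<mu> p. (x i)\<^sup>2 * (x 0) ^ (2 * k)))" using I by (subst lint_sum) auto
  also have "{..<p} = insert 0 {1..<p}" using p by auto
  also have "(\<Sum>i\<in>.... (LINT x|\<mu> p. (x i)\<^sup>2 * (x 0) ^ (2 * k))) =
     smom p (2 * k + 2) + (\<Sum>i\<in>{1..<p}. (LINT x|\<mu> p. (x i)\<^sup>2 * (x 0) ^ (2 * k)))"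
    by (simp add: m power_add[symmetric] add.commute[of 2])
  also have "(\<Sum>i\<in>{1..<p}. (LINT x|\<mu> p. (x i)\<^sup>2 * (x 0) ^ (2 * k))) = (\<Sum>i\<in>{1..<p}. smom p (2 * k + 2) / (2 * real k + 1))"
    using mixed_moment_sphere[of _ p k] by (intro sum.cong) (auto simp: field_simps)
  also have "... = (real p - 1) * smom p (2 * k + 2) / (2 * real k + 1)" using p by (simp add: of_nat_diff)
  finally show ?thesis by (simp add: field_simps)
qed

lemma smom_even:
  assumes p: "p > 0"
  shows "smom p (2 * k) / fact (2 * k) = bessel_coeff p k / ((2 * real p) ^ k * fact k)"
proof (induction k)
  case 0 then show ?case by (simp add: smom_0 bessel_coeff_def)
next
  case (Suc k)
  have q: "real p + 2 * real k > 0" using p by (simp add: add_pos_nonneg)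
  have "smom p (2 * k + 2) = (2 * real k + 1) * smom p (2 * k) / (real p + 2 * real k)" using smom_rec[OF p, of k] q by (simp add: field_simps)
  moreover have f: "(fact (2 * k + 2) :: real) = (2 * real k + 2) * ((2 * real k + 1) * fact (2 * k))" by (simp add: algebra_simps)
  ultimately have "smom p (2 * Suc k) / fact (2 * Suc k) = ((2 * real k + 1) * smom p (2 * k) / (real p + 2 * real k)) / ((2 * real k + 2) * ((2 * real k + 1) * fact (2 * k)))"
    by (simp only: mult_Suc_right add.commute[of 2])
  also have "... = (smom p (2 * k) / fact (2 * k)) * (1 / ((2 * real k + 2) * (real p + 2 * real k)))"
  proof -
    have gen: "(B * m / Q) / (A * (B * F)) = (m / F) * (1 / (A * Q))" if "A > 0" "B > 0" "F > 0" "Q > 0" for A B F Q m :: real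
      using that by (simp add: field_simps)
    show ?thesis by (rule gen) (use q in auto)
  qed
  also have "... = bessel_coeff p (Suc k) / ((2 * real p) ^ Suc k * fact (Suc k))"
  proof -
    have b: "bessel_coeff p (Suc k) = bessel_coeff p k * (real p / (real p + 2 * real k))" using p q by (simp add: bessel_coeff_def field_simps)
    have gen: "(b / (D * F)) * (1 / ((2 * s) * Q)) = (b * (P / Q)) / ((2 * P * D) * (s * F))" if "P > 0" "Q > 0" for b D F s P Q :: real
      using that by (cases "D = 0"; cases "F = 0"; cases "s = 0") (simp_all add: field_simps)
    have s: "2 * real k + 2 = 2 * real (Suc k)" "(fact (Suc k) :: real) = real (Suc k) * fact k" by simp_all
    show ?thesis unfolding Suc b s power_Suc by (rule gen) (use p q in auto)
  qed
  finally show ?case .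
qed

lemma smom_2: "p > 0 \<Longrightarrow> smom p 2 = 1 / real p"
  using smom_rec[of p 0, unfolded mult_0_right add_0 of_nat_0] by (simp add: smom_0 field_simps)

lemma smom_4_le: "p > 0 \<Longrightarrow> smom p 4 \<le> 3 / (real p)\<^sup>2"
proof -
  assume p: "p > 0"
  have "smom p 4 = 3 / (real p * (real p + 2))"
  proof -
    have e: "2 * 1 + 2 = (4::nat)" "2 * 1 = (2::nat)" by simp_all
    have "smom p 4 * (real p * (real p + 2)) = 3" using smom_rec[OF p, of 1, unfolded e] smom_2[OF p] p by (simp add: field_simps)
    moreover have "real p * (real p + 2) \<noteq> 0" using p by simp
    ultimately show ?thesis by (simp only: eq_divide_eq) simp
  qed
  also have "... \<le> 3 / (real p)\<^sup>2" using p by (intro divide_left_mono) (auto simp: power2_eq_square)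
  finally show ?thesis .
qed

text \<open>A complex parameter covers the moment generating function and the characteristic
  function at once. Odd moments vanish, which leaves a series in the square of
  \<open>z\<close>.\<close>

lemma slaw_transform_sums:
  assumes p: "p > 0"
  shows "(\<lambda>k. (z\<^sup>2 / (2 * of_nat p)) ^ k / fact k * of_real (bessel_coeff p k)) sums
     (LINT t|slaw p. exp (z * complex_of_real t))"
proof -
  define f where "f k t = (z * complex_of_real t) ^ k /\<^sub>R fact k" for k t
  have nf: "norm (f k t) \<le> norm z ^ k /\<^sub>R fact k" if "\<bar>t\<bar> \<le> 1" for k t
  proof -
    have "norm (f k t) = norm z ^ k * \<bar>t\<bar> ^ k / fact k" by (simp add: f_def norm_power norm_mult power_mult_distrib divide_inverse)
    also have "... \<le> norm z ^ k * 1 / fact k" using that by (intro divide_right_mono mult_left_mono power_le_one) auto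
    finally show ?thesis by (simp add: divide_inverse mult.commute)
  qed
  have fm [measurable]: "f k \<in> borel_measurable borel" for k unfolding f_def by measurable
  have fI: "integrable (slaw p) (f k)" for k by (rule integrable_slaw_bounded[OF p fm nf])
  have zs: "summable (\<lambda>k. norm z ^ k /\<^sub>R fact k)" by (rule summable_exp_generic)
  have "(\<lambda>k. LINT t|slaw p. f k t) sums (LINT t|slaw p. (\<Sum>k. f k t))"
  proof (rule sums_integral)
    show "integrable (slaw p) (f k)" for k by (rule fI)
    show "AE t in slaw p. summable (\<lambda>k. norm (f k t))"
      using AE_slaw_le_1[OF p] by eventually_elim (rule summable_comparison_test[OF _ zs], use nf in auto)
    have "norm (LINT t|slaw p. norm (f k t)) \<le> norm z ^ k /\<^sub>R fact k" for k
    proof -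
      have "(LINT t|slaw p. norm (f k t)) \<le> (LINT t|slaw p. norm z ^ k /\<^sub>R fact k)"
        using AE_slaw_le_1[OF p] nf fI by (intro integral_mono_AE integrable_norm) (auto elim!: eventually_mono)
      then show ?thesis using S.prob_space by simp
    qed
    then show "summable (\<lambda>k. LINT t|slaw p. norm (f k t))" by (intro summable_comparison_test[OF _ zs]) auto
  qed
  moreover have "(\<Sum>k. f k t) = exp (z * complex_of_real t)" for t by (simp add: f_def exp_def)
  moreover have "(LINT t|slaw p. f k t) = z ^ k / fact k * of_real (smom p k)" for k
  proof -
    have "f k t = (z ^ k / fact k) * complex_of_real (t ^ k)" for t
      by (simp add: f_def power_mult_distrib scaleR_conv_of_real divide_inverse mult.commute mult.left_commute)
    then show ?thesis by (simp add: smom_def del: of_real_power)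
  qed
  ultimately have s: "(\<lambda>k. z ^ k / fact k * of_real (smom p k)) sums (LINT t|slaw p. exp (z * complex_of_real t))" by simp
  have "(\<lambda>k. z ^ (2 * k) / fact (2 * k) * of_real (smom p (2 * k))) sums (LINT t|slaw p. exp (z * complex_of_real t))"
  proof (subst sums_mono_reindex[of "\<lambda>k. 2 * k"])
    show "strict_mono (\<lambda>k::nat. 2 * k)" by (auto simp: strict_mono_def)
    show "z ^ n / fact n * of_real (smom p n) = 0" if "n \<notin> range (\<lambda>k. 2 * k)" for n
      using that smom_odd[OF p, of n] by (auto elim: evenE)
  qed (rule s)
  moreover have "z ^ (2 * k) / fact (2 * k) * of_real (smom p (2 * k)) = (z\<^sup>2 / (2 * of_nat p)) ^ k / fact k * of_real (bessel_coeff p k)" for k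
  proof -
    have "z ^ (2 * k) / fact (2 * k) * of_real (smom p (2 * k)) = (z\<^sup>2) ^ k * complex_of_real (smom p (2 * k) / fact (2 * k))"
      by (simp add: power_mult)
    also have "... = (z\<^sup>2 / (2 * of_nat p)) ^ k / fact k * of_real (bessel_coeff p k)" unfolding smom_even[OF p] by (simp add: power_divide)
    finally show ?thesis .
  qed
  ultimately show ?thesis by simp
qed

lemma slaw_mgf:
  assumes p: "p > 0"
  shows "(LINT t|slaw p. exp (r * t)) = bessel_series p (r\<^sup>2 / (2 * real p))"
proof -
  have "(\<lambda>k. complex_of_real ((r\<^sup>2 / (2 * real p)) ^ k / fact k * bessel_coeff p k)) sums complex_of_real (LINT t|slaw p. exp (r * t))"
  proof -
    have "(LINT t|slaw p. exp (complex_of_real r * complex_of_real t)) = complex_of_real (LINT t|slaw p. exp (r * t))"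
      by (simp add: integral_complex_of_real[symmetric] exp_of_real[symmetric] del: integral_complex_of_real)
    then show ?thesis using slaw_transform_sums[OF p, of "complex_of_real r"] by simp
  qed
  then show ?thesis unfolding sums_of_real_iff by (rule sums_unique2) (rule bessel_series_sums)
qed

lemma slaw_char:
  assumes p: "p > 0"
  shows "(LINT t|slaw p. iexp (r * t)) = complex_of_real (bessel_series p (- (r\<^sup>2 / (2 * real p))))"
proof -
  have "(\<lambda>k. complex_of_real ((- (r\<^sup>2 / (2 * real p))) ^ k / fact k * bessel_coeff p k)) sums (LINT t|slaw p. iexp (r * t))"
    using slaw_transform_sums[OF p, of "\<i> * complex_of_real r"] by (simp add: power_mult_distrib mult.assoc)
  moreover have "(\<lambda>k. complex_of_real ((- (r\<^sup>2 / (2 * real p))) ^ k / fact k * bessel_coeff p k)) sums complex_of_real (bessel_series p (- (r\<^sup>2 / (2 * real p))))"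
    unfolding sums_of_real_iff by (rule bessel_series_sums)
  ultimately show ?thesis by (rule sums_unique2)
qed

text \<open>At nonpositive arguments the terms alternate in sign, but there the series is a value of
  a characteristic function.\<close>

lemma abs_bessel_series_le_1: "p > 0 \<Longrightarrow> x \<ge> 0 \<Longrightarrow> \<bar>bessel_series p (- x)\<bar> \<le> 1"
proof -
  assume p: "p > 0" and x: "x \<ge> 0"
  have "- x = - ((sqrt (2 * real p * x))\<^sup>2 / (2 * real p))" using p x by simp
  then have "complex_of_real (bessel_series p (- x)) = (LINT t|slaw p. iexp (sqrt (2 * real p * x) * t))"
    using slaw_char[OF p, of "sqrt (2 * real p * x)"] by simp
  also have "cmod ... \<le> 1"
  proof (rule S.norm_integral_le_const)
    show "(\<lambda>t. iexp (sqrt (2 * real p * x) * t)) \<in> borel_measurable (slaw p)" by measurable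
  qed simp
  finally show ?thesis by simp
qed

text \<open>Tonelli's theorem with the coordinate \<open>k\<close> integrated first.\<close>

lemma null_sets_if_finite_slices:
  fixes k p :: nat
  assumes N: "N \<in> sets (PiM {..<p} (\<lambda>_. lborel :: real measure))" and k: "k < p" and fin: "\<And>x. finite {t. x(k := t) \<in> N}"
  shows "N \<in> null_sets (PiM {..<p} (\<lambda>_. lborel))"
proof -
  interpret product_sigma_finite "\<lambda>_::nat. lborel :: real measure" by unfold_locales
  let ?I = "{..<p} - {k}"
  have I: "insert k ?I = {..<p}" using k by auto
  have "emeasure (PiM {..<p} (\<lambda>_. lborel)) N = (\<integral>\<^sup>+x. indicator N x \<partial>PiM (insert k ?I) (\<lambda>_. lborel))"
    using N unfolding I by simp
  also have "... = (\<integral>\<^sup>+x. \<integral>\<^sup>+t. indicator N (x(k := t)) \<partial>lborel \<partial>PiM ?I (\<lambda>_. lborel))"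
    using N I product_nn_integral_insert[of ?I k "indicator N"] by simp
  also have "... = (\<integral>\<^sup>+x. 0 \<partial>PiM ?I (\<lambda>_. lborel :: real measure))"
  proof (rule nn_integral_cong)
    fix x
    have "(\<integral>\<^sup>+t. indicator N (x(k := t)) \<partial>lborel) = (\<integral>\<^sup>+t. 0 \<partial>(lborel :: real measure))"
      by (rule nn_integral_cong_AE, rule AE_I'[OF finite_imp_null_set_lborel[OF fin[of x]]]) (auto simp: indicator_def)
    then show "(\<integral>\<^sup>+t. indicator N (x(k := t)) \<partial>lborel) = 0" by simp
  qed
  finally show ?thesis using N by auto
qed

text \<open>The cone over a parallel is Lebesgue null: all coordinates but one determine the last one up to
  two values.\<close>

lemma slaw_no_atom:
  assumes p: "p \<ge> 2"
  shows "measure (slaw p) {c} = 0"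
proof -
  let ?L = "PiM {..<p} (\<lambda>_. lborel :: real measure)"
  define N where "N = {x \<in> space (rvec p). x 0 = c * norm2 p x}"
  have "(\<lambda>x. x 0) \<in> borel_measurable (rvec p)" using p by (auto simp: rvec_def intro!: measurable_component_singleton)
  then have N: "N \<in> sets ?L" unfolding N_def rvec_eq_lborel by measurable
  \<comment> \<open>For \<open>c = 0\<close> the cone is the hyperplane on which coordinate 0
    vanishes, so this coordinate is the one to integrate. Otherwise coordinate 1, which exists as
    \<open>p \<ge> 2\<close>, is determined by the others up to sign.\<close>
  define k :: nat where "k = (if c = 0 then 0 else 1)"
  have kp: "k < p" using p by (simp add: k_def)
  have "finite {t. x(k := t) \<in> N}" for x
  proof (cases "c = 0")
    case True
    then have "{t. x(k := t) \<in> N} \<subseteq> {0}" by (auto simp: N_def k_def)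
    then show ?thesis by (rule finite_subset) simp
  next
    case False
    define s where "s = (x 0)\<^sup>2 / c\<^sup>2 - (\<Sum>i\<in>{..<p} - {1}. (x i)\<^sup>2)"
    have "{t. x(k := t) \<in> N} \<subseteq> {sqrt s, - sqrt s}"
    proof
      fix t assume "t \<in> {t. x(k := t) \<in> N}"
      then have "x 0 = c * norm2 p (x(1 := t))" using False by (simp add: N_def k_def)
      then have "(x 0)\<^sup>2 = c\<^sup>2 * (norm2 p (x(1 := t)))\<^sup>2" by (metis power_mult_distrib)
      also have "(norm2 p (x(1 := t)))\<^sup>2 = (\<Sum>i<p. ((x(1 := t)) i)\<^sup>2)" by (simp add: norm2_def sum_nonneg)
      also have "... = t\<^sup>2 + (\<Sum>i\<in>{..<p} - {1}. (x i)\<^sup>2)" using p by (subst sum.remove[of _ 1]) auto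
      finally have "t\<^sup>2 = s" using False by (simp add: s_def)
      then have "sqrt s = \<bar>t\<bar>" by auto
      then show "t \<in> {sqrt s, - sqrt s}" by auto
    qed
    then show ?thesis by (rule finite_subset) simp
  qed
  then have null: "N \<in> null_sets ?L" by (rule null_sets_if_finite_slices[OF N kp])
  have m: "normalise p \<in> uniform_measure ?L (unit_ball p) \<rightarrow>\<^sub>M rvec p"
    using measurable_normalise[of p] measurable_cong_sets[OF rvec_eq_lborel refl] by (simp add: measurable_def rvec_eq_lborel space_PiM rvec_def)
  have sp: "space ?L = space (rvec p)" by (rule sets_eq_imp_space_eq[OF rvec_eq_lborel])
  have "AE x in ?L. x \<notin> N" by (rule AE_not_in[OF null])
  then have "AE x in uniform_measure ?L (unit_ball p). x \<notin> N" by (intro AE_uniform_measureI) (auto simp: rvec_eq_lborel)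
  then have "AE x in uniform_measure ?L (unit_ball p). dot p (normalise p x) (unitv p 0) \<noteq> c" using AE_space
  proof eventually_elim
    fix x assume x: "x \<notin> N" "x \<in> space (uniform_measure ?L (unit_ball p))"
    \<comment> \<open>The origin belongs to \<open>N\<close>, so the value of
      \<open>normalise\<close> there, a quotient by zero, does no harm.\<close>
    have "norm2 p x = 0 \<Longrightarrow> x 0 = 0" using p by (auto simp: norm2_def sum_nonneg_eq_0_iff)
    then show "dot p (normalise p x) (unitv p 0) \<noteq> c" using x p by (cases "norm2 p x = 0") (auto simp: dot_unitv normalise_def N_def sp)
  qed
  then have "AE x in \<mu> p. dot p x (unitv p 0) \<noteq> c" unfolding unif_sphere_def by (subst AE_distr_iff[OF m]) auto
  then have "AE t in slaw p. t \<noteq> c" unfolding slaw_def by (subst AE_distr_iff) auto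
  then show ?thesis using prob_space.prob_eq_0[OF prob_space_slaw, of "{c}" p] by simp
qed

text \<open>The reflection along \<open>w\<close> keeps the inner product with \<open>y\<close> and
  changes the sign of the one with \<open>w\<close>.\<close>

lemma integral_dot_orthogonal:
  assumes y: "y \<in> unit_sphere p" and w: "w \<in> space (rvec p)" and yw: "dot p y w = 0"
    and [measurable]: "f \<in> borel_measurable borel"
  shows "(LINT x|\<mu> p. f (dot p x y) * dot p x w) = 0"
proof (cases "norm2 p w = 0")
  case True
  have "dot p x w = 0" for x using abs_dot_le[of p x w] True by simp
  then show ?thesis by simp
next
  case False
  define v where "v = vec_comb p (1 / norm2 p w) w 0 w"
  have "(norm2 p v)\<^sup>2 = 1" using False unfolding v_def norm2_vec_comb dot_self by (simp add: power_divide)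
  then have "norm2 p v = 1" using norm2_nonneg[of p v] by (simp add: power2_eq_1_iff)
  then have v: "v \<in> unit_sphere p" by (simp add: unit_sphere_def v_def)
  note [measurable] = unit_sphere_space[OF y] w
  have vy: "dot p v y = 0" using yw dot_commute[of p w y] by (simp add: v_def dot_vec_comb)
  have wv: "dot p x w = norm2 p w * dot p v x" for x using False dot_commute[of p w x] by (simp add: v_def dot_vec_comb)
  have vv: "dot p v (hrefl p v x) = - dot p v x" for x
    using dot_hrefl[of p v x v] dot_self_sphere[OF v] dot_commute[of p "hrefl p v x" v] dot_commute[of p x v] by simp
  have "(LINT x|\<mu> p. f (dot p x y) * dot p x w) = (LINT x|\<mu> p. f (dot p (hrefl p v x) y) * dot p (hrefl p v x) w)"
    by (rule integral_hrefl[OF v, symmetric]) measurable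
  also have "... = (LINT x|\<mu> p. - (f (dot p x y) * dot p x w))"
  proof -
    have "dot p (hrefl p v x) w = - dot p x w" "dot p (hrefl p v x) y = dot p x y" for x
      using wv[of "hrefl p v x"] wv[of x] vv[of x] by (simp_all add: dot_hrefl[of p v x y] vy)
    then show ?thesis by simp
  qed
  finally show ?thesis by simp
qed

text \<open>The Funk-Hecke formula in degree one: \<open>z\<close> is split into its component along
  \<open>y\<close> and a part orthogonal to \<open>y\<close>, and the latter integrates to
  zero.\<close>

lemma integral_dot_linear:
  assumes y: "y \<in> unit_sphere p" and z: "z \<in> space (rvec p)"
    and [measurable]: "f \<in> borel_measurable borel" and f: "\<And>t. \<bar>t\<bar> \<le> 1 \<Longrightarrow> \<bar>f t\<bar> \<le> C"
  shows "(LINT x|\<mu> p. f (dot p x y) * dot p x z) = dot p y z * (LINT t|slaw p. f t * t)"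
proof -
  note [measurable] = unit_sphere_space[OF y] z
  have p: "p > 0" using y by (rule sphere_imp_pos)
  have C: "C \<ge> 0" using f[of 0] by simp
  define w where "w = vec_comb p 1 z (- dot p y z) y"
  have yw: "dot p y w = 0" by (simp add: w_def dot_vec_comb_right dot_self_sphere[OF y])
  have ws [measurable]: "w \<in> space (rvec p)" by (simp add: w_def)
  have I: "integrable (\<mu> p) (\<lambda>x. f (dot p x y) * dot p x u)" if [measurable]: "u \<in> space (rvec p)" for u
  proof (rule integrable_unif_sphere_bounded[OF p])
    fix x assume x: "x \<in> unit_sphere p"
    have "\<bar>dot p x u\<bar> \<le> norm2 p u" using abs_dot_le[of p x u] x by (simp add: unit_sphere_def)
    then show "norm (f (dot p x y) * dot p x u) \<le> C * norm2 p u"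
      unfolding real_norm_def abs_mult using abs_dot_sphere_le[OF x y] f C by (intro mult_mono) auto
  qed measurable
  have "f (dot p x y) * dot p x z = f (dot p x y) * dot p x w + dot p y z * (f (dot p x y) * dot p x y)" for x
    by (simp add: w_def dot_vec_comb_right algebra_simps)
  then have "(LINT x|\<mu> p. f (dot p x y) * dot p x z) = (LINT x|\<mu> p. f (dot p x y) * dot p x w) + dot p y z * (LINT x|\<mu> p. f (dot p x y) * dot p x y)"
    using I[OF ws] I[OF unit_sphere_space[OF y]] by simp
  then show ?thesis using integral_dot_orthogonal[OF y ws yw, of f] integral_dot_sphere[OF y, of "\<lambda>t. f t * t"] by simp
qed

section \<open>Normal limit of the inner product\<close>

definition wlaw :: "nat \<Rightarrow> real measure" where
  "wlaw p = distr (slaw p) borel (\<lambda>t. sqrt p * t)"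

lemma real_distribution_wlaw: "real_distribution (wlaw p)" unfolding wlaw_def
  by (intro real_distribution.intro real_distribution_axioms.intro prob_space.prob_space_distr[OF prob_space_slaw]) auto

lemma char_wlaw: "p > 0 \<Longrightarrow> char (wlaw p) s = complex_of_real (bessel_series p (- (s\<^sup>2 / 2)))"
proof -
  assume p: "p > 0"
  have "char (wlaw p) s = (LINT t|slaw p. iexp ((s * sqrt p) * t))" unfolding char_def wlaw_def by (subst integral_distr) (auto simp: mult.assoc)
  then show ?thesis unfolding slaw_char[OF p] using p by (simp add: power_mult_distrib)
qed

lemma bessel_series_tendsto_exp: "(\<lambda>p. bessel_series p x) \<longlonglongrightarrow> exp x"
proof (rule LIM_zero_cancel, rule Lim_null_comparison)
  show "\<forall>\<^sub>F p in sequentially. norm (bessel_series p x - exp x) \<le> (x\<^sup>2 * exp \<bar>x\<bar>) / real p"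
    using bessel_series_minus_exp[of _ x] by simp
  show "(\<lambda>p. (x\<^sup>2 * exp \<bar>x\<bar>) / real p) \<longlonglongrightarrow> 0" by (rule lim_const_over_n)
qed

lemma wlaw_weak_conv: "weak_conv_m wlaw \<N>"
proof (rule levy_continuity[OF real_distribution_wlaw real_dist_normal_dist])
  fix s
  have "(\<lambda>p. complex_of_real (bessel_series p (- (s\<^sup>2 / 2)))) \<longlonglongrightarrow> complex_of_real (exp (- (s\<^sup>2 / 2)))"
    by (intro tendsto_of_real bessel_series_tendsto_exp)
  moreover have "\<forall>\<^sub>F p in sequentially. complex_of_real (bessel_series p (- (s\<^sup>2 / 2))) = char (wlaw p) s"
    using eventually_gt_at_top[of 0] by eventually_elim (simp add: char_wlaw)
  ultimately show "(\<lambda>p. char (wlaw p) s) \<longlonglongrightarrow> char \<N> s"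
    by (simp add: char_std_normal_distribution Lim_transform_eventually)
qed

lemma std_normal_no_atom: "emeasure \<N> {x} = 0"
proof -
  have "AE y in lborel. y \<notin> {x}" by (rule AE_lborel_singleton[of x, THEN eventually_mono]) simp
  then show ?thesis by (subst emeasure_density) (auto intro!: nn_integral_0_iff_AE[THEN iffD2] elim!: eventually_mono)
qed

lemma wlaw_integral_tendsto:
  fixes f :: "real \<Rightarrow> real"
  assumes [measurable]: "f \<in> borel_measurable borel" and "\<And>x. \<bar>f x\<bar> \<le> C" and "\<And>x. x \<noteq> a \<Longrightarrow> isCont f x"
  shows "(\<lambda>p. LINT t|slaw p. f (sqrt p * t)) \<longlonglongrightarrow> (LINT x|\<N>. f x)"
proof -
  have "{x. \<not> isCont f x} \<subseteq> {a}" using assms(3) by auto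
  then have "emeasure \<N> {x. \<not> isCont f x} \<le> emeasure \<N> {a}" by (intro emeasure_mono) auto
  then have "emeasure \<N> {x. \<not> isCont f x} = 0" by (simp add: std_normal_no_atom)
  then have "(\<lambda>p. integral\<^sup>L (wlaw p) f) \<longlonglongrightarrow> (LINT x|\<N>. f x)"
    using assms(2) by (intro weak_conv_imp_bdd_ae_continuous_conv[where B=C] real_distribution_wlaw real_dist_normal_dist wlaw_weak_conv) auto
  then show ?thesis unfolding wlaw_def by (subst (asm) integral_distr) auto
qed

lemma slaw_cdf_tendsto: "(\<lambda>p. measure (slaw p) {t. sqrt p * t \<le> a}) \<longlonglongrightarrow> std_normal_cdf a"
proof -
  have "isCont (indicator {..a} :: real \<Rightarrow> real) x" if "x \<noteq> a" for x using that by (auto simp: isCont_indicator)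
  then have "(\<lambda>p. LINT t|slaw p. hs p a t) \<longlonglongrightarrow> (LINT x|\<N>. indicat_real {..a} x)"
    by (intro wlaw_integral_tendsto[where a=a and C=1]) auto
  moreover have "(LINT t|slaw p. hs p a t) = measure (slaw p) {t. sqrt p * t \<le> a}" for p
  proof -
    have "(LINT t|slaw p. hs p a t) = (LINT t|slaw p. indicator {t. sqrt p * t \<le> a} t)" by (intro lint_cong) (auto simp: indicator_def)
    then show ?thesis by simp
  qed
  ultimately show ?thesis by (simp add: std_normal_cdf_def cdf_def)
qed

text \<open>\<open>- std_normal_density\<close> is an antiderivative of the integrand. This integral
  is the covariance of an indicator with the normal variable itself, and thereby the origin of the
  drift in the limit process.\<close>

lemma integral_std_normal_half_line:
  "(LINT x|\<N>. x * indicator {..a} x) = - std_normal_density a"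
proof -
  have I: "integrable lborel (\<lambda>x. x * std_normal_density x)" using integrable_std_normal_distribution_moment[of 1]
    by (subst (asm) integrable_density) (auto simp: mult.commute)
  have "(LBINT x=-\<infinity>..ereal a. x * std_normal_density x) = - std_normal_density a - 0"
  proof (rule interval_integral_FTC_integrable[where F="\<lambda>x. - std_normal_density x"])
    show "((\<lambda>x. - std_normal_density x) has_vector_derivative x * std_normal_density x) (at x)" for x
    proof -
      have "((\<lambda>x. - (c * exp (- x\<^sup>2 / 2))) has_real_derivative x * (c * exp (- x\<^sup>2 / 2))) (at x)" for c
        by (auto intro!: derivative_eq_intros)
      then show ?thesis unfolding std_normal_density_def has_real_derivative_iff_has_vector_derivative[symmetric] .
    qed
    show "isCont (\<lambda>x. x * std_normal_density x) x" for x unfolding std_normal_density_def by (intro continuous_intros) auto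
    show "set_integrable lborel (einterval (- \<infinity>) (ereal a)) (\<lambda>x. x * std_normal_density x)"
      unfolding set_integrable_def using I by (intro integrable_mult_indicator) auto
    have "((\<lambda>x. - std_normal_density x) \<longlongrightarrow> 0) at_bot" unfolding std_normal_density_def by real_asymp
    then show "(((\<lambda>x. - std_normal_density x) \<circ> real_of_ereal) \<longlongrightarrow> 0) (at_right (- \<infinity>))"
      by (simp add: ereal_tendsto_simps)
    have "isCont (\<lambda>x. - std_normal_density x) a" unfolding std_normal_density_def by (intro continuous_intros) auto
    then have "((\<lambda>x. - std_normal_density x) \<longlongrightarrow> - std_normal_density a) (at_left a)"
      by (simp add: isCont_def filterlim_at_split)
    then show "(((\<lambda>x. - std_normal_density x) \<circ> real_of_ereal) \<longlongrightarrow> - std_normal_density a) (at_left (ereal a))"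
      by (simp add: ereal_tendsto_simps)
  qed simp
  moreover have "(LBINT x=-\<infinity>..ereal a. x * std_normal_density x) = (LINT x|lborel. x * std_normal_density x * indicator {..a} x)"
  proof -
    have "(LBINT x=-\<infinity>..ereal a. x * std_normal_density x) = (LINT x|lborel. indicator {..<a} x *\<^sub>R (x * std_normal_density x))"
      by (simp add: interval_lebesgue_integral_def set_lebesgue_integral_def einterval_def lessThan_def)
    also have "... = (LINT x|lborel. x * std_normal_density x * indicator {..a} x)"
      using AE_lborel_singleton[of a] by (intro integral_cong_AE) (auto elim!: eventually_mono simp: indicator_def)
    finally show ?thesis .
  qed
  moreover have "(LINT x|\<N>. x * indicator {..a} x) = (LINT x|lborel. x * std_normal_density x * indicator {..a} x)"
    by (subst integral_density) (auto simp: mult_ac)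
  ultimately show ?thesis by simp
qed

text \<open>Weak convergence handles bounded functions only, hence the truncation at
  \<open>L\<close>. Beyond it the error is at most the absolute value of x, which is then at most
  \<open>x^2 / L\<close>.\<close>

lemma (in real_distribution) truncated_first_moment:
  assumes i: "integrable M (\<lambda>x. x\<^sup>2)" and m: "(LINT x|M. x\<^sup>2) \<le> 1" and L: "L > 0"
  shows "\<bar>(LINT x|M. x * indicator {..a} x) - (LINT x|M. max (- L) (min L x) * indicator {..a} x)\<bar> \<le> 1 / L"
proof -
  have le: "\<bar>x\<bar> \<le> 1 + x\<^sup>2" for x :: real using zero_le_power2[of "\<bar>x\<bar> - 1"] by (simp add: power2_diff)
  have I1: "integrable M (\<lambda>x. x * indicator {..a} x)"
    by (rule lintegrable_bound[of M "\<lambda>x. 1 + x\<^sup>2"]) (use i le in \<open>auto simp: indicator_def\<close>)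
  have I2: "integrable M (\<lambda>x. max (- L) (min L x) * indicator {..a} x)"
    using L by (intro integrable_bounded[of _ L]) (auto simp: indicator_def)
  have "\<bar>(LINT x|M. x * indicator {..a} x) - (LINT x|M. max (- L) (min L x) * indicator {..a} x)\<bar> =
    \<bar>LINT x|M. x * indicator {..a} x - max (- L) (min L x) * indicator {..a} x\<bar>" using I1 I2 by simp
  also have "... \<le> (LINT x|M. \<bar>x * indicator {..a} x - max (- L) (min L x) * indicator {..a} x\<bar>)" by (rule integral_abs_bound)
  also have "... \<le> (LINT x|M. x\<^sup>2 / L)"
  proof (rule integral_mono)
    show "\<bar>x * indicator {..a} x - max (- L) (min L x) * indicator {..a} x\<bar> \<le> x\<^sup>2 / L" for x
    proof (cases "\<bar>x\<bar> \<le> L")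
      case True
      then have "max (- L) (min L x) = x" by auto
      then show ?thesis using L by simp
    next
      case False
      have "\<bar>x * indicator {..a} x - max (- L) (min L x) * indicator {..a} x\<bar> \<le> \<bar>x\<bar>"
        using False L by (auto simp: indicator_def)
      also have "\<bar>x\<bar> * L \<le> \<bar>x\<bar> * \<bar>x\<bar>" using False by (intro mult_left_mono) auto
      then have "\<bar>x\<bar> \<le> x\<^sup>2 / L" using L by (simp add: field_simps power2_eq_square)
      finally show ?thesis .
    qed
  qed (use i I1 I2 in auto)
  also have "... \<le> 1 / L" using m L by (simp add: divide_right_mono)
  finally show ?thesis .
qed

lemma wlaw_second_moment:
  assumes "p > 0"
  shows "(LINT x|wlaw p. x\<^sup>2) = 1" "integrable (wlaw p) (\<lambda>x. x\<^sup>2)"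
proof -
  have "(LINT x|wlaw p. x\<^sup>2) = (LINT t|slaw p. real p * t\<^sup>2)" unfolding wlaw_def by (subst integral_distr) (auto simp: power_mult_distrib)
  then show "(LINT x|wlaw p. x\<^sup>2) = 1" using smom_2[OF assms] assms by (simp add: smom_def)
  show "integrable (wlaw p) (\<lambda>x. x\<^sup>2)" unfolding wlaw_def using assms by (subst integrable_distr_eq) (auto simp: power_mult_distrib)
qed

lemma wlaw_half_line_tendsto:
  "(\<lambda>p. LINT t|slaw p. sqrt p * t * indicator {..a} (sqrt p * t)) \<longlonglongrightarrow> - std_normal_density a"
proof -
  define f where "f L x = max (- L) (min L x) * indicator {..a} x" for L x :: real
  have fm [measurable]: "f L \<in> borel_measurable borel" for L unfolding f_def by measurable
  define e where "e p = (LINT x|wlaw p. x * indicator {..a} x)" for p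
  have N2: "(LINT x|\<N>. x\<^sup>2) \<le> 1" using std_normal_distribution_even_moments(1)[of 1] by (simp add: fact_numeral)
  have "e \<longlonglongrightarrow> - std_normal_density a"
  proof (rule LIMSEQ_I)
    fix r :: real assume r: "r > 0"
    define L where "L = 3 / r"
    have L: "L > 0" "1 / L = r / 3" using r by (auto simp: L_def)
    have "(\<lambda>p. LINT t|slaw p. f L (sqrt p * t)) \<longlonglongrightarrow> (LINT x|\<N>. f L x)"
    proof (rule wlaw_integral_tendsto[where C=L and a=a])
      show "\<bar>f L x\<bar> \<le> L" for x using L by (auto simp: f_def indicator_def)
      show "isCont (f L) x" if "x \<noteq> a" for x unfolding f_def using that by (intro continuous_intros) (auto simp: isCont_indicator)
    qed measurable
    then have "(\<lambda>p. integral\<^sup>L (wlaw p) (f L)) \<longlonglongrightarrow> (LINT x|\<N>. f L x)"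
      unfolding wlaw_def by (subst integral_distr) auto
    then have "\<forall>\<^sub>F p in sequentially. dist (integral\<^sup>L (wlaw p) (f L)) (LINT x|\<N>. f L x) < r / 3"
      using r by (intro tendstoD) auto
    then have "\<forall>\<^sub>F p in sequentially. norm (e p - (- std_normal_density a)) < r" using eventually_gt_at_top[of 0]
    proof eventually_elim
      fix p :: nat assume p: "p > 0" and d: "dist (integral\<^sup>L (wlaw p) (f L)) (LINT x|\<N>. f L x) < r / 3"
      have "\<bar>e p - integral\<^sup>L (wlaw p) (f L)\<bar> \<le> r / 3"
        using real_distribution.truncated_first_moment[OF real_distribution_wlaw wlaw_second_moment(2)[OF p] _ L(1), of a] wlaw_second_moment(1)[OF p] L(2)
        unfolding e_def f_def by simp
      moreover have "\<bar>- std_normal_density a - (LINT x|\<N>. f L x)\<bar> \<le> r / 3"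
        using real_distribution.truncated_first_moment[OF real_dist_normal_dist integrable_std_normal_distribution_moment N2 L(1), of a] L(2)
        unfolding integral_std_normal_half_line f_def by simp
      ultimately show "norm (e p - (- std_normal_density a)) < r" using d unfolding dist_real_def real_norm_def by linarith
    qed
    then show "\<exists>no. \<forall>p\<ge>no. norm (e p - (- std_normal_density a)) < r" by (simp add: eventually_sequentially)
  qed
  then show ?thesis unfolding e_def wlaw_def by (subst (asm) integral_distr) auto
qed

section \<open>Zonal kernels\<close>

definition svec :: "nat \<Rightarrow> rseq \<Rightarrow> nat \<Rightarrow> real" where
  "svec p x = (if x \<in> unit_sphere p then x else unitv p 0)"

text \<open>Agrees almost surely with \<open>dot p\<close>, but the sup bound by \<open>1\<close> and the independence of
  the law of \<open>ip p x Y\<close> from \<open>x\<close> hold for all \<open>x\<close>.\<close>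

definition ip :: "nat \<Rightarrow> rseq \<Rightarrow> rseq \<Rightarrow> real" where
  "ip p x y = dot p (svec p x) (svec p y)"

lemma svec_sphere: "p > 0 \<Longrightarrow> svec p x \<in> unit_sphere p" by (simp add: svec_def unitv_sphere)

lemma svec_space: "svec p x \<in> space (rvec p)" by (simp add: svec_def unit_sphere_space)

lemma measurable_svec [measurable]: "svec p \<in> rvec p \<rightarrow>\<^sub>M rvec p" unfolding svec_def by measurable

lemma measurable_ip [measurable (raw)]:
  "f \<in> N \<rightarrow>\<^sub>M rvec p \<Longrightarrow> g \<in> N \<rightarrow>\<^sub>M rvec p \<Longrightarrow> (\<lambda>x. ip p (f x) (g x)) \<in> borel_measurable N"
  unfolding ip_def by (rule measurable_dot) (erule measurable_compose[OF _ measurable_svec])+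

lemma ip_commute: "ip p x y = ip p y x" by (simp add: ip_def dot_commute)

lemma ip_flip: "ip p x y = dot p (svec p y) (svec p x)" by (simp add: ip_def dot_commute)

lemma abs_ip_le: "p > 0 \<Longrightarrow> \<bar>ip p x y\<bar> \<le> 1" unfolding ip_def by (intro abs_dot_sphere_le svec_sphere)

lemma integral_svec:
  fixes f :: "rseq \<Rightarrow> 'b::{banach,second_countable_topology}"
  assumes p: "p > 0" and [measurable]: "f \<in> borel_measurable (rvec p)"
  shows "(LINT x|\<mu> p. f (svec p x)) = (LINT x|\<mu> p. f x)"
proof (rule integral_cong_AE)
  show "AE x in \<mu> p. f (svec p x) = f x" using AE_unif_sphere[OF p] by eventually_elim (simp add: svec_def)
qed measurable

lemma integral_ip:
  fixes f :: "real \<Rightarrow> 'b::{banach,second_countable_topology}"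
  assumes p: "p > 0" and [measurable]: "f \<in> borel_measurable borel"
  shows "(LINT y|\<mu> p. f (ip p x y)) = (LINT t|slaw p. f t)"
proof -
  note [measurable] = svec_space
  have "(LINT y|\<mu> p. f (ip p x y)) = (LINT y|\<mu> p. f (dot p (svec p y) (svec p x)))" by (simp add: ip_def dot_commute)
  also have "... = (LINT y|\<mu> p. f (dot p y (svec p x)))" by (rule integral_svec[OF p]) measurable
  also have "... = (LINT t|slaw p. f t)" by (rule integral_dot_sphere[OF svec_sphere[OF p]]) measurable
  finally show ?thesis .
qed

text \<open>The exponent is the inner product of \<open>z\<close> with a linear combination of
  \<open>x\<close> and \<open>y\<close>. Its law depends only on the length of that vector, hence
  only on \<open>ip p x y\<close>.\<close>

lemma integral_ip_char:
  assumes p: "p > 0"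
  shows "(LINT z|\<mu> p. iexp (a * ip p x z + b * ip p y z)) =
     complex_of_real (bessel_series p (- ((a\<^sup>2 + b\<^sup>2 + 2 * a * b * ip p x y) / (2 * real p))))"
proof -
  define w where "w = vec_comb p a (svec p x) b (svec p y)"
  have w [measurable]: "w \<in> space (rvec p)" by (simp add: w_def)
  have n: "(norm2 p w)\<^sup>2 = a\<^sup>2 + b\<^sup>2 + 2 * a * b * ip p x y"
    by (simp add: w_def norm2_vec_comb dot_self_sphere svec_sphere[OF p] ip_def)
  have "(LINT z|\<mu> p. iexp (a * ip p x z + b * ip p y z)) = (LINT z|\<mu> p. iexp (dot p (svec p z) w))"
    by (simp add: w_def dot_vec_comb_right ip_flip)
  also have "... = (LINT z|\<mu> p. iexp (dot p z w))" by (rule integral_svec[OF p]) measurable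
  also have "... = (LINT t|slaw p. iexp (norm2 p w * t))" by (rule integral_dot[OF p w]) measurable
  also have "... = complex_of_real (bessel_series p (- ((norm2 p w)\<^sup>2 / (2 * real p))))" by (rule slaw_char[OF p])
  finally show ?thesis by (simp add: n)
qed

lemma integral_ip_linear:
  assumes p: "p > 0" and [measurable]: "f \<in> borel_measurable borel" and f: "\<And>t. \<bar>t\<bar> \<le> 1 \<Longrightarrow> \<bar>f t\<bar> \<le> C"
  shows "(LINT z|\<mu> p. f (ip p x z) * ip p y z) = ip p x y * (LINT t|slaw p. f t * t)"
proof -
  note [measurable] = svec_space
  have "(LINT z|\<mu> p. f (ip p x z) * ip p y z) = (LINT z|\<mu> p. f (dot p (svec p z) (svec p x)) * dot p (svec p z) (svec p y))"
    by (simp only: ip_flip)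
  also have "... = (LINT z|\<mu> p. f (dot p z (svec p x)) * dot p z (svec p y))" by (rule integral_svec[OF p]) measurable
  also have "... = ip p x y * (LINT t|slaw p. f t * t)"
    unfolding ip_def[of p x y] by (rule integral_dot_linear[OF svec_sphere[OF p] svec_space _ f]) auto
  finally show ?thesis .
qed

lemma zonal_homogeneous_kernel:
  assumes p: "p > 0" and k [measurable]: "k \<in> borel_measurable borel" and C: "\<And>t. \<bar>t\<bar> \<le> 1 \<Longrightarrow> \<bar>k t\<bar> \<le> C"
    and 0: "(LINT t|slaw p. k t) = 0" and K: "(LINT t|slaw p. (k t)^4) \<le> K"
  shows "homogeneous_kernel (\<mu> p) (\<lambda>x y. k (ip p x y)) C (LINT t|slaw p. (k t)\<^sup>2) K"
proof -
  show ?thesis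
  proof
    show "(\<lambda>(x, y). k (ip p x y)) \<in> borel_measurable (\<mu>2 p)" by measurable
    show "\<bar>k (ip p x y)\<bar> \<le> C" for x y by (rule C[OF abs_ip_le[OF p]])
    show "k (ip p x y) = k (ip p y x)" for x y by (simp add: ip_commute)
    show "(LINT y|\<mu> p. k (ip p x y)) = 0" for x using integral_ip[OF p k, of x] 0 by simp
    show "(LINT y|\<mu> p. (k (ip p x y))\<^sup>2) = (LINT t|slaw p. (k t)\<^sup>2)" for x
      by (rule integral_ip[OF p, of "\<lambda>t. (k t)\<^sup>2"]) measurable
    show "(LINT y|\<mu> p. (k (ip p x y))^4) \<le> K" for x using integral_ip[OF p, of "\<lambda>t. (k t)^4" x] K by simp
  qed
qed

text \<open>The squared Hilbert-Schmidt norm of the composition of the operators with kernels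
  \<open>k (ip p x z)\<close> and \<open>l (ip p y z)\<close>.\<close>

definition cyc :: "nat \<Rightarrow> (real \<Rightarrow> real) \<Rightarrow> (real \<Rightarrow> real) \<Rightarrow> real" where
  "cyc p k l = (LINT y|\<mu> p. LINT x|\<mu> p. (LINT z|\<mu> p. k (ip p x z) * l (ip p y z))\<^sup>2)"

section \<open>Four-cycles of inner products\<close>

lemma pair_integral_mult:
  fixes f g :: "_ \<Rightarrow> 'b::{banach,second_countable_topology,real_normed_field}"
  assumes "prob_space M" "prob_space N" "f \<in> borel_measurable M" "g \<in> borel_measurable N"
    and "\<And>x. x \<in> space M \<Longrightarrow> norm (f x) \<le> C" "\<And>x. x \<in> space N \<Longrightarrow> norm (g x) \<le> D"
  shows "(LINT z|(M \<Otimes>\<^sub>M N). f (fst z) * g (snd z)) = (LINT x|M. f x) * (LINT y|N. g y)"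
proof -
  interpret M: prob_space M by fact
  interpret N: prob_space N by fact
  interpret P: pair_prob_space M N ..
  note [measurable] = assms(3,4)
  have "norm (f (fst z) * g (snd z)) \<le> \<bar>C\<bar> * \<bar>D\<bar>" if "z \<in> space (M \<Otimes>\<^sub>M N)" for z
    unfolding norm_mult using that assms(5)[of "fst z"] assms(6)[of "snd z"]
    by (intro mult_mono) (auto simp: space_pair_measure intro: order_trans[OF _ abs_ge_self])
  then have I: "integrable (M \<Otimes>\<^sub>M N) (\<lambda>z. f (fst z) * g (snd z))" by (intro P.P.integrable_bounded) auto
  show ?thesis using P.integral_fst'[OF I] by simp
qed

text \<open>Given the pair \<open>w\<close>, the two remaining points are independent, so the inner
  integral factors.\<close>

lemma integral_pair_pair:
  fixes F G :: "'a \<times> 'a \<Rightarrow> 'a \<Rightarrow> 'b::{banach,second_countable_topology,real_normed_field}"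
  assumes M: "prob_space M"
    and F: "case_prod F \<in> borel_measurable ((M \<Otimes>\<^sub>M M) \<Otimes>\<^sub>M M)" "\<And>w z. norm (F w z) \<le> 1"
    and G: "case_prod G \<in> borel_measurable ((M \<Otimes>\<^sub>M M) \<Otimes>\<^sub>M M)" "\<And>w z. norm (G w z) \<le> 1"
  shows "(LINT \<omega>|((M \<Otimes>\<^sub>M M) \<Otimes>\<^sub>M (M \<Otimes>\<^sub>M M)). F (fst \<omega>) (fst (snd \<omega>)) * G (fst \<omega>) (snd (snd \<omega>)))
    = (LINT w|(M \<Otimes>\<^sub>M M). (LINT z|M. F w z) * (LINT z|M. G w z))"
proof -
  interpret M: prob_space M by (rule M)
  interpret PM: pair_prob_space M M ..
  interpret PP: pair_prob_space "M \<Otimes>\<^sub>M M" "M \<Otimes>\<^sub>M M" ..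
  have "(\<lambda>\<omega>. case_prod F (fst \<omega>, fst (snd \<omega>)) * case_prod G (fst \<omega>, snd (snd \<omega>))) \<in> borel_measurable ((M \<Otimes>\<^sub>M M) \<Otimes>\<^sub>M (M \<Otimes>\<^sub>M M))"
    by (intro borel_measurable_times measurable_compose[OF _ F(1)] measurable_compose[OF _ G(1)]) measurable
  then have I: "integrable ((M \<Otimes>\<^sub>M M) \<Otimes>\<^sub>M (M \<Otimes>\<^sub>M M)) (\<lambda>\<omega>. F (fst \<omega>) (fst (snd \<omega>)) * G (fst \<omega>) (snd (snd \<omega>)))"
    using F(2) G(2) by (intro PP.P.integrable_bounded[where C=1]) (auto simp: norm_mult intro!: mult_le_one)
  have "(LINT w'|(M \<Otimes>\<^sub>M M). F w (fst w') * G w (snd w')) = (LINT z|M. F w z) * (LINT z|M. G w z)" if w: "w \<in> space (M \<Otimes>\<^sub>M M)" for w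
    using F(2) G(2) measurable_compose[OF measurable_Pair1'[OF w] F(1)] measurable_compose[OF measurable_Pair1'[OF w] G(1)]
    by (intro pair_integral_mult[where C=1 and D=1] M) auto
  then show ?thesis using PP.integral_fst'[OF I] by (simp cong: lint_cong)
qed

lemma (in prob_space) iterated_integral:
  fixes f :: "'a \<Rightarrow> 'a \<Rightarrow> real"
  assumes "integrable (M \<Otimes>\<^sub>M M) (\<lambda>w. f (fst w) (snd w))"
  shows "(LINT y|M. LINT x|M. f x y) = (LINT w|(M \<Otimes>\<^sub>M M). f (fst w) (snd w))"
proof -
  interpret P: pair_prob_space M M ..
  show ?thesis using P.integral_snd[of f] assms by (simp add: case_prod_beta')
qed

text \<open>Here \<open>v\<close> stands for the inner product of two points of the sphere;
  \<open>\<bar>v\<bar> \<le> 1\<close> keeps the argument of the series between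
  \<open>- (a^2 + b^2)\<close> and 0. The first error term replaces the series by the exponential,
  the second drops the mixed term.\<close>

lemma bessel_series_correlated:
  assumes p: "p > 0" and v: "\<bar>v\<bar> \<le> 1"
  shows "\<bar>bessel_series p (- ((a\<^sup>2 + b\<^sup>2 + 2 * a * b * v) / 2)) - exp (- ((a\<^sup>2 + b\<^sup>2) / 2))\<bar> \<le>
     (a\<^sup>2 + b\<^sup>2)\<^sup>2 * exp (a\<^sup>2 + b\<^sup>2) / real p + \<bar>a * b\<bar> * \<bar>v\<bar>"
    and "\<bar>bessel_series p (- ((a\<^sup>2 + b\<^sup>2 + 2 * a * b * v) / 2))\<bar> \<le> 1"
proof -
  define q where "q = (a\<^sup>2 + b\<^sup>2 + 2 * a * b * v) / 2"
  have ab: "2 * \<bar>a * b\<bar> \<le> a\<^sup>2 + b\<^sup>2"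
    using zero_le_power2[of "\<bar>a\<bar> - \<bar>b\<bar>"] by (simp add: power2_diff abs_mult)
  have "\<bar>a * b * v\<bar> \<le> \<bar>a * b\<bar>" unfolding abs_mult[of "a * b"] using v by (simp add: mult_left_le)
  then have "- \<bar>a * b\<bar> \<le> a * b * v" "a * b * v \<le> \<bar>a * b\<bar>" by linarith+
  moreover have "- s \<le> t \<Longrightarrow> t \<le> s \<Longrightarrow> 2 * s \<le> u \<Longrightarrow> 0 \<le> (u + 2 * t) / 2 \<and> (u + 2 * t) / 2 \<le> u" for s t u :: real
    by simp
  ultimately have "0 \<le> (a\<^sup>2 + b\<^sup>2 + 2 * (a * b * v)) / 2 \<and> (a\<^sup>2 + b\<^sup>2 + 2 * (a * b * v)) / 2 \<le> a\<^sup>2 + b\<^sup>2"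
    using ab by blast
  then have q: "0 \<le> q" "q \<le> a\<^sup>2 + b\<^sup>2" unfolding q_def by (simp_all only: mult.assoc)
  show "\<bar>bessel_series p (- ((a\<^sup>2 + b\<^sup>2 + 2 * a * b * v) / 2))\<bar> \<le> 1"
    using abs_bessel_series_le_1[OF p q(1)] by (simp add: q_def)
  have "\<bar>bessel_series p (- q) - exp (- q)\<bar> \<le> (- q)\<^sup>2 * exp \<bar>- q\<bar> / real p" by (rule bessel_series_minus_exp)
  also have "... \<le> (a\<^sup>2 + b\<^sup>2)\<^sup>2 * exp (a\<^sup>2 + b\<^sup>2) / real p"
    using q by (intro divide_right_mono mult_mono) (auto intro!: power_mono)
  finally have 1: "\<bar>bessel_series p (- q) - exp (- q)\<bar> \<le> (a\<^sup>2 + b\<^sup>2)\<^sup>2 * exp (a\<^sup>2 + b\<^sup>2) / real p" .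
  have 2: "\<bar>exp (- q) - exp (- ((a\<^sup>2 + b\<^sup>2) / 2))\<bar> \<le> \<bar>q - (a\<^sup>2 + b\<^sup>2) / 2\<bar>"
    using q by (intro exp_minus_lipschitz) auto
  have 3: "\<bar>q - (a\<^sup>2 + b\<^sup>2) / 2\<bar> = \<bar>a * b\<bar> * \<bar>v\<bar>" by (simp add: q_def add_divide_distrib abs_mult)
  from 1 2 show "\<bar>bessel_series p (- ((a\<^sup>2 + b\<^sup>2 + 2 * a * b * v) / 2)) - exp (- ((a\<^sup>2 + b\<^sup>2) / 2))\<bar> \<le>
     (a\<^sup>2 + b\<^sup>2)\<^sup>2 * exp (a\<^sup>2 + b\<^sup>2) / real p + \<bar>a * b\<bar> * \<bar>v\<bar>"
    unfolding 3 q_def[symmetric] by linarith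
qed

lemma slaw_abs_mean: "p > 0 \<Longrightarrow> (LINT t|slaw p. \<bar>t\<bar>) \<le> 1 / sqrt p"
proof -
  assume p: "p > 0"
  have I: "integrable (slaw p) (\<lambda>t. \<bar>t\<bar>)" using integrable_slaw_power[OF p, of 1] by simp
  have "(LINT t|slaw p. \<bar>t\<bar>)\<^sup>2 \<le> (LINT t|slaw p. \<bar>t\<bar>\<^sup>2)"
    using S.variance_positive[of p "\<lambda>t. \<bar>t\<bar>"] S.variance_eq[OF I] integrable_slaw_power[OF p, of 2] by simp
  also have "... = 1 / real p" using smom_2[OF p] by (simp add: smom_def)
  finally have "(LINT t|slaw p. \<bar>t\<bar>)\<^sup>2 \<le> (1 / sqrt p)\<^sup>2" using p by (simp add: power_divide)
  then show ?thesis by (rule power2_le_imp_le) simp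
qed

text \<open>With \<omega> = ((x, y), (z, z')), the edges 0 to 3 of the cycle x z y z' are xz, yz,
  xz', yz'.\<close>

definition cycle_edge :: "nat \<Rightarrow> nat \<Rightarrow> (rseq \<times> rseq) \<times> (rseq \<times> rseq) \<Rightarrow> real" where
  "cycle_edge p k \<omega> = sqrt p * ip p ((if k = 0 \<or> k = 2 then fst else snd) (fst \<omega>)) ((if k < 2 then fst else snd) (snd \<omega>))"

lemma measurable_cycle_edge [measurable]:
  "cycle_edge p k \<in> borel_measurable ((\<mu>2 p) \<Otimes>\<^sub>M (\<mu>2 p))"
  unfolding cycle_edge_def by (cases "k = 0 \<or> k = 2"; cases "k < 2"; simp) measurable

text \<open>Given x and y the halves through z and z' are independent, and each depends on x and y
  only through \<open>ip p x y\<close>. The mean absolute value of the latter is at most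
  \<open>1 / sqrt p\<close>, so in the limit the four edges are independent standard normal
  variables.\<close>

lemma four_cycle_char:
  fixes a :: rseq
  shows "(\<lambda>p. LINT \<omega>|((\<mu>2 p) \<Otimes>\<^sub>M (\<mu>2 p)). iexp (\<Sum>k<4. a k * cycle_edge p k \<omega>))
     \<longlonglongrightarrow> complex_of_real (exp (- (((a 0)\<^sup>2 + (a 1)\<^sup>2) / 2)) * exp (- (((a 2)\<^sup>2 + (a 3)\<^sup>2) / 2)))"
proof -
  let ?Z = cycle_edge
  define l where "l u v = exp (- ((u\<^sup>2 + v\<^sup>2) / 2))" for u v :: real
  define e where "e u v p = (u\<^sup>2 + v\<^sup>2)\<^sup>2 * exp (u\<^sup>2 + v\<^sup>2) / real p" for u v :: real and p :: nat
  define err where "err p = e (a 0) (a 1) p + e (a 2) (a 3) p + (\<bar>a 0 * a 1\<bar> + \<bar>a 2 * a 3\<bar>) * (1 / sqrt p)" for p :: nat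
  let ?\<Omega> = "\<lambda>p. (\<mu>2 p) \<Otimes>\<^sub>M (\<mu>2 p)"
  have bound: "cmod ((LINT \<omega>|?\<Omega> p. iexp (\<Sum>k<4. a k * ?Z p k \<omega>)) - complex_of_real (l (a 0) (a 1) * l (a 2) (a 3))) \<le> err p"
    if p: "p > 0" for p
  proof -
    interpret PU: pair_prob_space "\<mu> p" "\<mu> p" ..
    let ?s = "sqrt p"
    define B where "B u v x y = bessel_series p (- ((u\<^sup>2 + v\<^sup>2 + 2 * u * v * ip p x y) / 2))" for u v x y
    have inner: "(LINT z|\<mu> p. iexp (?s * u * ip p x z + ?s * v * ip p y z)) = complex_of_real (B u v x y)" for u v x y
    proof -
      have "((?s * u)\<^sup>2 + (?s * v)\<^sup>2 + 2 * (?s * u) * (?s * v) * ip p x y) / (2 * real p) = (u\<^sup>2 + v\<^sup>2 + 2 * u * v * ip p x y) / 2"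
        using p by (simp add: power_mult_distrib power2_eq_square field_simps)
      then show ?thesis unfolding integral_ip_char[OF p] B_def by (simp only:)
    qed
    have Bm: "(\<lambda>z. B u v (fst z) (snd z)) \<in> borel_measurable (\<mu>2 p)" for u v
    proof -
      have "(\<lambda>z. Re (complex_of_real (B u v (fst z) (snd z)))) \<in> borel_measurable (\<mu>2 p)" unfolding inner[symmetric] by measurable
      then show ?thesis by simp
    qed
    have B1: "\<bar>B u v x y\<bar> \<le> 1" for u v x y unfolding B_def by (rule bessel_series_correlated(2)[OF p abs_ip_le[OF p]])
    have Bl: "\<bar>B u v x y - l u v\<bar> \<le> e u v p + \<bar>u * v\<bar> * \<bar>ip p x y\<bar>" for u v x y
      unfolding B_def l_def e_def by (rule bessel_series_correlated(1)[OF p abs_ip_le[OF p]])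
    have l1: "0 \<le> l u v" "l u v \<le> 1" for u v by (auto simp: l_def)
    let ?F = "\<lambda>u v w z. iexp (?s * u * ip p (fst w) z + ?s * v * ip p (snd w) z)"
    have "(LINT \<omega>|?\<Omega> p. iexp (\<Sum>k<4. a k * ?Z p k \<omega>)) =
        (LINT \<omega>|?\<Omega> p. ?F (a 0) (a 1) (fst \<omega>) (fst (snd \<omega>)) * ?F (a 2) (a 3) (fst \<omega>) (snd (snd \<omega>)))"
    proof (intro lint_cong refl)
      fix \<omega>
      have "(\<Sum>k<4. a k * ?Z p k \<omega>) = (?s * a 0 * ip p (fst (fst \<omega>)) (fst (snd \<omega>)) + ?s * a 1 * ip p (snd (fst \<omega>)) (fst (snd \<omega>)))
          + (?s * a 2 * ip p (fst (fst \<omega>)) (snd (snd \<omega>)) + ?s * a 3 * ip p (snd (fst \<omega>)) (snd (snd \<omega>)))"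
        by (simp add: cycle_edge_def lessThan_Suc eval_nat_numeral One_nat_def)
      then show "iexp (\<Sum>k<4. a k * ?Z p k \<omega>) = ?F (a 0) (a 1) (fst \<omega>) (fst (snd \<omega>)) * ?F (a 2) (a 3) (fst \<omega>) (snd (snd \<omega>))"
        unfolding exp_add[symmetric] distrib_left[symmetric] of_real_add[symmetric] by (simp only:)
    qed
    also have "... = (LINT w|\<mu>2 p. (LINT z|\<mu> p. ?F (a 0) (a 1) w z) * (LINT z|\<mu> p. ?F (a 2) (a 3) w z))"
      by (rule integral_pair_pair[OF prob_space_unif_sphere]) (auto simp: case_prod_beta')
    finally have eq: "(LINT \<omega>|?\<Omega> p. iexp (\<Sum>k<4. a k * ?Z p k \<omega>)) =
       complex_of_real (LINT w|\<mu>2 p. B (a 0) (a 1) (fst w) (snd w) * B (a 2) (a 3) (fst w) (snd w))"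
      unfolding inner by (simp only: integral_complex_of_real of_real_mult[symmetric])
    let ?BB = "\<lambda>w. B (a 0) (a 1) (fst w) (snd w) * B (a 2) (a 3) (fst w) (snd w)"
    let ?ll = "l (a 0) (a 1) * l (a 2) (a 3)"
    let ?E = "\<lambda>w. e (a 0) (a 1) p + e (a 2) (a 3) p + (\<bar>a 0 * a 1\<bar> + \<bar>a 2 * a 3\<bar>) * \<bar>ip p (fst w) (snd w)\<bar>"
    have BB1: "\<bar>?BB w\<bar> \<le> 1" for w unfolding abs_mult using B1 by (intro mult_le_one) auto
    have IB: "integrable (\<mu>2 p) ?BB" using Bm BB1 by (intro PU.P.integrable_bounded[of _ 1]) auto
    have Iip: "integrable (\<mu>2 p) (\<lambda>w. \<bar>ip p (fst w) (snd w)\<bar>)"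
      using abs_ip_le[OF p] by (intro PU.P.integrable_bounded[of _ 1]) auto
    have pw: "\<bar>?BB w - ?ll\<bar> \<le> ?E w" for w
    proof -
      have *: "\<bar>b * b' - m * m'\<bar> \<le> \<bar>b - m\<bar> + \<bar>b' - m'\<bar>" if "\<bar>b'\<bar> \<le> 1" "0 \<le> m" "m \<le> 1" for b b' m m' :: real
      proof -
        have "b * b' - m * m' = (b - m) * b' + m * (b' - m')" by (simp add: algebra_simps)
        also have "\<bar>...\<bar> \<le> \<bar>(b - m) * b'\<bar> + \<bar>m * (b' - m')\<bar>" by (rule abs_triangle_ineq)
        also have "... \<le> \<bar>b - m\<bar> + \<bar>b' - m'\<bar>"
          unfolding abs_mult using that by (intro add_mono mult_left_le mult_left_le_one_le) auto
        finally show ?thesis .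
      qed
      have "\<bar>?BB w - ?ll\<bar> \<le> \<bar>B (a 0) (a 1) (fst w) (snd w) - l (a 0) (a 1)\<bar> + \<bar>B (a 2) (a 3) (fst w) (snd w) - l (a 2) (a 3)\<bar>"
        by (rule *[OF B1 l1])
      also have "... \<le> (e (a 0) (a 1) p + \<bar>a 0 * a 1\<bar> * \<bar>ip p (fst w) (snd w)\<bar>) + (e (a 2) (a 3) p + \<bar>a 2 * a 3\<bar> * \<bar>ip p (fst w) (snd w)\<bar>)"
        by (intro add_mono Bl)
      finally show ?thesis by (simp add: algebra_simps)
    qed
    have "(LINT w|\<mu>2 p. \<bar>ip p (fst w) (snd w)\<bar>) = (LINT x|\<mu> p. LINT y|\<mu> p. \<bar>ip p x y\<bar>)"
      using PU.integral_fst'[OF Iip] by simp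
    also have "... = (LINT x|\<mu> p. (LINT t|slaw p. \<bar>t\<bar>))" by (intro lint_cong integral_ip[OF p]) auto
    also have "... \<le> 1 / sqrt p" using slaw_abs_mean[OF p] U.prob_space by simp
    finally have ipm: "(LINT w|\<mu>2 p. \<bar>ip p (fst w) (snd w)\<bar>) \<le> 1 / sqrt p" .
    have "cmod ((LINT \<omega>|?\<Omega> p. iexp (\<Sum>k<4. a k * ?Z p k \<omega>)) - complex_of_real ?ll) = \<bar>(LINT w|\<mu>2 p. ?BB w) - ?ll\<bar>"
      unfolding eq of_real_diff[symmetric] norm_of_real ..
    also have "... = \<bar>LINT w|\<mu>2 p. ?BB w - ?ll\<bar>" using IB by (simp add: PU.P.prob_space)
    also have "... \<le> (LINT w|\<mu>2 p. \<bar>?BB w - ?ll\<bar>)" by (rule integral_abs_bound)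
    also have "... \<le> (LINT w|\<mu>2 p. ?E w)" using IB Iip pw by (intro integral_mono) auto
    also have "... = e (a 0) (a 1) p + e (a 2) (a 3) p + (\<bar>a 0 * a 1\<bar> + \<bar>a 2 * a 3\<bar>) * (LINT w|\<mu>2 p. \<bar>ip p (fst w) (snd w)\<bar>)"
      using Iip by (simp add: PU.P.prob_space)
    also have "... \<le> err p" unfolding err_def using ipm by (intro add_left_mono mult_left_mono) auto
    finally show ?thesis .
  qed
  have "err \<longlonglongrightarrow> 0"
  proof -
    have "(\<lambda>p. e u v p) \<longlonglongrightarrow> 0" for u v unfolding e_def by (rule lim_const_over_n)
    moreover have "(\<lambda>p. 1 / sqrt p) \<longlonglongrightarrow> 0" by real_asymp
    ultimately have "err \<longlonglongrightarrow> 0 + 0 + (\<bar>a 0 * a 1\<bar> + \<bar>a 2 * a 3\<bar>) * 0"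
      unfolding err_def by (intro tendsto_add tendsto_mult tendsto_const)
    then show ?thesis by simp
  qed
  moreover have "\<forall>\<^sub>F p in sequentially. norm ((LINT \<omega>|?\<Omega> p. iexp (\<Sum>k<4. a k * ?Z p k \<omega>)) - complex_of_real (l (a 0) (a 1) * l (a 2) (a 3))) \<le> err p"
    using eventually_gt_at_top[of 0] by eventually_elim (rule bound)
  ultimately have "(\<lambda>p. (LINT \<omega>|?\<Omega> p. iexp (\<Sum>k<4. a k * ?Z p k \<omega>)) - complex_of_real (l (a 0) (a 1) * l (a 2) (a 3))) \<longlonglongrightarrow> 0"
    by (rule Lim_null_comparison[rotated])
  then show ?thesis unfolding l_def by (rule LIM_zero_cancel)
qed

lemma AE_std_normal_neq: "AE x in \<N>. x \<noteq> a" using std_normal_no_atom[of a] by (intro AE_I[where N="{a}"]) auto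

lemma measurable_zonal_product [measurable]:
  fixes k l :: "real \<Rightarrow> real"
  assumes [measurable]: "k \<in> borel_measurable borel" "l \<in> borel_measurable borel"
  shows "(\<lambda>w. LINT z|\<mu> p. k (ip p (fst w) z) * l (ip p (snd w) z)) \<in> borel_measurable (\<mu>2 p)"
proof -
  have 1: "(\<lambda>w. ip p (fst (fst w)) (snd w)) \<in> borel_measurable ((\<mu>2 p) \<Otimes>\<^sub>M \<mu> p)"
    "(\<lambda>w. ip p (snd (fst w)) (snd w)) \<in> borel_measurable ((\<mu>2 p) \<Otimes>\<^sub>M \<mu> p)" by measurable
  have "(\<lambda>(w, z). k (ip p (fst w) z) * l (ip p (snd w) z)) \<in> borel_measurable ((\<mu>2 p) \<Otimes>\<^sub>M \<mu> p)"
    unfolding case_prod_beta' using measurable_compose[OF 1(1) assms(1)] measurable_compose[OF 1(2) assms(2)] by (rule borel_measurable_times)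
  then show ?thesis by (rule U.borel_measurable_lebesgue_integral)
qed

text \<open>Writing the square with a second copy z' of z gives the probability of an event about
  the four edges of a cycle, which factors in the limit.\<close>

lemma four_cycle_tendsto:
  "(\<lambda>p. LINT y|\<mu> p. LINT x|\<mu> p. (LINT z|\<mu> p. hs p \<alpha> (ip p x z) * hs p \<beta> (ip p y z))\<^sup>2)
    \<longlonglongrightarrow> (std_normal_cdf \<alpha> * std_normal_cdf \<beta>)\<^sup>2"
proof -
  define \<theta> where "\<theta> k = (if k = 0 \<or> k = 2 then \<alpha> else \<beta>)" for k :: nat
  let ?\<Omega> = "\<lambda>p. (\<mu>2 p) \<Otimes>\<^sub>M (\<mu>2 p)"
  let ?P = "PiM {..<4::nat} (\<lambda>_. \<N>)"
  interpret PN: product_prob_space "\<lambda>_::nat. \<N>" "{..<4}" by unfold_locales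
  have PPax: "prob_space ?P" by (intro prob_space_PiM N.prob_space_axioms)
  have ps: "prob_space (?\<Omega> p)" for p
  proof -
    interpret PU: pair_prob_space "\<mu> p" "\<mu> p" ..
    interpret PP: pair_prob_space "\<mu>2 p" "\<mu>2 p" ..
    show ?thesis by (rule PP.P.prob_space_axioms)
  qed
  have "(\<lambda>p. LINT \<omega>|?\<Omega> p. (\<Prod>k<4. indicat_real {..\<theta> k} (cycle_edge p k \<omega>))) \<longlonglongrightarrow> (LINT \<omega>|?P. (\<Prod>k<4. indicat_real {..\<theta> k} (\<omega> k)))"
  proof (rule joint_iexp_imp_prod[OF ps PPax, where m=4 and Z=cycle_edge and Z'="\<lambda>k \<omega>. \<omega> k" and f="\<lambda>k. indicat_real {..\<theta> k}"])
    show "(\<lambda>\<omega>. \<omega> k) \<in> borel_measurable ?P" if "k < 4" for k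
      using that by (auto intro: measurable_component_singleton[of k "{..<4}" "\<lambda>_. \<N>", simplified])
    fix a :: rseq
    have "(LINT \<omega>|?P. iexp (\<Sum>k<4. a k * \<omega> k)) = (LINT \<omega>|?P. (\<Prod>k<4. iexp (a k * \<omega> k)))"
      by (simp add: sum_distrib_left exp_sum)
    also have "... = (\<Prod>k<4. LINT x|\<N>. iexp (a k * x))" by (rule PN.product_integral_prod) (auto intro!: N.integrable_iexp)
    also have "... = (\<Prod>k<4. complex_of_real (exp (- ((a k)\<^sup>2 / 2))))"
      using char_std_normal_distribution by (simp add: char_def fun_eq_iff)
    also have "... = complex_of_real (exp (- (((a 0)\<^sup>2 + (a 1)\<^sup>2) / 2)) * exp (- (((a 2)\<^sup>2 + (a 3)\<^sup>2) / 2)))"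
      by (simp add: eval_nat_numeral One_nat_def lessThan_Suc exp_add[symmetric] exp_of_real[symmetric] add_divide_distrib algebra_simps)
    finally show "(\<lambda>p. LINT \<omega>|?\<Omega> p. iexp (\<Sum>k<4. a k * cycle_edge p k \<omega>)) \<longlonglongrightarrow> (LINT \<omega>|?P. iexp (\<Sum>k<4. a k * \<omega> k))"
      using four_cycle_char[of a] by simp
  next
    fix k :: nat assume k: "k < 4"
    have "AE \<omega> in ?P. \<omega> k \<noteq> \<theta> k"
      using k AE_std_normal_neq[of "\<theta> k"] by (intro AE_PiM_component N.prob_space_axioms) auto
    then show "AE \<omega> in ?P. isCont (indicat_real {..\<theta> k}) (\<omega> k)" by eventually_elim (auto simp: isCont_indicator)
  qed (auto simp: indicator_def)
  moreover have "(LINT \<omega>|?P. (\<Prod>k<4. indicat_real {..\<theta> k} (\<omega> k))) = (std_normal_cdf \<alpha> * std_normal_cdf \<beta>)\<^sup>2"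
  proof -
    have "(LINT \<omega>|?P. (\<Prod>k<4. indicat_real {..\<theta> k} (\<omega> k))) = (\<Prod>k<4. LINT x|\<N>. indicat_real {..\<theta> k} x)"
      by (rule PN.product_integral_prod) (auto simp: N.emeasure_eq_measure)
    also have "... = (\<Prod>k<4. std_normal_cdf (\<theta> k))" by (simp add: std_normal_cdf_def cdf_def)
    finally show ?thesis by (simp add: \<theta>_def eval_nat_numeral One_nat_def lessThan_Suc power2_eq_square)
  qed
  moreover have "(LINT \<omega>|?\<Omega> p. (\<Prod>k<4. indicat_real {..\<theta> k} (cycle_edge p k \<omega>))) =
    (LINT y|\<mu> p. LINT x|\<mu> p. (LINT z|\<mu> p. hs p \<alpha> (ip p x z) * hs p \<beta> (ip p y z))\<^sup>2)" for p
  proof -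
    interpret PU: pair_prob_space "\<mu> p" "\<mu> p" ..
    let ?f = "\<lambda>x y z. hs p \<alpha> (ip p x z) * hs p \<beta> (ip p y z)"
    let ?g = "\<lambda>w. ?f (fst w) (snd w)"
    have f1: "\<bar>?f x y z\<bar> \<le> 1" for x y z by (simp add: indicator_def)
    have "(\<Prod>k<4. indicat_real {..\<theta> k} (cycle_edge p k \<omega>)) = ?g (fst \<omega>) (fst (snd \<omega>)) * ?g (fst \<omega>) (snd (snd \<omega>))" for \<omega>
      by (simp add: \<theta>_def cycle_edge_def eval_nat_numeral One_nat_def lessThan_Suc)
    then have "(LINT \<omega>|?\<Omega> p. (\<Prod>k<4. indicat_real {..\<theta> k} (cycle_edge p k \<omega>))) = (LINT \<omega>|?\<Omega> p. ?g (fst \<omega>) (fst (snd \<omega>)) * ?g (fst \<omega>) (snd (snd \<omega>)))"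
      by (simp only:)
    also have "... = (LINT w|\<mu>2 p. (LINT z|\<mu> p. ?g w z) * (LINT z|\<mu> p. ?g w z))"
      by (rule integral_pair_pair[OF prob_space_unif_sphere]) (use f1 in \<open>auto simp: case_prod_beta'\<close>)
    also have "... = (LINT w|\<mu>2 p. (LINT z|\<mu> p. ?g w z)\<^sup>2)" by (simp only: power2_eq_square)
    also have "... = (LINT y|\<mu> p. LINT x|\<mu> p. (LINT z|\<mu> p. ?f x y z)\<^sup>2)"
    proof (rule U.iterated_integral[symmetric])
      have m: "(\<lambda>w. LINT z|\<mu> p. ?g w z) \<in> borel_measurable (\<mu>2 p)"
        by (rule measurable_zonal_product[of "\<lambda>t. hs p \<alpha> t" "\<lambda>t. hs p \<beta> t"]) measurable
      have b: "\<bar>LINT z|\<mu> p. ?g w z\<bar> \<le> 1" if w: "w \<in> space (\<mu>2 p)" for w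
      proof -
        have [measurable]: "fst w \<in> space (rvec p)" "snd w \<in> space (rvec p)" using w by (auto simp: space_pair_measure)
        show ?thesis unfolding real_norm_def[symmetric] using f1 by (intro U.norm_integral_le_const) auto
      qed
      show "integrable (\<mu>2 p) (\<lambda>w. (LINT z|\<mu> p. ?g w z)\<^sup>2)"
        using m b by (intro PU.P.integrable_bounded[of _ 1]) (auto simp: abs_square_le_1)
    qed
    finally show ?thesis .
  qed
  ultimately show ?thesis by simp
qed

section \<open>Centred indicators and their cycle norms\<close>

definition icdf :: "nat \<Rightarrow> real \<Rightarrow> real" where
  "icdf p \<alpha> = measure (slaw p) {t. sqrt p * t \<le> \<alpha>}"

definition ik :: "nat \<Rightarrow> real \<Rightarrow> real \<Rightarrow> real" where
  "ik p \<alpha> t = hs p \<alpha> t - icdf p \<alpha>"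

lemma measurable_ik [measurable]: "ik p \<alpha> \<in> borel_measurable borel" unfolding ik_def by measurable

lemma icdf_01: "0 \<le> icdf p \<alpha>" "icdf p \<alpha> \<le> 1" unfolding icdf_def using prob_space.prob_le_1[OF prob_space_slaw] by auto

lemma abs_ik_le: "\<bar>ik p \<alpha> t\<bar> \<le> 1" using icdf_01[of p \<alpha>] by (auto simp: ik_def indicator_def)

lemma integral_indicator_icdf: "(LINT t|slaw p. hs p \<alpha> t) = icdf p \<alpha>"
proof -
  have "(LINT t|slaw p. hs p \<alpha> t) = (LINT t|slaw p. indicator {t. sqrt p * t \<le> \<alpha>} t)"
    by (intro lint_cong) (auto simp: indicator_def)
  then show ?thesis by (simp add: icdf_def)
qed

lemma integrable_indicator_icdf: "integrable (slaw p) (\<lambda>t. hs p \<alpha> t)"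
  by (rule prob_space.integrable_bounded[OF prob_space_slaw, where C=1]) (auto simp: indicator_def)

lemma integral_ik: "(LINT t|slaw p. ik p \<alpha> t) = 0"
proof -
  show ?thesis
  unfolding ik_def using integrable_indicator_icdf[where p=p and \<alpha>=\<alpha>] integral_indicator_icdf[where p=p and \<alpha>=\<alpha>] S.prob_space
  by simp
qed

lemma integral_ik_ik: "(LINT t|slaw p. ik p \<alpha> t * ik p \<beta> t) = icdf p (min \<alpha> \<beta>) - icdf p \<alpha> * icdf p \<beta>"
proof -
  have "ik p \<alpha> t * ik p \<beta> t = indicat_real {..min \<alpha> \<beta>} (sqrt p * t) - icdf p \<beta> * hs p \<alpha> t
      - icdf p \<alpha> * hs p \<beta> t + icdf p \<alpha> * icdf p \<beta>" for t by (auto simp: ik_def indicator_def algebra_simps)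
  then show ?thesis using integrable_indicator_icdf[where p=p] S.prob_space by (simp add: integral_indicator_icdf)
qed

lemma icdf_tendsto: "(\<lambda>p. icdf p \<alpha>) \<longlonglongrightarrow> std_normal_cdf \<alpha>" unfolding icdf_def by (rule slaw_cdf_tendsto)

text \<open>Centring changes the inner integral by the constant \<open>c\<close>, which is also its
  mean over \<open>x\<close>. The second moment therefore drops by exactly \<open>c^2\<close>, and
  this has the same limit as the four-cycle expectation.\<close>

lemma cyc_ik_tendsto: "(\<lambda>p. cyc p (ik p \<alpha>) (ik p \<beta>)) \<longlonglongrightarrow> 0"
proof -
  let ?f = "\<lambda>p x y z. hs p \<alpha> (ip p x z) * hs p \<beta> (ip p y z)"
  let ?I2 = "\<lambda>p. LINT y|\<mu> p. LINT x|\<mu> p. (LINT z|\<mu> p. ?f p x y z)\<^sup>2"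
  have eq: "cyc p (ik p \<alpha>) (ik p \<beta>) = ?I2 p - (icdf p \<alpha> * icdf p \<beta>)\<^sup>2" if p: "p > 0" for p
  proof -
    interpret PU: pair_prob_space "\<mu> p" "\<mu> p" ..
    define c where "c = icdf p \<alpha> * icdf p \<beta>"
    define J where "J x y = (LINT z|\<mu> p. ?f p x y z)" for x y
    have f1: "\<bar>?f p x y z\<bar> \<le> 1" for x y z by (simp add: indicator_def)
    have inner: "(LINT z|\<mu> p. ik p \<alpha> (ip p x z) * ik p \<beta> (ip p y z)) = J x y - c"
      if [measurable]: "x \<in> space (rvec p)" "y \<in> space (rvec p)" for x y
    proof -
      have ia: "integrable (\<mu> p) (\<lambda>z. hs p \<alpha> (ip p x z))"
        "integrable (\<mu> p) (\<lambda>z. hs p \<beta> (ip p y z))" by (auto intro!: U.integrable_bounded[where C=1] simp: indicator_def)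
      have ib: "integrable (\<mu> p) (\<lambda>z. ?f p x y z)" using f1 by (intro U.integrable_bounded[where C=1]) auto
      have va: "(LINT z|\<mu> p. hs p \<alpha> (ip p x z)) = icdf p \<alpha>"
        "(LINT z|\<mu> p. hs p \<beta> (ip p y z)) = icdf p \<beta>" using integral_ip[OF p, of "\<lambda>t. hs p \<alpha> t" x]
          integral_ip[OF p, of "\<lambda>t. hs p \<beta> t" y] by (simp_all add: integral_indicator_icdf)
      have "ik p \<alpha> (ip p x z) * ik p \<beta> (ip p y z) = ?f p x y z - icdf p \<beta> * hs p \<alpha> (ip p x z)
        - icdf p \<alpha> * hs p \<beta> (ip p y z) + c" for z by (simp add: ik_def c_def algebra_simps)
      then show ?thesis using ia ib va U.prob_space by (simp add: J_def c_def)
    qed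
    have Jm: "(\<lambda>w. J (fst w) (snd w)) \<in> borel_measurable (\<mu>2 p)" unfolding J_def
      by (rule measurable_zonal_product[of "\<lambda>t. hs p \<alpha> t" "\<lambda>t. hs p \<beta> t"]) measurable
    have Jb: "\<bar>J x y\<bar> \<le> 1" if [measurable]: "x \<in> space (rvec p)" "y \<in> space (rvec p)" for x y
      unfolding J_def real_norm_def[symmetric] using f1 by (intro U.norm_integral_le_const) auto
    have I1: "integrable (\<mu>2 p) (\<lambda>w. J (fst w) (snd w))"
      using Jm Jb by (intro PU.P.integrable_bounded[of _ 1]) (auto simp: space_pair_measure)
    have I2: "integrable (\<mu>2 p) (\<lambda>w. (J (fst w) (snd w))\<^sup>2)"
      using Jm Jb by (intro PU.P.integrable_bounded[of _ 1]) (auto simp: space_pair_measure abs_square_le_1)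
    have I3: "integrable (\<mu>2 p) (\<lambda>w. (J (fst w) (snd w) - c)\<^sup>2)" using I1 I2 unfolding power2_diff by auto
    have mJ: "(LINT y|\<mu> p. LINT x|\<mu> p. J x y) = c"
    proof -
      have "(LINT x|\<mu> p. J x y) = c" if y [measurable]: "y \<in> space (rvec p)" for y
      proof -
        have I: "integrable (\<mu>2 p) (\<lambda>(x, z). ?f p x y z)"
          unfolding case_prod_beta' using f1 by (intro PU.P.integrable_bounded[of _ 1]) auto
        have "(LINT x|\<mu> p. J x y) = (LINT z|\<mu> p. LINT x|\<mu> p. ?f p x y z)" unfolding J_def by (rule PU.Fubini_integral[OF I, symmetric])
        also have "... = (LINT z|\<mu> p. icdf p \<alpha> * hs p \<beta> (ip p y z))"
        proof (rule lint_cong)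
          fix z
          show "(LINT x|\<mu> p. ?f p x y z) = icdf p \<alpha> * hs p \<beta> (ip p y z)" using integral_ip[OF p, of "\<lambda>t. hs p \<alpha> t" z]
            by (simp add: integral_indicator_icdf ip_commute[of p _ z])
        qed simp
        also have "... = c" using integral_ip[OF p, of "\<lambda>t. hs p \<beta> t" y] by (simp add: integral_indicator_icdf c_def)
        finally show ?thesis .
      qed
      then have "(LINT y|\<mu> p. LINT x|\<mu> p. J x y) = (LINT y|\<mu> p. c)" by (intro lint_cong) auto
      then show ?thesis using U.prob_space by simp
    qed
    have "cyc p (ik p \<alpha>) (ik p \<beta>) = (LINT y|\<mu> p. LINT x|\<mu> p. (J x y - c)\<^sup>2)"
      unfolding cyc_def by (intro lint_cong) (auto simp: inner)
    also have "... = (LINT w|\<mu>2 p. (J (fst w) (snd w) - c)\<^sup>2)" by (rule U.iterated_integral[OF I3])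
    also have "... = (LINT w|\<mu>2 p. (J (fst w) (snd w))\<^sup>2) + c\<^sup>2 - 2 * (LINT w|\<mu>2 p. J (fst w) (snd w)) * c"
      unfolding power2_diff using I1 I2 by (simp add: PU.P.prob_space)
    also have "(LINT w|\<mu>2 p. J (fst w) (snd w)) = c" using U.iterated_integral[OF I1] mJ by simp
    also have "(LINT w|\<mu>2 p. (J (fst w) (snd w))\<^sup>2) = ?I2 p" using U.iterated_integral[OF I2] by (simp add: J_def)
    finally show ?thesis by (simp add: c_def power2_eq_square)
  qed
  have "(\<lambda>p. ?I2 p - (icdf p \<alpha> * icdf p \<beta>)\<^sup>2) \<longlonglongrightarrow> (std_normal_cdf \<alpha> * std_normal_cdf \<beta>)\<^sup>2 - (std_normal_cdf \<alpha> * std_normal_cdf \<beta>)\<^sup>2"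
    by (intro tendsto_intros four_cycle_tendsto icdf_tendsto)
  moreover have "\<forall>\<^sub>F p in sequentially. ?I2 p - (icdf p \<alpha> * icdf p \<beta>)\<^sup>2 = cyc p (ik p \<alpha>) (ik p \<beta>)"
    using eventually_gt_at_top[of 0] by eventually_elim (simp add: eq)
  ultimately show ?thesis by (simp add: Lim_transform_eventually)
qed

text \<open>By the degree-one formula the composition with a linear kernel is again linear in the
  inner product, with factor \<open>m\<close>. Its squared norm is \<open>m^2\<close>, which
  Cauchy-Schwarz bounds because the second moment of the inner product is
  \<open>1 / p\<close>.\<close>

lemma cyc_linear:
  assumes p: "p > 0" and [measurable]: "l \<in> borel_measurable borel" and C: "\<And>t. \<bar>t\<bar> \<le> 1 \<Longrightarrow> \<bar>l t\<bar> \<le> C"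
  shows "cyc p (\<lambda>t. sqrt p * t) l \<le> (LINT t|slaw p. (l t)\<^sup>2) / real p"
    and "cyc p l (\<lambda>t. sqrt p * t) \<le> (LINT t|slaw p. (l t)\<^sup>2) / real p"
proof -
  define m where "m = (LINT t|slaw p. l t * t)"
  have lin: "(LINT z|\<mu> p. l (ip p x z) * (sqrt p * ip p y z)) = sqrt p * ip p x y * m" for x y
  proof -
    have "(LINT z|\<mu> p. l (ip p x z) * (sqrt p * ip p y z)) = sqrt p * (LINT z|\<mu> p. l (ip p x z) * ip p y z)"
      by (subst integral_mult_right_zero[symmetric]) (simp add: mult.left_commute)
    then show ?thesis unfolding m_def by (subst (asm) integral_ip_linear[OF p _ C]) auto
  qed
  have m2: "m\<^sup>2 \<le> (LINT t|slaw p. (l t)\<^sup>2) / real p"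
  proof -
    have li: "integrable (slaw p) (\<lambda>t. (l t)\<^sup>2)"
      using C by (intro integrable_slaw_bounded[OF p, where C="C\<^sup>2"]) (auto simp: abs_le_square_iff[symmetric] intro: order_trans[OF _ abs_ge_self])
    have t2: "integrable (slaw p) (\<lambda>t. t\<^sup>2)" using p by simp
    have lt: "integrable (slaw p) (\<lambda>t. l t * t)"
      using C by (intro integrable_slaw_bounded[OF p, where C="\<bar>C\<bar>"]) (auto simp: abs_mult intro!: mult_le_one mult_left_le[THEN order_trans] intro: order_trans[OF _ abs_ge_self])
    define L where "L = (LINT t|slaw p. (l t)\<^sup>2)"
    have e2: "(LINT t|slaw p. t\<^sup>2) = 1 / real p" using smom_2[OF p] by (simp add: smom_def)
    \<comment> \<open>The coefficient \<open>p * m\<close> is that of the orthogonal projection of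
      \<open>l\<close> onto the identity function.\<close>
    have "0 \<le> (LINT t|slaw p. (l t - (real p * m) * t)\<^sup>2)" by (intro lint_nonneg) auto
    also have "... = (LINT t|slaw p. (l t)\<^sup>2 - (2 * (real p * m)) * (l t * t) + (real p * m)\<^sup>2 * t\<^sup>2)"
      by (intro lint_cong) (auto simp: power2_diff power_mult_distrib)
    also have "... = L - (2 * (real p * m)) * m + (real p * m)\<^sup>2 * (1 / real p)" using li t2 lt by (simp add: L_def m_def e2)
    also have "... = L - real p * m\<^sup>2" using p by (simp add: power2_eq_square)
    finally show ?thesis using p by (simp add: L_def field_simps)
  qed
  have *: "(LINT y|\<mu> p. LINT x|\<mu> p. (sqrt p * ip p x y * m)\<^sup>2) = m\<^sup>2"
  proof -
    have "(LINT x|\<mu> p. (sqrt p * ip p x y * m)\<^sup>2) = m\<^sup>2" for y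
    proof -
      have "(LINT x|\<mu> p. (sqrt p * ip p x y * m)\<^sup>2) = real p * m\<^sup>2 * (LINT x|\<mu> p. (ip p y x)\<^sup>2)"
        by (subst integral_mult_right_zero[symmetric]) (simp add: power_mult_distrib ip_commute[of p y] mult_ac)
      also have "(LINT x|\<mu> p. (ip p y x)\<^sup>2) = 1 / real p"
        using integral_ip[OF p, of "\<lambda>t. t\<^sup>2" y] smom_2[OF p] by (simp add: smom_def)
      finally show ?thesis using p by simp
    qed
    then show ?thesis using U.prob_space by simp
  qed
  have "cyc p l (\<lambda>t. sqrt p * t) = m\<^sup>2" unfolding cyc_def lin by (rule *)
  then show "cyc p l (\<lambda>t. sqrt p * t) \<le> (LINT t|slaw p. (l t)\<^sup>2) / real p" using m2 by simp
  have "cyc p (\<lambda>t. sqrt p * t) l = m\<^sup>2"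
    unfolding cyc_def mult.commute[of "sqrt p * ip p _ _" "l _"] lin using * by (simp add: ip_commute)
  then show "cyc p (\<lambda>t. sqrt p * t) l \<le> (LINT t|slaw p. (l t)\<^sup>2) / real p" using m2 by simp
qed

text \<open>Cauchy-Schwarz over the pairs of indices. The factor is harmless, as the number of
  kernels stays fixed while \<open>p\<close> grows.\<close>

lemma cyc_sum_le:
  assumes p: "p > 0" and I: "finite I" and k [measurable]: "\<And>i. i \<in> I \<Longrightarrow> k i \<in> borel_measurable borel"
    and C: "\<And>i t. i \<in> I \<Longrightarrow> \<bar>t\<bar> \<le> 1 \<Longrightarrow> \<bar>k i t\<bar> \<le> C"
  shows "cyc p (\<lambda>t. \<Sum>i\<in>I. c i * k i t) (\<lambda>t. \<Sum>i\<in>I. c i * k i t) \<le>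
    (real (card I))\<^sup>2 * (\<Sum>i\<in>I. \<Sum>j\<in>I. (c i * c j)\<^sup>2 * cyc p (k i) (k j))"
proof -
  interpret PU: pair_prob_space "\<mu> p" "\<mu> p" ..
  define T where "T i j x y = (LINT z|\<mu> p. k i (ip p x z) * k j (ip p y z))" for i j x y
  have kk: "\<bar>k i (ip p x z) * k j (ip p y z)\<bar> \<le> \<bar>C\<bar> * \<bar>C\<bar>" if "i \<in> I" "j \<in> I" for i j x y z
    unfolding abs_mult using C[OF that(1) abs_ip_le[OF p]] C[OF that(2) abs_ip_le[OF p]]
    by (intro mult_mono) (auto intro: order_trans[OF _ abs_ge_self])
  have Ik: "integrable (\<mu> p) (\<lambda>z. k i (ip p x z) * k j (ip p y z))"
    if ij: "i \<in> I" "j \<in> I" and [measurable]: "x \<in> space (rvec p)" "y \<in> space (rvec p)" for i j x y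
  proof -
    note [measurable] = k[OF ij(1)] k[OF ij(2)]
    show ?thesis using kk[OF ij] by (intro U.integrable_bounded[where C="\<bar>C\<bar> * \<bar>C\<bar>"]) auto
  qed
  have Tb: "\<bar>T i j x y\<bar> \<le> \<bar>C\<bar> * \<bar>C\<bar>" if ij: "i \<in> I" "j \<in> I" and [measurable]: "x \<in> space (rvec p)" "y \<in> space (rvec p)" for i j x y
  proof -
    note [measurable] = k[OF ij(1)] k[OF ij(2)]
    show ?thesis unfolding T_def real_norm_def[symmetric] using kk[OF ij] by (intro U.norm_integral_le_const) auto
  qed
  have Tm: "(\<lambda>w. T i j (fst w) (snd w)) \<in> borel_measurable (\<mu>2 p)" if "i \<in> I" "j \<in> I" for i j
    unfolding T_def by (rule measurable_zonal_product) (use that k in auto)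
  have IT: "integrable (\<mu>2 p) (\<lambda>w. (T i j (fst w) (snd w))\<^sup>2)" if "i \<in> I" "j \<in> I" for i j
    using Tm[OF that] power_mono[OF Tb[OF that] abs_ge_zero, of _ _ 2]
    by (intro PU.P.integrable_bounded[of _ "(\<bar>C\<bar> * \<bar>C\<bar>)\<^sup>2"]) (auto simp: space_pair_measure)
  have inner: "(LINT z|\<mu> p. (\<Sum>i\<in>I. c i * k i (ip p x z)) * (\<Sum>j\<in>I. c j * k j (ip p y z))) = (\<Sum>i\<in>I. \<Sum>j\<in>I. c i * c j * T i j x y)"
    if "x \<in> space (rvec p)" "y \<in> space (rvec p)" for x y
  proof -
    have "(\<Sum>i\<in>I. c i * k i (ip p x z)) * (\<Sum>j\<in>I. c j * k j (ip p y z)) = (\<Sum>i\<in>I. \<Sum>j\<in>I. c i * c j * (k i (ip p x z) * k j (ip p y z)))" for z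
      by (simp add: sum_product mult_ac)
    then have "(LINT z|\<mu> p. (\<Sum>i\<in>I. c i * k i (ip p x z)) * (\<Sum>j\<in>I. c j * k j (ip p y z))) =
        (LINT z|\<mu> p. (\<Sum>i\<in>I. \<Sum>j\<in>I. c i * c j * (k i (ip p x z) * k j (ip p y z))))" by simp
    also have "... = (\<Sum>i\<in>I. LINT z|\<mu> p. (\<Sum>j\<in>I. c i * c j * (k i (ip p x z) * k j (ip p y z))))"
      using Ik that by (intro lint_sum lintegrable_sum integrable_mult_right) auto
    also have "... = (\<Sum>i\<in>I. \<Sum>j\<in>I. c i * c j * T i j x y)" unfolding T_def using Ik that
      by (intro sum.cong refl trans[OF lint_sum]) auto
    finally show ?thesis .
  qed
  have sq: "(\<Sum>i\<in>I. \<Sum>j\<in>I. c i * c j * T i j x y)\<^sup>2 \<le> (real (card I))\<^sup>2 * (\<Sum>i\<in>I. \<Sum>j\<in>I. (c i * c j)\<^sup>2 * (T i j x y)\<^sup>2)" for x y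
  proof -
    have "(\<Sum>i\<in>I. \<Sum>j\<in>I. c i * c j * T i j x y)\<^sup>2 = (\<Sum>s\<in>I \<times> I. c (fst s) * c (snd s) * T (fst s) (snd s) x y)\<^sup>2"
      by (simp add: sum.cartesian_product case_prod_beta')
    also have "... \<le> (\<Sum>s\<in>I \<times> I. (c (fst s) * c (snd s) * T (fst s) (snd s) x y)\<^sup>2) * real (card (I \<times> I))"
      by (rule sum_squared_le_sum_of_squares)
    also have "... = (real (card I))\<^sup>2 * (\<Sum>i\<in>I. \<Sum>j\<in>I. (c i * c j)\<^sup>2 * (T i j x y)\<^sup>2)"
      by (simp add: sum.cartesian_product case_prod_beta' card_cartesian_product power2_eq_square mult_ac)
    finally show ?thesis .
  qed
  have S1: "integrable (\<mu>2 p) (\<lambda>w. (\<Sum>i\<in>I. \<Sum>j\<in>I. c i * c j * T i j (fst w) (snd w))\<^sup>2)"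
  proof (rule lintegrable_bound)
    show "integrable (\<mu>2 p) (\<lambda>w. (real (card I))\<^sup>2 * (\<Sum>i\<in>I. \<Sum>j\<in>I. (c i * c j)\<^sup>2 * (T i j (fst w) (snd w))\<^sup>2))"
      using IT by (intro integrable_mult_right lintegrable_sum) auto
    show "(\<lambda>w. (\<Sum>i\<in>I. \<Sum>j\<in>I. c i * c j * T i j (fst w) (snd w))\<^sup>2) \<in> borel_measurable (\<mu>2 p)"
      using Tm by (intro borel_measurable_power borel_measurable_sum borel_measurable_times) auto
  qed (use sq in \<open>auto intro!: AE_I2 intro: order_trans[OF _ abs_ge_self]\<close>)
  have "cyc p (\<lambda>t. \<Sum>i\<in>I. c i * k i t) (\<lambda>t. \<Sum>i\<in>I. c i * k i t) =
      (LINT y|\<mu> p. LINT x|\<mu> p. (\<Sum>i\<in>I. \<Sum>j\<in>I. c i * c j * T i j x y)\<^sup>2)"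
    unfolding cyc_def by (intro lint_cong refl) (auto simp: inner)
  also have "... = (LINT w|\<mu>2 p. (\<Sum>i\<in>I. \<Sum>j\<in>I. c i * c j * T i j (fst w) (snd w))\<^sup>2)" by (rule U.iterated_integral[OF S1])
  also have "... \<le> (LINT w|\<mu>2 p. (real (card I))\<^sup>2 * (\<Sum>i\<in>I. \<Sum>j\<in>I. (c i * c j)\<^sup>2 * (T i j (fst w) (snd w))\<^sup>2))"
    using IT by (intro integral_mono[OF S1] sq integrable_mult_right lintegrable_sum) auto
  also have "... = (real (card I))\<^sup>2 * (\<Sum>i\<in>I. \<Sum>j\<in>I. (c i * c j)\<^sup>2 * (LINT w|\<mu>2 p. (T i j (fst w) (snd w))\<^sup>2))"
    using IT by (simp add: lint_sum)
  also have "... = (real (card I))\<^sup>2 * (\<Sum>i\<in>I. \<Sum>j\<in>I. (c i * c j)\<^sup>2 * cyc p (k i) (k j))"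
    by (intro arg_cong2[of _ _ _ _ "(*)"] sum.cong refl) (simp add: cyc_def T_def[symmetric] U.iterated_integral[OF IT])
  finally show ?thesis .
qed

section \<open>The central limit theorem under the uniform distribution\<close>

text \<open>The indices below \<open>m\<close> carry the empirical process at \<open>\<xi>\<close>, the index \<open>m\<close> the likelihood.\<close>

definition kk :: "nat \<Rightarrow> nat \<Rightarrow> rseq \<Rightarrow> nat \<Rightarrow> real \<Rightarrow> real" where
  "kk p m \<xi> i t = (if i < m then ik p (\<xi> i) t else sqrt p * t)"

definition zk :: "nat \<Rightarrow> nat \<Rightarrow> rseq \<Rightarrow> rseq \<Rightarrow> real \<Rightarrow> real" where
  "zk p m \<xi> c t = (\<Sum>i\<in>{..m}. c i * kk p m \<xi> i t)"

text \<open>Covariance matrix of the indicators of Z \<le> \<open>\<xi> i\<close> for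
  \<open>i < m\<close>, followed by Z itself, for one standard normal variable Z.\<close>

definition gcov :: "nat \<Rightarrow> rseq \<Rightarrow> nat \<Rightarrow> nat \<Rightarrow> real" where
  "gcov m \<xi> i j =
    (if i < m \<and> j < m then min (std_normal_cdf (\<xi> i)) (std_normal_cdf (\<xi> j)) - std_normal_cdf (\<xi> i) * std_normal_cdf (\<xi> j)
     else if i < m then - std_normal_density (\<xi> i)
     else if j < m then - std_normal_density (\<xi> j) else 1)"

definition gvar :: "nat \<Rightarrow> rseq \<Rightarrow> rseq \<Rightarrow> real" where
  "gvar m \<xi> c = (\<Sum>i\<in>{..m}. \<Sum>j\<in>{..m}. c i * c j * gcov m \<xi> i j)"

lemma measurable_kk [measurable]: "kk p m \<xi> i \<in> borel_measurable borel" unfolding kk_def by measurable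

lemma measurable_zk [measurable]: "zk p m \<xi> c \<in> borel_measurable borel" unfolding zk_def by measurable

lemma abs_kk_le: "\<bar>t\<bar> \<le> 1 \<Longrightarrow> \<bar>kk p m \<xi> i t\<bar> \<le> 1 + sqrt p"
proof -
  assume t: "\<bar>t\<bar> \<le> 1"
  have "sqrt p * \<bar>t\<bar> \<le> sqrt p * 1" using t by (intro mult_left_mono) auto
  moreover have "\<bar>ik p (\<xi> i) t\<bar> \<le> 1" by (rule abs_ik_le)
  ultimately show ?thesis by (auto simp: kk_def abs_mult intro: order_trans)
qed

lemma integrable_kk_power: "p > 0 \<Longrightarrow> integrable (slaw p) (\<lambda>t. kk p m \<xi> i t ^ k)"
  using power_mono[OF abs_kk_le abs_ge_zero, of _ p m \<xi> i k] by (intro integrable_slaw_bounded[where C="(1 + sqrt p) ^ k"]) (auto simp: power_abs)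

lemma integrable_kk_kk: "p > 0 \<Longrightarrow> integrable (slaw p) (\<lambda>t. kk p m \<xi> i t * kk p m \<xi> j t)"
  by (intro integrable_slaw_bounded[where C="(1 + sqrt p) * (1 + sqrt p)"])
     (auto simp: abs_mult intro!: mult_mono abs_kk_le)

lemma kk_mean: "p > 0 \<Longrightarrow> (LINT t|slaw p. kk p m \<xi> i t) = 0"
  using smom_odd[of p 1] by (cases "i < m") (simp_all add: kk_def[abs_def] integral_ik smom_def)

lemma kk_fourth: "p > 0 \<Longrightarrow> (LINT t|slaw p. kk p m \<xi> i t ^ 4) \<le> 3"
proof (cases "i < m")
  case True
  assume p: "p > 0"
  have "(LINT t|slaw p. kk p m \<xi> i t ^ 4) \<le> (LINT t|slaw p. 1)"
  proof (rule integral_mono)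
    show "kk p m \<xi> i t ^ 4 \<le> 1" for t using power_mono[OF abs_ik_le abs_ge_zero, of p "\<xi> i" t 4] True by (simp add: kk_def)
  qed (use integrable_kk_power[OF p] in auto)
  then show ?thesis using S.prob_space by simp
next
  case False
  assume p: "p > 0"
  have "(LINT t|slaw p. kk p m \<xi> i t ^ 4) = (LINT t|slaw p. (real p)\<^sup>2 * t ^ 4)"
  proof -
    have "(sqrt p)^4 = ((sqrt p)\<^sup>2)\<^sup>2"
    proof -
      have "(4::nat) = 2 * 2" by simp
      then show ?thesis by (simp only: power_mult)
    qed
    also have "(sqrt p)\<^sup>2 = real p" by simp
    finally have "(sqrt p)^4 = (real p)\<^sup>2" .
    then show ?thesis using False by (simp add: kk_def[abs_def] power_mult_distrib)
  qed
  also have "... = (real p)\<^sup>2 * smom p 4" by (simp add: smom_def)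
  also have "... \<le> (real p)\<^sup>2 * (3 / (real p)\<^sup>2)" using smom_4_le[OF p] by (intro mult_left_mono) auto
  finally show ?thesis using p by simp
qed

lemma kk_cov_tendsto: "(\<lambda>p. LINT t|slaw p. kk p m \<xi> i t * kk p m \<xi> j t) \<longlonglongrightarrow> gcov m \<xi> i j"
proof -
  have \<Phi>_mono: "std_normal_cdf (min a b) = min (std_normal_cdf a) (std_normal_cdf b)" for a b
  proof -
    have "mono std_normal_cdf" unfolding std_normal_cdf_def mono_def using N.cdf_nondecreasing by auto
    then show ?thesis by (rule min_of_mono[symmetric])
  qed
  have mixed: "(\<lambda>p. LINT t|slaw p. ik p \<alpha> t * (sqrt p * t)) \<longlonglongrightarrow> - std_normal_density \<alpha>" for \<alpha>
  proof -
    have "\<forall>\<^sub>F p in sequentially. (LINT t|slaw p. sqrt p * t * indicator {..\<alpha>} (sqrt p * t)) = (LINT t|slaw p. ik p \<alpha> t * (sqrt p * t))"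
      using eventually_gt_at_top[of 0]
    proof eventually_elim
      fix p :: nat assume p: "p > 0"
      have I1: "integrable (slaw p) (\<lambda>t. t)" using integrable_slaw_power[OF p, of 1] by simp
      have I2: "integrable (slaw p) (\<lambda>t. sqrt p * t * indicator {..\<alpha>} (sqrt p * t))"
        by (intro integrable_slaw_bounded[OF p, where C="sqrt p"]) (auto simp: indicator_def abs_mult mult_left_le)
      have "ik p \<alpha> t * (sqrt p * t) = sqrt p * t * indicator {..\<alpha>} (sqrt p * t) - (icdf p \<alpha> * sqrt p) * t" for t
        by (simp add: ik_def algebra_simps)
      then show "(LINT t|slaw p. sqrt p * t * indicator {..\<alpha>} (sqrt p * t)) = (LINT t|slaw p. ik p \<alpha> t * (sqrt p * t))"
        using I1 I2 smom_odd[OF p, of 1] by (simp add: smom_def)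
    qed
    then show ?thesis by (rule Lim_transform_eventually[OF wlaw_half_line_tendsto])
  qed
  consider "i < m" "j < m" | "i < m" "\<not> j < m" | "\<not> i < m" "j < m" | "\<not> i < m" "\<not> j < m" by auto
  then show ?thesis
  proof cases
    case 1
    then show ?thesis by (simp add: kk_def gcov_def integral_ik_ik \<Phi>_mono[symmetric]) (intro tendsto_intros icdf_tendsto)
  next
    case 2
    then show ?thesis using mixed[of "\<xi> i"] by (simp add: kk_def gcov_def)
  next
    case 3
    then show ?thesis using mixed[of "\<xi> j"] by (simp add: kk_def gcov_def mult.commute)
  next
    case 4
    have "\<forall>\<^sub>F p in sequentially. 1 = (LINT t|slaw p. kk p m \<xi> i t * kk p m \<xi> j t)" using eventually_gt_at_top[of 0]
    proof eventually_elim
      fix p :: nat assume p: "p > 0"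
      have "(LINT t|slaw p. kk p m \<xi> i t * kk p m \<xi> j t) = (LINT t|slaw p. real p * t\<^sup>2)"
        using 4 by (intro lint_cong) (auto simp: kk_def power2_eq_square)
      then show "1 = (LINT t|slaw p. kk p m \<xi> i t * kk p m \<xi> j t)" using smom_2[OF p] p by (simp add: smom_def)
    qed
    then show ?thesis using 4 by (simp add: gcov_def tendsto_eventually eventually_mono)
  qed
qed

lemma cyc_nonneg: "cyc p k l \<ge> 0" unfolding cyc_def by (intro lint_nonneg) auto

lemma cyc_kk_tendsto: "(\<lambda>p. cyc p (kk p m \<xi> i) (kk p m \<xi> j)) \<longlonglongrightarrow> 0"
proof (cases "i < m \<and> j < m")
  case True
  then show ?thesis using cyc_ik_tendsto by (simp add: kk_def[abs_def])
next
  case False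
  have v: "(LINT t|slaw p. (kk p m \<xi> i t)\<^sup>2) \<le> 1" if p: "p > 0" for p i
  proof (cases "i < m")
    case True
    have "(LINT t|slaw p. (kk p m \<xi> i t)\<^sup>2) \<le> (LINT t|slaw p. 1)"
      using integrable_kk_power[OF p, of m \<xi> i 2] abs_ik_le[of p "\<xi> i"] True by (intro integral_mono) (auto simp: kk_def abs_square_le_1)
    then show ?thesis using S.prob_space by simp
  next
    case False
    have "(LINT t|slaw p. (kk p m \<xi> i t)\<^sup>2) = (LINT t|slaw p. real p * t\<^sup>2)"
      using False by (simp add: kk_def[abs_def] power_mult_distrib)
    then show ?thesis using smom_2[OF p] p by (simp add: smom_def)
  qed
  have le: "cyc p (kk p m \<xi> i) (kk p m \<xi> j) \<le> 1 / real p" if p: "p > 0" for p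
  proof (cases "i < m")
    case True
    then have "kk p m \<xi> j = (\<lambda>t. sqrt p * t)" using False by (auto simp: kk_def)
    then have "cyc p (kk p m \<xi> i) (kk p m \<xi> j) \<le> (LINT t|slaw p. (kk p m \<xi> i t)\<^sup>2) / real p"
      using cyc_linear(2)[OF p measurable_kk[of p m \<xi> i] abs_kk_le] by simp
    also have "... \<le> 1 / real p" using v[OF p] by (intro divide_right_mono) auto
    finally show ?thesis .
  next
    case F: False
    then have "kk p m \<xi> i = (\<lambda>t. sqrt p * t)" by (auto simp: kk_def)
    then have "cyc p (kk p m \<xi> i) (kk p m \<xi> j) \<le> (LINT t|slaw p. (kk p m \<xi> j t)\<^sup>2) / real p"
      using cyc_linear(1)[OF p measurable_kk[of p m \<xi> j] abs_kk_le] by simp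
    also have "... \<le> 1 / real p" using v[OF p] by (intro divide_right_mono) auto
    finally show ?thesis .
  qed
  show ?thesis
  proof (rule Lim_null_comparison)
    show "\<forall>\<^sub>F p in sequentially. norm (cyc p (kk p m \<xi> i) (kk p m \<xi> j)) \<le> 1 / real p"
      using eventually_gt_at_top[of 0] by eventually_elim (simp add: le cyc_nonneg)
    show "(\<lambda>p. 1 / real p) \<longlonglongrightarrow> 0" by (rule lim_const_over_n)
  qed
qed

lemma zk_bound: "\<bar>t\<bar> \<le> 1 \<Longrightarrow> \<bar>zk p m \<xi> c t\<bar> \<le> (\<Sum>i\<in>{..m}. \<bar>c i\<bar> * (1 + sqrt p))"
proof -
  assume t: "\<bar>t\<bar> \<le> 1"
  have "\<bar>zk p m \<xi> c t\<bar> \<le> (\<Sum>i\<in>{..m}. \<bar>c i * kk p m \<xi> i t\<bar>)" unfolding zk_def by (rule sum_abs)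
  also have "... \<le> (\<Sum>i\<in>{..m}. \<bar>c i\<bar> * (1 + sqrt p))" unfolding abs_mult by (intro sum_mono mult_left_mono abs_kk_le t) auto
  finally show ?thesis .
qed

lemma zk_mean: "p > 0 \<Longrightarrow> (LINT t|slaw p. zk p m \<xi> c t) = 0" unfolding zk_def using integrable_kk_power[of p m \<xi> _ 1]
  by (subst lint_sum) (auto simp: kk_mean)

lemma zk_var:
  assumes p: "p > 0"
  shows "(LINT t|slaw p. (zk p m \<xi> c t)\<^sup>2) = (\<Sum>i\<in>{..m}. \<Sum>j\<in>{..m}. c i * c j * (LINT t|slaw p. kk p m \<xi> i t * kk p m \<xi> j t))"
proof -
  have "(zk p m \<xi> c t)\<^sup>2 = (\<Sum>i\<in>{..m}. \<Sum>j\<in>{..m}. c i * c j * (kk p m \<xi> i t * kk p m \<xi> j t))" for t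
    by (simp add: zk_def power2_eq_square sum_product mult_ac)
  then have "(LINT t|slaw p. (zk p m \<xi> c t)\<^sup>2) = (LINT t|slaw p. (\<Sum>i\<in>{..m}. \<Sum>j\<in>{..m}. c i * c j * (kk p m \<xi> i t * kk p m \<xi> j t)))"
    by simp
  also have "... = (\<Sum>i\<in>{..m}. LINT t|slaw p. (\<Sum>j\<in>{..m}. c i * c j * (kk p m \<xi> i t * kk p m \<xi> j t)))"
    using integrable_kk_kk[OF p] by (intro lint_sum lintegrable_sum integrable_mult_right) auto
  also have "... = (\<Sum>i\<in>{..m}. \<Sum>j\<in>{..m}. c i * c j * (LINT t|slaw p. kk p m \<xi> i t * kk p m \<xi> j t))"
    using integrable_kk_kk[OF p] by (intro sum.cong refl trans[OF lint_sum]) auto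
  finally show ?thesis .
qed

lemma zk_var_tendsto: "(\<lambda>p. LINT t|slaw p. (zk p m \<xi> c t)\<^sup>2) \<longlonglongrightarrow> gvar m \<xi> c"
proof -
  have "(\<lambda>p. \<Sum>i\<in>{..m}. \<Sum>j\<in>{..m}. c i * c j * (LINT t|slaw p. kk p m \<xi> i t * kk p m \<xi> j t)) \<longlonglongrightarrow> gvar m \<xi> c"
    unfolding gvar_def by (intro tendsto_intros kk_cov_tendsto)
  moreover have "\<forall>\<^sub>F p in sequentially. (\<Sum>i\<in>{..m}. \<Sum>j\<in>{..m}. c i * c j * (LINT t|slaw p. kk p m \<xi> i t * kk p m \<xi> j t)) = (LINT t|slaw p. (zk p m \<xi> c t)\<^sup>2)"
    using eventually_gt_at_top[of 0] by eventually_elim (simp add: zk_var)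
  ultimately show ?thesis by (rule Lim_transform_eventually)
qed

lemma zk_fourth:
  assumes p: "p > 0"
  shows "(LINT t|slaw p. (zk p m \<xi> c t) ^ 4) \<le> (real m + 1) ^ 3 * (\<Sum>i\<in>{..m}. (c i) ^ 4 * 3)"
proof -
  have "(zk p m \<xi> c t) ^ 4 \<le> (real m + 1) ^ 3 * (\<Sum>i\<in>{..m}. (c i) ^ 4 * kk p m \<xi> i t ^ 4)" for t
  proof -
    let ?u = "\<lambda>i. c i * kk p m \<xi> i t"
    have 1: "(zk p m \<xi> c t)\<^sup>2 \<le> (\<Sum>i\<in>{..m}. (?u i)\<^sup>2) * real (card {..m})"
      unfolding zk_def by (rule sum_squared_le_sum_of_squares)
    have 2: "(\<Sum>i\<in>{..m}. (?u i)\<^sup>2)\<^sup>2 \<le> (\<Sum>i\<in>{..m}. ((?u i)\<^sup>2)\<^sup>2) * real (card {..m})"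
      by (rule sum_squared_le_sum_of_squares)
    have "(zk p m \<xi> c t) ^ 4 = ((zk p m \<xi> c t)\<^sup>2)\<^sup>2" by simp
    also have "... \<le> ((\<Sum>i\<in>{..m}. (?u i)\<^sup>2) * real (card {..m}))\<^sup>2" using 1 by (intro power_mono) auto
    also have "... = (\<Sum>i\<in>{..m}. (?u i)\<^sup>2)\<^sup>2 * (real m + 1)\<^sup>2" by (simp add: power_mult_distrib add.commute)
    also have "... \<le> ((\<Sum>i\<in>{..m}. ((?u i)\<^sup>2)\<^sup>2) * (real m + 1)) * (real m + 1)\<^sup>2"
      using 2 by (intro mult_right_mono) (auto simp: add.commute)
    also have "... = (real m + 1) ^ 3 * (\<Sum>i\<in>{..m}. (c i) ^ 4 * kk p m \<xi> i t ^ 4)"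
      by (simp add: power3_eq_cube power2_eq_square power_mult_distrib power4_eq_xxxx mult_ac)
    finally show ?thesis .
  qed
  moreover have "integrable (slaw p) (\<lambda>t. (zk p m \<xi> c t) ^ 4)" using power_mono[OF zk_bound abs_ge_zero, of _ p m \<xi> c 4]
    by (intro integrable_slaw_bounded[OF p, where C="(\<Sum>i\<in>{..m}. \<bar>c i\<bar> * (1 + sqrt p)) ^ 4"]) (auto simp: power_abs)
  moreover have I: "integrable (slaw p) (\<lambda>t. (c i) ^ 4 * kk p m \<xi> i t ^ 4)" for i using integrable_kk_power[OF p] by auto
  ultimately have "(LINT t|slaw p. (zk p m \<xi> c t) ^ 4) \<le> (LINT t|slaw p. (real m + 1) ^ 3 * (\<Sum>i\<in>{..m}. (c i) ^ 4 * kk p m \<xi> i t ^ 4))"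
    by (intro integral_mono) auto
  also have "... = (real m + 1) ^ 3 * (\<Sum>i\<in>{..m}. (c i) ^ 4 * (LINT t|slaw p. kk p m \<xi> i t ^ 4))" using I by (simp add: lint_sum)
  also have "... \<le> (real m + 1) ^ 3 * (\<Sum>i\<in>{..m}. (c i) ^ 4 * 3)" by (intro mult_left_mono sum_mono kk_fourth[OF p]) auto
  finally show ?thesis .
qed

lemma cyc_zk_tendsto: "(\<lambda>p. cyc p (zk p m \<xi> c) (zk p m \<xi> c)) \<longlonglongrightarrow> 0"
proof (rule Lim_null_comparison)
  show "\<forall>\<^sub>F p in sequentially. norm (cyc p (zk p m \<xi> c) (zk p m \<xi> c)) \<le>
      (real (card {..m}))\<^sup>2 * (\<Sum>i\<in>{..m}. \<Sum>j\<in>{..m}. (c i * c j)\<^sup>2 * cyc p (kk p m \<xi> i) (kk p m \<xi> j))"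
    using eventually_gt_at_top[of 0]
  proof eventually_elim
    fix p :: nat assume p: "p > 0"
    have z: "zk p m \<xi> c = (\<lambda>t. \<Sum>i\<in>{..m}. c i * kk p m \<xi> i t)" by (auto simp: zk_def)
    have "cyc p (zk p m \<xi> c) (zk p m \<xi> c) \<le> (real (card {..m}))\<^sup>2 * (\<Sum>i\<in>{..m}. \<Sum>j\<in>{..m}. (c i * c j)\<^sup>2 * cyc p (kk p m \<xi> i) (kk p m \<xi> j))"
      unfolding z by (rule cyc_sum_le[OF p finite_atMost measurable_kk abs_kk_le])
    then show "norm (cyc p (zk p m \<xi> c) (zk p m \<xi> c)) \<le> (real (card {..m}))\<^sup>2 * (\<Sum>i\<in>{..m}. \<Sum>j\<in>{..m}. (c i * c j)\<^sup>2 * cyc p (kk p m \<xi> i) (kk p m \<xi> j))"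
      using cyc_nonneg[of p "zk p m \<xi> c" "zk p m \<xi> c"] by simp
  qed
  have "(\<lambda>p. (real (card {..m}))\<^sup>2 * (\<Sum>i\<in>{..m}. \<Sum>j\<in>{..m}. (c i * c j)\<^sup>2 * cyc p (kk p m \<xi> i) (kk p m \<xi> j)))
     \<longlonglongrightarrow> (real (card {..m}))\<^sup>2 * (\<Sum>i\<in>{..m}. \<Sum>j\<in>{..m}. (c i * c j)\<^sup>2 * 0)"
    by (intro tendsto_mult tendsto_sum tendsto_const cyc_kk_tendsto)
  then show "(\<lambda>p. (real (card {..m}))\<^sup>2 * (\<Sum>i\<in>{..m}. \<Sum>j\<in>{..m}. (c i * c j)\<^sup>2 * cyc p (kk p m \<xi> i) (kk p m \<xi> j))) \<longlonglongrightarrow> 0"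
    by simp
qed

section \<open>The normalised statistic: its limit and its moments\<close>

abbreviation usample :: "nat \<Rightarrow> nat \<Rightarrow> sample_pts measure" where
  "usample p n \<equiv> PiM {1..n} (\<lambda>_. \<mu> p)"

definition nrm :: rseq where
  "nrm n = sqrt (2 / (real n * (real n - 1)))"

definition zstat :: "nat \<Rightarrow> nat \<Rightarrow> (real \<Rightarrow> real) \<Rightarrow> sample_pts \<Rightarrow> real" where
  "zstat p n k x = nrm n * usum (\<lambda>x y. k (ip p x y)) n x"

lemma nrm_sq: "n \<ge> 2 \<Longrightarrow> (nrm n)\<^sup>2 = 2 / (real n * (real n - 1))" by (simp add: nrm_def)

lemma nrm_nonneg [simp]: "0 \<le> nrm n" unfolding nrm_def by (cases n) auto

lemma measurable_zstat [measurable]: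
  assumes [measurable]: "k \<in> borel_measurable borel"
  shows "zstat p n k \<in> borel_measurable (usample p n)"
proof -
  have "(\<lambda>x. k (ip p (x i) (x j))) \<in> borel_measurable (usample p n)" if "j \<in> {1..n}" "i \<in> {1..<j}" for i j
  proof -
    have "(\<lambda>x. x i) \<in> usample p n \<rightarrow>\<^sub>M \<mu> p" "(\<lambda>x. x j) \<in> usample p n \<rightarrow>\<^sub>M \<mu> p"
      using that by (auto intro!: measurable_component_singleton)
    then have "(\<lambda>x. x i) \<in> usample p n \<rightarrow>\<^sub>M rvec p" "(\<lambda>x. x j) \<in> usample p n \<rightarrow>\<^sub>M rvec p"
      by (auto simp: measurable_cong_sets[OF refl sets_unif_sphere])
    from measurable_ip[OF this] assms show ?thesis by (rule measurable_compose)
  qed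
  then show ?thesis unfolding zstat_def usum_def by measurable
qed

lemma prob_space_usample: "prob_space (usample p n)" by (intro prob_space_PiM prob_space_unif_sphere)

lemma sq_kernel_cyc:
  assumes "degenerate_kernel (\<mu> p) (\<lambda>x y. k (ip p x y)) C"
  shows "(LINT y|\<mu> p. LINT x|\<mu> p. degenerate_kernel.sq_kernel (\<mu> p) (\<lambda>x y. k (ip p x y)) x y ^ 2) = cyc p k k"
  unfolding degenerate_kernel.sq_kernel_def[OF assms] cyc_def ..

text \<open>In \<open>n * clt_err\<close> the three terms are of order \<open>1 / n\<close>,
  \<open>sqrt (\<gamma> n)\<close> and \<open>1 / sqrt n\<close>, since the variances converge and
  the fourth moments are bounded. The cycle norm \<open>\<gamma> n\<close> tends to 0 with growing
  dimension alone, so \<open>n\<close> and \<open>p n\<close> may grow at any relative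
  speed.\<close>

theorem null_clt:
  assumes p: "filterlim p at_top sequentially"
  shows "(\<lambda>n. LINT x|usample (p n) n. iexp (zstat (p n) n (zk (p n) m \<xi> c) x)) \<longlonglongrightarrow> complex_of_real (exp (- gvar m \<xi> c / 2))"
proof -
  define v where "v n = (LINT t|slaw (p n). (zk (p n) m \<xi> c t)\<^sup>2)" for n
  define \<gamma> where "\<gamma> n = cyc (p n) (zk (p n) m \<xi> c) (zk (p n) m \<xi> c)" for n
  define K where "K = (real m + 1) ^ 3 * (\<Sum>i\<in>{..m}. (c i) ^ 4 * 3)"
  define err where "err n = real n * clt_err (nrm n) n (v n) K (\<gamma> n)" for n
  have v: "v \<longlonglongrightarrow> gvar m \<xi> c" unfolding v_def by (rule filterlim_compose[OF zk_var_tendsto p])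
  have \<gamma>: "\<gamma> \<longlonglongrightarrow> 0" unfolding \<gamma>_def by (rule filterlim_compose[OF cyc_zk_tendsto p])
  have pe: "\<forall>\<^sub>F n in sequentially. p n > 0"
  proof -
    have "\<forall>\<^sub>F n in sequentially. 1 \<le> p n" using p unfolding filterlim_at_top by blast
    then show ?thesis by eventually_elim simp
  qed
  have ne: "\<forall>\<^sub>F n in sequentially. (n::nat) \<ge> 2" by (rule eventually_ge_at_top)
  have bound: "\<forall>\<^sub>F n in sequentially. norm ((LINT x|usample (p n) n. iexp (zstat (p n) n (zk (p n) m \<xi> c) x)) - complex_of_real (exp (- v n / 2))) \<le> err n"
    using pe ne
  proof eventually_elim
    fix n assume pn: "p n > 0" and n: "n \<ge> 2"
    interpret H: homogeneous_kernel "\<mu> (p n)" "\<lambda>x y. zk (p n) m \<xi> c (ip (p n) x y)" "\<Sum>i\<in>{..m}. \<bar>c i\<bar> * (1 + sqrt (p n))" "v n" K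
      unfolding v_def K_def by (rule zonal_homogeneous_kernel[OF pn measurable_zk zk_bound zk_mean[OF pn] zk_fourth[OF pn]])
    have "(nrm n)\<^sup>2 * (real n * (real n - 1)) = 2" using n by (simp add: nrm_sq)
    then have h: "(nrm n)\<^sup>2 * (real n * (real n - 1)) * v n / 4 = v n / 2" by simp
    show "norm ((LINT x|usample (p n) n. iexp (zstat (p n) n (zk (p n) m \<xi> c) x)) - complex_of_real (exp (- v n / 2))) \<le> err n"
      using H.clt_bound[where a="nrm n" and n=n] unfolding sq_kernel_cyc[OF H.degenerate_kernel_axioms] err_def \<gamma>_def zstat_def h minus_divide_left .
  qed
  have "err \<longlonglongrightarrow> 0"
  proof -
    \<comment> \<open>Each summand is split into an explicit function of \<open>n\<close> and a
      factor that converges together with \<open>v\<close> and \<gamma>.\<close>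
    have e: "\<forall>\<^sub>F n in sequentially. (real n / (2 * (real n - 1)\<^sup>2)) * (v n)\<^sup>2 + (2 * real n / (real n - 1)) * sqrt (\<gamma> n) +
       (real n * (sqrt (2 / (real n * (real n - 1)))) ^ 3 * sqrt (real n ^ 3) / 6) * (sqrt (v n) * sqrt (K / real n + 3 * (v n)\<^sup>2)) = err n"
      using ne
    proof eventually_elim
      fix n :: nat assume n: "n \<ge> 2"
      have a2: "(nrm n)\<^sup>2 = 2 / (real n * (real n - 1))" using n by (rule nrm_sq)
      have n0: "real n > 0" "real n - 1 > 0" using n by auto
      have t1: "real n * ((nrm n)\<^sup>2 * real n * v n)\<^sup>2 / 8 = (real n / (2 * (real n - 1)\<^sup>2)) * (v n)\<^sup>2"
      proof -
        have gen: "N * (2 / (N * L) * N * V)\<^sup>2 / 8 = N / (2 * L\<^sup>2) * V\<^sup>2" if "N > 0" "L > 0" for N L V :: real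
          using that by (simp add: field_simps power2_eq_square)
        show ?thesis unfolding a2 by (rule gen[OF n0])
      qed
      have t2: "real n * ((nrm n)\<^sup>2 * (real n * sqrt (\<gamma> n))) = (2 * real n / (real n - 1)) * sqrt (\<gamma> n)"
        unfolding a2 using n0 by (simp add: field_simps)
      have "sqrt (real n * v n) * sqrt (real n * K + 3 * (real n)\<^sup>2 * (v n)\<^sup>2) = sqrt (real n ^ 3) * (sqrt (v n) * sqrt (K / real n + 3 * (v n)\<^sup>2))"
      proof -
        have "real n * K + 3 * (real n)\<^sup>2 * (v n)\<^sup>2 = (real n)\<^sup>2 * (K / real n + 3 * (v n)\<^sup>2)"
          using n0 by (simp add: power2_eq_square distrib_left)
        moreover have "sqrt (real n ^ 3) = sqrt (real n) * sqrt ((real n)\<^sup>2)" by (simp add: power3_eq_cube power2_eq_square real_sqrt_mult)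
        ultimately show ?thesis by (simp add: real_sqrt_mult)
      qed
      then have t3: "real n * (\<bar>nrm n\<bar> ^ 3 / 6 * (sqrt (real n * v n) * sqrt (real n * K + 3 * (real n)\<^sup>2 * (v n)\<^sup>2))) =
        (real n * (sqrt (2 / (real n * (real n - 1)))) ^ 3 * sqrt (real n ^ 3) / 6) * (sqrt (v n) * sqrt (K / real n + 3 * (v n)\<^sup>2))"
        by (simp add: nrm_def[symmetric])
      show "(real n / (2 * (real n - 1)\<^sup>2)) * (v n)\<^sup>2 + (2 * real n / (real n - 1)) * sqrt (\<gamma> n) +
       (real n * (sqrt (2 / (real n * (real n - 1)))) ^ 3 * sqrt (real n ^ 3) / 6) * (sqrt (v n) * sqrt (K / real n + 3 * (v n)\<^sup>2)) = err n"
        unfolding t1[symmetric] t2[symmetric] t3[symmetric] err_def clt_err_def by (simp add: distrib_left)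
    qed
    have "(\<lambda>n. (real n / (2 * (real n - 1)\<^sup>2))) \<longlonglongrightarrow> 0" by real_asymp
    moreover have "(\<lambda>n. (2 * real n / (real n - 1))) \<longlonglongrightarrow> 2" by real_asymp
    moreover have "(\<lambda>n. (real n * (sqrt (2 / (real n * (real n - 1)))) ^ 3 * sqrt (real n ^ 3) / 6)) \<longlonglongrightarrow> 0" by real_asymp
    moreover have "(\<lambda>n. K / real n) \<longlonglongrightarrow> 0" by (rule lim_const_over_n)
    ultimately have "(\<lambda>n. (real n / (2 * (real n - 1)\<^sup>2)) * (v n)\<^sup>2 + (2 * real n / (real n - 1)) * sqrt (\<gamma> n) +
       (real n * (sqrt (2 / (real n * (real n - 1)))) ^ 3 * sqrt (real n ^ 3) / 6) * (sqrt (v n) * sqrt (K / real n + 3 * (v n)\<^sup>2)))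
       \<longlonglongrightarrow> 0 * (gvar m \<xi> c)\<^sup>2 + 2 * sqrt 0 + 0 * (sqrt (gvar m \<xi> c) * sqrt (0 + 3 * (gvar m \<xi> c)\<^sup>2))"
      by (intro tendsto_add tendsto_mult tendsto_power tendsto_real_sqrt tendsto_const v \<gamma>)
    then have "(\<lambda>n. (real n / (2 * (real n - 1)\<^sup>2)) * (v n)\<^sup>2 + (2 * real n / (real n - 1)) * sqrt (\<gamma> n) +
       (real n * (sqrt (2 / (real n * (real n - 1)))) ^ 3 * sqrt (real n ^ 3) / 6) * (sqrt (v n) * sqrt (K / real n + 3 * (v n)\<^sup>2))) \<longlonglongrightarrow> 0"
      by simp
    then show ?thesis using e by (rule Lim_transform_eventually)
  qed
  with bound have "(\<lambda>n. (LINT x|usample (p n) n. iexp (zstat (p n) n (zk (p n) m \<xi> c) x)) - complex_of_real (exp (- v n / 2))) \<longlonglongrightarrow> 0"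
    by (rule Lim_null_comparison)
  moreover have "(\<lambda>n. complex_of_real (exp (- v n / 2))) \<longlonglongrightarrow> complex_of_real (exp (- gvar m \<xi> c / 2))"
    by (intro tendsto_intros v) auto
  ultimately show ?thesis using tendsto_add by fastforce
qed

lemma zstat_second_moment:
  assumes p: "p > 0" and n: "n \<ge> 2" and k [measurable]: "k \<in> borel_measurable borel"
    and C: "\<And>t. \<bar>t\<bar> \<le> 1 \<Longrightarrow> \<bar>k t\<bar> \<le> C" and 0: "(LINT t|slaw p. k t) = 0"
  shows "(LINT x|usample p n. (zstat p n k x)\<^sup>2) = (LINT t|slaw p. (k t)\<^sup>2)"
proof -
  interpret H: homogeneous_kernel "\<mu> p" "\<lambda>x y. k (ip p x y)" C "LINT t|slaw p. (k t)\<^sup>2" "LINT t|slaw p. (k t) ^ 4"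
    by (rule zonal_homogeneous_kernel[OF p k C 0 order_refl])
  have "(LINT x|usample p n. (zstat p n k x)\<^sup>2) = (nrm n)\<^sup>2 * (LINT x|usample p n. (usum (\<lambda>x y. k (ip p x y)) n x)\<^sup>2)"
    unfolding zstat_def by (simp add: power_mult_distrib)
  also have "... = (nrm n)\<^sup>2 * (real n * (real n - 1) / 2) * (LINT y|\<mu> p. LINT x|\<mu> p. (k (ip p x y))\<^sup>2)"
    unfolding H.usum_second_moment by simp
  also have "(LINT y|\<mu> p. LINT x|\<mu> p. (k (ip p x y))\<^sup>2) = (LINT t|slaw p. (k t)\<^sup>2)"
  proof -
    have "(LINT y|\<mu> p. LINT x|\<mu> p. (k (ip p x y))\<^sup>2) = (LINT y|\<mu> p. (LINT t|slaw p. (k t)\<^sup>2))"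
      by (intro lint_cong H.var') auto
    then show ?thesis using U.prob_space by simp
  qed
  finally show ?thesis using n by (simp add: nrm_sq)
qed

text \<open>One \<delta> bounds both moments of the kernel, as is natural for the increment of an
  indicator. The constant is \<open>16 * 4^2 * 3\<close>: the 16 and the 3 come from
  \<open>usum_fourth_moment\<close>, and \<open>nrm n ^ 2 \<le> 4 / n^2\<close> from
  \<open>n - 1 \<ge> n / 2\<close>.\<close>

lemma zstat_fourth_moment:
  assumes p: "p > 0" and n: "n \<ge> 2" and k [measurable]: "k \<in> borel_measurable borel"
    and C: "\<And>t. \<bar>t\<bar> \<le> 1 \<Longrightarrow> \<bar>k t\<bar> \<le> C" and 0: "(LINT t|slaw p. k t) = 0"
    and v: "(LINT t|slaw p. (k t)\<^sup>2) \<le> \<delta>" and K: "(LINT t|slaw p. (k t) ^ 4) \<le> \<delta>"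
  shows "(LINT x|usample p n. (zstat p n k x) ^ 4) \<le> 768 * (\<delta>\<^sup>2 + \<delta> / real n)"
proof -
  interpret H: homogeneous_kernel "\<mu> p" "\<lambda>x y. k (ip p x y)" C "LINT t|slaw p. (k t)\<^sup>2" \<delta>
    by (rule zonal_homogeneous_kernel[OF p k C 0 K])
  have n0: "real n > 0" "real n - 1 \<ge> real n / 2" using n by auto
  have "(LINT x|usample p n. (zstat p n k x) ^ 4) = (nrm n) ^ 4 * (LINT x|usample p n. (usum (\<lambda>x y. k (ip p x y)) n x) ^ 4)"
    unfolding zstat_def by (simp add: power_mult_distrib)
  also have "... \<le> (nrm n) ^ 4 * (16 * (real n)\<^sup>2 * (real n * \<delta> + 3 * (real n)\<^sup>2 * (LINT t|slaw p. (k t)\<^sup>2)\<^sup>2))"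
    by (intro mult_left_mono H.usum_fourth_moment) auto
  also have "... \<le> (4 / (real n)\<^sup>2)\<^sup>2 * (16 * (real n)\<^sup>2 * (real n * \<delta> + 3 * (real n)\<^sup>2 * \<delta>\<^sup>2))"
  proof (rule mult_mono)
    have "(nrm n)\<^sup>2 \<le> 4 / (real n)\<^sup>2"
    proof -
      have "2 / (real n * (real n - 1)) \<le> 2 / (real n * (real n / 2))" using n0 by (intro divide_left_mono mult_left_mono mult_pos_pos) auto
      then show ?thesis unfolding nrm_sq[OF n] by (simp add: power2_eq_square)
    qed
    then have "((nrm n)\<^sup>2)\<^sup>2 \<le> (4 / (real n)\<^sup>2)\<^sup>2" by (intro power_mono) auto
    then show "(nrm n) ^ 4 \<le> (4 / (real n)\<^sup>2)\<^sup>2" by simp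
    have "(LINT t|slaw p. (k t)\<^sup>2)\<^sup>2 \<le> \<delta>\<^sup>2" using v H.v_nonneg by (intro power_mono) auto
    then show "16 * (real n)\<^sup>2 * (real n * \<delta> + 3 * (real n)\<^sup>2 * (LINT t|slaw p. (k t)\<^sup>2)\<^sup>2) \<le> 16 * (real n)\<^sup>2 * (real n * \<delta> + 3 * (real n)\<^sup>2 * \<delta>\<^sup>2)"
      by (intro mult_left_mono add_left_mono) auto
    show "0 \<le> 16 * (real n)\<^sup>2 * (real n * \<delta> + 3 * (real n)\<^sup>2 * (LINT t|slaw p. (k t)\<^sup>2)\<^sup>2)"
      using H.K_nonneg by (intro mult_nonneg_nonneg add_nonneg_nonneg) auto
  qed auto
  also have "... = 256 * (\<delta> / real n) + 768 * \<delta>\<^sup>2" using n0 by (simp add: field_simps power2_eq_square)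
  also have "... \<le> 768 * (\<delta>\<^sup>2 + \<delta> / real n)"
  proof -
    have "0 \<le> \<delta> / real n" using H.K_nonneg by simp
    then show ?thesis unfolding distrib_left by linarith
  qed
  finally show ?thesis .
qed

section \<open>The likelihood averaged over the location\<close>

lemma (in product_sigma_finite) distr_PiM_componentwise:
  assumes I: "finite I" and T: "\<And>i. i \<in> I \<Longrightarrow> T i \<in> M i \<rightarrow>\<^sub>M M i" "\<And>i. i \<in> I \<Longrightarrow> distr (M i) (M i) (T i) = M i"
  shows "distr (PiM I M) (PiM I M) (\<lambda>x. \<lambda>i\<in>I. T i (x i)) = PiM I M"
proof (rule PiM_eqI[OF I])
  have m: "(\<lambda>x. \<lambda>i\<in>I. T i (x i)) \<in> PiM I M \<rightarrow>\<^sub>M PiM I M"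
    using T(1) by (intro measurable_restrict measurable_compose[OF measurable_component_singleton]) auto
  fix A assume A: "\<And>i. i \<in> I \<Longrightarrow> A i \<in> sets (M i)"
  have eq: "(\<lambda>x. \<lambda>i\<in>I. T i (x i)) -` (Pi\<^sub>E I A) \<inter> space (PiM I M) = (\<Pi>\<^sub>E i\<in>I. T i -` A i \<inter> space (M i))"
    by (auto simp: space_PiM PiE_iff)
  have s: "T i -` A i \<inter> space (M i) \<in> sets (M i)" if "i \<in> I" for i using measurable_sets[OF T(1)[OF that] A[OF that]] .
  have "emeasure (distr (PiM I M) (PiM I M) (\<lambda>x. \<lambda>i\<in>I. T i (x i))) (Pi\<^sub>E I A) = emeasure (PiM I M) (\<Pi>\<^sub>E i\<in>I. T i -` A i \<inter> space (M i))"
    unfolding eq[symmetric] using A I by (intro emeasure_distr[OF m] sets_PiM_I_finite) auto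
  also have "... = (\<Prod>i\<in>I. emeasure (M i) (T i -` A i \<inter> space (M i)))" using I s by (rule emeasure_PiM)
  also have "... = (\<Prod>i\<in>I. emeasure (M i) (A i))"
  proof (rule prod.cong)
    fix i assume i: "i \<in> I"
    have "emeasure (M i) (A i) = emeasure (distr (M i) (M i) (T i)) (A i)" by (simp only: T(2)[OF i])
    also have "... = emeasure (M i) (T i -` A i \<inter> space (M i))" by (rule emeasure_distr[OF T(1)[OF i] A[OF i]])
    finally show "emeasure (M i) (T i -` A i \<inter> space (M i)) = emeasure (M i) (A i)" by simp
  qed simp
  finally show "emeasure (distr (PiM I M) (PiM I M) (\<lambda>x. \<lambda>i\<in>I. T i (x i))) (Pi\<^sub>E I A) = (\<Prod>i\<in>I. emeasure (M i) (A i))" .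
qed simp

lemma PiM_density:
  assumes I: "finite I" and M: "\<And>i. prob_space (M i)" and D: "\<And>i. prob_space (density (M i) (f i))"
    and f [measurable]: "\<And>i. f i \<in> borel_measurable (M i)"
  shows "PiM I (\<lambda>i. density (M i) (f i)) = density (PiM I M) (\<lambda>x. \<Prod>i\<in>I. f i (x i))"
proof -
  interpret D: prob_space "density (M i) (f i)" for i by (rule D)
  interpret M: prob_space "M i" for i by (rule M)
  interpret PD: product_sigma_finite "\<lambda>i. density (M i) (f i)" ..
  interpret PM: product_sigma_finite M ..
  have m: "(\<lambda>x. \<Prod>i\<in>I. f i (x i)) \<in> borel_measurable (PiM I M)"
    by (intro borel_measurable_prod_ennreal measurable_compose[OF measurable_component_singleton]) auto
  have "density (PiM I M) (\<lambda>x. \<Prod>i\<in>I. f i (x i)) = PiM I (\<lambda>i. density (M i) (f i))"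
  proof (rule PD.PiM_eqI[OF I])
    show "sets (density (PiM I M) (\<lambda>x. \<Prod>i\<in>I. f i (x i))) = sets (PiM I (\<lambda>i. density (M i) (f i)))"
      by (simp cong: sets_PiM_cong)
    fix A assume A: "\<And>i. i \<in> I \<Longrightarrow> A i \<in> sets (density (M i) (f i))"
    have As: "Pi\<^sub>E I A \<in> sets (PiM I M)" using A I by (intro sets_PiM_I_finite) auto
    have "emeasure (density (PiM I M) (\<lambda>x. \<Prod>i\<in>I. f i (x i))) (Pi\<^sub>E I A) = (\<integral>\<^sup>+x. (\<Prod>i\<in>I. f i (x i)) * indicator (Pi\<^sub>E I A) x \<partial>PiM I M)"
      using m As by (rule emeasure_density)
    also have "... = (\<integral>\<^sup>+x. (\<Prod>i\<in>I. f i (x i) * indicator (A i) (x i)) \<partial>PiM I M)"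
    proof (rule nn_integral_cong)
      fix x assume x: "x \<in> space (PiM I M)"
      have "indicator (Pi\<^sub>E I A) x = (\<Prod>i\<in>I. indicator (A i) (x i) :: ennreal)"
        using x I by (auto simp: indicator_def space_PiM PiE_iff prod_zero_iff)
      then show "(\<Prod>i\<in>I. f i (x i)) * indicator (Pi\<^sub>E I A) x = (\<Prod>i\<in>I. f i (x i) * indicator (A i) (x i))"
        by (simp add: prod.distrib)
    qed
    also have "... = (\<Prod>i\<in>I. \<integral>\<^sup>+x. f i x * indicator (A i) x \<partial>M i)"
      using A by (intro PM.product_nn_integral_prod[OF I]) auto
    also have "... = (\<Prod>i\<in>I. emeasure (density (M i) (f i)) (A i))" using A by (intro prod.cong) (auto simp: emeasure_density)
    finally show "emeasure (density (PiM I M) (\<lambda>x. \<Prod>i\<in>I. f i (x i))) (Pi\<^sub>E I A) = (\<Prod>i\<in>I. emeasure (density (M i) (f i)) (A i))" .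
  qed
  then show ?thesis ..
qed

section \<open>Likelihood ratios for a given and for a random location\<close>

definition vconst :: "nat \<Rightarrow> real \<Rightarrow> real" where
  "vconst p \<kappa> = bessel_series p (\<kappa>\<^sup>2 / (2 * real p))"

text \<open>The average of \<open>exp (\<kappa> \<theta> \<cdot> \<Sum>x\<^sub>i)\<close> over \<open>\<theta>\<close> is \<open>bessel_series p (\<kappa>\<^sup>2 \<bar>\<Sum>x\<^sub>i\<bar>\<^sup>2 / (2 p))\<close>, and
  \<open>\<bar>\<Sum>x\<^sub>i\<bar>\<^sup>2 = n + 2 \<Sum>\<^sub>i\<^sub><\<^sub>j x\<^sub>i \<cdot> x\<^sub>j\<close> on the sphere.\<close>

definition lik :: "nat \<Rightarrow> nat \<Rightarrow> real \<Rightarrow> sample_pts \<Rightarrow> real" where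
  "lik p n \<kappa> x = bessel_series p (\<kappa>\<^sup>2 * (real n + 2 * usum (ip p) n x) / (2 * real p)) / vconst p \<kappa> ^ n"

text \<open>Likelihood ratio at location \<theta> against uniform sampling. Passing through
  \<open>svec\<close> makes it bounded everywhere and not only almost surely.\<close>

definition loclik :: "nat \<Rightarrow> nat \<Rightarrow> real \<Rightarrow> rseq \<Rightarrow> sample_pts \<Rightarrow> real" where
  "loclik p n \<kappa> \<theta> x = (\<Prod>i\<in>{1..n}. exp (\<kappa> * dot p (svec p (x i)) \<theta>) / vconst p \<kappa>)"

lemma vconst_ge_1: "vconst p \<kappa> \<ge> 1" unfolding vconst_def by (rule bessel_series_ge_1) simp

lemma integral_exp_dot:
  assumes p: "p > 0" and a: "a \<in> space (rvec p)"
  shows "(LINT x|\<mu> p. exp (dot p x a)) = bessel_series p ((norm2 p a)\<^sup>2 / (2 * real p))"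
  using integral_dot[OF p a, of exp] slaw_mgf[OF p, of "norm2 p a"] by simp

lemma integral_exp_dot_sphere:
  assumes \<theta>: "\<theta> \<in> unit_sphere p"
  shows "(LINT x|\<mu> p. exp (\<kappa> * dot p x \<theta>)) = vconst p \<kappa>"
  using integral_dot_sphere[OF \<theta>, of "\<lambda>t. exp (\<kappa> * t)"] slaw_mgf[OF sphere_imp_pos[OF \<theta>], of \<kappa>]
  by (simp add: vconst_def)

lemma FvML_eq:
  assumes \<theta>: "\<theta> \<in> unit_sphere p"
  shows "FvML p \<kappa> \<theta> = density (\<mu> p) (\<lambda>x. ennreal (exp (\<kappa> * dot p (svec p x) \<theta>) / vconst p \<kappa>))"
proof -
  note [measurable] = unit_sphere_space[OF \<theta>]
  show ?thesis unfolding FvML_def integral_exp_dot_sphere[OF \<theta>]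
  proof (rule density_cong)
    show "AE x in \<mu> p. ennreal (exp (\<kappa> * dot p x \<theta>) / vconst p \<kappa>) = ennreal (exp (\<kappa> * dot p (svec p x) \<theta>) / vconst p \<kappa>)"
      using AE_unif_sphere[OF sphere_imp_pos[OF \<theta>]] by eventually_elim (simp add: svec_def)
  qed measurable
qed

lemma prob_space_FvML:
  assumes \<theta>: "\<theta> \<in> unit_sphere p"
  shows "prob_space (FvML p \<kappa> \<theta>)"
proof -
  note [measurable] = unit_sphere_space[OF \<theta>]
  have p: "p > 0" by (rule sphere_imp_pos[OF \<theta>])
  have le: "\<kappa> * dot p x \<theta> \<le> \<bar>\<kappa>\<bar>" if x: "x \<in> unit_sphere p" for x
  proof -
    have "\<kappa> * dot p x \<theta> \<le> \<bar>\<kappa>\<bar> * \<bar>dot p x \<theta>\<bar>" by (metis abs_ge_self abs_mult)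
    also have "... \<le> \<bar>\<kappa>\<bar> * 1" using abs_dot_sphere_le[OF x \<theta>] by (intro mult_left_mono) auto
    finally show ?thesis by simp
  qed
  have I: "integrable (\<mu> p) (\<lambda>x. exp (\<kappa> * dot p x \<theta>))"
    using le by (intro integrable_unif_sphere_bounded[OF p, where C="exp \<bar>\<kappa>\<bar>"]) auto
  show ?thesis unfolding FvML_def using vconst_ge_1[of p \<kappa>] integral_exp_dot_sphere[OF \<theta>, of \<kappa>]
    by (intro prob_space_density_normalised I) auto
qed

lemma PiM_FvML:
  assumes \<theta>: "\<theta> \<in> unit_sphere p"
  shows "PiM {1..n} (\<lambda>_. FvML p \<kappa> \<theta>) = density (usample p n) (\<lambda>x. ennreal (loclik p n \<kappa> \<theta> x))"
proof -
  note [measurable] = unit_sphere_space[OF \<theta>]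
  have "PiM {1..n} (\<lambda>_. FvML p \<kappa> \<theta>) = density (usample p n) (\<lambda>x. \<Prod>i\<in>{1..n}. ennreal (exp (\<kappa> * dot p (svec p (x i)) \<theta>) / vconst p \<kappa>))"
    unfolding FvML_eq[OF \<theta>] using prob_space_FvML[OF \<theta>, of \<kappa>] unfolding FvML_eq[OF \<theta>]
    by (intro PiM_density prob_space_unif_sphere) auto
  also have "(\<lambda>x. \<Prod>i\<in>{1..n}. ennreal (exp (\<kappa> * dot p (svec p (x i)) \<theta>) / vconst p \<kappa>)) = (\<lambda>x. ennreal (loclik p n \<kappa> \<theta> x))"
    unfolding loclik_def using vconst_ge_1[of p \<kappa>] by (intro ext prod_ennreal) auto
  finally show ?thesis .
qed

definition srefl :: "nat \<Rightarrow> nat \<Rightarrow> rseq \<Rightarrow> sample_pts \<Rightarrow> nat \<Rightarrow> nat \<Rightarrow> real" where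
  "srefl p n v x = (\<lambda>i\<in>{1..n}. hrefl p v (x i))"

lemma sets_usample: "sets (usample p n) = sets (PiM {1..n} (\<lambda>_. rvec p))" by (rule sets_PiM_cong) auto

lemma
  assumes v: "v \<in> unit_sphere p"
  shows measurable_srefl: "srefl p n v \<in> usample p n \<rightarrow>\<^sub>M usample p n"
    and distr_usample_srefl: "distr (usample p n) (usample p n) (srefl p n v) = usample p n"
proof -
  interpret product_sigma_finite "\<lambda>_::nat. \<mu> p" ..
  note [measurable] = unit_sphere_space[OF v]
  have h: "hrefl p v \<in> \<mu> p \<rightarrow>\<^sub>M \<mu> p" by measurable
  show "srefl p n v \<in> usample p n \<rightarrow>\<^sub>M usample p n"
    unfolding srefl_def using h by (intro measurable_restrict measurable_compose[OF _ h]) auto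
  have "distr (\<mu> p) (\<mu> p) (hrefl p v) = \<mu> p" using distr_unif_sphere_hrefl[OF v] by (simp cong: distr_cong)
  then show "distr (usample p n) (usample p n) (srefl p n v) = usample p n" unfolding srefl_def using h by (intro distr_PiM_componentwise) auto
qed

lemma AE_usample_sphere:
  assumes p: "p > 0"
  shows "AE x in usample p n. \<forall>i\<in>{1..n}. x i \<in> unit_sphere p"
proof -
  have "AE x in usample p n. x i \<in> unit_sphere p" if "i \<in> {1..n}" for i
    using that AE_unif_sphere[OF p] by (intro AE_PiM_component prob_space_unif_sphere) auto
  then show ?thesis by (subst AE_ball_countable) auto
qed

lemma measurable_loclik [measurable (raw)]:
  assumes [measurable]: "f \<in> N \<rightarrow>\<^sub>M usample p n" "g \<in> N \<rightarrow>\<^sub>M rvec p"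
  shows "(\<lambda>z. loclik p n \<kappa> (g z) (f z)) \<in> borel_measurable N"
proof -
  have "(\<lambda>z. f z i) \<in> N \<rightarrow>\<^sub>M rvec p" if "i \<in> {1..n}" for i
  proof -
    have "(\<lambda>z. f z i) \<in> N \<rightarrow>\<^sub>M \<mu> p"
      using that by (intro measurable_compose[OF assms(1) measurable_component_singleton]) auto
    then show ?thesis by (simp add: measurable_cong_sets[OF refl sets_unif_sphere])
  qed
  then have "(\<lambda>z. dot p (svec p (f z i)) (g z)) \<in> borel_measurable N" if "i \<in> {1..n}" for i
    using that by (intro measurable_dot measurable_compose[OF _ measurable_svec] assms) auto
  then show ?thesis unfolding loclik_def by measurable
qed

lemma loclik_bounds:
  assumes p: "p > 0" and \<theta>: "\<theta> \<in> unit_sphere p"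
  shows "0 \<le> loclik p n \<kappa> \<theta> x" "loclik p n \<kappa> \<theta> x \<le> exp \<bar>\<kappa>\<bar> ^ n"
proof -
  have 0: "0 \<le> exp (\<kappa> * dot p (svec p (x i)) \<theta>) / vconst p \<kappa>" for i using vconst_ge_1[of p \<kappa>] by simp
  show "0 \<le> loclik p n \<kappa> \<theta> x" unfolding loclik_def using 0 by (intro prod_nonneg) auto
  have "exp (\<kappa> * dot p (svec p (x i)) \<theta>) / vconst p \<kappa> \<le> exp \<bar>\<kappa>\<bar>" for i
  proof -
    have "\<kappa> * dot p (svec p (x i)) \<theta> \<le> \<bar>\<kappa>\<bar> * \<bar>dot p (svec p (x i)) \<theta>\<bar>" by (metis abs_ge_self abs_mult)
    also have "... \<le> \<bar>\<kappa>\<bar> * 1" using abs_dot_sphere_le[OF svec_sphere[OF p] \<theta>] by (intro mult_left_mono) auto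
    finally have "exp (\<kappa> * dot p (svec p (x i)) \<theta>) \<le> exp \<bar>\<kappa>\<bar>" by simp
    also have "... \<le> exp \<bar>\<kappa>\<bar> * vconst p \<kappa>" using vconst_ge_1[of p \<kappa>] by simp
    finally show ?thesis using vconst_ge_1[of p \<kappa>] by (simp add: divide_le_eq)
  qed
  then have "loclik p n \<kappa> \<theta> x \<le> (\<Prod>i\<in>{1..n}. exp \<bar>\<kappa>\<bar>)"
    unfolding loclik_def using 0 by (intro prod_mono) auto
  then show "loclik p n \<kappa> \<theta> x \<le> exp \<bar>\<kappa>\<bar> ^ n" by simp
qed

lemma integral_loclik_average:
  assumes p: "p > 0"
  shows "(LINT \<theta>|\<mu> p. loclik p n \<kappa> (svec p \<theta>) x) = lik p n \<kappa> x"
proof -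
  define s where "s = (\<lambda>k\<in>{..<p}. \<kappa> * (\<Sum>i\<in>{1..n}. svec p (x i) k))"
  have s [measurable]: "s \<in> space (rvec p)" by (simp add: s_def space_rvec)
  have ds: "dot p y s = (\<Sum>i\<in>{1..n}. \<kappa> * dot p (svec p (x i)) y)" for y
  proof -
    have "dot p y s = (\<Sum>k<p. \<Sum>i\<in>{1..n}. \<kappa> * (svec p (x i) k * y k))" by (simp add: dot_def s_def sum_distrib_left mult_ac)
    also have "... = (\<Sum>i\<in>{1..n}. \<kappa> * dot p (svec p (x i)) y)" by (subst sum.swap) (simp add: dot_def sum_distrib_left)
    finally show ?thesis .
  qed
  have "(norm2 p s)\<^sup>2 = dot p s s" by (simp add: dot_self)
  also have "... = (\<Sum>i\<in>{1..n}. \<kappa> * dot p (svec p (x i)) s)" by (rule ds)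
  also have "... = \<kappa>\<^sup>2 * (\<Sum>i\<in>{1..n}. \<Sum>j\<in>{1..n}. ip p (x j) (x i))"
    unfolding ds by (simp add: sum_distrib_left ip_def power2_eq_square mult_ac)
  also have "(\<Sum>i\<in>{1..n}. \<Sum>j\<in>{1..n}. ip p (x j) (x i)) = (\<Sum>i\<in>{1..n}. \<Sum>j\<in>{1..n}. ip p (x i) (x j))"
    by (simp add: ip_commute)
  also have "... = real n + 2 * usum (ip p) n x"
  proof -
    have "ip p (x i) (x i) = 1" for i by (simp add: ip_def dot_self_sphere svec_sphere[OF p])
    then show ?thesis using double_sum_eq_usum[of n "ip p" x] by (simp add: ip_commute)
  qed
  finally have ns: "(norm2 p s)\<^sup>2 = \<kappa>\<^sup>2 * (real n + 2 * usum (ip p) n x)" .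
  have "loclik p n \<kappa> \<theta> x = exp (dot p \<theta> s) / vconst p \<kappa> ^ n" for \<theta>
    by (simp add: loclik_def ds exp_sum prod_dividef)
  then have "(LINT \<theta>|\<mu> p. loclik p n \<kappa> (svec p \<theta>) x) = (LINT \<theta>|\<mu> p. exp (dot p (svec p \<theta>) s)) / vconst p \<kappa> ^ n"
    by simp
  also have "(LINT \<theta>|\<mu> p. exp (dot p (svec p \<theta>) s)) = (LINT \<theta>|\<mu> p. exp (dot p \<theta> s))"
    by (rule integral_svec[OF p]) measurable
  also have "... = bessel_series p ((norm2 p s)\<^sup>2 / (2 * real p))" by (rule integral_exp_dot[OF p s])
  finally show ?thesis by (simp add: lik_def ns)
qed

text \<open>The reflection that exchanges the two locations preserves uniform sampling and
  \<open>F\<close>, and it turns one likelihood ratio into the other.\<close>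

lemma integral_loclik_invariant:
  assumes \<theta>: "\<theta> \<in> unit_sphere p" and \<theta>': "\<theta>' \<in> unit_sphere p"
    and F [measurable]: "F \<in> borel_measurable (usample p n)"
    and inv: "\<And>v x. v \<in> unit_sphere p \<Longrightarrow> x \<in> space (usample p n) \<Longrightarrow> \<forall>i\<in>{1..n}. x i \<in> unit_sphere p \<Longrightarrow> F (srefl p n v x) = F x"
  shows "(LINT x|usample p n. F x * loclik p n \<kappa> \<theta> x) = (LINT x|usample p n. F x * loclik p n \<kappa> \<theta>' x)"
proof (cases "\<theta> = \<theta>'")
  case False
  obtain v where v: "v \<in> unit_sphere p" "hrefl p v \<theta> = \<theta>'" using hrefl_swap[OF \<theta> \<theta>' False] .
  have p: "p > 0" by (rule sphere_imp_pos[OF \<theta>])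
  note [measurable] = unit_sphere_space[OF \<theta>] unit_sphere_space[OF \<theta>'] measurable_srefl[OF v(1), of n]
  have "(LINT x|usample p n. F x * loclik p n \<kappa> \<theta> x) = (LINT x|distr (usample p n) (usample p n) (srefl p n v). F x * loclik p n \<kappa> \<theta> x)"
    by (simp only: distr_usample_srefl[OF v(1)])
  also have "... = (LINT x|usample p n. F (srefl p n v x) * loclik p n \<kappa> \<theta> (srefl p n v x))" by (rule integral_distr) measurable
  also have "... = (LINT x|usample p n. F x * loclik p n \<kappa> \<theta>' x)"
  proof (rule integral_cong_AE)
    show "AE x in usample p n. F (srefl p n v x) * loclik p n \<kappa> \<theta> (srefl p n v x) = F x * loclik p n \<kappa> \<theta>' x"
      using AE_usample_sphere[OF p] AE_space
    proof eventually_elim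
      fix x assume xs: "x \<in> space (usample p n)" and x: "\<forall>i\<in>{1..n}. x i \<in> unit_sphere p"
      have "dot p (svec p (srefl p n v x i)) \<theta> = dot p (svec p (x i)) \<theta>'" if i: "i \<in> {1..n}" for i
        using x i hrefl_sphere[OF v(1)] v(2) by (simp add: srefl_def svec_def dot_hrefl_adjoint)
      then have "loclik p n \<kappa> \<theta> (srefl p n v x) = loclik p n \<kappa> \<theta>' x" unfolding loclik_def by (intro prod.cong) auto
      then show "F (srefl p n v x) * loclik p n \<kappa> \<theta> (srefl p n v x) = F x * loclik p n \<kappa> \<theta>' x"
        using inv[OF v(1) xs x] by simp
    qed
  qed measurable
  finally show ?thesis .
qed simp

lemma measurable_lik [measurable]:
  assumes p: "p > 0"
  shows "lik p n \<kappa> \<in> borel_measurable (usample p n)"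
proof -
  have "(\<lambda>(x, \<theta>). loclik p n \<kappa> (svec p \<theta>) x) \<in> borel_measurable (usample p n \<Otimes>\<^sub>M \<mu> p)" by measurable
  then have "(\<lambda>x. LINT \<theta>|\<mu> p. loclik p n \<kappa> (svec p \<theta>) x) \<in> borel_measurable (usample p n)"
    by (rule U.borel_measurable_lebesgue_integral)
  then show ?thesis by (simp add: integral_loclik_average[OF p])
qed

lemma lik_nonneg: "p > 0 \<Longrightarrow> 0 \<le> lik p n \<kappa> x"
  using loclik_bounds(1)[OF _ svec_sphere] unfolding integral_loclik_average[symmetric] by (intro lint_nonneg) auto

lemma lik_le: "p > 0 \<Longrightarrow> x \<in> space (usample p n) \<Longrightarrow> lik p n \<kappa> x \<le> exp \<bar>\<kappa>\<bar> ^ n"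
proof -
  assume p: "p > 0" and x [measurable]: "x \<in> space (usample p n)"
  have "norm (LINT \<theta>|\<mu> p. loclik p n \<kappa> (svec p \<theta>) x) \<le> exp \<bar>\<kappa>\<bar> ^ n"
    using loclik_bounds[OF p svec_sphere[OF p]] by (intro U.norm_integral_le_const) auto
  then show ?thesis by (simp add: integral_loclik_average[OF p])
qed

text \<open>The left side is the same for every location, so it may be averaged over a uniform one;
  Fubini's theorem then moves the average inside.\<close>

lemma integral_loclik_eq_lik:
  assumes \<theta>: "\<theta> \<in> unit_sphere p"
    and F [measurable]: "F \<in> borel_measurable (usample p n)" and Fb: "\<And>x. \<bar>F x\<bar> \<le> 1"
    and inv: "\<And>v x. v \<in> unit_sphere p \<Longrightarrow> x \<in> space (usample p n) \<Longrightarrow> \<forall>i\<in>{1..n}. x i \<in> unit_sphere p \<Longrightarrow> F (srefl p n v x) = F x"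
  shows "(LINT x|usample p n. F x * loclik p n \<kappa> \<theta> x) = (LINT x|usample p n. F x * lik p n \<kappa> x)"
proof -
  have p: "p > 0" by (rule sphere_imp_pos[OF \<theta>])
  interpret S: prob_space "usample p n" by (rule prob_space_usample)
  interpret P: pair_prob_space "\<mu> p" "usample p n" ..
  have I: "integrable (\<mu> p \<Otimes>\<^sub>M usample p n) (\<lambda>(\<theta>, x). F x * loclik p n \<kappa> (svec p \<theta>) x)"
  proof (rule P.P.integrable_bounded)
    show "(\<lambda>(\<theta>, x). F x * loclik p n \<kappa> (svec p \<theta>) x) \<in> borel_measurable (\<mu> p \<Otimes>\<^sub>M usample p n)" by measurable
    show "norm (case z of (\<theta>, x) \<Rightarrow> F x * loclik p n \<kappa> (svec p \<theta>) x) \<le> 1 * exp \<bar>\<kappa>\<bar> ^ n" for z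
    proof (cases z)
      case (Pair \<theta> x)
      show ?thesis unfolding Pair prod.case real_norm_def abs_mult
        using Fb[of x] loclik_bounds[OF p svec_sphere[OF p], of n \<kappa> \<theta> x] by (intro mult_mono) auto
    qed
  qed
  have "(LINT x|usample p n. F x * loclik p n \<kappa> \<theta> x) = (LINT \<theta>'|\<mu> p. LINT x|usample p n. F x * loclik p n \<kappa> \<theta> x)"
    using U.prob_space by simp
  also have "... = (LINT \<theta>'|\<mu> p. LINT x|usample p n. F x * loclik p n \<kappa> (svec p \<theta>') x)"
  proof (rule lint_cong[OF refl])
    fix \<theta>' :: rseq
    show "(LINT x|usample p n. F x * loclik p n \<kappa> \<theta> x) = (LINT x|usample p n. F x * loclik p n \<kappa> (svec p \<theta>') x)"
      by (rule integral_loclik_invariant[where F=F, OF \<theta> svec_sphere[OF p] F inv])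
  qed
  also have "... = (LINT x|usample p n. LINT \<theta>'|\<mu> p. F x * loclik p n \<kappa> (svec p \<theta>') x)"
    by (rule P.Fubini_integral[OF I, symmetric])
  also have "... = (LINT x|usample p n. F x * lik p n \<kappa> x)" by (simp add: integral_loclik_average[OF p])
  finally show ?thesis .
qed

lemma measure_PiM_FvML_eq_lik:
  assumes \<theta>: "\<theta> \<in> unit_sphere p" and A [measurable]: "A \<in> sets (usample p n)"
    and inv: "\<And>v x. v \<in> unit_sphere p \<Longrightarrow> x \<in> space (usample p n) \<Longrightarrow> \<forall>i\<in>{1..n}. x i \<in> unit_sphere p \<Longrightarrow> srefl p n v x \<in> A \<longleftrightarrow> x \<in> A"
  shows "measure (PiM {1..n} (\<lambda>_. FvML p \<kappa> \<theta>)) A = (LINT x|usample p n. indicator A x * lik p n \<kappa> x)"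
proof -
  have p: "p > 0" by (rule sphere_imp_pos[OF \<theta>])
  note [measurable] = unit_sphere_space[OF \<theta>]
  interpret S: prob_space "usample p n" by (rule prob_space_usample)
  have I: "integrable (usample p n) (\<lambda>x. indicator A x * loclik p n \<kappa> \<theta> x)"
    using loclik_bounds[OF p \<theta>] by (intro S.integrable_bounded[of _ "exp \<bar>\<kappa>\<bar> ^ n"]) (auto simp: indicator_def)
  have "emeasure (PiM {1..n} (\<lambda>_. FvML p \<kappa> \<theta>)) A = (\<integral>\<^sup>+x. ennreal (indicator A x * loclik p n \<kappa> \<theta> x) \<partial>usample p n)"
    unfolding PiM_FvML[OF \<theta>] using loclik_bounds(1)[OF p \<theta>, of n \<kappa>]
    by (subst emeasure_density) (auto simp: indicator_def intro!: nn_integral_cong)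
  also have "... = ennreal (LINT x|usample p n. indicator A x * loclik p n \<kappa> \<theta> x)"
    using I loclik_bounds(1)[OF p \<theta>, of n \<kappa>] by (intro nn_integral_eq_integral) auto
  finally have "measure (PiM {1..n} (\<lambda>_. FvML p \<kappa> \<theta>)) A = (LINT x|usample p n. indicator A x * loclik p n \<kappa> \<theta> x)"
    using loclik_bounds(1)[OF p \<theta>, of n \<kappa>] by (simp add: measure_def lint_nonneg)
  also have "... = (LINT x|usample p n. indicator A x * lik p n \<kappa> x)"
  proof (rule integral_loclik_eq_lik[where F="indicator A", OF \<theta>])
    show "indicat_real A (srefl p n v x) = indicat_real A x"
      if "v \<in> unit_sphere p" "x \<in> space (usample p n)" "\<forall>i\<in>{1..n}. x i \<in> unit_sphere p" for v x
      using inv[OF that] by (simp add: indicator_def)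
  qed (auto simp: indicator_def)
  finally show ?thesis .
qed

lemma integral_lik:
  assumes p: "p > 0"
  shows "(LINT x|usample p n. lik p n \<kappa> x) = 1"
proof -
  have \<theta>: "unitv p 0 \<in> unit_sphere p" by (rule unitv_sphere[OF p])
  interpret F: prob_space "FvML p \<kappa> (unitv p 0)" by (rule prob_space_FvML[OF \<theta>])
  interpret PF: prob_space "PiM {1..n} (\<lambda>_. FvML p \<kappa> (unitv p 0))" by (intro prob_space_PiM F.prob_space_axioms)
  have sp: "space (PiM {1..n} (\<lambda>_. FvML p \<kappa> (unitv p 0))) = space (usample p n)" by (simp add: space_PiM FvML_def)
  have "1 = measure (PiM {1..n} (\<lambda>_. FvML p \<kappa> (unitv p 0))) (space (usample p n))" using PF.prob_space unfolding sp by simp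
  also have "... = (LINT x|usample p n. indicator (space (usample p n)) x * lik p n \<kappa> x)"
    using measurable_space[OF measurable_srefl] by (intro measure_PiM_FvML_eq_lik[OF \<theta>]) auto
  also have "... = (LINT x|usample p n. lik p n \<kappa> x)" by (intro lint_cong) auto
  finally show ?thesis by simp
qed

section \<open>Asymptotics of the likelihood ratio\<close>

lemma kappa_squared:
  assumes "\<kappa> = \<tau>s * real p powr (3/4) / sqrt (real n)"
  shows "\<kappa>\<^sup>2 = \<tau>s\<^sup>2 * (real p * sqrt p) / real n"
proof -
  have "(real p powr (3/4))\<^sup>2 = real p * sqrt p"
  proof (cases "p = 0")
    case False
    have "(real p powr (3/4))\<^sup>2 = real p powr (3/4 + 3/4)" unfolding powr_add by (simp add: power2_eq_square)
    also have "... = real p powr (1 + 1/2)" by simp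
    also have "... = real p * sqrt p" using False by (simp only: powr_add powr_half_sqrt) simp
    finally show ?thesis .
  qed simp
  then show ?thesis unfolding assms by (simp add: power_divide power_mult_distrib)
qed

text \<open>The bounded sequence \<open>r\<close> takes the place of the statistic. The argument
  \<open>X n\<close> of the upper series is about \<open>\<tau>^2 * sqrt (p n) / 2\<close>, so that
  \<open>X n ^ 2 / p n\<close> tends to \<open>\<tau>^4 / 4 = c^2 / 2\<close> and the series is
  about \<open>exp (X n - c^2 / 2)\<close>. The lower power is about \<open>exp (n * y n)\<close>,
  which leaves \<open>exp (d n * r n - c^2 / 2)\<close>, and \<open>d n\<close> tends to
  \<open>c\<close>.\<close>

lemma lik_sequence_asymp:
  fixes p :: "nat \<Rightarrow> nat" and \<tau>s r :: rseq
  assumes p: "filterlim p at_top sequentially" and \<tau>s: "\<tau>s \<longlonglongrightarrow> \<tau>" and \<tau>: "\<tau> > 0" and r: "\<And>n. \<bar>r n\<bar> \<le> B"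
  defines "y \<equiv> \<lambda>n. (\<tau>s n)\<^sup>2 * sqrt (p n) / (2 * real n)"
    and "d \<equiv> \<lambda>n. (\<tau>s n)\<^sup>2 / (real n * nrm n)"
  shows "(\<lambda>n. bessel_series (p n) (real n * y n + d n * r n) / bessel_series (p n) (y n) ^ n
      - exp (\<tau>\<^sup>2 / sqrt 2 * r n - (\<tau>\<^sup>2 / sqrt 2)\<^sup>2 / 2)) \<longlonglongrightarrow> 0"
proof -
  define c where "c = \<tau>\<^sup>2 / sqrt 2"
  define X where "X n = real n * y n + d n * r n" for n
  have B: "B \<ge> 0" using r[of 0] by linarith
  have pr: "filterlim (\<lambda>n. real (p n)) at_top sequentially" by (rule filterlim_compose[OF filterlim_real_sequentially p])
  have sp: "filterlim (\<lambda>n. sqrt (p n)) at_top sequentially" by (rule filterlim_compose[OF sqrt_at_top pr])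
  have isp: "(\<lambda>n. 1 / sqrt (p n)) \<longlonglongrightarrow> 0"
    by (rule tendsto_divide_0[OF tendsto_const filterlim_at_top_imp_at_infinity[OF sp]])
  have nn: "(\<lambda>n. real n * nrm n) \<longlonglongrightarrow> sqrt 2"
  proof -
    have "(\<lambda>n. sqrt (2 * real n / (real n - 1))) \<longlonglongrightarrow> sqrt 2" by (intro tendsto_real_sqrt) real_asymp
    moreover have "\<forall>\<^sub>F n in sequentially. sqrt (2 * real n / (real n - 1)) = real n * nrm n" using eventually_ge_at_top[of 2]
    proof eventually_elim
      fix n :: nat assume n: "2 \<le> n"
      have "(real n * nrm n)\<^sup>2 = 2 * real n / (real n - 1)" using n by (simp add: power_mult_distrib nrm_sq) (simp add: power2_eq_square)
      moreover have "real n * nrm n \<ge> 0" by simp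
      ultimately show "sqrt (2 * real n / (real n - 1)) = real n * nrm n" by (metis real_sqrt_unique)
    qed
    ultimately show ?thesis by (rule Lim_transform_eventually)
  qed
  have d: "d \<longlonglongrightarrow> c" unfolding d_def c_def by (intro tendsto_intros nn \<tau>s) simp
  have bdd0: "(\<lambda>n. a n * r n) \<longlonglongrightarrow> 0" if a: "a \<longlonglongrightarrow> 0" for a :: rseq
  proof (rule tendsto_0_le[OF a, where K=B])
    show "\<forall>\<^sub>F n in sequentially. norm (a n * r n) \<le> norm (a n) * B"
      using r by (intro always_eventually allI) (simp add: abs_mult mult_left_mono)
  qed
  have Xs: "(\<lambda>n. X n / sqrt (p n)) \<longlonglongrightarrow> \<tau>\<^sup>2 / 2"
  proof -
    have "(\<lambda>n. (\<tau>s n)\<^sup>2 / 2 + (d n * (1 / sqrt (p n))) * r n) \<longlonglongrightarrow> \<tau>\<^sup>2 / 2 + 0"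
      by (intro tendsto_intros \<tau>s bdd0) (use tendsto_mult[OF d isp] in simp_all)
    moreover have "\<forall>\<^sub>F n in sequentially. (\<tau>s n)\<^sup>2 / 2 + (d n * (1 / sqrt (p n))) * r n = X n / sqrt (p n)"
      using eventually_gt_at_top[of 0] filterlim_at_top_dense[THEN iffD1, OF pr, rule_format, of 0]
    proof eventually_elim
      fix n assume "0 < n" "0 < real (p n)"
      then show "(\<tau>s n)\<^sup>2 / 2 + (d n * (1 / sqrt (p n))) * r n = X n / sqrt (p n)" by (simp add: X_def y_def add_divide_distrib)
    qed
    ultimately show ?thesis by (simp add: Lim_transform_eventually)
  qed
  have X2: "(\<lambda>n. (X n)\<^sup>2 / real (p n)) \<longlonglongrightarrow> c\<^sup>2 / 2"
  proof -
    have "(\<lambda>n. (X n / sqrt (p n))\<^sup>2) \<longlonglongrightarrow> (\<tau>\<^sup>2 / 2)\<^sup>2" by (intro tendsto_intros Xs)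
    moreover have "(\<tau>\<^sup>2 / 2)\<^sup>2 = c\<^sup>2 / 2" by (simp add: c_def power_divide)
    ultimately show ?thesis by (simp add: power_divide)
  qed
  have Xb: "\<forall>\<^sub>F n in sequentially. X n / sqrt (p n) < \<tau>\<^sup>2 / 2 + 1" by (rule order_tendstoD[OF Xs]) simp
  have y2: "(\<lambda>n. real n * ((y n)\<^sup>2 / real (p n))) \<longlonglongrightarrow> 0"
  proof -
    have "(\<lambda>n. (\<tau>s n)^4 / 4 * (1 / real n)) \<longlonglongrightarrow> \<tau>^4 / 4 * 0"
      by (intro tendsto_intros \<tau>s lim_1_over_n) simp
    moreover have "\<forall>\<^sub>F n in sequentially. (\<tau>s n)^4 / 4 * (1 / real n) = real n * ((y n)\<^sup>2 / real (p n))"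
      using eventually_gt_at_top[of 0] filterlim_at_top_dense[THEN iffD1, OF pr, rule_format, of 0]
    proof eventually_elim
      fix n assume *: "0 < n" "0 < real (p n)"
      have "(y n)\<^sup>2 = ((\<tau>s n)\<^sup>2)\<^sup>2 * real (p n) / (4 * (real n)\<^sup>2)" by (simp add: y_def power_divide power_mult_distrib)
      also have "((\<tau>s n)\<^sup>2)\<^sup>2 = (\<tau>s n)^4" by simp
      finally show "(\<tau>s n)^4 / 4 * (1 / real n) = real n * ((y n)\<^sup>2 / real (p n))" using * by (simp add: power2_eq_square)
    qed
    ultimately show ?thesis by (simp add: Lim_transform_eventually)
  qed
  have y0: "y n \<ge> 0" for n by (simp add: y_def)
  \<comment> \<open>The two exponential bounds of the series pinch \<open>V\<close>: the exponent is
    off by at most \<open>n * y n ^ 2 / p n\<close>, which is of order \<open>1 / n\<close>.\<close>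
  define V where "V n = exp (real n * y n) / bessel_series (p n) (y n) ^ n" for n
  have V: "V \<longlonglongrightarrow> 1"
  proof (rule tendsto_sandwich[OF _ _ tendsto_const])
    have "(\<lambda>n. exp (real n * ((y n)\<^sup>2 / real (p n)))) \<longlonglongrightarrow> exp 0" by (intro tendsto_intros y2)
    then show "(\<lambda>n. exp (real n * ((y n)\<^sup>2 / real (p n)))) \<longlonglongrightarrow> 1" by simp
    have b0: "bessel_series (p n) (y n) > 0" for n using bessel_series_ge_1[OF y0, of "p n" n] by linarith
    show "\<forall>\<^sub>F n in sequentially. 1 \<le> V n"
    proof (intro always_eventually allI)
      fix n
      have "bessel_series (p n) (y n) ^ n \<le> exp (y n) ^ n" using b0[of n] by (intro power_mono bessel_series_le_exp y0) auto
      then show "1 \<le> V n" using b0[of n] by (simp add: V_def exp_of_nat_mult[symmetric])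
    qed
    show "\<forall>\<^sub>F n in sequentially. V n \<le> exp (real n * ((y n)\<^sup>2 / real (p n)))"
    proof (intro always_eventually allI)
      fix n
      have "exp (y n - (y n)\<^sup>2 / real (p n)) ^ n \<le> bessel_series (p n) (y n) ^ n" by (intro power_mono bessel_series_ge_exp y0) auto
      then have "exp (real n * y n - real n * ((y n)\<^sup>2 / real (p n))) \<le> bessel_series (p n) (y n) ^ n"
        by (simp only: exp_of_nat_mult[symmetric] right_diff_distrib)
      then have "exp (real n * y n) \<le> exp (real n * ((y n)\<^sup>2 / real (p n))) * bessel_series (p n) (y n) ^ n"
        by (simp add: exp_diff field_simps)
      then show "V n \<le> exp (real n * ((y n)\<^sup>2 / real (p n)))" using b0[of n] by (simp add: V_def divide_le_eq)
    qed
  qed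
  define G where "G n = bessel_series (p n) (X n) * exp (- X n)" for n
  have GE: "(\<lambda>n. G n - exp (- ((X n)\<^sup>2 / real (p n)))) \<longlonglongrightarrow> 0"
  proof (rule tendstoI)
    fix \<epsilon> :: real assume \<epsilon>: "\<epsilon> > 0"
    define A where "A = \<tau>\<^sup>2 / 2 + 1"
    have A: "A > 0" by (simp add: A_def add_nonneg_pos)
    have "\<forall>\<^sub>F n in sequentially. X n / sqrt (p n) > 0" by (rule order_tendstoD[OF Xs]) (use \<tau> in simp)
    moreover have "\<forall>\<^sub>F n in sequentially. \<forall>x. 0 \<le> x \<and> x \<le> A * sqrt (p n) \<longrightarrow>
        \<bar>bessel_series (p n) x * exp (- x) - exp (- (x\<^sup>2 / real (p n)))\<bar> \<le> \<epsilon> / 2"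
      by (rule eventually_compose_filterlim[OF bessel_series_asymp p]) (use A \<epsilon> in auto)
    ultimately show "\<forall>\<^sub>F n in sequentially. dist (G n - exp (- ((X n)\<^sup>2 / real (p n)))) 0 < \<epsilon>"
      using Xb filterlim_at_top_dense[THEN iffD1, OF pr, rule_format, of 0]
    proof eventually_elim
      case (elim n)
      then have "0 \<le> X n" "X n \<le> A * sqrt (p n)" by (auto simp: A_def zero_less_divide_iff divide_less_eq)
      then show ?case using elim(2) \<epsilon> unfolding G_def by force
    qed
  qed
  have G: "G \<longlonglongrightarrow> exp (- (c\<^sup>2 / 2))"
  proof -
    have "(\<lambda>n. (G n - exp (- ((X n)\<^sup>2 / real (p n)))) + exp (- ((X n)\<^sup>2 / real (p n)))) \<longlonglongrightarrow> 0 + exp (- (c\<^sup>2 / 2))"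
      by (intro tendsto_add GE tendsto_intros X2)
    then show ?thesis by simp
  qed
  \<comment> \<open>With \<open>exp (c * r n)\<close> pulled out, which stays bounded along with
    \<open>r\<close>, it remains to see that \<open>q\<close> vanishes in the limit.\<close>
  define q where "q n = exp ((d n - c) * r n) * (G n * V n) - exp (- (c\<^sup>2 / 2))" for n
  have q: "q \<longlonglongrightarrow> 0"
  proof -
    have "(\<lambda>n. exp ((d n - c) * r n) * (G n * V n) - exp (- (c\<^sup>2 / 2))) \<longlonglongrightarrow> exp 0 * (exp (- (c\<^sup>2 / 2)) * 1) - exp (- (c\<^sup>2 / 2))"
      by (intro tendsto_intros G V bdd0) (use tendsto_diff[OF d tendsto_const[of c]] in simp)
    then show ?thesis by (simp add: q_def[abs_def])
  qed
  have eq: "bessel_series (p n) (X n) / bessel_series (p n) (y n) ^ n - exp (c * r n - c\<^sup>2 / 2) = exp (c * r n) * q n" for n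
  proof -
    have "exp (c * r n) * (exp ((d n - c) * r n) * (G n * V n))
        = (exp (c * r n) * exp ((d n - c) * r n) * exp (- X n) * exp (real n * y n)) * (bessel_series (p n) (X n) / bessel_series (p n) (y n) ^ n)"
      by (simp add: G_def V_def)
    also have "exp (c * r n) * exp ((d n - c) * r n) * exp (- X n) * exp (real n * y n) = 1"
      unfolding exp_add[symmetric] by (simp add: X_def algebra_simps)
    finally have 1: "exp (c * r n) * (exp ((d n - c) * r n) * (G n * V n)) = bessel_series (p n) (X n) / bessel_series (p n) (y n) ^ n" by simp
    have 2: "exp (c * r n) * exp (- (c\<^sup>2 / 2)) = exp (c * r n - c\<^sup>2 / 2)" by (simp add: exp_add[symmetric])
    show ?thesis unfolding q_def right_diff_distrib 1 2 ..
  qed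
  have "(\<lambda>n. exp (c * r n) * q n) \<longlonglongrightarrow> 0"
  proof (rule tendsto_0_le[OF q, where K="exp (\<bar>c\<bar> * B)"])
    show "\<forall>\<^sub>F n in sequentially. norm (exp (c * r n) * q n) \<le> norm (q n) * exp (\<bar>c\<bar> * B)"
    proof (intro always_eventually allI)
      fix n
      have "c * r n \<le> \<bar>c\<bar> * B"
        using mult_mono[OF order_refl r[of n], of "\<bar>c\<bar>"] abs_ge_self[of "c * r n"] by (simp add: abs_mult)
      then show "norm (exp (c * r n) * q n) \<le> norm (q n) * exp (\<bar>c\<bar> * B)" by (simp add: abs_mult mult.commute mult_left_mono)
    qed
  qed
  then have "(\<lambda>n. bessel_series (p n) (X n) / bessel_series (p n) (y n) ^ n - exp (c * r n - c\<^sup>2 / 2)) \<longlonglongrightarrow> 0"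
    unfolding eq .
  then show ?thesis unfolding X_def c_def .
qed

definition rstat :: "nat \<Rightarrow> nat \<Rightarrow> sample_pts \<Rightarrow> real" where
  "rstat p n = zstat p n (\<lambda>t. sqrt p * t)"

lemma measurable_rstat [measurable]: "rstat p n \<in> borel_measurable (usample p n)" unfolding rstat_def by measurable

lemma lik_eq_rstat:
  assumes p: "p > 0" and n: "n \<ge> 2" and \<kappa>: "\<kappa> = \<tau>s * real p powr (3/4) / sqrt (real n)"
  defines "y \<equiv> \<tau>s\<^sup>2 * sqrt p / (2 * real n)"
  shows "lik p n \<kappa> x = bessel_series p (real n * y + \<tau>s\<^sup>2 / (real n * nrm n) * rstat p n x) / bessel_series p y ^ n"
proof -
  have nrm: "nrm n > 0" using n nrm_sq[OF n] nrm_nonneg[of n] by (cases "nrm n = 0") (auto simp: less_le)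
  have y: "\<kappa>\<^sup>2 / (2 * real p) = y" unfolding kappa_squared[OF \<kappa>] y_def using p by simp
  have R: "rstat p n x = nrm n * (sqrt p * usum (ip p) n x)" unfolding rstat_def zstat_def usum_def by (simp add: sum_distrib_left)
  have "\<kappa>\<^sup>2 * (real n + 2 * usum (ip p) n x) / (2 * real p) = y * (real n + 2 * usum (ip p) n x)" unfolding y[symmetric] by simp
  also have "... = real n * y + \<tau>s\<^sup>2 / (real n * nrm n) * rstat p n x" unfolding R y_def using n nrm by (simp add: field_simps)
  finally show ?thesis unfolding lik_def vconst_def y by simp
qed

locale fvml_asymptotics =
  fixes p :: "nat \<Rightarrow> nat" and \<tau>s \<kappa> :: rseq and \<tau> :: real
  assumes p_lim: "filterlim p at_top sequentially"
    and tau_lim: "\<tau>s \<longlonglongrightarrow> \<tau>" and tau_pos: "\<tau> > 0"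
    and kappa: "\<And>n. n \<ge> 1 \<Longrightarrow> \<kappa> n = \<tau>s n * real (p n) powr (3/4) / sqrt (real n)"
begin

definition c :: real where "c = \<tau>\<^sup>2 / sqrt 2"

lemma eventually_p_ge: "\<forall>\<^sub>F n in sequentially. p n \<ge> N" using p_lim by (simp add: filterlim_at_top)

text \<open>A failure of uniformity would give a bounded sequence of bad arguments; along it
  \<open>lik_sequence_asymp\<close> applies.\<close>

lemma lik_uniform:
  assumes \<epsilon>: "\<epsilon> > 0" and B: "B \<ge> 0"
  shows "\<forall>\<^sub>F n in sequentially. \<forall>x. \<bar>rstat (p n) n x\<bar> \<le> B \<longrightarrow>
    \<bar>lik (p n) n (\<kappa> n) x - exp (c * rstat (p n) n x - c\<^sup>2 / 2)\<bar> \<le> \<epsilon>"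
proof -
  define h where "h n r = bessel_series (p n) (real n * ((\<tau>s n)\<^sup>2 * sqrt (p n) / (2 * real n)) + (\<tau>s n)\<^sup>2 / (real n * nrm n) * r)
      / bessel_series (p n) ((\<tau>s n)\<^sup>2 * sqrt (p n) / (2 * real n)) ^ n - exp (c * r - c\<^sup>2 / 2)" for n r
  define bad where "bad n r \<longleftrightarrow> \<bar>r\<bar> \<le> B \<and> \<bar>h n r\<bar> > \<epsilon>" for n r
  define r where "r n = (if \<exists>r. bad n r then SOME r. bad n r else 0)" for n
  have r: "bad n (r n)" if "bad n s" for n s using that someI[of "bad n" s] by (auto simp: r_def)
  have rB: "\<bar>r n\<bar> \<le> B" for n
  proof (cases "\<exists>s. bad n s")
    case True
    then show ?thesis using r by (auto simp: bad_def)
  qed (use B in \<open>simp add: r_def\<close>)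
  have "(\<lambda>n. h n (r n)) \<longlonglongrightarrow> 0" unfolding h_def c_def by (rule lik_sequence_asymp[OF p_lim tau_lim tau_pos rB])
  then have "\<forall>\<^sub>F n in sequentially. \<bar>h n (r n)\<bar> < \<epsilon>" using \<epsilon> by (auto dest: tendstoD[of _ _ _ \<epsilon>])
  then show ?thesis using eventually_ge_at_top[of 2] eventually_p_ge[of 1]
  proof eventually_elim
    case (elim n)
    show ?case
    proof (intro allI impI)
      fix x assume x: "\<bar>rstat (p n) n x\<bar> \<le> B"
      have "\<not> bad n (rstat (p n) n x)" using r[of n "rstat (p n) n x"] elim(1) unfolding bad_def by linarith
      then have "\<bar>h n (rstat (p n) n x)\<bar> \<le> \<epsilon>" using x by (auto simp: bad_def)
      moreover have "p n > 0" using elim by linarith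
      moreover have "\<kappa> n = \<tau>s n * real (p n) powr (3/4) / sqrt (real n)" using elim by (intro kappa) auto
      ultimately show "\<bar>lik (p n) n (\<kappa> n) x - exp (c * rstat (p n) n x - c\<^sup>2 / 2)\<bar> \<le> \<epsilon>"
        using elim(2) by (simp only: lik_eq_rstat h_def)
    qed
  qed
qed

end

section \<open>Exponentially tilted sequences and contiguity\<close>

lemma norm_integral_le_integral:
  fixes f :: "'a \<Rightarrow> 'b::{banach, second_countable_topology}"
  assumes f: "integrable N f" and h: "integrable N h" and le: "\<And>x. x \<in> space N \<Longrightarrow> norm (f x) \<le> h x"
  shows "norm (LINT x|N. f x) \<le> (LINT x|N. h x)"
proof -
  have "norm (LINT x|N. f x) \<le> (LINT x|N. norm (f x))" by (rule integral_norm_bound)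
  also have "... \<le> (LINT x|N. h x)" using f h le by (intro integral_mono) auto
  finally show ?thesis .
qed

text \<open>Continuous rather than an indicator, so that weak convergence applies to truncated
  tilts.\<close>

definition cutoff :: "real \<Rightarrow> real \<Rightarrow> real" where
  "cutoff K r = max 0 (min 1 (K + 1 - \<bar>r\<bar>))"

lemma cutoff_01: "0 \<le> cutoff K r" "cutoff K r \<le> 1" by (auto simp: cutoff_def)

lemma cutoff_eq_0: "\<bar>r\<bar> > K + 1 \<Longrightarrow> cutoff K r = 0" by (simp add: cutoff_def)

lemma measurable_cutoff [measurable]: "cutoff K \<in> borel_measurable borel" unfolding cutoff_def by measurable

lemma isCont_cutoff: "isCont (cutoff K) r" unfolding cutoff_def by (intro continuous_intros)

lemma cutoff_tendsto_1: "(\<lambda>k. cutoff (real k) r) \<longlonglongrightarrow> 1"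
proof (rule tendsto_eventually)
  show "\<forall>\<^sub>F k in sequentially. cutoff (real k) r = 1" using eventually_ge_at_top[of "nat \<lceil>\<bar>r\<bar>\<rceil>"]
  proof eventually_elim
    fix k assume "nat \<lceil>\<bar>r\<bar>\<rceil> \<le> k"
    then have "\<bar>r\<bar> \<le> real k" by linarith
    then show "cutoff (real k) r = 1" by (simp add: cutoff_def)
  qed
qed

text \<open>\<open>L n\<close> is a likelihood ratio that is, locally uniformly, the exponential
  tilt of a statistic \<open>R n\<close>. The limit of \<open>R n\<close> is a variable on a space
  \<open>P\<close> of free choice, so that \<open>P\<close> can also carry the limits of other
  statistics.\<close>

locale exponential_tilt =
  fixes M :: "nat \<Rightarrow> 'a measure" and L R :: "nat \<Rightarrow> 'a \<Rightarrow> real" and c :: real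
    and P :: "'b measure" and R' :: "'b \<Rightarrow> real"
  assumes M: "\<And>n. prob_space (M n)"
    and L [measurable]: "\<And>n. L n \<in> borel_measurable (M n)"
    and L_nonneg: "\<And>n x. 0 \<le> L n x"
    and L_int: "\<And>n. integrable (M n) (L n)"
    and L_1: "\<forall>\<^sub>F n in sequentially. (LINT x|M n. L n x) = 1"
    and R [measurable]: "\<And>n. R n \<in> borel_measurable (M n)"
    and unif: "\<And>B \<epsilon>. B \<ge> 0 \<Longrightarrow> \<epsilon> > 0 \<Longrightarrow>
      \<forall>\<^sub>F n in sequentially. \<forall>x\<in>space (M n). \<bar>R n x\<bar> \<le> B \<longrightarrow> \<bar>L n x - exp (c * R n x - c\<^sup>2 / 2)\<bar> \<le> \<epsilon>"
    and P: "prob_space P" and R' [measurable]: "R' \<in> borel_measurable P"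
    and tilt_int: "integrable P (\<lambda>x. exp (c * R' x - c\<^sup>2 / 2))"
    and tilt_1: "(LINT x|P. exp (c * R' x - c\<^sup>2 / 2)) = 1"
    and R_conv: "\<And>b. (\<lambda>n. LINT x|M n. iexp (b * R n x)) \<longlonglongrightarrow> (LINT x|P. iexp (b * R' x))"
begin

definition g :: "real \<Rightarrow> real \<Rightarrow> real" where
  "g K r = exp (c * r - c\<^sup>2 / 2) * cutoff K r"

lemma measurable_g [measurable]: "g K \<in> borel_measurable borel" unfolding g_def by measurable

lemma g_bound: "\<bar>g K r\<bar> \<le> exp (\<bar>c\<bar> * (\<bar>K\<bar> + 1))"
proof (cases "\<bar>r\<bar> > K + 1")
  case True
  then show ?thesis by (simp add: g_def cutoff_eq_0)
next
  case False
  have "c * r \<le> \<bar>c\<bar> * \<bar>r\<bar>" by (metis abs_ge_self abs_mult)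
  also have "... \<le> \<bar>c\<bar> * (\<bar>K\<bar> + 1)" using False by (intro mult_left_mono) auto
  finally have le: "c * r \<le> \<bar>c\<bar> * (\<bar>K\<bar> + 1)" .
  have "exp (c * r - c\<^sup>2 / 2) \<le> exp (c * r)" by simp
  also have "... \<le> exp (\<bar>c\<bar> * (\<bar>K\<bar> + 1))" using le by (simp only: exp_le_cancel_iff)
  finally have "exp (c * r - c\<^sup>2 / 2) \<le> exp (\<bar>c\<bar> * (\<bar>K\<bar> + 1))" .
  then show ?thesis using mult_mono[of "exp (c * r - c\<^sup>2 / 2)" "exp (\<bar>c\<bar> * (\<bar>K\<bar> + 1))" "cutoff K r" 1] cutoff_01[of K r]
    by (simp add: g_def abs_mult)
qed

lemma truncated_conv:
  assumes Y [measurable]: "\<And>n. Y n \<in> borel_measurable (M n)" "Y' \<in> borel_measurable P"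
    and conv: "\<And>a b. (\<lambda>n. LINT x|M n. iexp (a * Y n x + b * R n x)) \<longlonglongrightarrow> (LINT x|P. iexp (a * Y' x + b * R' x))"
  shows "(\<lambda>n. LINT x|M n. g K (R n x) *\<^sub>R iexp (Y n x)) \<longlonglongrightarrow> (LINT x|P. g K (R' x) *\<^sub>R iexp (Y' x))"
proof -
  have gc: "isCont (g K) r" for r unfolding g_def by (intro continuous_intros isCont_cutoff)
  have "(\<lambda>n. LINT x|M n. (1 * g K (R n x)) *\<^sub>R iexp (Y n x)) \<longlonglongrightarrow> (LINT x|P. (1 * g K (R' x)) *\<^sub>R iexp (Y' x))"
  proof (rule weighted_levy_continuity_iexp[where M=M and P=P and R=R and R'=R' and Y=Y and Y'=Y' and F="\<lambda>_ _. 1" and F'="\<lambda>_. 1"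
        and C=1 and g="g K" and G="exp (\<bar>c\<bar> * (\<bar>K\<bar> + 1))"])
    show "(\<lambda>n. LINT x|M n. 1 *\<^sub>R iexp (a * Y n x + b * R n x)) \<longlonglongrightarrow> (LINT x|P. 1 *\<^sub>R iexp (a * Y' x + b * R' x))" for a b
      using conv[of a b] by (simp only: scaleR_one)
    show "AE x in P. isCont (g K) (R' x)" by (intro AE_I2 gc)
    show "\<bar>g K r\<bar> \<le> exp (\<bar>c\<bar> * (\<bar>K\<bar> + 1))" for r by (rule g_bound)
  qed (rule M P R R' Y measurable_g | simp)+
  then show ?thesis by (simp only: mult_1)
qed

lemma truncated_mass_conv: "(\<lambda>n. LINT x|M n. g K (R n x)) \<longlonglongrightarrow> (LINT x|P. g K (R' x))"
proof -
  interpret M: prob_space "M n" for n by (rule M)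
  interpret P: prob_space P by (rule P)
  have "(\<lambda>n. LINT x|M n. g K (R n x) *\<^sub>R iexp 0) \<longlonglongrightarrow> (LINT x|P. g K (R' x) *\<^sub>R iexp 0)"
  proof (rule truncated_conv)
    show "(\<lambda>n. LINT x|M n. iexp (a * 0 + b * R n x)) \<longlonglongrightarrow> (LINT x|P. iexp (a * 0 + b * R' x))" for a b
      using R_conv[of b] by (simp only: mult_zero_right add_0)
  qed measurable
  moreover have "(LINT x|M n. g K (R n x) *\<^sub>R iexp 0) = complex_of_real (LINT x|M n. g K (R n x))" for n by (simp add: scaleR_conv_of_real)
  moreover have "(LINT x|P. g K (R' x) *\<^sub>R iexp 0) = complex_of_real (LINT x|P. g K (R' x))" by (simp add: scaleR_conv_of_real)
  ultimately show ?thesis by (simp only: tendsto_of_real_iff)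
qed

lemma integrable_g:
  "integrable (M n) (\<lambda>x. g K (R n x))" "integrable P (\<lambda>x. g K (R' x))"
proof -
  interpret M: prob_space "M n" by (rule M)
  interpret P: prob_space P by (rule P)
  show "integrable (M n) (\<lambda>x. g K (R n x))" "integrable P (\<lambda>x. g K (R' x))"
    by (rule M.integrable_bounded[where C="exp (\<bar>c\<bar> * (\<bar>K\<bar> + 1))"], use g_bound in simp_all)
       (rule P.integrable_bounded[where C="exp (\<bar>c\<bar> * (\<bar>K\<bar> + 1))"], use g_bound in simp_all)
qed

lemma truncated_mass_limit: "(\<lambda>k. LINT x|P. g (real k) (R' x)) \<longlonglongrightarrow> 1"
proof -
  have "(\<lambda>k. LINT x|P. g (real k) (R' x)) \<longlonglongrightarrow> (LINT x|P. exp (c * R' x - c\<^sup>2 / 2) * 1)" unfolding g_def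
  proof (rule integral_dominated_convergence[OF _ _ tilt_int])
    show "AE x in P. (\<lambda>k. exp (c * R' x - c\<^sup>2 / 2) * cutoff (real k) (R' x)) \<longlonglongrightarrow> exp (c * R' x - c\<^sup>2 / 2) * 1"
      by (intro AE_I2 tendsto_intros cutoff_tendsto_1)
    show "AE x in P. norm (exp (c * R' x - c\<^sup>2 / 2) * cutoff (real k) (R' x)) \<le> exp (c * R' x - c\<^sup>2 / 2)" for k
      using cutoff_01 by (intro AE_I2) (simp add: abs_mult mult_left_le)
  qed measurable
  then show ?thesis using tilt_1 by simp
qed

lemma integrable_L_cutoff: "integrable (M n) (\<lambda>x. L n x * cutoff K (R n x))" "integrable (M n) (\<lambda>x. L n x * (1 - cutoff K (R n x)))"
  using cutoff_01 L_nonneg by (auto intro!: lintegrable_bound[OF L_int] simp: abs_mult mult_left_le)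

lemma L_cutoff_close:
  assumes \<epsilon>: "\<epsilon> > 0" and K: "K \<ge> 0"
  shows "\<forall>\<^sub>F n in sequentially. \<forall>x\<in>space (M n). \<bar>L n x * cutoff K (R n x) - g K (R n x)\<bar> \<le> \<epsilon>"
proof -
  have "\<forall>\<^sub>F n in sequentially. \<forall>x\<in>space (M n). \<bar>R n x\<bar> \<le> K + 1 \<longrightarrow> \<bar>L n x - exp (c * R n x - c\<^sup>2 / 2)\<bar> \<le> \<epsilon>"
    using K \<epsilon> by (intro unif) auto
  then show ?thesis
  proof eventually_elim
    case (elim n)
    show ?case
    proof
      fix x assume x: "x \<in> space (M n)"
      show "\<bar>L n x * cutoff K (R n x) - g K (R n x)\<bar> \<le> \<epsilon>"
      proof (cases "\<bar>R n x\<bar> \<le> K + 1")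
        case True
        have "\<bar>L n x * cutoff K (R n x) - g K (R n x)\<bar> = \<bar>L n x - exp (c * R n x - c\<^sup>2 / 2)\<bar> * cutoff K (R n x)"
          using cutoff_01(1)[of K "R n x"] by (simp add: g_def abs_mult[symmetric] left_diff_distrib[symmetric] flip: abs_mult_pos)
        also have "... \<le> \<epsilon> * 1" using elim x True cutoff_01[of K "R n x"] \<epsilon> by (intro mult_mono) auto
        finally show ?thesis by simp
      qed (use \<epsilon> in \<open>simp add: g_def cutoff_eq_0\<close>)
    qed
  qed
qed

text \<open>No mass of \<open>L n\<close> escapes to large \<open>R n\<close>, because \<open>L n\<close> and its limit both have integral 1.\<close>

lemma tail_small:
  assumes \<epsilon>: "\<epsilon> > 0"
  obtains K where "K \<ge> 0" "\<forall>\<^sub>F n in sequentially. (LINT x|M n. L n x * (1 - cutoff K (R n x))) \<le> \<epsilon>"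
    "(LINT x|P. exp (c * R' x - c\<^sup>2 / 2) * (1 - cutoff K (R' x))) \<le> \<epsilon>"
proof -
  interpret M: prob_space "M n" for n by (rule M)
  have "\<forall>\<^sub>F k in sequentially. (LINT x|P. g (real k) (R' x)) > 1 - \<epsilon> / 3"
    by (rule order_tendstoD[OF truncated_mass_limit]) (use \<epsilon> in simp)
  then obtain k where k: "(LINT x|P. g (real k) (R' x)) > 1 - \<epsilon> / 3" unfolding eventually_sequentially by auto
  define K where "K = real k"
  have "\<forall>\<^sub>F n in sequentially. (LINT x|M n. g K (R n x)) > 1 - \<epsilon> / 3"
    by (rule order_tendstoD[OF truncated_mass_conv]) (use k in \<open>simp add: K_def\<close>)
  moreover have "\<forall>\<^sub>F n in sequentially. \<forall>x\<in>space (M n). \<bar>L n x * cutoff K (R n x) - g K (R n x)\<bar> \<le> \<epsilon> / 3"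
    using \<epsilon> by (intro L_cutoff_close) (auto simp: K_def)
  ultimately have "\<forall>\<^sub>F n in sequentially. (LINT x|M n. L n x * (1 - cutoff K (R n x))) \<le> \<epsilon>" using L_1
  proof eventually_elim
    case (elim n)
    have "(LINT x|M n. g K (R n x) - \<epsilon> / 3) \<le> (LINT x|M n. L n x * cutoff K (R n x))"
    proof (rule integral_mono)
      show "g K (R n x) - \<epsilon> / 3 \<le> L n x * cutoff K (R n x)" if "x \<in> space (M n)" for x using bspec[OF elim(2) that] by linarith
    qed (use integrable_g integrable_L_cutoff in auto)
    then have 1: "(LINT x|M n. g K (R n x)) - \<epsilon> / 3 \<le> (LINT x|M n. L n x * cutoff K (R n x))"
      using integrable_g(1) by (simp add: M.prob_space)
    have "(LINT x|M n. L n x * (1 - cutoff K (R n x))) = (LINT x|M n. L n x - L n x * cutoff K (R n x))" by (simp add: right_diff_distrib)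
    also have "... = 1 - (LINT x|M n. L n x * cutoff K (R n x))" using elim(3) L_int integrable_L_cutoff by simp
    finally show ?case using 1 elim(1) \<epsilon> by linarith
  qed
  moreover have "(LINT x|P. exp (c * R' x - c\<^sup>2 / 2) * (1 - cutoff K (R' x))) \<le> \<epsilon>"
  proof -
    have "(LINT x|P. exp (c * R' x - c\<^sup>2 / 2) * (1 - cutoff K (R' x))) = (LINT x|P. exp (c * R' x - c\<^sup>2 / 2) - g K (R' x))"
      by (simp add: right_diff_distrib g_def)
    also have "... = 1 - (LINT x|P. g K (R' x))" using tilt_1 tilt_int integrable_g(2) by simp
    finally show ?thesis using k \<epsilon> by (simp add: K_def)
  qed
  ultimately show ?thesis using that[of K] by (simp add: K_def)
qed

text \<open>\<open>L n * cutoff K (R n)\<close> is at most \<open>G\<close>, the bound on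
  \<open>g\<close> plus the approximation error 1, so it has a small integral over events of small
  probability. The remaining mass is small by \<open>tail_small\<close>.\<close>

theorem contiguity:
  assumes \<epsilon>: "\<epsilon> > 0"
  obtains \<delta> where "\<delta> > 0" "\<forall>\<^sub>F n in sequentially. \<forall>A\<in>sets (M n). measure (M n) A \<le> \<delta> \<longrightarrow> (LINT x|M n. indicator A x * L n x) \<le> \<epsilon>"
proof -
  interpret M: prob_space "M n" for n by (rule M)
  have "\<epsilon> / 2 > 0" using \<epsilon> by simp
  from tail_small[OF this] obtain K where K: "K \<ge> 0"
    and tail: "\<forall>\<^sub>F n in sequentially. (LINT x|M n. L n x * (1 - cutoff K (R n x))) \<le> \<epsilon> / 2" by auto
  define G where "G = exp (\<bar>c\<bar> * (\<bar>K\<bar> + 1)) + 1"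
  have G: "G > 0" by (simp add: G_def add_pos_pos)
  have "\<forall>\<^sub>F n in sequentially. \<forall>x\<in>space (M n). \<bar>L n x * cutoff K (R n x) - g K (R n x)\<bar> \<le> 1"
    by (rule L_cutoff_close[OF _ K]) simp
  then have "\<forall>\<^sub>F n in sequentially. \<forall>A\<in>sets (M n). measure (M n) A \<le> \<epsilon> / (2 * G) \<longrightarrow> (LINT x|M n. indicator A x * L n x) \<le> \<epsilon>"
    using tail
  proof eventually_elim
    case (elim n)
    show ?case
    proof (intro ballI impI)
      fix A assume A [measurable]: "A \<in> sets (M n)" and m: "measure (M n) A \<le> \<epsilon> / (2 * G)"
      have I: "integrable (M n) (\<lambda>x. indicator A x * L n x)" using integrable_mult_indicator[OF A L_int[of n]] by simp
      have "(LINT x|M n. indicator A x * L n x) \<le> (LINT x|M n. L n x * (1 - cutoff K (R n x)) + indicator A x * G)"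
      proof (rule integral_mono[OF I])
        fix x assume x: "x \<in> space (M n)"
        have "L n x * cutoff K (R n x) \<le> G" using bspec[OF elim(1) x] g_bound[of K "R n x"] unfolding G_def by linarith
        moreover have "0 \<le> L n x * (1 - cutoff K (R n x))" using L_nonneg cutoff_01 by simp
        ultimately show "indicator A x * L n x \<le> L n x * (1 - cutoff K (R n x)) + indicator A x * G"
          by (simp add: indicator_def right_diff_distrib)
      qed (use integrable_L_cutoff in \<open>auto simp: M.emeasure_eq_measure\<close>)
      also have "... = (LINT x|M n. L n x * (1 - cutoff K (R n x))) + measure (M n) A * G"
        using integrable_L_cutoff by (subst Bochner_Integration.integral_add) (auto simp: M.emeasure_eq_measure)
      also have "... \<le> \<epsilon> / 2 + \<epsilon> / (2 * G) * G" using elim(2) m G by (intro add_mono mult_right_mono) auto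
      also have "... = \<epsilon>" using G by simp
      finally show "(LINT x|M n. indicator A x * L n x) \<le> \<epsilon>" .
    qed
  qed
  moreover have "\<epsilon> / (2 * G) > 0" using \<epsilon> G by simp
  ultimately show ?thesis using that by blast
qed

text \<open>Le Cam's third lemma in terms of characteristic functions: truncation makes the tilt a
  bounded continuous weight, and \<open>tail_small\<close> controls what it removes on both
  sides.\<close>

theorem tilted_conv:
  assumes Y [measurable]: "\<And>n. Y n \<in> borel_measurable (M n)" "Y' \<in> borel_measurable P"
    and conv: "\<And>a b. (\<lambda>n. LINT x|M n. iexp (a * Y n x + b * R n x)) \<longlonglongrightarrow> (LINT x|P. iexp (a * Y' x + b * R' x))"
  shows "(\<lambda>n. LINT x|M n. L n x *\<^sub>R iexp (Y n x)) \<longlonglongrightarrow> (LINT x|P. exp (c * R' x - c\<^sup>2 / 2) *\<^sub>R iexp (Y' x))"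
proof (rule tendstoI)
  fix \<epsilon> :: real assume "\<epsilon> > 0"
  \<comment> \<open>The error is made up of one \<delta> each for the tail of \<open>L n\<close>,
    its uniform approximation, the truncated limit, and the tail of the limit; the fifth makes the
    inequality strict.\<close>
  define \<delta> where "\<delta> = \<epsilon> / 5"
  have \<delta>: "\<delta> > 0" "5 * \<delta> = \<epsilon>" using \<open>\<epsilon> > 0\<close> by (auto simp: \<delta>_def)
  interpret M: prob_space "M n" for n by (rule M)
  interpret P: prob_space P by (rule P)
  from tail_small[OF \<delta>(1)] obtain K where K: "K \<ge> 0"
    and tail: "\<forall>\<^sub>F n in sequentially. (LINT x|M n. L n x * (1 - cutoff K (R n x))) \<le> \<delta>"
    and tail': "(LINT x|P. exp (c * R' x - c\<^sup>2 / 2) * (1 - cutoff K (R' x))) \<le> \<delta>" by auto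
  have I': "integrable P (\<lambda>x. f x *\<^sub>R iexp (Y' x))" if "integrable P f" for f :: "'b \<Rightarrow> real"
    using that by (rule lintegrable_bound) (use that in auto)
  have I: "integrable (M n) (\<lambda>x. f x *\<^sub>R iexp (Y n x))" if "integrable (M n) f" for f :: "'a \<Rightarrow> real" and n
    using that by (rule lintegrable_bound) (use that in auto)
  have lim: "norm ((LINT x|P. g K (R' x) *\<^sub>R iexp (Y' x)) - (LINT x|P. exp (c * R' x - c\<^sup>2 / 2) *\<^sub>R iexp (Y' x))) \<le> \<delta>"
  proof -
    have "norm ((LINT x|P. g K (R' x) *\<^sub>R iexp (Y' x)) - (LINT x|P. exp (c * R' x - c\<^sup>2 / 2) *\<^sub>R iexp (Y' x)))
      = norm (LINT x|P. g K (R' x) *\<^sub>R iexp (Y' x) - exp (c * R' x - c\<^sup>2 / 2) *\<^sub>R iexp (Y' x))"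
      by (subst Bochner_Integration.integral_diff) (use I' integrable_g(2) tilt_int in auto)
    also have "... \<le> (LINT x|P. exp (c * R' x - c\<^sup>2 / 2) * (1 - cutoff K (R' x)))"
    proof (rule norm_integral_le_integral)
      show "integrable P (\<lambda>x. exp (c * R' x - c\<^sup>2 / 2) * (1 - cutoff K (R' x)))"
        using cutoff_01 by (intro lintegrable_bound[OF tilt_int]) (auto simp: abs_mult mult_left_le)
      show "norm (g K (R' x) *\<^sub>R iexp (Y' x) - exp (c * R' x - c\<^sup>2 / 2) *\<^sub>R iexp (Y' x)) \<le> exp (c * R' x - c\<^sup>2 / 2) * (1 - cutoff K (R' x))" for x
      proof -
        have "g K (R' x) - exp (c * R' x - c\<^sup>2 / 2) = - (exp (c * R' x - c\<^sup>2 / 2) * (1 - cutoff K (R' x)))"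
          by (simp add: g_def right_diff_distrib)
        then show ?thesis unfolding scaleR_left_diff_distrib[symmetric] using cutoff_01[of K "R' x"] by (simp add: abs_mult)
      qed
    qed (use I' integrable_g(2) tilt_int in auto)
    finally show ?thesis using tail' by linarith
  qed
  have "\<forall>\<^sub>F n in sequentially. norm ((LINT x|M n. g K (R n x) *\<^sub>R iexp (Y n x)) - (LINT x|P. g K (R' x) *\<^sub>R iexp (Y' x))) < \<delta>"
    using tendstoD[OF truncated_conv[OF Y conv] \<delta>(1)] by (simp add: dist_norm)
  then show "\<forall>\<^sub>F n in sequentially. dist (LINT x|M n. L n x *\<^sub>R iexp (Y n x)) (LINT x|P. exp (c * R' x - c\<^sup>2 / 2) *\<^sub>R iexp (Y' x)) < \<epsilon>"
    using tail L_cutoff_close[OF \<delta>(1) K]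
  proof eventually_elim
    case (elim n)
    have "norm ((LINT x|M n. L n x *\<^sub>R iexp (Y n x)) - (LINT x|M n. g K (R n x) *\<^sub>R iexp (Y n x)))
        = norm (LINT x|M n. L n x *\<^sub>R iexp (Y n x) - g K (R n x) *\<^sub>R iexp (Y n x))"
      by (subst Bochner_Integration.integral_diff) (use I integrable_g(1) L_int in auto)
    also have "... \<le> (LINT x|M n. L n x * (1 - cutoff K (R n x)) + \<delta>)"
    proof (rule norm_integral_le_integral)
      fix x assume x: "x \<in> space (M n)"
      have "\<bar>L n x - g K (R n x)\<bar> \<le> L n x * (1 - cutoff K (R n x)) + \<delta>"
        using bspec[OF elim(3) x] mult_nonneg_nonneg[of "L n x" "1 - cutoff K (R n x)"] L_nonneg[of n x] cutoff_01(2)[of K "R n x"]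
        unfolding right_diff_distrib by linarith
      then show "norm (L n x *\<^sub>R iexp (Y n x) - g K (R n x) *\<^sub>R iexp (Y n x)) \<le> L n x * (1 - cutoff K (R n x)) + \<delta>"
        unfolding scaleR_left_diff_distrib[symmetric] by simp
    qed (use I integrable_g(1) L_int integrable_L_cutoff in auto)
    also have "... = (LINT x|M n. L n x * (1 - cutoff K (R n x))) + \<delta>" using integrable_L_cutoff(2) by (simp add: M.prob_space)
    finally have 1: "norm ((LINT x|M n. L n x *\<^sub>R iexp (Y n x)) - (LINT x|M n. g K (R n x) *\<^sub>R iexp (Y n x))) \<le> 2 * \<delta>"
      using elim(2) by linarith
    have tri: "norm (a - d) \<le> norm (a - b) + norm (b - e) + norm (e - d)" for a b e d :: complex
      using norm_triangle_ineq[of "a - b" "b - d"] norm_triangle_ineq[of "b - e" "e - d"] by simp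
    show ?case unfolding dist_norm
      using tri[of "LINT x|M n. L n x *\<^sub>R iexp (Y n x)" "LINT x|P. exp (c * R' x - c\<^sup>2 / 2) *\<^sub>R iexp (Y' x)"
          "LINT x|M n. g K (R n x) *\<^sub>R iexp (Y n x)" "LINT x|P. g K (R' x) *\<^sub>R iexp (Y' x)"] 1 elim(1) lim \<delta> by linarith
  qed
qed

end

section \<open>Finite-dimensional limits under the alternative\<close>

lemma zstat_sum:
  "finite I \<Longrightarrow> zstat p n (\<lambda>t. \<Sum>i\<in>I. c i * k i t) x = (\<Sum>i\<in>I. c i * zstat p n (k i) x)"
proof (induction rule: finite_induct)
  case empty
  then show ?case by (simp add: zstat_def usum_def)
next
  case (insert i I)
  have "zstat p n (\<lambda>t. c i * k i t + (\<Sum>i\<in>I. c i * k i t)) x = c i * zstat p n (k i) x + zstat p n (\<lambda>t. \<Sum>i\<in>I. c i * k i t) x"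
    by (simp add: zstat_def usum_def sum.distrib distrib_left sum_distrib_left mult.left_commute)
  then show ?case using insert by simp
qed

text \<open>Limiting covariance of the linear combination with the likelihood statistic;
  \<open>gquad\<close> is the limiting variance of the combination.\<close>

definition gmix :: "nat \<Rightarrow> rseq \<Rightarrow> rseq \<Rightarrow> real" where
  "gmix m \<xi> a = - (\<Sum>k<m. a k * std_normal_density (\<xi> k))"

definition gquad :: "nat \<Rightarrow> rseq \<Rightarrow> rseq \<Rightarrow> real" where
  "gquad m \<xi> a = (\<Sum>j<m. \<Sum>k<m. a j * a k * (min (std_normal_cdf (\<xi> j)) (std_normal_cdf (\<xi> k)) - std_normal_cdf (\<xi> j) * std_normal_cdf (\<xi> k)))"

lemma gvar_split:
  "gvar m \<xi> (\<lambda>i. if i < m then t * a i else b) = t\<^sup>2 * gquad m \<xi> a + 2 * t * b * gmix m \<xi> a + b\<^sup>2"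
proof -
  have S: "sum f {..m} = sum f {..<m} + f m" for f :: rseq by (simp add: lessThan_Suc_atMost[symmetric])
  have 1: "(\<Sum>i<m. \<Sum>j<m. t * a i * (t * a j) * gcov m \<xi> i j) = t\<^sup>2 * gquad m \<xi> a"
    unfolding gquad_def sum_distrib_left by (intro sum.cong) (auto simp: gcov_def power2_eq_square)
  have 2: "(\<Sum>i<m. t * a i * b * gcov m \<xi> i m) = t * b * gmix m \<xi> a"
    unfolding gmix_def sum_negf[symmetric] sum_distrib_left by (intro sum.cong) (auto simp: gcov_def)
  have 3: "(\<Sum>i<m. b * (t * a i) * gcov m \<xi> m i) = t * b * gmix m \<xi> a"
    unfolding gmix_def sum_negf[symmetric] sum_distrib_left by (intro sum.cong) (auto simp: gcov_def)
  have 4: "gcov m \<xi> m m = 1" by (simp add: gcov_def)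
  show ?thesis unfolding gvar_def S by (simp add: sum.distrib 1 2 3 4 power2_eq_square)
qed

lemma gvar_nonneg: "gvar m \<xi> c \<ge> 0" by (rule tendsto_lowerbound[OF zk_var_tendsto]) (auto intro!: always_eventually lint_nonneg)

text \<open>Cauchy-Schwarz for a combination and the likelihood statistic of variance 1: the
  quadratic form \<open>gvar\<close> is nonnegative at the minimising coefficient.\<close>

lemma gquad_ge: "gquad m \<xi> a \<ge> (gmix m \<xi> a)\<^sup>2"
  using gvar_nonneg[of m \<xi> "\<lambda>i. if i < m then 1 * a i else - gmix m \<xi> a"] unfolding gvar_split by (simp add: power2_eq_square)

text \<open>Completing the square: the tilted normal density is the normal density shifted by
  \<open>c\<close>.\<close>

lemma tilted_std_normal:
  "integrable \<N> (\<lambda>x. exp (c * x - c\<^sup>2 / 2))"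
  "(LINT x|\<N>. exp (c * x - c\<^sup>2 / 2) *\<^sub>R iexp (s * x)) = iexp (s * c) * complex_of_real (exp (- s\<^sup>2 / 2))"
proof -
  have d: "std_normal_density x * exp (c * x - c\<^sup>2 / 2) = std_normal_density (x - c)" for x
    unfolding std_normal_density_def by (simp add: exp_add[symmetric] power2_eq_square field_simps)
  have nd: "std_normal_density (x - c) = normal_density c 1 x" for x by (simp add: normal_density_def)
  show "integrable \<N> (\<lambda>x. exp (c * x - c\<^sup>2 / 2))" by (subst integrable_density) (auto simp: d nd)
  have "(LINT x|\<N>. exp (c * x - c\<^sup>2 / 2) *\<^sub>R iexp (s * x))
      = (LINT x|lborel. std_normal_density (x - c) *\<^sub>R iexp (s * x))" by (subst integral_density) (auto simp: d[symmetric])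
  also have "... = (LINT x|lborel. std_normal_density x *\<^sub>R iexp (s * (c + x)))" by (subst lborel_integral_real_affine[where c=1 and t=c]) auto
  also have "... = (LINT x|lborel. iexp (s * c) * (std_normal_density x *\<^sub>R iexp (s * x)))"
    by (simp add: distrib_left exp_add scaleR_conv_of_real mult.left_commute)
  also have "... = iexp (s * c) * (LINT x|lborel. std_normal_density x *\<^sub>R iexp (s * x))" by (rule integral_mult_right_zero)
  also have "(LINT x|lborel. std_normal_density x *\<^sub>R iexp (s * x)) = char \<N> s" unfolding char_def by (subst integral_density) auto
  finally show "(LINT x|\<N>. exp (c * x - c\<^sup>2 / 2) *\<^sub>R iexp (s * x)) = iexp (s * c) * complex_of_real (exp (- s\<^sup>2 / 2))"
    by (simp add: char_std_normal_distribution)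
qed

lemma integral_iexp_std_normal: "(LINT x|\<N>. iexp (s * x)) = complex_of_real (exp (- s\<^sup>2 / 2))"
  using char_std_normal_distribution unfolding char_def fun_eq_iff by blast

lemma integrable_pair_tilt:
  "integrable (\<N> \<Otimes>\<^sub>M \<N>) (\<lambda>z. exp (c * fst z - c\<^sup>2 / 2))"
proof -
  have "integrable (distr (\<N> \<Otimes>\<^sub>M \<N>) \<N> fst) (\<lambda>x. exp (c * x - c\<^sup>2 / 2))"
    unfolding N.distr_pair_fst by (rule tilted_std_normal(1))
  then show ?thesis by (rule integrable_distr[rotated]) measurable
qed

lemma pair_std_normal_iexp:
  "(LINT z|(\<N> \<Otimes>\<^sub>M \<N>). exp (c * fst z - c\<^sup>2 / 2) *\<^sub>R iexp (s * fst z + u * snd z))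
    = iexp (s * c) * complex_of_real (exp (- (s\<^sup>2 + u\<^sup>2) / 2))"
proof -
  interpret P: pair_prob_space \<N> \<N> ..
  have I: "integrable (\<N> \<Otimes>\<^sub>M \<N>) (\<lambda>(x, y). exp (c * x - c\<^sup>2 / 2) *\<^sub>R iexp (s * x + u * y))"
  proof (rule lintegrable_bound)
    show "integrable (\<N> \<Otimes>\<^sub>M \<N>) (\<lambda>z. exp (c * fst z - c\<^sup>2 / 2))" by (rule integrable_pair_tilt)
  qed (auto simp: split_beta)
  have "(LINT z|(\<N> \<Otimes>\<^sub>M \<N>). exp (c * fst z - c\<^sup>2 / 2) *\<^sub>R iexp (s * fst z + u * snd z))
     = (LINT x|\<N>. LINT y|\<N>. exp (c * x - c\<^sup>2 / 2) *\<^sub>R iexp (s * x + u * y))"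
  proof -
    have "(LINT z|(\<N> \<Otimes>\<^sub>M \<N>). exp (c * fst z - c\<^sup>2 / 2) *\<^sub>R iexp (s * fst z + u * snd z))
      = (\<integral>(x, y). exp (c * x - c\<^sup>2 / 2) *\<^sub>R iexp (s * x + u * y) \<partial>(\<N> \<Otimes>\<^sub>M \<N>))"
      by (simp only: case_prod_unfold)
    then show ?thesis using P.integral_fst'[OF I] by (simp only: prod.case)
  qed
  also have "... = (LINT x|\<N>. (exp (c * x - c\<^sup>2 / 2) *\<^sub>R iexp (s * x)) * complex_of_real (exp (- u\<^sup>2 / 2)))"
  proof (intro lint_cong refl)
    fix x :: real
    have "(LINT y|\<N>. exp (c * x - c\<^sup>2 / 2) *\<^sub>R iexp (s * x + u * y))
       = (LINT y|\<N>. (exp (c * x - c\<^sup>2 / 2) *\<^sub>R iexp (s * x)) * iexp (u * y))" by (simp add: distrib_left exp_add)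
    also have "... = (exp (c * x - c\<^sup>2 / 2) *\<^sub>R iexp (s * x)) * (LINT y|\<N>. iexp (u * y))" by (rule integral_mult_right_zero)
    finally show "(LINT y|\<N>. exp (c * x - c\<^sup>2 / 2) *\<^sub>R iexp (s * x + u * y)) =
        (exp (c * x - c\<^sup>2 / 2) *\<^sub>R iexp (s * x)) * complex_of_real (exp (- u\<^sup>2 / 2))" unfolding integral_iexp_std_normal .
  qed
  also have "... = iexp (s * c) * complex_of_real (exp (- s\<^sup>2 / 2)) * complex_of_real (exp (- u\<^sup>2 / 2))"
    by (subst integral_mult_left_zero) (simp only: tilted_std_normal(2))
  also have "... = iexp (s * c) * complex_of_real (exp (- (s\<^sup>2 + u\<^sup>2) / 2))"
  proof -
    have "exp (- s\<^sup>2 / 2) * exp (- u\<^sup>2 / 2) = exp (- (s\<^sup>2 + u\<^sup>2) / 2)" by (simp add: exp_add[symmetric] field_simps)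
    then show ?thesis by (simp only: mult.assoc of_real_mult[symmetric])
  qed
  finally show ?thesis .
qed

context fvml_asymptotics
begin

abbreviation "L n \<equiv> lik (p n) n (\<kappa> n)"
abbreviation "R n \<equiv> rstat (p n) n"
abbreviation "U n \<equiv> usample (p n) n"

text \<open>Finitely many \<open>p n\<close> may be 0, while \<open>exponential_tilt\<close> asks
  for measurability and integrability at every \<open>n\<close>. In dimension 0 the quotients by
  zero make the likelihood constant.\<close>

lemma lik_0: "lik 0 n k = (\<lambda>x. bessel_series 0 0 / bessel_series 0 0 ^ n)" by (simp add: lik_def vconst_def fun_eq_iff)

lemma measurable_L [measurable]: "L n \<in> borel_measurable (U n)" using measurable_lik[of "p n"] by (cases "p n = 0") (auto simp: lik_0)

lemma L_nonneg: "0 \<le> L n x" using lik_nonneg[of "p n"] bessel_series_ge_1[of 0 0] by (cases "p n = 0") (auto simp: lik_0)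

lemma integrable_L: "integrable (U n) (L n)"
proof -
  interpret prob_space "U n" by (rule prob_space_usample)
  show ?thesis
  proof (cases "p n = 0")
    case False
    have "norm (L n x) \<le> exp \<bar>\<kappa> n\<bar> ^ n" if "x \<in> space (U n)" for x
      using L_nonneg[of n x] lik_le[OF _ that, of "\<kappa> n"] False by simp
    then show ?thesis by (intro integrable_const_bound[where B="exp \<bar>\<kappa> n\<bar> ^ n"]) auto
  next
    case True
    then have "L n = (\<lambda>x. bessel_series 0 0 / bessel_series 0 0 ^ n)" by (simp add: lik_0)
    then show ?thesis by (simp only: integrable_const)
  qed
qed

lemma null_joint_conv:
  "(\<lambda>n. LINT x|U n. iexp (t * (\<Sum>k<m. a k * zstat (p n) n (ik (p n) (\<xi> k)) x) + b * R n x))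
    \<longlonglongrightarrow> complex_of_real (exp (- (t\<^sup>2 * gquad m \<xi> a + 2 * t * b * gmix m \<xi> a + b\<^sup>2) / 2))"
proof -
  have eq: "t * (\<Sum>k<m. a k * zstat q n (ik q (\<xi> k)) x) + b * rstat q n x
    = zstat q n (zk q m \<xi> (\<lambda>i. if i < m then t * a i else b)) x" for q n x
  proof -
    have "zstat q n (zk q m \<xi> (\<lambda>i. if i < m then t * a i else b)) x
      = (\<Sum>i\<in>{..m}. (if i < m then t * a i else b) * zstat q n (kk q m \<xi> i) x)" unfolding zk_def[abs_def] by (rule zstat_sum) simp
    also have "... = (\<Sum>i<m. t * a i * zstat q n (kk q m \<xi> i) x) + b * zstat q n (kk q m \<xi> m) x"
      by (simp add: lessThan_Suc_atMost[symmetric])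
    also have "... = t * (\<Sum>k<m. a k * zstat q n (ik q (\<xi> k)) x) + b * rstat q n x"
      unfolding sum_distrib_left rstat_def by (simp add: kk_def[abs_def] mult.assoc)
    finally show ?thesis by simp
  qed
  show ?thesis unfolding eq gvar_split[symmetric] by (rule null_clt[OF p_lim])
qed

text \<open>The first normal variable is the limit of the likelihood statistic; the second carries
  the part of other statistics that is independent of it.\<close>

lemma tilt_locale:
  "exponential_tilt (\<lambda>n. U n) (\<lambda>n. L n) (\<lambda>n. R n) c (\<N> \<Otimes>\<^sub>M \<N>) fst"
proof -
  interpret P: pair_prob_space \<N> \<N> ..
  let ?P = "\<N> \<Otimes>\<^sub>M \<N>"
  show ?thesis
  proof (rule exponential_tilt.intro)
    show "prob_space ?P" by (rule P.prob_space_axioms)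
    show "fst \<in> borel_measurable ?P" by measurable
    show "\<forall>\<^sub>F n in sequentially. (LINT x|U n. L n x) = 1" using eventually_p_ge[of 1] by eventually_elim (simp add: integral_lik)
    show "\<forall>\<^sub>F n in sequentially. \<forall>x\<in>space (U n). \<bar>R n x\<bar> \<le> B \<longrightarrow> \<bar>L n x - exp (c * R n x - c\<^sup>2 / 2)\<bar> \<le> \<epsilon>"
      if "B \<ge> 0" "\<epsilon> > 0" for B \<epsilon> using lik_uniform[OF that(2,1)] by (rule eventually_mono) blast
    have "complex_of_real (LINT x|?P. exp (c * fst x - c\<^sup>2 / 2)) = (LINT x|?P. exp (c * fst x - c\<^sup>2 / 2) *\<^sub>R iexp (0 * fst x + 0 * snd x))"
      by (simp add: scaleR_conv_of_real)
    also have "... = 1" unfolding pair_std_normal_iexp by simp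
    finally show "(LINT x|?P. exp (c * fst x - c\<^sup>2 / 2)) = 1" by (simp only: of_real_eq_1_iff)
    show "(\<lambda>n. LINT x|U n. iexp (b * R n x)) \<longlonglongrightarrow> (LINT x|?P. iexp (b * fst x))" for b
      using null_joint_conv[of 0 "\<lambda>_. 0" "\<lambda>_. 0" 0 b] pair_std_normal_iexp[of 0 b 0] by simp
  qed (use prob_space_usample L_nonneg integrable_L integrable_pair_tilt in auto)
qed

text \<open>The combination has the limit \<gamma> Z1 + \<sigma> Z2, with Z1 the limit of
  \<open>R n\<close>, \<gamma> its covariance with Z1, and Z2 independent. The tilt shifts Z1 by
  \<open>c\<close>, hence the mean by \<open>c * \<gamma>\<close>, and leaves the variance
  unchanged.\<close>

theorem alternative_fidi:
  "(\<lambda>n. LINT x|U n. L n x *\<^sub>R iexp (\<Sum>k<m. a k * zstat (p n) n (ik (p n) (\<xi> k)) x))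
    \<longlonglongrightarrow> iexp (c * gmix m \<xi> a) * complex_of_real (exp (- gquad m \<xi> a / 2))"
proof -
  interpret T: exponential_tilt "\<lambda>n. U n" "\<lambda>n. L n" "\<lambda>n. R n" c "\<N> \<Otimes>\<^sub>M \<N>" fst by (rule tilt_locale)
  define \<gamma> where "\<gamma> = gmix m \<xi> a"
  define \<sigma> where "\<sigma> = sqrt (gquad m \<xi> a - \<gamma>\<^sup>2)"
  have \<sigma>2: "\<sigma>\<^sup>2 = gquad m \<xi> a - \<gamma>\<^sup>2" using gquad_ge[of m \<xi> a] by (simp add: \<sigma>_def \<gamma>_def)
  let ?P = "\<N> \<Otimes>\<^sub>M \<N>"
  let ?Y = "\<lambda>n x. \<Sum>k<m. a k * zstat (p n) n (ik (p n) (\<xi> k)) x"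
  have "(\<lambda>n. LINT x|U n. L n x *\<^sub>R iexp (?Y n x)) \<longlonglongrightarrow> (LINT z|?P. exp (c * fst z - c\<^sup>2 / 2) *\<^sub>R iexp (\<gamma> * fst z + \<sigma> * snd z))"
  proof (rule T.tilted_conv)
    fix t b
    have "(LINT z|?P. iexp (t * (\<gamma> * fst z + \<sigma> * snd z) + b * fst z))
      = (LINT z|?P. exp (0 * fst z - 0\<^sup>2 / 2) *\<^sub>R iexp ((t * \<gamma> + b) * fst z + (t * \<sigma>) * snd z))"
      by (intro lint_cong refl) (simp add: algebra_simps)
    also have "... = complex_of_real (exp (- ((t * \<gamma> + b)\<^sup>2 + (t * \<sigma>)\<^sup>2) / 2))" unfolding pair_std_normal_iexp by simp
    also have "(t * \<gamma> + b)\<^sup>2 + (t * \<sigma>)\<^sup>2 = t\<^sup>2 * gquad m \<xi> a + 2 * t * b * gmix m \<xi> a + b\<^sup>2"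
      unfolding power_mult_distrib \<sigma>2 \<gamma>_def by (simp add: power2_eq_square algebra_simps)
    finally show "(\<lambda>n. LINT x|U n. iexp (t * ?Y n x + b * R n x)) \<longlonglongrightarrow> (LINT z|?P. iexp (t * (\<gamma> * fst z + \<sigma> * snd z) + b * fst z))"
      using null_joint_conv[of t a \<xi> m b] by simp
  qed measurable
  also have "(LINT z|?P. exp (c * fst z - c\<^sup>2 / 2) *\<^sub>R iexp (\<gamma> * fst z + \<sigma> * snd z)) = iexp (c * \<gamma>) * complex_of_real (exp (- gquad m \<xi> a / 2))"
    unfolding pair_std_normal_iexp \<sigma>2 by (simp add: mult.commute)
  finally show ?thesis unfolding \<gamma>_def .
qed

end

section \<open>Chaining for the empirical process of the angles\<close>

definition ez :: "nat \<Rightarrow> nat \<Rightarrow> real \<Rightarrow> sample_pts \<Rightarrow> real" where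
  "ez p n \<alpha> = zstat p n (ik p \<alpha>)"

definition sN :: rseq where
  "sN n = sqrt (real n * (real n - 1) / 2)"

lemma measurable_ez [measurable]: "ez p n \<alpha> \<in> borel_measurable (usample p n)" unfolding ez_def by measurable

lemma sN_nonneg: "0 \<le> sN n" unfolding sN_def by (cases n) auto

lemma sN_le: "sN n \<le> real n"
proof -
  have "real n * (real n - 1) / 2 \<le> (real n)\<^sup>2" by (simp add: power2_eq_square field_simps)
  then have "sN n \<le> sqrt ((real n)\<^sup>2)" unfolding sN_def by (rule real_sqrt_le_mono)
  then show ?thesis by simp
qed

lemma nrm_mult: "n \<ge> 2 \<Longrightarrow> nrm n * (real n * (real n - 1) / 2) = sN n"
proof -
  assume n: "n \<ge> 2"
  have "nrm n * sN n = sqrt (2 / (real n * (real n - 1)) * (real n * (real n - 1) / 2))" unfolding nrm_def sN_def by (simp only: real_sqrt_mult)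
  also have "... = 1" using n by simp
  finally have "nrm n * sN n = 1" .
  moreover have "real n * (real n - 1) / 2 = sN n * sN n" using n by (simp add: sN_def)
  ultimately show ?thesis by (metis mult.assoc mult_1)
qed

lemma usum_const: "usum (\<lambda>x y. a) n x = a * (real n * (real n - 1) / 2)"
proof (induction n)
  case (Suc n)
  have "usum (\<lambda>x y. a) (Suc n) x = usum (\<lambda>x y. a) n x + real n * a" by (simp add: usum_def)
  then show ?case using Suc by (simp add: field_simps)
qed (simp add: usum_def)

lemma ez_eq:
  assumes "n \<ge> 2"
  shows "ez p n \<alpha> x = nrm n * usum (\<lambda>x y. hs p \<alpha> (ip p x y)) n x - sN n * icdf p \<alpha>"
proof -
  have "usum (\<lambda>x y. ik p \<alpha> (ip p x y)) n x = usum (\<lambda>x y. hs p \<alpha> (ip p x y)) n x - usum (\<lambda>x y. icdf p \<alpha>) n x"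
    by (simp add: usum_def ik_def sum_subtractf)
  then show ?thesis unfolding ez_def zstat_def usum_const nrm_mult[OF assms, symmetric] by (simp only: right_diff_distrib mult_ac)
qed

lemma usum_mono: "(\<And>x y. h x y \<le> h' x y) \<Longrightarrow> usum h n x \<le> usum h' n x" unfolding usum_def by (intro sum_mono) auto

lemma ez_bound:
  assumes n: "n \<ge> 2"
  shows "\<bar>ez p n \<alpha> x\<bar> \<le> sN n"
proof -
  let ?u = "usum (\<lambda>x y. hs p \<alpha> (ip p x y)) n x"
  have "usum (\<lambda>x y. 0) n x \<le> ?u" by (rule usum_mono) simp
  then have 0: "0 \<le> ?u" unfolding usum_const by simp
  have "?u \<le> usum (\<lambda>x y. 1) n x" by (rule usum_mono) (simp add: indicator_def)
  then have "?u \<le> real n * (real n - 1) / 2" unfolding usum_const by simp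
  from mult_left_mono[OF this nrm_nonneg[of n]] mult_nonneg_nonneg[OF nrm_nonneg[of n] 0]
  have "0 \<le> nrm n * ?u" "nrm n * ?u \<le> sN n" unfolding nrm_mult[OF n] by blast+
  moreover have "0 \<le> sN n * icdf p \<alpha>" "sN n * icdf p \<alpha> \<le> sN n"
    using icdf_01[of p \<alpha>] sN_nonneg[of n] by (simp_all add: mult_left_le)
  ultimately show ?thesis unfolding ez_eq[OF n] by linarith
qed

text \<open>The count of inner products below a level increases with the level, so the process can
  decrease only through its centring.\<close>

lemma ez_mono:
  assumes n: "n \<ge> 2" and le: "\<alpha> \<le> \<beta>"
  shows "ez p n \<alpha> x - sN n * (icdf p \<beta> - icdf p \<alpha>) \<le> ez p n \<beta> x"
proof -
  have "nrm n * usum (\<lambda>x y. hs p \<alpha> (ip p x y)) n x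
    \<le> nrm n * usum (\<lambda>x y. hs p \<beta> (ip p x y)) n x"
    by (rule mult_left_mono[OF usum_mono nrm_nonneg]) (use le in \<open>simp add: indicator_def\<close>)
  then show ?thesis unfolding ez_eq[OF n] right_diff_distrib by linarith
qed

lemma integrable_ez_diff_power: "n \<ge> 2 \<Longrightarrow> integrable (usample p n) (\<lambda>x. (ez p n \<beta> x - ez p n \<alpha> x) ^ k)"
proof -
  assume n: "n \<ge> 2"
  interpret prob_space "usample p n" by (rule prob_space_usample)
  have "\<bar>ez p n \<beta> x - ez p n \<alpha> x\<bar> \<le> 2 * sN n" for x
    using ez_bound[OF n, of p \<beta> x] ez_bound[OF n, of p \<alpha> x] by linarith
  then show ?thesis
    by (intro integrable_bounded[where C="(2 * sN n) ^ k"]) (auto simp only: real_norm_def power_abs abs_ge_zero intro!: power_mono, measurable)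
qed

section \<open>Increments of the empirical process between quantiles\<close>

lemma icdf_mono: "\<alpha> \<le> \<beta> \<Longrightarrow> icdf p \<alpha> \<le> icdf p \<beta>"
proof -
  assume "\<alpha> \<le> \<beta>"
  show ?thesis unfolding icdf_def using \<open>\<alpha> \<le> \<beta>\<close> by (intro S.finite_measure_mono) (auto simp: sets_slaw)
qed

lemma integral_ik_diff_sq:
  assumes p: "p > 0" and le: "\<alpha> \<le> \<beta>"
  shows "(LINT t|slaw p. (ik p \<beta> t - ik p \<alpha> t)\<^sup>2) \<le> icdf p \<beta> - icdf p \<alpha>"
proof -
  have I: "integrable (slaw p) (\<lambda>t. ik p a t * ik p b t)" for a b
    using abs_ik_le by (intro S.integrable_bounded[where C="1"]) (auto simp: abs_mult intro!: mult_le_one)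
  have "(ik p \<beta> t - ik p \<alpha> t)\<^sup>2 = ik p \<beta> t * ik p \<beta> t - 2 * (ik p \<alpha> t * ik p \<beta> t) + ik p \<alpha> t * ik p \<alpha> t" for t
    by (simp add: power2_eq_square algebra_simps)
  then have "(LINT t|slaw p. (ik p \<beta> t - ik p \<alpha> t)\<^sup>2) = (icdf p \<beta> - icdf p \<alpha>) - (icdf p \<beta> - icdf p \<alpha>)\<^sup>2"
    using I le by (simp add: integral_ik_ik power2_eq_square algebra_simps)
  then show ?thesis by simp
qed

lemma ez_diff: "ez p n \<beta> x - ez p n \<alpha> x = zstat p n (\<lambda>t. ik p \<beta> t - ik p \<alpha> t) x"
  by (simp add: ez_def zstat_def usum_def sum_subtractf right_diff_distrib)

lemma abs_ik_diff_le:
  assumes "\<alpha> \<le> \<beta>"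
  shows "\<bar>ik p \<beta> t - ik p \<alpha> t\<bar> \<le> 1"
  using icdf_01[of p \<alpha>] icdf_01[of p \<beta>] icdf_mono[OF assms, of p] assms by (auto simp: ik_def indicator_def)

lemma integral_ik_diff: "(LINT t|slaw p. ik p \<beta> t - ik p \<alpha> t) = 0"
proof -
  have "integrable (slaw p) (ik p a)" for a using abs_ik_le by (intro S.integrable_bounded[where C="1"]) auto
  then show ?thesis by (simp add: integral_ik)
qed

lemma ez_diff_second_moment:
  assumes p: "p > 0" and n: "n \<ge> 2" and le: "\<alpha> \<le> \<beta>"
  shows "(LINT x|usample p n. (ez p n \<beta> x - ez p n \<alpha> x)\<^sup>2) \<le> icdf p \<beta> - icdf p \<alpha>"
  unfolding ez_diff using integral_ik_diff_sq[OF p le] by (subst zstat_second_moment[OF p n _ abs_ik_diff_le[OF le] integral_ik_diff]) auto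

text \<open>The kernel of an increment is bounded by 1, so its fourth moment is at most its second,
  and both are at most the probability between the two levels.\<close>

lemma ez_diff_fourth_moment:
  assumes p: "p > 0" and n: "n \<ge> 2" and le: "\<alpha> \<le> \<beta>" and \<delta>: "\<delta> = icdf p \<beta> - icdf p \<alpha>"
  shows "(LINT x|usample p n. (ez p n \<beta> x - ez p n \<alpha> x) ^ 4) \<le> 768 * (\<delta>\<^sup>2 + \<delta> / real n)" unfolding ez_diff
proof (rule zstat_fourth_moment[OF p n _ abs_ik_diff_le[OF le] integral_ik_diff])
  show 2: "(LINT t|slaw p. (ik p \<beta> t - ik p \<alpha> t)\<^sup>2) \<le> \<delta>" using integral_ik_diff_sq[OF p le] \<delta> by simp
  have I: "integrable (slaw p) (\<lambda>t. (ik p \<beta> t - ik p \<alpha> t) ^ k)" for k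
    using abs_ik_diff_le[OF le] by (intro S.integrable_bounded[where C="1"]) (auto simp: power_abs intro!: power_le_one)
  have "(LINT t|slaw p. (ik p \<beta> t - ik p \<alpha> t) ^ 4) \<le> (LINT t|slaw p. (ik p \<beta> t - ik p \<alpha> t)\<^sup>2)"
  proof (rule integral_mono[OF I I])
    fix t
    have "\<bar>ik p \<beta> t - ik p \<alpha> t\<bar> ^ 4 \<le> \<bar>ik p \<beta> t - ik p \<alpha> t\<bar> ^ 2"
      using abs_ik_diff_le[OF le] by (intro power_decreasing) auto
    then show "(ik p \<beta> t - ik p \<alpha> t) ^ 4 \<le> (ik p \<beta> t - ik p \<alpha> t)\<^sup>2" by simp
  qed
  then show "(LINT t|slaw p. (ik p \<beta> t - ik p \<alpha> t) ^ 4) \<le> \<delta>" using 2 by simp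
qed measurable

lemma icdf_eq_0: "p > 0 \<Longrightarrow> \<alpha> < - sqrt p \<Longrightarrow> icdf p \<alpha> = 0"
proof -
  assume p: "p > 0" and \<alpha>: "\<alpha> < - sqrt p"
  have "AE t in slaw p. \<not> sqrt p * t \<le> \<alpha>" using AE_slaw_le_1[OF p]
  proof eventually_elim
    fix t :: real assume "\<bar>t\<bar> \<le> 1"
    then have "sqrt p * (-1) \<le> sqrt p * t" by (intro mult_left_mono) auto
    then show "\<not> sqrt p * t \<le> \<alpha>" using \<alpha> by simp
  qed
  then show ?thesis unfolding icdf_def by (subst S.prob_eq_0) (auto simp: sets_slaw)
qed

lemma icdf_eq_1: "p > 0 \<Longrightarrow> \<alpha> \<ge> sqrt p \<Longrightarrow> icdf p \<alpha> = 1"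
proof -
  assume p: "p > 0" and \<alpha>: "\<alpha> \<ge> sqrt p"
  have "AE t in slaw p. t \<in> {t. sqrt p * t \<le> \<alpha>}" using AE_slaw_le_1[OF p]
  proof eventually_elim
    fix t :: real assume "\<bar>t\<bar> \<le> 1"
    then have "sqrt p * t \<le> sqrt p * 1" by (intro mult_left_mono) auto
    then show "t \<in> {t. sqrt p * t \<le> \<alpha>}" using \<alpha> by simp
  qed
  then show ?thesis unfolding icdf_def by (subst S.prob_eq_1) (auto simp: sets_slaw)
qed

lemma continuous_icdf:
  assumes p: "p \<ge> 2"
  shows "isCont (icdf p) \<alpha>"
proof -
  interpret S: real_distribution "slaw p" by (rule real_distribution_slaw)
  have eq: "icdf p = (\<lambda>\<alpha>. cdf (slaw p) (\<alpha> / sqrt p))"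
  proof
    fix \<alpha>
    have "{t. sqrt p * t \<le> \<alpha>} = {..\<alpha> / sqrt p}" using p by (auto simp: pos_le_divide_eq mult.commute)
    then show "icdf p \<alpha> = cdf (slaw p) (\<alpha> / sqrt p)" by (simp only: icdf_def cdf_def)
  qed
  show ?thesis unfolding eq
  proof (rule isCont_o2[where f="\<lambda>\<alpha>. \<alpha> / sqrt p"])
    show "isCont (\<lambda>\<alpha>. \<alpha> / sqrt p) \<alpha>" using p by (intro continuous_intros) auto
    show "isCont (cdf (slaw p)) (\<alpha> / sqrt p)" using slaw_no_atom[OF p] by (simp only: S.isCont_cdf)
  qed
qed

text \<open>The end points are chosen outside the range of the scaled inner products, where \<open>ez\<close> vanishes.\<close>

definition yq :: "nat \<Rightarrow> real \<Rightarrow> real" where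
  "yq p u = (if u \<le> 0 then - sqrt p - 1 else if 1 \<le> u then sqrt p + 1 else SOME \<alpha>. icdf p \<alpha> = u)"

lemma icdf_yq:
  assumes p: "p \<ge> 2" and u: "0 \<le> u" "u \<le> 1"
  shows "icdf p (yq p u) = u"
proof -
  have p0: "p > 0" using p by simp
  consider "u = 0" | "u = 1" | "0 < u" "u < 1" using u by linarith
  then show ?thesis
  proof cases
    case 3
    have "\<exists>\<alpha>. - sqrt p - 1 \<le> \<alpha> \<and> \<alpha> \<le> sqrt p \<and> icdf p \<alpha> = u"
      using continuous_icdf[OF p] icdf_eq_0[OF p0, of "- sqrt p - 1"] icdf_eq_1[OF p0, of "sqrt p"] u by (intro IVT) (auto intro: order_trans[of _ 0])
    then have "\<exists>\<alpha>. icdf p \<alpha> = u" by blast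
    then have "icdf p (SOME \<alpha>. icdf p \<alpha> = u) = u" by (rule someI_ex)
    then show ?thesis using 3 by (simp add: yq_def)
  qed (use p0 in \<open>auto simp: yq_def icdf_eq_0 icdf_eq_1\<close>)
qed

lemma yq_mono: "p \<ge> 2 \<Longrightarrow> 0 \<le> u \<Longrightarrow> u < v \<Longrightarrow> v \<le> 1 \<Longrightarrow> yq p u < yq p v"
  using icdf_mono[of "yq p v" "yq p u" p] icdf_yq[of p u] icdf_yq[of p v] by linarith

lemma ez_increment_prob:
  assumes p: "p \<ge> 2" and n: "n \<ge> 2" and u: "0 \<le> u" "u < v" "v \<le> 1" and l: "l > 0"
  shows "measure (usample p n) {x \<in> space (usample p n). l < \<bar>ez p n (yq p v) x - ez p n (yq p u) x\<bar>} \<le> 768 * ((v - u)\<^sup>2 + (v - u) / real n) / l ^ 4"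
proof -
  interpret prob_space "usample p n" by (rule prob_space_usample)
  let ?D = "\<lambda>x. ez p n (yq p v) x - ez p n (yq p u) x"
  have "measure (usample p n) {x \<in> space (usample p n). l < \<bar>?D x\<bar>} \<le> measure (usample p n) {x \<in> space (usample p n). l ^ 4 \<le> ?D x ^ 4}"
  proof (rule finite_measure_mono)
    show "{x \<in> space (usample p n). l < \<bar>?D x\<bar>} \<subseteq> {x \<in> space (usample p n). l ^ 4 \<le> ?D x ^ 4}"
    proof safe
      fix x assume "l < \<bar>?D x\<bar>"
      then have "l ^ 4 \<le> \<bar>?D x\<bar> ^ 4" using l by (intro power_mono) auto
      then show "l ^ 4 \<le> ?D x ^ 4" by simp
    qed
  qed measurable
  also have "... \<le> (LINT x|usample p n. ?D x ^ 4) / l ^ 4"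
    using integrable_ez_diff_power[OF n] l by (intro integral_Markov_inequality_measure[where A="space (usample p n)"]) auto
  also have "... \<le> 768 * ((v - u)\<^sup>2 + (v - u) / real n) / l ^ 4"
    using p n u l yq_mono[OF p u] icdf_yq[OF p] by (intro divide_right_mono ez_diff_fourth_moment) auto
  finally show ?thesis .
qed

text \<open>Beyond the range of the scaled inner products the indicator is constant and equals its
  mean.\<close>

lemma ez_endpoint: "p \<ge> 2 \<Longrightarrow> n \<ge> 2 \<Longrightarrow> u = 0 \<or> u = 1 \<Longrightarrow> ez p n (yq p u) x = 0"
proof -
  assume p: "p \<ge> 2" and n: "n \<ge> 2" and u: "u = 0 \<or> u = 1"
  have p0: "p > 0" using p by simp
  have b: "- sqrt p \<le> sqrt p * ip p a b" "sqrt p * ip p a b \<le> sqrt p" for a b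
    using abs_ip_le[OF p0, of a b] mult_left_mono[of "-1" "ip p a b" "sqrt p"] mult_left_mono[of "ip p a b" 1 "sqrt p"] by auto
  have u0: "usum (\<lambda>x y. indicat_real {..yq p u} (sqrt p * ip p x y)) n x = usum (\<lambda>x y. u) n x"
  proof -
    have "indicat_real {..yq p u} (sqrt p * ip p a b) = u" for a b using u b[of a b] by (auto simp: yq_def indicator_def)
    then show ?thesis by simp
  qed
  have "icdf p (yq p u) = u" using icdf_yq[OF p, of u] u by auto
  then show ?thesis unfolding ez_eq[OF n] u0 usum_const using nrm_mult[OF n] by (simp add: mult.left_commute mult.commute)
qed

lemma geometric_sum_bounds:
  "(\<Sum>i=1..l. (4/5) ^ i) \<le> (4::real)" "(\<Sum>i=1..l. (9/10) ^ i) \<le> (9::real)"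
proof -
  have "(\<Sum>i=1..l. (4/5) ^ i) = 4 - 4 * (4/5::real) ^ l" "(\<Sum>i=1..l. (9/10) ^ i) = 9 - 9 * (9/10::real) ^ l" by (induction l) auto
  then show "(\<Sum>i=1..l. (4/5) ^ i) \<le> (4::real)" "(\<Sum>i=1..l. (9/10) ^ i) \<le> (9::real)" by auto
qed

text \<open>The thresholds sum up to less than \<open>\<epsilon>\<close>, while \<open>2\<^sup>-\<^sup>i\<close> divided by their fourth powers is still summable.\<close>

definition cbad :: "nat \<Rightarrow> nat \<Rightarrow> nat \<Rightarrow> nat \<Rightarrow> real \<Rightarrow> sample_pts set" where
  "cbad p n K l \<epsilon> = (\<Union>i\<in>{1..l}. \<Union>j\<in>{1..2 ^ (K + i)}. {x \<in> space (usample p n).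
     \<epsilon> / 10 * (9/10) ^ i < \<bar>ez p n (yq p (real j / 2 ^ (K + i))) x - ez p n (yq p ((real j - 1) / 2 ^ (K + i))) x\<bar>})"

lemma cbad_sets [measurable]: "cbad p n K l \<epsilon> \<in> sets (usample p n)"
  unfolding cbad_def by (intro sets.finite_UN finite_atLeastAtMost) measurable

text \<open>The condition on \<open>l\<close> keeps the mesh at least
  \<open>\<epsilon> / (2 * n)\<close>. Down to there the term with \<open>1 / n\<close> in the
  fourth moment is at most \<open>2 / \<epsilon>\<close> times the squared mesh, and the union bound
  over the levels is a geometric series.\<close>

lemma cbad_prob:
  assumes p: "p \<ge> 2" and n: "n \<ge> 2" and \<epsilon>: "\<epsilon> > 0" and l: "\<And>i. i \<in> {1..l} \<Longrightarrow> 2 ^ (K + i) \<le> 2 * real n / \<epsilon>"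
  shows "measure (usample p n) (cbad p n K l \<epsilon>) \<le> 768 * (1 + 2 / \<epsilon>) * 10 ^ 4 / \<epsilon> ^ 4 * 4 / 2 ^ K"
proof -
  interpret prob_space "usample p n" by (rule prob_space_usample)
  define C where "C = 768 * (1 + 2 / \<epsilon>) * 10 ^ 4 / \<epsilon> ^ 4"
  have C: "C \<ge> 0" using \<epsilon> by (simp add: C_def)
  let ?E = "\<lambda>i j. {x \<in> space (usample p n). \<epsilon> / 10 * (9/10) ^ i < \<bar>ez p n (yq p (real j / 2 ^ (K + i))) x - ez p n (yq p ((real j - 1) / 2 ^ (K + i))) x\<bar>}"
  have E: "measure (usample p n) (?E i j) \<le> C / 2 ^ K * (4/5) ^ i / 2 ^ (K + i)" if i: "i \<in> {1..l}" and j: "j \<in> {1..2 ^ (K + i)}" for i j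
  proof -
    define h :: real where "h = 1 / 2 ^ (K + i)"
    have h: "h > 0" by (simp add: h_def)
    have "real j \<le> 2 ^ (K + i)" using j by (metis atLeastAtMost_iff of_nat_le_iff of_nat_numeral of_nat_power)
    then have uv: "0 \<le> (real j - 1) / 2 ^ (K + i)" "(real j - 1) / 2 ^ (K + i) < real j / 2 ^ (K + i)" "real j / 2 ^ (K + i) \<le> 1"
      using j by (auto simp: divide_strict_right_mono)
    have d: "real j / 2 ^ (K + i) - (real j - 1) / 2 ^ (K + i) = h" by (simp add: h_def diff_divide_distrib[symmetric])
    have n0: "real n > 0" using n by simp
    have hn: "1 / real n \<le> 2 / \<epsilon> * h" using l[OF i] \<epsilon> n0 by (simp add: h_def field_simps)
    have pos: "\<epsilon> / 10 * (9/10) ^ i > 0" using \<epsilon> by simp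
    have "measure (usample p n) (?E i j) \<le> 768 * (h\<^sup>2 + h / real n) / (\<epsilon> / 10 * (9/10) ^ i) ^ 4"
      using ez_increment_prob[OF p n uv pos] unfolding d .
    also have "... \<le> 768 * (h\<^sup>2 + h * (2 / \<epsilon> * h)) / (\<epsilon> / 10 * (9/10) ^ i) ^ 4"
      using hn h mult_left_mono[OF hn, of h] by (intro divide_right_mono mult_left_mono add_left_mono) auto
    also have "... = 768 * (1 + 2 / \<epsilon>) * h\<^sup>2 / (\<epsilon> / 10 * (9/10) ^ i) ^ 4" by (simp add: power2_eq_square algebra_simps)
    also have "... = C * h\<^sup>2 * (10000/6561) ^ i"
    proof -
      have "((9/10::real) ^ i) ^ 4 = (6561/10000) ^ i"
        unfolding power_mult[symmetric] mult.commute[of i 4] unfolding power_mult by (simp add: power_divide)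
      then have "(\<epsilon> / 10 * (9/10) ^ i) ^ 4 = \<epsilon> ^ 4 / 10 ^ 4 * (6561/10000) ^ i" by (simp only: power_mult_distrib power_divide)
      then show ?thesis by (simp add: C_def power_divide)
    qed
    \<comment> \<open>The ratio \<open>5000 / 6561\<close> is 1 / (2 (9/10)^4): halving the mesh
      gains 1/2 per interval after the number of intervals is accounted for, and the thresholds lose
      (9/10)^4. It is below \<open>4/5\<close>.\<close>
    also have "... = C / 2 ^ K * (5000/6561) ^ i * h"
    proof -
      have "(5000/6561::real) ^ i = (10000/6561) ^ i / 2 ^ i" by (simp add: power_divide[symmetric])
      then show ?thesis by (simp add: h_def power2_eq_square power_add)
    qed
    also have "... \<le> C / 2 ^ K * (4/5) ^ i * h" using C h by (intro mult_right_mono mult_left_mono power_mono) auto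
    finally show ?thesis by (simp add: h_def)
  qed
  have "measure (usample p n) (cbad p n K l \<epsilon>) \<le> (\<Sum>i=1..l. measure (usample p n) (\<Union>j\<in>{1..2 ^ (K + i)}. ?E i j))"
    unfolding cbad_def by (intro finite_measure_subadditive_finite) auto
  also have "... \<le> (\<Sum>i=1..l. \<Sum>j=1..2 ^ (K + i). measure (usample p n) (?E i j))"
    by (intro sum_mono finite_measure_subadditive_finite) auto
  also have "... \<le> (\<Sum>i=1..l. \<Sum>j=1..(2::nat) ^ (K + i). C / 2 ^ K * (4/5) ^ i / 2 ^ (K + i))" by (intro sum_mono E) auto
  also have "... = C / 2 ^ K * (\<Sum>i=1..l. (4/5) ^ i)" unfolding sum_distrib_left by (intro sum.cong) auto
  also have "... \<le> C / 2 ^ K * 4" using C by (intro mult_left_mono geometric_sum_bounds) auto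
  finally show ?thesis by (simp add: C_def)
qed

text \<open>A dyadic point of the next level is either a point of the present one or, if its
  numerator is odd, the right neighbour of such a point. Outside \<open>cbad\<close> that last step
  costs at most the threshold of the level.\<close>

lemma chain_levels:
  assumes \<epsilon>: "\<epsilon> > 0" and x: "x \<in> space (usample p n) - cbad p n K l \<epsilon>" and i: "i \<le> l" and j: "j \<le> 2 ^ (K + i)"
    and A: "\<And>j. j \<le> 2 ^ K \<Longrightarrow> \<bar>ez p n (yq p (real j / 2 ^ K)) x\<bar> \<le> A"
  shows "\<bar>ez p n (yq p (real j / 2 ^ (K + i))) x\<bar> \<le> A + \<epsilon> / 10 * (\<Sum>i=1..i. (9/10) ^ i)" using i j
proof (induction i arbitrary: j)
  case 0
  then show ?case using A by simp
next
  case (Suc i)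
  define h where "h = j div 2"
  have h: "h \<le> 2 ^ (K + i)" using Suc.prems(2) by (simp add: h_def)
  have IH: "\<bar>ez p n (yq p (real h / 2 ^ (K + i))) x\<bar> \<le> A + \<epsilon> / 10 * (\<Sum>i=1..i. (9/10) ^ i)"
    by (rule Suc.IH) (use Suc.prems h in auto)
  show ?case
  proof (cases "even j")
    case True
    then have "real j / 2 ^ (K + Suc i) = real h / 2 ^ (K + i)" by (auto simp: h_def elim!: evenE)
    moreover have "0 \<le> \<epsilon> / 10 * (9/10) ^ Suc i" using \<epsilon> by simp
    ultimately show ?thesis using IH by (simp add: distrib_left)
  next
    case False
    then have j: "j = 2 * h + 1" unfolding h_def by (metis odd_two_times_div_two_succ)
    have jh: "(real j - 1) / 2 ^ (K + Suc i) = real h / 2 ^ (K + i)" by (simp add: j)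
    have "\<not> \<epsilon> / 10 * (9/10) ^ Suc i < \<bar>ez p n (yq p (real j / 2 ^ (K + Suc i))) x - ez p n (yq p ((real j - 1) / 2 ^ (K + Suc i))) x\<bar>"
    proof -
      have "Suc i \<in> {1..l}" "j \<in> {1..2 ^ (K + Suc i)}" using Suc.prems j by auto
      then show ?thesis using x unfolding cbad_def by blast
    qed
    moreover have "\<epsilon> / 10 * (\<Sum>i=1..Suc i. (9/10) ^ i) = \<epsilon> / 10 * (\<Sum>i=1..i. (9/10) ^ i) + \<epsilon> / 10 * (9/10) ^ Suc i"
      by (simp add: distrib_left)
    ultimately show ?thesis using IH unfolding jh by linarith
  qed
qed

text \<open>The thresholds of all levels together cost at most \<open>9/10 * \<epsilon>\<close>.
  Levels end with the first mesh at most \<open>\<epsilon> / n\<close>, and between neighbouring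
  points of that mesh monotonicity costs another \<epsilon>. \<open>K\<close> depends neither on
  \<open>p\<close> nor on \<open>n\<close>, so it can be fixed before the limit.\<close>

theorem chaining:
  assumes \<epsilon>: "\<epsilon> > 0" and \<eta>: "\<eta> > 0"
  obtains K where "\<And>p n. p \<ge> 2 \<Longrightarrow> n \<ge> 2 \<Longrightarrow> \<exists>D\<in>sets (usample p n). measure (usample p n) D \<le> \<eta> \<and>
    (\<forall>x\<in>space (usample p n) - D. \<forall>A. (\<forall>j\<le>2 ^ K. \<bar>ez p n (yq p (real j / 2 ^ K)) x\<bar> \<le> A) \<longrightarrow>
      (\<forall>\<alpha>\<in>{- sqrt p..sqrt p}. \<bar>ez p n \<alpha> x\<bar> \<le> A + 2 * \<epsilon>))"
proof -
  define C where "C = 768 * (1 + 2 / \<epsilon>) * 10 ^ 4 / \<epsilon> ^ 4 * 4"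
  obtain K where K: "C / \<eta> < 2 ^ K" using real_arch_pow[of 2 "C / \<eta>"] by auto
  show ?thesis
  proof (rule that[of K])
    fix p n :: nat assume p: "p \<ge> 2" and n: "n \<ge> 2"
    have ex: "\<exists>l. real n / \<epsilon> \<le> 2 ^ (K + l)"
    proof -
      obtain l where "real n / \<epsilon> < 2 ^ l" using real_arch_pow[of 2 "real n / \<epsilon>"] by auto
      also have "(2::real) ^ l \<le> 2 ^ (K + l)" by (intro power_increasing) auto
      finally show ?thesis by (auto intro: less_imp_le)
    qed
    \<comment> \<open>Minimality matters: the level before \<open>l\<close> is still coarser than
      \<open>\<epsilon> / n\<close>, so every level up to \<open>l\<close> meets the condition of
      \<open>cbad_prob\<close>.\<close>
    define l where "l = (LEAST l. real n / \<epsilon> \<le> 2 ^ (K + l))"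
    have l: "real n / \<epsilon> \<le> 2 ^ (K + l)" unfolding l_def by (rule LeastI_ex[OF ex])
    have l': "2 ^ (K + i) \<le> 2 * real n / \<epsilon>" if "i \<in> {1..l}" for i
    proof -
      have "i - 1 < l" using that by auto
      then have "\<not> real n / \<epsilon> \<le> 2 ^ (K + (i - 1))" unfolding l_def by (rule not_less_Least)
      moreover have "(2::real) ^ (K + i) = 2 * 2 ^ (K + (i - 1))" using that by (cases i) auto
      ultimately show ?thesis by simp
    qed
    let ?D = "cbad p n K l \<epsilon>"
    have "C / 2 ^ K \<le> \<eta>" using K \<eta> by (simp add: field_simps)
    then have D: "measure (usample p n) ?D \<le> \<eta>" using cbad_prob[where l=l and K=K, OF p n \<epsilon>] l' unfolding C_def by fastforce
    have bound: "\<bar>ez p n \<alpha> x\<bar> \<le> A + 2 * \<epsilon>"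
      if x: "x \<in> space (usample p n) - ?D" and A: "\<And>j. j \<le> 2 ^ K \<Longrightarrow> \<bar>ez p n (yq p (real j / 2 ^ K)) x\<bar> \<le> A"
        and \<alpha>: "\<alpha> \<in> {- sqrt p..sqrt p}" for x A \<alpha>
    proof -
      let ?y = "\<lambda>j. yq p (real j / 2 ^ (K + l))"
      have y: "\<bar>ez p n (?y j) x\<bar> \<le> A + \<epsilon>" if "j \<le> 2 ^ (K + l)" for j
      proof -
        have "\<epsilon> / 10 * (\<Sum>i=1..l. (9/10) ^ i) \<le> \<epsilon> / 10 * 9"
          using \<epsilon> by (intro mult_left_mono geometric_sum_bounds) auto
        then show ?thesis using chain_levels[OF \<epsilon> x order_refl that A] \<epsilon> by linarith
      qed
      have "\<alpha> < ?y (2 ^ (K + l))" "\<not> \<alpha> < ?y 0" using \<alpha> by (auto simp: yq_def)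
      then obtain j where j: "j < 2 ^ (K + l)" "\<not> \<alpha> < ?y j" "\<alpha> < ?y (Suc j)"
        using ex_least_nat_less[of "\<lambda>j. \<alpha> < ?y j" "2 ^ (K + l)"] by blast
      have "real (Suc j) \<le> 2 ^ (K + l)" using j(1) by (metis Suc_leI of_nat_le_iff of_nat_numeral of_nat_power)
      then have "real j \<le> 2 ^ (K + l)" "real (Suc j) \<le> 2 ^ (K + l)" by linarith+
      then have F: "icdf p (?y j) = real j / 2 ^ (K + l)" "icdf p (?y (Suc j)) = real (Suc j) / 2 ^ (K + l)"
        by (auto intro!: icdf_yq[OF p] simp del: of_nat_Suc)
      \<comment> \<open>Within one mesh the centring moves by at most \<open>sN n\<close> times the
        mesh, and \<open>sN n \<le> n\<close>.\<close>
      have small: "sN n * a \<le> \<epsilon>" if "a \<le> 1 / 2 ^ (K + l)" for a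
      proof -
        have "sN n * a \<le> real n * (1 / 2 ^ (K + l))"
          using that sN_le[of n] sN_nonneg[of n] mult_left_mono[OF that sN_nonneg[of n]] mult_right_mono[OF sN_le[of n], of "1 / 2 ^ (K + l)"] by simp
        also have "... \<le> \<epsilon>" using l \<epsilon> by (simp add: field_simps)
        finally show ?thesis .
      qed
      have d: "icdf p (?y (Suc j)) - icdf p (?y j) = 1 / 2 ^ (K + l)" unfolding F by (simp add: diff_divide_distrib[symmetric])
      have m: "icdf p (?y j) \<le> icdf p \<alpha>" "icdf p \<alpha> \<le> icdf p (?y (Suc j))" using j by (auto intro!: icdf_mono)
      have "sN n * (icdf p \<alpha> - icdf p (?y j)) \<le> \<epsilon>" "sN n * (icdf p (?y (Suc j)) - icdf p \<alpha>) \<le> \<epsilon>"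
        using d m by (auto intro!: small)
      moreover have "ez p n (?y j) x - sN n * (icdf p \<alpha> - icdf p (?y j)) \<le> ez p n \<alpha> x"
        "ez p n \<alpha> x - sN n * (icdf p (?y (Suc j)) - icdf p \<alpha>) \<le> ez p n (?y (Suc j)) x" using j by (auto intro!: ez_mono[OF n])
      moreover have "\<bar>ez p n (?y j) x\<bar> \<le> A + \<epsilon>" "\<bar>ez p n (?y (Suc j)) x\<bar> \<le> A + \<epsilon>" using y[of j] y[of "Suc j"] j(1) by linarith+
      ultimately show ?thesis by linarith
    qed
    show "\<exists>D\<in>sets (usample p n). measure (usample p n) D \<le> \<eta> \<and>
      (\<forall>x\<in>space (usample p n) - D. \<forall>A. (\<forall>j\<le>2 ^ K. \<bar>ez p n (yq p (real j / 2 ^ K)) x\<bar> \<le> A) \<longrightarrow>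
        (\<forall>\<alpha>\<in>{- sqrt p..sqrt p}. \<bar>ez p n \<alpha> x\<bar> \<le> A + 2 * \<epsilon>))"
      using D bound by (intro bexI[of _ ?D] conjI ballI allI impI) auto
  qed
qed

section \<open>The limit process\<close>

lemma std_normal_cdf_strict_mono: "a < b \<Longrightarrow> std_normal_cdf a < std_normal_cdf b"
proof -
  assume ab: "a < b"
  have "emeasure \<N> {a<..b} \<noteq> 0"
  proof
    assume "emeasure \<N> {a<..b} = 0"
    then have "(\<integral>\<^sup>+x. ennreal (std_normal_density x) * indicator {a<..b} x \<partial>lborel) = 0"
      by (subst (asm) emeasure_density) auto
    then have "AE x in lborel. ennreal (std_normal_density x) * indicator {a<..b} x = 0" by (subst (asm) nn_integral_0_iff_AE) auto
    then have "AE x in lborel. x \<notin> {a<..b}" by eventually_elim (auto simp: indicator_def std_normal_density_def split: if_splits)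
    moreover have "{x \<in> space lborel. \<not> x \<notin> {a<..b}} = {a<..b}" by auto
    ultimately have "emeasure lborel {a<..b} = 0" by (subst (asm) AE_iff_measurable[of "{a<..b}"]) auto
    then show False using ab by simp
  qed
  then have "measure \<N> {a<..b} > 0" by (simp add: N.emeasure_eq_measure zero_less_measure_iff)
  then show ?thesis using N.cdf_diff_eq[OF ab] by (simp add: std_normal_cdf_def)
qed

lemma isCont_std_normal_cdf: "isCont std_normal_cdf a"
proof -
  show ?thesis unfolding std_normal_cdf_def N.isCont_cdf using std_normal_no_atom by (simp add: measure_def)
qed

lemma std_normal_cdf_inv:
  assumes t: "0 < t" "t < 1"
  shows "std_normal_cdf (inv std_normal_cdf t) = t"
proof -
  have "\<forall>\<^sub>F x in at_bot. std_normal_cdf x < t" "\<forall>\<^sub>F x in at_top. t < std_normal_cdf x"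
    unfolding std_normal_cdf_def using t by (auto intro: order_tendstoD[OF N.cdf_lim_at_bot] order_tendstoD[OF N.cdf_lim_at_top_prob])
  then obtain a b where ab: "std_normal_cdf a < t" "t < std_normal_cdf b" by (meson eventually_at_bot_linorder eventually_at_top_linorder order_refl)
  have "a \<le> b"
  proof (rule ccontr)
    assume "\<not> a \<le> b"
    then have "std_normal_cdf b < std_normal_cdf a" by (intro std_normal_cdf_strict_mono) auto
    then show False using ab by linarith
  qed
  then have "\<exists>x. a \<le> x \<and> x \<le> b \<and> std_normal_cdf x = t" using ab isCont_std_normal_cdf by (intro IVT) auto
  then have "t \<in> range std_normal_cdf" by auto
  then show ?thesis by (rule f_inv_into_f)
qed

lemma inv_std_normal_cdf: "inv std_normal_cdf (std_normal_cdf x) = x"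
proof (rule inv_f_f)
  show "inj std_normal_cdf" using std_normal_cdf_strict_mono by (intro strict_mono_imp_inj_on strict_monoI) auto
qed

lemma isCont_phi_quantile:
  assumes t: "0 < t" "t < 1"
  shows "isCont phi_quantile t"
proof -
  let ?x = "inv std_normal_cdf t"
  have "isCont (inv std_normal_cdf) (std_normal_cdf ?x)"
    by (rule isCont_inverse_function2[of "?x - 1" _ "?x + 1"]) (auto simp: inv_std_normal_cdf isCont_std_normal_cdf)
  then have "isCont (\<lambda>s. std_normal_density (inv std_normal_cdf s)) t"
    unfolding std_normal_density_def std_normal_cdf_inv[OF t] by (intro continuous_intros) auto
  moreover have "\<forall>\<^sub>F s in nhds t. phi_quantile s = std_normal_density (inv std_normal_cdf s)"
  proof -
    have "\<forall>\<^sub>F s in nhds t. s \<in> {0<..<1}" using t by (intro eventually_nhds_in_open) auto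
    then show ?thesis by eventually_elim (simp add: phi_quantile_def)
  qed
  ultimately show ?thesis by (simp add: isCont_cong)
qed

lemma phi_quantile_bounds: "0 \<le> phi_quantile t" "phi_quantile t \<le> 1"
proof -
  have "std_normal_density x \<le> 1" for x
  proof -
    have "1 / sqrt (2 * pi) \<le> 1" using pi_gt3 by (simp add: divide_le_eq)
    moreover have "exp (- x\<^sup>2 / 2) \<le> 1" by simp
    ultimately show ?thesis unfolding std_normal_density_def by (intro mult_le_one) auto
  qed
  then show "0 \<le> phi_quantile t" "phi_quantile t \<le> 1" by (auto simp: phi_quantile_def)
qed

lemma char_centred_normal:
  assumes v: "v \<ge> 0"
  shows "(LINT x|centred_normal v. iexp x) = complex_of_real (exp (- v / 2))"
proof (cases "v = 0")
  case True
  then show ?thesis by (simp add: centred_normal_def integral_return)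
next
  case False
  define \<sigma> where "\<sigma> = sqrt v"
  have \<sigma>: "\<sigma> > 0" "\<sigma>\<^sup>2 = v" using False v by (auto simp: \<sigma>_def)
  have d: "\<sigma> * normal_density 0 \<sigma> (\<sigma> * y) = std_normal_density y" for y
  proof -
    have "(\<sigma> * y)\<^sup>2 / (2 * \<sigma>\<^sup>2) = y\<^sup>2 / 2" using \<sigma>(1) by (simp add: power_mult_distrib)
    moreover have "sqrt (2 * pi * \<sigma>\<^sup>2) = sqrt (2 * pi) * \<sigma>" using \<sigma>(1) by (simp add: real_sqrt_mult)
    ultimately show ?thesis using \<sigma>(1) by (simp add: normal_density_def std_normal_density_def)
  qed
  have "(LINT x|centred_normal v. iexp x) = (LINT x|lborel. normal_density 0 \<sigma> x *\<^sub>R iexp x)"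
    using False \<sigma> by (simp add: centred_normal_def \<sigma>_def[symmetric]) (subst integral_density, auto)
  also have "... = \<bar>\<sigma>\<bar> *\<^sub>R (LINT y|lborel. normal_density 0 \<sigma> (0 + \<sigma> * y) *\<^sub>R iexp (0 + \<sigma> * y))"
    using \<sigma> by (intro lborel_integral_real_affine) auto
  also have "... = (LINT y|lborel. (\<sigma> * normal_density 0 \<sigma> (\<sigma> * y)) *\<^sub>R iexp (\<sigma> * y))"
    using \<sigma> by (simp flip: integral_scaleR_right)
  also have "... = (LINT y|\<N>. iexp (\<sigma> * y))" unfolding d by (subst integral_density) auto
  finally show ?thesis unfolding integral_iexp_std_normal by (simp add: \<sigma>(2))
qed

lemma centred_normal_no_atom: "v > 0 \<Longrightarrow> AE x in centred_normal v. x \<noteq> a"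
proof -
  assume v: "v > 0"
  have "AE x in lborel. x \<noteq> (a::real)" by (rule AE_lborel_singleton)
  then have "AE x in density lborel (normal_density 0 (sqrt v)). x \<noteq> a" by (subst AE_density) auto
  moreover have "centred_normal v = density lborel (normal_density 0 (sqrt v))" using v by (simp add: centred_normal_def)
  ultimately show ?thesis by (simp only:)
qed

section \<open>Finite-dimensional laws of the bridge, and suprema over intervals\<close>

lemma bridge_measurable: "brownian_bridge P B \<Longrightarrow> 0 \<le> t \<Longrightarrow> t \<le> 1 \<Longrightarrow> B t \<in> borel_measurable P"
  unfolding brownian_bridge_def by auto

lemma bridge_distr:
  assumes "brownian_bridge P B" "finite S" "S \<subseteq> {0..1}"
  shows "distr P borel (\<lambda>\<omega>. \<Sum>t\<in>S. a t * B t \<omega>) = centred_normal (\<Sum>s\<in>S. \<Sum>t\<in>S. a s * a t * (min s t - s * t))"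
proof -
  note * = assms(1)[unfolded brownian_bridge_def, THEN conjunct2, THEN conjunct2, THEN conjunct1]
  show ?thesis by (rule *[rule_format]) (use assms(2,3) in simp)
qed

lemma bridge_marginal:
  assumes "brownian_bridge P B" "0 \<le> t" "t \<le> 1"
  shows "distr P borel (B t) = centred_normal (t - t * t)" using bridge_distr[OF assms(1), of "{t}" "\<lambda>_. 1"] assms(2,3) by simp

text \<open>In \<open>brownian_bridge\<close> the coefficients are attached to times; injectivity of
  \<open>t\<close> allows coefficients attached to indices to be carried over.\<close>

lemma bridge_char:
  fixes t a :: rseq
  assumes b: "brownian_bridge P B" and inj: "inj_on t {..<m}" and t: "\<And>k. k < m \<Longrightarrow> t k \<in> {0..1}"
    and v: "v = (\<Sum>j<m. \<Sum>k<m. a j * a k * (min (t j) (t k) - t j * t k))" "v \<ge> 0"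
  shows "(LINT \<omega>|P. iexp (\<Sum>k<m. a k * B (t k) \<omega>)) = complex_of_real (exp (- v / 2))"
proof -
  define b where "b s = a (the_inv_into {..<m} t s)" for s
  have bt: "b (t k) = a k" if "k < m" for k using the_inv_into_f_f[OF inj, of k] that by (simp add: b_def)
  have s1: "(\<Sum>s\<in>t ` {..<m}. b s * B s \<omega>) = (\<Sum>k<m. a k * B (t k) \<omega>)" for \<omega> by (simp add: sum.reindex[OF inj] bt)
  have s2: "(\<Sum>s\<in>t ` {..<m}. \<Sum>u\<in>t ` {..<m}. b s * b u * (min s u - s * u)) = v" unfolding v(1) by (simp add: sum.reindex[OF inj] bt)
  have "t ` {..<m} \<subseteq> {0..1}" using t by auto
  then have d: "distr P borel (\<lambda>\<omega>. \<Sum>s\<in>t ` {..<m}. b s * B s \<omega>) = centred_normal (\<Sum>s\<in>t ` {..<m}. \<Sum>u\<in>t ` {..<m}. b s * b u * (min s u - s * u))"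
    by (intro bridge_distr[OF assms(1)]) auto
  have [measurable]: "B (t k) \<in> borel_measurable P" if "k < m" for k using t[OF that] by (intro bridge_measurable[OF assms(1)]) auto
  have "(LINT \<omega>|P. iexp (\<Sum>k<m. a k * B (t k) \<omega>)) = (LINT x|distr P borel (\<lambda>\<omega>. \<Sum>k<m. a k * B (t k) \<omega>). iexp x)"
    by (subst integral_distr) auto
  also have "... = complex_of_real (exp (- v / 2))" using d char_centred_normal[OF v(2)] unfolding s1 s2 by simp
  finally show ?thesis .
qed

lemma exceeds_right:
  fixes h :: "real \<Rightarrow> real"
  assumes "(h \<longlongrightarrow> h t) (at_right t)" "\<not> \<bar>h t\<bar> \<le> y"
  obtains d where "d > t" "\<And>s. t < s \<Longrightarrow> s < d \<Longrightarrow> y < \<bar>h s\<bar>"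
proof -
  have "\<forall>\<^sub>F s in at_right t. y < \<bar>h s\<bar>" using assms(2) by (intro order_tendstoD(1)[OF tendsto_rabs[OF assms(1)]]) auto
  then show ?thesis using that unfolding eventually_at_right_field by auto
qed

text \<open>By right continuity an excess at a level persists at rational levels to its right, so
  countably many levels decide.\<close>

lemma right_continuous_sup_sets:
  fixes h :: "real \<Rightarrow> 'a \<Rightarrow> real"
  assumes h [measurable]: "\<And>t. h t \<in> borel_measurable N"
    and rc: "\<And>x t. x \<in> space N \<Longrightarrow> ((\<lambda>s. h s x) \<longlongrightarrow> h t x) (at_right t)"
  shows "{x \<in> space N. \<forall>t\<in>{a..b}. \<bar>h t x\<bar> \<le> y} \<in> sets N"
proof -
  \<comment> \<open>The end point \<open>b\<close> has no levels of the interval to its right and is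
    added by hand.\<close>
  define C where "C = {a..b} \<inter> (\<rat> \<union> {b})"
  have C: "countable C" unfolding C_def by (intro countable_Int2 countable_Un countable_rat) auto
  have "(\<forall>t\<in>{a..b}. \<bar>h t x\<bar> \<le> y) \<longleftrightarrow> (\<forall>t\<in>C. \<bar>h t x\<bar> \<le> y)" if x: "x \<in> space N" for x
  proof
    assume C: "\<forall>t\<in>C. \<bar>h t x\<bar> \<le> y"
    show "\<forall>t\<in>{a..b}. \<bar>h t x\<bar> \<le> y"
    proof (rule ballI, rule ccontr)
      fix t assume t: "t \<in> {a..b}" and y: "\<not> \<bar>h t x\<bar> \<le> y"
      have "t \<noteq> b" using C t y by (auto simp: C_def)
      then have tb: "t < b" using t by auto
      obtain d where d: "d > t" "\<And>s. t < s \<Longrightarrow> s < d \<Longrightarrow> y < \<bar>h s x\<bar>"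
        using exceeds_right[of "\<lambda>s. h s x", OF rc[OF x] y] by blast
      obtain q where "q \<in> \<rat>" "t < q" "q < min d b" using Rats_dense_in_real[of t "min d b"] d tb by auto
      then have "q \<in> C" "y < \<bar>h q x\<bar>" using d(2)[of q] t by (auto simp: C_def)
      then show False using C by fastforce
    qed
  qed (auto simp: C_def)
  then have "{x \<in> space N. \<forall>t\<in>{a..b}. \<bar>h t x\<bar> \<le> y} = {x \<in> space N. \<forall>t\<in>C. \<bar>h t x\<bar> \<le> y}" by blast
  also have "... = space N - (\<Union>t\<in>C. {x \<in> space N. \<not> \<bar>h t x\<bar> \<le> y})" by auto
  also have "... \<in> sets N" using C by (intro sets.Diff sets.top sets.countable_UN'') measurable
  finally show ?thesis .
qed

section \<open>The supremum under the alternative\<close>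

lemma indicator_right_continuous:
  fixes t v :: real
  shows "((\<lambda>s. indicat_real {..s} v) \<longlongrightarrow> indicat_real {..t} v) (at_right t)"
proof (rule tendsto_eventually)
  show "\<forall>\<^sub>F s in at_right t. indicat_real {..s} v = indicat_real {..t} v"
  proof (cases "v \<le> t")
    case True
    have "\<forall>\<^sub>F s in at_right t. s \<in> {t<..<t + 1}" by (rule eventually_at_right_real) simp
    then show ?thesis by eventually_elim (use True in auto)
  next
    case False
    then have "\<forall>\<^sub>F s in at_right t. s \<in> {t<..<v}" by (intro eventually_at_right_real) simp
    then show ?thesis by eventually_elim auto
  qed
qed

lemma ez_right_continuous:
  assumes p: "p \<ge> 2" and n: "n \<ge> 2"
  shows "((\<lambda>s. ez p n s x) \<longlongrightarrow> ez p n t x) (at_right t)"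
proof -
  have "(icdf p \<longlongrightarrow> icdf p t) (at_right t)" using continuous_icdf[OF p, of t] by (simp add: isCont_def filterlim_at_split)
  then show ?thesis unfolding ez_eq[OF n] usum_def by (intro tendsto_intros indicator_right_continuous)
qed

text \<open>The dyadic points in the open unit interval are \<open>dyad K k\<close> with \<open>k < 2\<^sup>K - 1\<close>.\<close>

definition dyad :: "nat \<Rightarrow> nat \<Rightarrow> real" where
  "dyad K k = real (Suc k) / 2 ^ K"

lemma dyad_01: "k < 2 ^ K - 1 \<Longrightarrow> 0 < dyad K k" "k < 2 ^ K - 1 \<Longrightarrow> dyad K k < 1"
proof -
  assume "k < 2 ^ K - 1"
  then have "Suc k < 2 ^ K" by (simp add: less_diff_conv One_nat_def)
  then have "real (Suc k) < real (2 ^ K)" by (simp only: of_nat_less_iff)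
  then show "dyad K k < 1" by (simp add: dyad_def divide_less_eq)
qed (simp add: dyad_def)

lemma dyad_Suc: "k < 2 ^ K - 1 \<Longrightarrow> \<exists>k' < 2 ^ Suc K - 1. dyad K k = dyad (Suc K) k'"
proof (intro exI conjI)
  assume "k < 2 ^ K - 1"
  then show "2 * k + 1 < 2 ^ Suc K - 1" by (simp add: One_nat_def)
  show "dyad K k = dyad (Suc K) (2 * k + 1)" by (simp add: dyad_def field_simps)
qed

lemma dyad_dense:
  assumes "0 \<le> a" "a < b" "b \<le> 1"
  obtains K k where "k < 2 ^ K - 1" "a < dyad K k" "dyad K k < b"
proof -
  obtain K where K: "2 / (b - a) < 2 ^ K" using real_arch_pow[of 2 "2 / (b - a)"] by auto
  then have h: "2 < (b - a) * 2 ^ K" using assms by (simp add: field_simps)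
  define k where "k = nat \<lfloor>a * 2 ^ K\<rfloor>"
  have "0 \<le> a * 2 ^ K" using assms by simp
  then have k: "real k \<le> a * 2 ^ K" "a * 2 ^ K < real k + 1" by (auto simp: k_def)
  have ab: "a < dyad K k" "dyad K k < b" using k h by (auto simp: dyad_def divide_less_eq less_divide_eq left_diff_distrib)
  then have "dyad K k < 1" using assms by linarith
  then have "real (Suc k) < 2 ^ K" by (simp add: dyad_def divide_less_eq)
  then have "real (Suc k) < real (2 ^ K)" by simp
  then have "Suc k < 2 ^ K" by (simp only: of_nat_less_iff)
  then have "k < 2 ^ K - 1" by (simp add: less_diff_conv One_nat_def)
  then show ?thesis using ab by (rule that)
qed

lemma prod_indicator_Icc:
  fixes f :: rseq
  shows "(\<Prod>k<m. indicat_real {-y..y} (f k)) = of_bool (\<forall>k\<in>{..<m}. \<bar>f k\<bar> \<le> y)"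
proof (induction m)
  case (Suc m)
  have "indicat_real {-y..y} r = of_bool (\<bar>r\<bar> \<le> y)" for r by (auto simp: indicator_def)
  then show ?case using Suc by (auto simp: lessThan_Suc)
qed simp

locale fvml_bridge = fvml_asymptotics +
  fixes P :: "'b measure" and B :: "real \<Rightarrow> 'b \<Rightarrow> real"
  assumes bridge: "brownian_bridge P B"
begin

sublocale P: prob_space P using bridge by (simp add: brownian_bridge_def)

definition Y :: "real \<Rightarrow> 'b \<Rightarrow> real" where
  "Y t \<omega> = B t \<omega> - c * phi_quantile t"

lemma measurable_Y: "0 \<le> t \<Longrightarrow> t \<le> 1 \<Longrightarrow> Y t \<in> borel_measurable P"
  unfolding Y_def using bridge_measurable[OF bridge, of t] by simp

lemma measurable_Y_dyad [measurable]: "k < 2 ^ K - 1 \<Longrightarrow> Y (dyad K k) \<in> borel_measurable P"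
  using dyad_01[of k K] by (intro measurable_Y) auto

definition H :: "nat \<Rightarrow> real \<Rightarrow> real" where
  "H K y = measure P {\<omega> \<in> space P. \<forall>k\<in>{..<2 ^ K - 1}. \<bar>Y (dyad K k) \<omega>\<bar> \<le> y}"

definition G :: "real \<Rightarrow> real" where
  "G y = measure P {\<omega> \<in> space P. \<forall>t\<in>{0..1}. \<bar>Y t \<omega>\<bar> \<le> y}"

text \<open>Continuity of \<open>phi_quantile\<close> is at hand in the open interval, so the end
  points are listed separately. Inside, an excess at \<open>t\<close> persists to the right of
  \<open>t\<close> and hence at a dyadic point.\<close>

lemma Y_sup_iff:
  assumes \<omega>: "\<omega> \<in> space P"
  shows "(\<forall>t\<in>{0..1}. \<bar>Y t \<omega>\<bar> \<le> y) \<longleftrightarrow>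
    \<bar>Y 0 \<omega>\<bar> \<le> y \<and> \<bar>Y 1 \<omega>\<bar> \<le> y \<and> (\<forall>K. \<forall>k\<in>{..<2 ^ K - 1}. \<bar>Y (dyad K k) \<omega>\<bar> \<le> y)"
proof
  assume *: "\<forall>t\<in>{0..1}. \<bar>Y t \<omega>\<bar> \<le> y"
  have "\<bar>Y (dyad K k) \<omega>\<bar> \<le> y" if "k < 2 ^ K - 1" for K k using * dyad_01[OF that] by (auto intro: less_imp_le)
  then show "\<bar>Y 0 \<omega>\<bar> \<le> y \<and> \<bar>Y 1 \<omega>\<bar> \<le> y \<and> (\<forall>K. \<forall>k\<in>{..<2 ^ K - 1}. \<bar>Y (dyad K k) \<omega>\<bar> \<le> y)"
    using * by auto
next
  assume *: "\<bar>Y 0 \<omega>\<bar> \<le> y \<and> \<bar>Y 1 \<omega>\<bar> \<le> y \<and> (\<forall>K. \<forall>k\<in>{..<2 ^ K - 1}. \<bar>Y (dyad K k) \<omega>\<bar> \<le> y)"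
  have co: "continuous_on {0..1} (\<lambda>t. B t \<omega>)" using bridge \<omega> by (auto simp: brownian_bridge_def)
  show "\<forall>t\<in>{0..1}. \<bar>Y t \<omega>\<bar> \<le> y"
  proof (rule ballI, rule ccontr)
    fix t :: real assume t: "t \<in> {0..1}" and y: "\<not> \<bar>Y t \<omega>\<bar> \<le> y"
    have t01: "0 < t" "t < 1" using t y * by (auto simp: less_le)
    have "isCont (\<lambda>t. B t \<omega>) t" using continuous_on_interior[OF co, of t] t01 by simp
    then have "isCont (\<lambda>t. Y t \<omega>) t" unfolding Y_def by (intro continuous_intros isCont_phi_quantile t01)
    then have "((\<lambda>t. Y t \<omega>) \<longlongrightarrow> Y t \<omega>) (at_right t)" by (simp add: isCont_def filterlim_at_split)
    then obtain d where d: "d > t" "\<And>s. t < s \<Longrightarrow> s < d \<Longrightarrow> y < \<bar>Y s \<omega>\<bar>"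
      using exceeds_right[of "\<lambda>t. Y t \<omega>", OF _ y] by blast
    obtain K k where k: "k < 2 ^ K - 1" "t < dyad K k" "dyad K k < min d 1" using d t01 by (auto intro: dyad_dense[of t "min d 1"])
    then have "y < \<bar>Y (dyad K k) \<omega>\<bar>" using d(2) by simp
    moreover have "\<bar>Y (dyad K k) \<omega>\<bar> \<le> y" using * k(1) by blast
    ultimately show False by simp
  qed
qed

lemma sets_dyad: "{\<omega> \<in> space P. \<forall>k\<in>{..<2 ^ K - 1}. \<bar>Y (dyad K k) \<omega>\<bar> \<le> y} \<in> sets P"
proof -
  have "{\<omega> \<in> space P. \<forall>k\<in>{..<2 ^ K - 1}. \<bar>Y (dyad K k) \<omega>\<bar> \<le> y}
      = space P - (\<Union>k\<in>{..<2 ^ K - 1}. {\<omega> \<in> space P. \<not> \<bar>Y (dyad K k) \<omega>\<bar> \<le> y})" by auto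
  also have "... \<in> sets P" by (intro sets.Diff sets.top sets.finite_UN) auto
  finally show ?thesis .
qed

lemma sets_Y_sup: "{\<omega> \<in> space P. \<forall>t\<in>{0..1}. \<bar>Y t \<omega>\<bar> \<le> y} \<in> sets P"
proof -
  have [measurable]: "Y 0 \<in> borel_measurable P" "Y 1 \<in> borel_measurable P" by (auto intro: measurable_Y)
  have "{\<omega> \<in> space P. \<forall>t\<in>{0..1}. \<bar>Y t \<omega>\<bar> \<le> y} = {\<omega> \<in> space P. \<bar>Y 0 \<omega>\<bar> \<le> y} \<inter> {\<omega> \<in> space P. \<bar>Y 1 \<omega>\<bar> \<le> y} \<inter>
      (\<Inter>K. {\<omega> \<in> space P. \<forall>k\<in>{..<2 ^ K - 1}. \<bar>Y (dyad K k) \<omega>\<bar> \<le> y})" using Y_sup_iff by blast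
  also have "... \<in> sets P" by (intro sets.Int sets.countable_INT) (auto intro: sets_dyad)
  finally show ?thesis .
qed

lemma G_le_H: "G y \<le> H K y" unfolding G_def H_def using Y_sup_iff by (intro P.finite_measure_mono sets_dyad) blast

lemma bridge_endpoint: "t = 0 \<or> t = 1 \<Longrightarrow> AE \<omega> in P. Y t \<omega> = 0"
proof -
  assume t: "t = 0 \<or> t = 1"
  have [measurable]: "B t \<in> borel_measurable P" using t bridge_measurable[OF bridge, of t] by auto
  have d: "distr P borel (B t) = return borel 0" using bridge_marginal[OF bridge, of t] t by (auto simp: centred_normal_def)
  have "AE x in distr P borel (B t). x = 0" unfolding d by (subst AE_return) auto
  then have "AE \<omega> in P. B t \<omega> = 0" by (subst (asm) AE_distr_iff) auto
  then show ?thesis by eventually_elim (use t in \<open>auto simp: Y_def phi_quantile_def\<close>)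
qed

text \<open>The dyadic events decrease with \<open>K\<close>. Their intersection differs from the
  full event only through the end points, where the process is almost surely 0, which is within the
  bound as \<open>y \<ge> 0\<close>.\<close>

lemma H_tendsto:
  assumes y: "y \<ge> 0"
  shows "(\<lambda>K. H K y) \<longlonglongrightarrow> G y"
proof -
  let ?A = "\<lambda>K. {\<omega> \<in> space P. \<forall>k\<in>{..<2 ^ K - 1}. \<bar>Y (dyad K k) \<omega>\<bar> \<le> y}"
  have "(\<lambda>K. measure P (?A K)) \<longlonglongrightarrow> measure P (\<Inter>K. ?A K)"
  proof (rule P.finite_Lim_measure_decseq)
    show "range ?A \<subseteq> sets P" using sets_dyad by auto
    show "decseq ?A"
    proof (rule decseq_SucI, rule subsetI)
      fix K \<omega> assume \<omega>: "\<omega> \<in> ?A (Suc K)"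
      show "\<omega> \<in> ?A K"
      proof (intro CollectI conjI ballI)
        fix k assume "k \<in> {..<2 ^ K - 1 :: nat}"
        then obtain k' where "k' < 2 ^ Suc K - 1" "dyad K k = dyad (Suc K) k'" using dyad_Suc[of k K] by auto
        then show "\<bar>Y (dyad K k) \<omega>\<bar> \<le> y" using \<omega> by (simp only: mem_Collect_eq lessThan_iff)
      qed (use \<omega> in auto)
    qed
  qed
  also have "measure P (\<Inter>K. ?A K) = G y" unfolding G_def
  proof (rule P.finite_measure_eq_AE)
    show "AE \<omega> in P. (\<omega> \<in> (\<Inter>K. ?A K)) = (\<omega> \<in> {\<omega> \<in> space P. \<forall>t\<in>{0..1}. \<bar>Y t \<omega>\<bar> \<le> y})"
      using bridge_endpoint[OF disjI1[OF refl]] bridge_endpoint[OF disjI2[OF refl]] AE_space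
    proof eventually_elim
      case (elim \<omega>)
      then show ?case using Y_sup_iff[of \<omega> y] y by auto
    qed
    show "(\<Inter>K. ?A K) \<in> sets P" by (intro sets.countable_INT) (auto intro: sets_dyad)
  qed (rule sets_Y_sup)
  finally show ?thesis unfolding H_def .
qed

definition alt :: "nat \<Rightarrow> sample_pts measure" where
  "alt n = density (U n) (\<lambda>x. ennreal (L n x))"

lemma sets_alt [measurable_cong, simp]: "sets (alt n) = sets (U n)" and space_alt [simp]: "space (alt n) = space (U n)" by (auto simp: alt_def)

lemma integral_L: "(LINT x|U n. L n x) = 1"
proof (cases "p n = 0")
  case True
  interpret prob_space "U n" by (rule prob_space_usample)
  have "bessel_series 0 0 = 1" using bessel_series_le_exp[of 0 0] bessel_series_ge_1[of 0 0] by simp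
  then have "L n = (\<lambda>x. 1)" using True by (simp add: lik_0)
  then show ?thesis by (simp only: lebesgue_integral_const prob_space) simp
qed (simp add: integral_lik)

lemma integral_alt:
  fixes f :: "_ \<Rightarrow> 'c::{banach,second_countable_topology}"
  shows "f \<in> borel_measurable (U n) \<Longrightarrow> (LINT x|alt n. f x) = (LINT x|U n. L n x *\<^sub>R f x)"
  unfolding alt_def using L_nonneg by (subst integral_density) auto

lemma prob_space_alt: "prob_space (alt n)"
proof (rule prob_spaceI)
  have "emeasure (alt n) (space (alt n)) = (\<integral>\<^sup>+x. ennreal (L n x) \<partial>U n)"
    unfolding alt_def by (subst emeasure_density) (auto cong: nn_integral_cong)
  also have "... = ennreal (LINT x|U n. L n x)" using integrable_L L_nonneg by (intro nn_integral_eq_integral) auto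
  finally show "emeasure (alt n) (space (alt n)) = 1" by (simp add: integral_L)
qed

lemma measure_alt:
  assumes A: "A \<in> sets (U n)"
  shows "measure (alt n) A = (LINT x|U n. indicator A x * L n x)"
proof -
  have "measure (alt n) A = (LINT x|alt n. indicat_real A x)" using A sets.sets_into_space[OF A] by (simp add: Int_absorb2)
  also have "... = (LINT x|U n. L n x *\<^sub>R indicat_real A x)" using A by (intro integral_alt) auto
  finally show ?thesis by (simp add: mult.commute)
qed

lemma alt_contiguity:
  assumes \<epsilon>: "\<epsilon> > 0"
  obtains \<delta> where "\<delta> > 0" "\<forall>\<^sub>F n in sequentially. \<forall>A\<in>sets (U n). measure (U n) A \<le> \<delta> \<longrightarrow> measure (alt n) A \<le> \<epsilon>"
proof -
  from exponential_tilt.contiguity[OF tilt_locale \<epsilon>] obtain \<delta> where \<delta>: "\<delta> > 0"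
    "\<forall>\<^sub>F n in sequentially. \<forall>A\<in>sets (U n). measure (U n) A \<le> \<delta> \<longrightarrow> (LINT x|U n. indicator A x * L n x) \<le> \<epsilon>" by blast
  from \<delta>(2) have "\<forall>\<^sub>F n in sequentially. \<forall>A\<in>sets (U n). measure (U n) A \<le> \<delta> \<longrightarrow> measure (alt n) A \<le> \<epsilon>"
    by eventually_elim (simp add: measure_alt)
  then show ?thesis using \<delta>(1) that by blast
qed

text \<open>Finite-dimensional limits need levels that do not move with \<open>n\<close>, hence the
  quantiles of the normal limit; chaining runs along the exact quantiles \<open>yq\<close>.
  \<open>ez_quantile_close\<close> links the two.\<close>

definition qz :: "nat \<Rightarrow> nat \<Rightarrow> real" where
  "qz K k = inv std_normal_cdf (dyad K k)"

definition fset :: "nat \<Rightarrow> nat \<Rightarrow> real \<Rightarrow> sample_pts set" where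
  "fset n K y = {x \<in> space (U n). \<forall>k\<in>{..<2 ^ K - 1}. \<bar>ez (p n) n (qz K k) x\<bar> \<le> y}"

lemma sets_fset: "fset n K y \<in> sets (U n)"
proof -
  have "fset n K y = space (U n) - (\<Union>k\<in>{..<2 ^ K - 1}. {x \<in> space (U n). \<not> \<bar>ez (p n) n (qz K k) x\<bar> \<le> y})"
    by (auto simp: fset_def)
  also have "... \<in> sets (U n)" by (intro sets.Diff sets.top sets.finite_UN) auto
  finally show ?thesis .
qed

text \<open>The probability of a box is the integral of a product of indicators, so
  \<open>joint_iexp_imp_prod\<close> applies, with the characteristic functions supplied by
  \<open>alternative_fidi\<close>.\<close>

lemma fidi_sets_tendsto: "(\<lambda>n. measure (alt n) (fset n K y)) \<longlonglongrightarrow> H K y"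
proof -
  define m :: nat where "m = 2 ^ K - 1"
  have t: "0 < dyad K k" "dyad K k < 1" if "k < m" for k using dyad_01[of k K] that by (auto simp: m_def)
  have \<Phi>: "std_normal_cdf (qz K k) = dyad K k" if "k < m" for k unfolding qz_def by (rule std_normal_cdf_inv[OF t[OF that]])
  have YB: "Y (dyad K k) \<omega> = B (dyad K k) \<omega> - c * std_normal_density (qz K k)" if "k < m" for k \<omega>
    using t[OF that] by (simp add: Y_def phi_quantile_def qz_def)
  have [measurable]: "Y (dyad K k) \<in> borel_measurable P" "B (dyad K k) \<in> borel_measurable P" if "k < m" for k
    using t[OF that] by (auto intro: measurable_Y bridge_measurable[OF bridge])
  have inj: "inj_on (dyad K) {..<m}" by (auto simp: inj_on_def dyad_def)
  let ?f = "\<lambda>k::nat. indicat_real {-y..y}"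
  have "(\<lambda>n. LINT x|alt n. (\<Prod>k<m. ?f k (ez (p n) n (qz K k) x))) \<longlonglongrightarrow> (LINT \<omega>|P. (\<Prod>k<m. ?f k (Y (dyad K k) \<omega>)))"
  proof (rule joint_iexp_imp_prod[where m=m and M=alt and P=P and Z="\<lambda>n k. ez (p n) n (qz K k)" and Z'="\<lambda>k. Y (dyad K k)" and f="?f"])
    fix a :: rseq
    have q: "gquad m (qz K) a = (\<Sum>j<m. \<Sum>k<m. a j * a k * (min (dyad K j) (dyad K k) - dyad K j * dyad K k))"
      unfolding gquad_def by (intro sum.cong) (auto simp: \<Phi>)
    have q0: "gquad m (qz K) a \<ge> 0" using gquad_ge[of m "qz K" a] by (rule order_trans[OF zero_le_power2])
    \<comment> \<open>At the dyadic points the drift of \<open>Y\<close> adds up to the constant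
      \<open>c * gmix m (qz K) a\<close>, which is the phase in
      \<open>alternative_fidi\<close>.\<close>
    have "(LINT \<omega>|P. iexp (\<Sum>k<m. a k * Y (dyad K k) \<omega>)) = (LINT \<omega>|P. iexp (c * gmix m (qz K) a) * iexp (\<Sum>k<m. a k * B (dyad K k) \<omega>))"
    proof (intro lint_cong refl)
      fix \<omega>
      have "(\<Sum>k<m. a k * Y (dyad K k) \<omega>) = c * gmix m (qz K) a + (\<Sum>k<m. a k * B (dyad K k) \<omega>)"
        by (simp add: YB gmix_def right_diff_distrib sum_subtractf sum_distrib_left mult.left_commute)
      then show "iexp (\<Sum>k<m. a k * Y (dyad K k) \<omega>) = iexp (c * gmix m (qz K) a) * iexp (\<Sum>k<m. a k * B (dyad K k) \<omega>)"
        by (simp only: of_real_add distrib_left exp_add)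
    qed
    also have "... = iexp (c * gmix m (qz K) a) * (LINT \<omega>|P. iexp (\<Sum>k<m. a k * B (dyad K k) \<omega>))" by (rule integral_mult_right_zero)
    also have "(LINT \<omega>|P. iexp (\<Sum>k<m. a k * B (dyad K k) \<omega>)) = complex_of_real (exp (- gquad m (qz K) a / 2))"
      using t by (intro bridge_char[OF bridge inj _ q q0]) (auto intro: less_imp_le)
    finally have lim: "(LINT \<omega>|P. iexp (\<Sum>k<m. a k * Y (dyad K k) \<omega>)) = iexp (c * gmix m (qz K) a) * complex_of_real (exp (- gquad m (qz K) a / 2))" .
    have "(LINT x|alt n. iexp (\<Sum>k<m. a k * ez (p n) n (qz K k) x)) = (LINT x|U n. L n x *\<^sub>R iexp (\<Sum>k<m. a k * ez (p n) n (qz K k) x))" for n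
      by (rule integral_alt) measurable
    then show "(\<lambda>n. LINT x|alt n. iexp (\<Sum>k<m. a k * ez (p n) n (qz K k) x)) \<longlonglongrightarrow> (LINT \<omega>|P. iexp (\<Sum>k<m. a k * Y (dyad K k) \<omega>))"
      unfolding lim using alternative_fidi[of a "qz K" m] by (simp only: ez_def)
  next
    fix k assume k: "k < m"
    \<comment> \<open>At an interior time \<open>t\<close> the bridge has the positive variance
      \<open>t - t * t\<close>, so the faces of the box carry no mass.\<close>
    have "AE x in distr P borel (B (dyad K k)). x \<noteq> c * std_normal_density (qz K k) + s" for s
      unfolding bridge_marginal[OF bridge less_imp_le[OF t(1)[OF k]] less_imp_le[OF t(2)[OF k]]]
      using t[OF k] by (intro centred_normal_no_atom) (simp add: mult_less_cancel_left1)
    then have E: "AE \<omega> in P. B (dyad K k) \<omega> \<noteq> c * std_normal_density (qz K k) + s" for s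
      using k by (subst (asm) AE_distr_iff) auto
    have "AE \<omega> in P. Y (dyad K k) \<omega> \<noteq> s" for s using E[of s] unfolding YB[OF k] by eventually_elim auto
    from this[of y] this[of "- y"] show "AE \<omega> in P. isCont (?f k) (Y (dyad K k) \<omega>)"
      by eventually_elim (auto simp: isCont_indicator frontier_def)
  qed (auto intro: prob_space_alt P.prob_space_axioms)
  moreover have "(LINT x|alt n. (\<Prod>k<m. ?f k (ez (p n) n (qz K k) x))) = measure (alt n) (fset n K y)" for n
  proof -
    have "(LINT x|alt n. (\<Prod>k<m. ?f k (ez (p n) n (qz K k) x))) = (LINT x|alt n. indicat_real (fset n K y) x)"
    proof (rule lint_cong[OF refl])
      fix x assume "x \<in> space (alt n)"
      then show "(\<Prod>k<m. ?f k (ez (p n) n (qz K k) x)) = indicat_real (fset n K y) x"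
        unfolding prod_indicator_Icc by (simp add: fset_def m_def indicator_def)
    qed
    also have "... = measure (alt n) (fset n K y)" using sets.sets_into_space[OF sets_fset[of n K y]] by (simp add: Int_absorb2)
    finally show ?thesis .
  qed
  moreover have "(LINT \<omega>|P. (\<Prod>k<m. ?f k (Y (dyad K k) \<omega>))) = H K y"
  proof -
    let ?A = "{\<omega> \<in> space P. \<forall>k\<in>{..<2 ^ K - 1}. \<bar>Y (dyad K k) \<omega>\<bar> \<le> y}"
    have "(LINT \<omega>|P. (\<Prod>k<m. ?f k (Y (dyad K k) \<omega>))) = (LINT \<omega>|P. indicat_real ?A \<omega>)"
      unfolding prod_indicator_Icc by (rule lint_cong[OF refl]) (simp add: m_def indicator_def)
    also have "... = H K y" unfolding H_def using sets.sets_into_space[OF sets_dyad[of K y]] by (simp add: Int_absorb2)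
    finally show ?thesis .
  qed
  ultimately show ?thesis by (simp only:)
qed

text \<open>The second moment of the difference is at most the probability between the two levels,
  that is, the distance from \<open>u\<close> to the value of \<open>icdf (p n)\<close> at the
  normal quantile. It tends to 0, and Chebyshev's inequality concludes.\<close>

lemma ez_quantile_close:
  assumes u: "0 < u" "u < 1" and \<epsilon>: "\<epsilon> > 0" and \<eta>: "\<eta> > 0"
  shows "\<forall>\<^sub>F n in sequentially. measure (U n) {x \<in> space (U n). \<epsilon> < \<bar>ez (p n) n (yq (p n) u) x - ez (p n) n (inv std_normal_cdf u) x\<bar>} \<le> \<eta>"
proof -
  let ?\<xi> = "inv std_normal_cdf u"
  have "(\<lambda>n. icdf (p n) ?\<xi>) \<longlonglongrightarrow> std_normal_cdf ?\<xi>" by (rule filterlim_compose[OF icdf_tendsto p_lim])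
  then have "\<forall>\<^sub>F n in sequentially. dist (icdf (p n) ?\<xi>) u < \<eta> * \<epsilon>\<^sup>2"
    unfolding std_normal_cdf_inv[OF u] using \<epsilon> \<eta> by (intro tendstoD) auto
  then show ?thesis using eventually_ge_at_top[of 2] eventually_p_ge[of 2]
  proof eventually_elim
    case (elim n)
    interpret prob_space "U n" by (rule prob_space_usample)
    have p0: "p n > 0" using elim by linarith
    let ?y = "yq (p n) u"
    let ?D = "\<lambda>x. ez (p n) n ?y x - ez (p n) n ?\<xi> x"
    have y: "icdf (p n) ?y = u" using elim u by (intro icdf_yq) auto
    have "(LINT x|U n. (?D x)\<^sup>2) \<le> \<eta> * \<epsilon>\<^sup>2"
    proof (cases "?\<xi> \<le> ?y")
      case True
      then show ?thesis using ez_diff_second_moment[OF p0 elim(2) True] elim(1) y by (simp add: dist_real_def)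
    next
      case False
      then have "(LINT x|U n. (ez (p n) n ?\<xi> x - ez (p n) n ?y x)\<^sup>2) \<le> \<eta> * \<epsilon>\<^sup>2"
        using ez_diff_second_moment[OF p0 elim(2), of ?y ?\<xi>] elim(1) y by (simp add: dist_real_def)
      then show ?thesis by (subst power2_commute)
    qed
    have "measure (U n) {x \<in> space (U n). \<epsilon> < \<bar>?D x\<bar>} \<le> measure (U n) {x \<in> space (U n). \<epsilon>\<^sup>2 \<le> (?D x)\<^sup>2}"
    proof (rule finite_measure_mono)
      show "{x \<in> space (U n). \<epsilon> < \<bar>?D x\<bar>} \<subseteq> {x \<in> space (U n). \<epsilon>\<^sup>2 \<le> (?D x)\<^sup>2}"
      proof safe
        fix x assume "\<epsilon> < \<bar>?D x\<bar>"
        then have "\<epsilon>\<^sup>2 \<le> \<bar>?D x\<bar>\<^sup>2" using \<epsilon> by (intro power_mono) auto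
        then show "\<epsilon>\<^sup>2 \<le> (?D x)\<^sup>2" by simp
      qed
    qed measurable
    also have "... \<le> (LINT x|U n. (?D x)\<^sup>2) / \<epsilon>\<^sup>2"
      using integrable_ez_diff_power[OF elim(2)] \<epsilon> by (intro integral_Markov_inequality_measure[where A="space (U n)"]) auto
    also have "... \<le> \<eta>" using \<open>(LINT x|U n. (?D x)\<^sup>2) \<le> \<eta> * \<epsilon>\<^sup>2\<close> \<epsilon> by (simp add: divide_le_eq)
    finally show ?case .
  qed
qed

section \<open>Distribution function of the supremum over all levels\<close>

definition good :: "nat \<Rightarrow> real \<Rightarrow> sample_pts set" where
  "good n y = {x \<in> space (U n). \<forall>\<alpha>\<in>{- sqrt (p n)..sqrt (p n)}. \<bar>ez (p n) n \<alpha> x\<bar> \<le> y}"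

lemma sets_good: "p n \<ge> 2 \<Longrightarrow> n \<ge> 2 \<Longrightarrow> good n y \<in> sets (U n)"
  unfolding good_def by (intro right_continuous_sup_sets ez_right_continuous measurable_ez)

text \<open>Restricting the supremum to the levels \<open>qz K k\<close> enlarges the event,
  provided these lie in the range of the scaled inner products, as they do for large
  \<open>p n\<close>. \<open>K\<close> is chosen so that \<open>H K y\<close> is close to
  \<open>G y\<close>.\<close>

lemma good_upper:
  assumes y: "y \<ge> 0" and \<delta>: "\<delta> > 0"
  shows "\<forall>\<^sub>F n in sequentially. measure (alt n) (good n y) \<le> G y + \<delta>"
proof -
  have "\<forall>\<^sub>F K in sequentially. H K y < G y + \<delta> / 2" by (rule order_tendstoD[OF H_tendsto[OF y]]) (use \<delta> in simp)
  then obtain K where K: "H K y < G y + \<delta> / 2" by (auto simp: eventually_sequentially)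
  have "\<forall>\<^sub>F n in sequentially. measure (alt n) (fset n K y) < G y + \<delta>"
    by (rule order_tendstoD[OF fidi_sets_tendsto]) (use K \<delta> in simp)
  moreover have "\<forall>\<^sub>F n in sequentially. \<forall>k\<in>{..<2 ^ K - 1}. \<bar>qz K k\<bar> \<le> sqrt (p n)"
  proof (rule eventually_ball_finite)
    show "\<forall>k\<in>{..<2 ^ K - 1}. \<forall>\<^sub>F n in sequentially. \<bar>qz K k\<bar> \<le> sqrt (p n)"
    proof
      fix k
      show "\<forall>\<^sub>F n in sequentially. \<bar>qz K k\<bar> \<le> sqrt (p n)"
        using eventually_p_ge[of "nat \<lceil>\<bar>qz K k\<bar>\<^sup>2\<rceil>"]
      proof eventually_elim
        case (elim n)
        then have "\<bar>qz K k\<bar>\<^sup>2 \<le> real (p n)" by linarith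
        then show ?case by (rule real_le_rsqrt)
      qed
    qed
  qed simp
  ultimately show ?thesis
  proof eventually_elim
    case (elim n)
    interpret A: prob_space "alt n" by (rule prob_space_alt)
    have "qz K k \<in> {- sqrt (p n)..sqrt (p n)}" if "k \<in> {..<2 ^ K - 1}" for k using bspec[OF elim(2) that] by auto
    then have "good n y \<subseteq> fset n K y" unfolding good_def fset_def by blast
    then have "measure (alt n) (good n y) \<le> measure (alt n) (fset n K y)" using sets_fset by (intro A.finite_measure_mono) auto
    then show ?case using elim(1) by linarith
  qed
qed

text \<open>The gap \<open>z - y\<close> is split into three: one part for passing from normal to
  exact quantiles, two for chaining. Both exceptional events are small under uniform sampling, and
  contiguity makes them small under \<open>alt\<close>. The \<open>K\<close> prescribed by chaining
  is acceptable because \<open>G y \<le> H K y\<close> for every \<open>K\<close>.\<close>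

lemma good_lower:
  assumes y: "y \<ge> 0" and yz: "y < z" and \<delta>: "\<delta> > 0"
  shows "\<forall>\<^sub>F n in sequentially. G y - \<delta> \<le> measure (alt n) (good n z)"
proof -
  define \<epsilon> where "\<epsilon> = (z - y) / 3"
  have \<epsilon>: "\<epsilon> > 0" "z = y + \<epsilon> + 2 * \<epsilon>" using yz by (auto simp: \<epsilon>_def field_simps)
  have "\<delta> / 2 > 0" using \<delta> by simp
  from alt_contiguity[OF this] obtain \<eta> where \<eta>: "\<eta> > 0"
    and cont: "\<forall>\<^sub>F n in sequentially. \<forall>A\<in>sets (U n). measure (U n) A \<le> \<eta> \<longrightarrow> measure (alt n) A \<le> \<delta> / 2" by blast
  have "\<eta> / 2 > 0" using \<eta> by simp
  from chaining[OF \<epsilon>(1) this] obtain K where K: "\<And>p n. p \<ge> 2 \<Longrightarrow> n \<ge> 2 \<Longrightarrow> \<exists>D\<in>sets (usample p n). measure (usample p n) D \<le> \<eta> / 2 \<and>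
    (\<forall>x\<in>space (usample p n) - D. \<forall>A. (\<forall>j\<le>2 ^ K. \<bar>ez p n (yq p (real j / 2 ^ K)) x\<bar> \<le> A) \<longrightarrow>
      (\<forall>\<alpha>\<in>{- sqrt p..sqrt p}. \<bar>ez p n \<alpha> x\<bar> \<le> A + 2 * \<epsilon>))" by blast
  let ?E = "\<lambda>n k. {x \<in> space (U n). \<epsilon> < \<bar>ez (p n) n (yq (p n) (dyad K k)) x - ez (p n) n (qz K k) x\<bar>}"
  have "\<forall>\<^sub>F n in sequentially. \<forall>k\<in>{..<2 ^ K - 1}. measure (U n) (?E n k) \<le> \<eta> / 2 / 2 ^ K"
    unfolding qz_def using \<epsilon> \<eta> dyad_01[of _ K] by (intro eventually_ball_finite ballI ez_quantile_close) auto
  moreover have "\<forall>\<^sub>F n in sequentially. H K y - \<delta> / 2 < measure (alt n) (fset n K y)"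
    by (rule order_tendstoD[OF fidi_sets_tendsto]) (use \<delta> in simp)
  ultimately show ?thesis using cont eventually_ge_at_top[of 2] eventually_p_ge[of 2]
  proof eventually_elim
    case (elim n)
    interpret A: prob_space "alt n" by (rule prob_space_alt)
    interpret U: prob_space "U n" by (rule prob_space_usample)
    from K[OF elim(5,4)] obtain D where D: "D \<in> sets (U n)" "measure (U n) D \<le> \<eta> / 2"
      and ch: "\<And>x A \<alpha>. x \<in> space (U n) - D \<Longrightarrow> (\<And>j. j \<le> 2 ^ K \<Longrightarrow> \<bar>ez (p n) n (yq (p n) (real j / 2 ^ K)) x\<bar> \<le> A) \<Longrightarrow>
        \<alpha> \<in> {- sqrt (p n)..sqrt (p n)} \<Longrightarrow> \<bar>ez (p n) n \<alpha> x\<bar> \<le> A + 2 * \<epsilon>" by blast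
    define bad where "bad = D \<union> (\<Union>k\<in>{..<2 ^ K - 1}. ?E n k)"
    have E: "?E n k \<in> sets (U n)" for k by measurable
    then have E': "(\<Union>k\<in>{..<2 ^ K - 1}. ?E n k) \<in> sets (U n)" by (intro sets.finite_UN) auto
    have bad: "bad \<in> sets (U n)" using D E' by (auto simp: bad_def)
    have "measure (U n) (\<Union>k\<in>{..<2 ^ K - 1}. ?E n k) \<le> (\<Sum>k\<in>{..<2 ^ K - 1}. measure (U n) (?E n k))"
      using E by (intro U.finite_measure_subadditive_finite) auto
    also have "... \<le> (\<Sum>k\<in>{..<2 ^ K - 1 :: nat}. \<eta> / 2 / 2 ^ K)" using elim(1) by (intro sum_mono) auto
    also have "... = real (2 ^ K - 1) * (\<eta> / 2 / 2 ^ K)" by simp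
    also have "... \<le> 2 ^ K * (\<eta> / 2 / 2 ^ K)" using \<eta> by (intro mult_right_mono) (auto simp: of_nat_diff)
    also have "... = \<eta> / 2" by simp
    finally have "measure (U n) bad \<le> \<eta>" using measure_Un_le[OF D(1) E'] D(2) by (simp add: bad_def)
    then have ab: "measure (alt n) bad \<le> \<delta> / 2" using elim(3) bad by blast
    have sub: "fset n K y \<subseteq> good n z \<union> bad"
    proof
      fix x assume x: "x \<in> fset n K y"
      then have xs: "x \<in> space (U n)" by (simp add: fset_def)
      show "x \<in> good n z \<union> bad"
      proof (cases "x \<in> bad")
        case False
        have "\<bar>ez (p n) n \<alpha> x\<bar> \<le> z" if \<alpha>: "\<alpha> \<in> {- sqrt (p n)..sqrt (p n)}" for \<alpha> unfolding \<epsilon>(2)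
        proof (rule ch[OF _ _ \<alpha>])
          show "x \<in> space (U n) - D" using xs False by (simp add: bad_def)
          fix j :: nat assume j: "j \<le> 2 ^ K"
          show "\<bar>ez (p n) n (yq (p n) (real j / 2 ^ K)) x\<bar> \<le> y + \<epsilon>"
          proof (cases "j = 0 \<or> j = 2 ^ K")
            case True
            then have "real j / 2 ^ K = 0 \<or> real j / 2 ^ K = 1" by auto
            then show ?thesis using ez_endpoint[OF elim(5,4)] y \<epsilon> by simp
          next
            case jK: False
            \<comment> \<open>\<open>dyad K k\<close> has the numerator \<open>k + 1\<close>, so the
              interior grid point with numerator \<open>j\<close> has index
              \<open>j - 1\<close>.\<close>
            define k where "k = j - 1"
            have k: "k < 2 ^ K - 1" "real j / 2 ^ K = dyad K k" using j jK by (auto simp: k_def dyad_def One_nat_def)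
            have "\<bar>ez (p n) n (qz K k) x\<bar> \<le> y" using x k(1) by (simp add: fset_def)
            moreover have "\<not> \<epsilon> < \<bar>ez (p n) n (yq (p n) (dyad K k)) x - ez (p n) n (qz K k) x\<bar>"
              using False k(1) xs by (auto simp: bad_def)
            ultimately show ?thesis unfolding k(2) by linarith
          qed
        qed
        then show ?thesis using xs by (simp add: good_def)
      qed simp
    qed
    have g: "good n z \<in> sets (U n)" by (rule sets_good[OF elim(5,4)])
    have "measure (alt n) (fset n K y) \<le> measure (alt n) (good n z \<union> bad)" using sub g bad by (intro A.finite_measure_mono) auto
    also have "... \<le> measure (alt n) (good n z) + measure (alt n) bad" using g bad by (intro measure_Un_le) auto
    finally show ?case using ab elim(2) G_le_H[of y K] by linarith
  qed
qed

end

section \<open>The statistic and the limit theorem\<close>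

definition tproc :: "nat \<Rightarrow> nat \<Rightarrow> real \<Rightarrow> sample_pts \<Rightarrow> real" where
  "tproc p n t x = 2 / (real n * (real n - 1)) * usum (\<lambda>a b. indicat_real {..t} (dot p a b)) n x - m_unif p t"

lemma sum_pairs_eq_usum:
  "(\<Sum>(i, j)\<in>{(i, j). 1 \<le> i \<and> i < j \<and> j \<le> n}. h (x i) (x j)) = usum h n x"
proof -
  have "usum h n x = (\<Sum>(j, i)\<in>(SIGMA j:{1..n}. {1..<j}). h (x i) (x j))" unfolding usum_def by (rule sum.Sigma) auto
  also have "... = (\<Sum>(i, j)\<in>{(i, j). 1 \<le> i \<and> i < j \<and> j \<le> n}. h (x i) (x j))"
    by (rule sum.reindex_bij_witness[where i="\<lambda>(i, j). (j, i)" and j="\<lambda>(j, i). (i, j)"]) auto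
  finally show ?thesis by simp
qed

lemma m_unif_01: "0 \<le> m_unif p t" "m_unif p t \<le> 1"
proof -
  interpret P: pair_prob_space "\<mu> p" "\<mu> p" ..
  show "0 \<le> m_unif p t" "m_unif p t \<le> 1" by (auto simp: m_unif_def)
qed

lemma T_stat_eq: "T_stat p n x = (SUP t\<in>{-1..1}. \<bar>tproc p n t x\<bar>)" unfolding T_stat_def tproc_def sum_pairs_eq_usum[symmetric]
  by (intro SUP_cong refl arg_cong[where f=abs] arg_cong2[where f="(-)"] arg_cong2[where f="(*)"] sum.cong) (auto simp: indicator_def)

lemma tproc_cong: "(\<And>i. i \<in> {1..n} \<Longrightarrow> x i = y i) \<Longrightarrow> tproc p n t x = tproc p n t y"
  unfolding tproc_def usum_def by (intro arg_cong2[where f="(-)"] arg_cong2[where f="(*)"] sum.cong refl) auto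

lemma T_stat_le_iff: "T_stat p n x \<le> y \<longleftrightarrow> (\<forall>t\<in>{-1..1}. \<bar>tproc p n t x\<bar> \<le> y)"
proof -
  have "bdd_above ((\<lambda>t. \<bar>tproc p n t x\<bar>) ` {-1..1})"
  proof (rule bdd_aboveI2)
    fix t
    have "\<bar>usum (\<lambda>a b. indicat_real {..t} (dot p a b)) n x\<bar> \<le> usum (\<lambda>a b. 1) n x"
      using usum_mono[of "\<lambda>a b. 0" "\<lambda>a b. indicat_real {..t} (dot p a b)" n x]
        usum_mono[of "\<lambda>a b. indicat_real {..t} (dot p a b)" "\<lambda>a b. 1" n x] by (simp add: usum_const indicator_def)
    then have "\<bar>2 / (real n * (real n - 1)) * usum (\<lambda>a b. indicat_real {..t} (dot p a b)) n x\<bar> \<le> \<bar>2 / (real n * (real n - 1))\<bar> * usum (\<lambda>a b. 1) n x"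
      unfolding abs_mult by (rule mult_left_mono) simp
    then show "\<bar>tproc p n t x\<bar> \<le> \<bar>2 / (real n * (real n - 1))\<bar> * usum (\<lambda>a b. 1) n x + 1"
      using m_unif_01[of p t] unfolding tproc_def by linarith
  qed
  then show ?thesis unfolding T_stat_eq by (subst cSUP_le_iff) auto
qed

lemma sN_pos: "n \<ge> 2 \<Longrightarrow> sN n > 0" by (simp add: sN_def)

definition tset :: "nat \<Rightarrow> nat \<Rightarrow> real \<Rightarrow> sample_pts set" where
  "tset p n y = {x \<in> space (usample p n). \<forall>t\<in>{-1..1}. \<bar>sN n * tproc p n t x\<bar> \<le> y}"

lemma scaled_T_stat_le_iff:
  assumes n: "n \<ge> 2"
  shows "sN n * T_stat p n x \<le> y \<longleftrightarrow> (\<forall>t\<in>{-1..1}. \<bar>sN n * tproc p n t x\<bar> \<le> y)"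
proof -
  have s: "sN n > 0" by (rule sN_pos[OF n])
  have "sN n * T_stat p n x \<le> y \<longleftrightarrow> T_stat p n x \<le> y / sN n" using s by (simp add: pos_le_divide_eq mult.commute)
  also have "... \<longleftrightarrow> (\<forall>t\<in>{-1..1}. \<bar>sN n * tproc p n t x\<bar> \<le> y)"
    unfolding T_stat_le_iff using s by (simp add: pos_le_divide_eq mult.commute abs_mult)
  finally show ?thesis .
qed

lemma m_unif_eq_icdf:
  assumes p: "p > 0"
  shows "m_unif p t = icdf p (sqrt p * t)"
proof -
  interpret P: pair_prob_space "\<mu> p" "\<mu> p" ..
  let ?A = "{(x, y) \<in> space (rvec p \<Otimes>\<^sub>M rvec p). dot p x y \<le> t}"
  have sp: "space (\<mu> p) = space (rvec p)" by (rule sets_eq_imp_space_eq[OF sets_unif_sphere])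
  have I: "integrable (\<mu>2 p) (\<lambda>z. indicat_real {..t} (dot p (fst z) (snd z)))"
    by (rule P.P.integrable_bounded[where C=1]) (auto simp: indicator_def)
  have "m_unif p t = (LINT z|\<mu>2 p. indicat_real ?A z)"
  proof -
    have "?A \<subseteq> space (\<mu>2 p)" by (auto simp: space_pair_measure sp)
    then show ?thesis by (simp add: m_unif_def Int_absorb2)
  qed
  also have "... = (LINT z|\<mu>2 p. indicat_real {..t} (dot p (fst z) (snd z)))"
    by (intro lint_cong refl) (auto simp: space_pair_measure sp indicator_def)
  also have "... = (LINT x|\<mu> p. LINT y|\<mu> p. indicat_real {..t} (dot p x y))" using P.integral_fst'[OF I] by simp
  also have "... = (LINT x|\<mu> p. measure (slaw p) {..t})"
  proof (rule integral_cong_AE)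
    show "AE x in \<mu> p. (LINT y|\<mu> p. indicat_real {..t} (dot p x y)) = measure (slaw p) {..t}" using AE_unif_sphere[OF p]
    proof eventually_elim
      fix x assume x: "x \<in> unit_sphere p"
      note [measurable] = unit_sphere_space[OF x]
      have "(LINT y|\<mu> p. indicat_real {..t} (dot p x y)) = (LINT y|\<mu> p. indicat_real {..t} (dot p y x))" by (simp only: dot_commute)
      also have "... = (LINT s|distr (\<mu> p) borel (\<lambda>y. dot p y x). indicat_real {..t} s)" by (rule integral_distr[symmetric]) measurable
      also have "... = measure (slaw p) {..t}" unfolding distr_dot_sphere[OF x] by simp
      finally show "(LINT y|\<mu> p. indicat_real {..t} (dot p x y)) = measure (slaw p) {..t}" .
    qed
  qed measurable
  also have "... = measure (slaw p) {..t}" using U.prob_space by simp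
  also have "{..t} = {s. sqrt p * s \<le> sqrt p * t}" using p by auto
  finally show ?thesis by (simp add: icdf_def)
qed

text \<open>On the sphere \<open>svec\<close> is the identity, so the raw inner products and
  \<open>ip\<close> agree. The level \<open>t\<close> corresponds to \<open>sqrt p * t\<close>
  because \<open>ez\<close> works with scaled inner products.\<close>

lemma tproc_eq_ez:
  assumes p: "p > 0" and n: "n \<ge> 2" and x: "\<forall>i\<in>{1..n}. x i \<in> unit_sphere p"
  shows "sN n * tproc p n t x = ez p n (sqrt p * t) x"
proof -
  have u: "usum (\<lambda>a b. indicat_real {..t} (dot p a b)) n x
    = usum (\<lambda>a b. indicat_real {..sqrt p * t} (sqrt p * ip p a b)) n x"
    unfolding usum_def using x p by (intro sum.cong refl) (auto simp: ip_def svec_def indicator_def)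
  have "sN n * (2 / (real n * (real n - 1))) = nrm n" unfolding nrm_mult[OF n, symmetric] using n by simp
  then show ?thesis unfolding tproc_def ez_eq[OF n] u m_unif_eq_icdf[OF p] right_diff_distrib mult.assoc[symmetric] by simp
qed

lemma sets_tset:
  assumes p: "p \<ge> 2"
  shows "tset p n y \<in> sets (usample p n)" unfolding tset_def
proof (rule right_continuous_sup_sets)
  fix t
  have "(\<lambda>x. dot p (x i) (x j)) \<in> borel_measurable (usample p n)" if "j \<in> {1..n}" "i \<in> {1..<j}" for i j
  proof -
    have "(\<lambda>x. x i) \<in> usample p n \<rightarrow>\<^sub>M \<mu> p" "(\<lambda>x. x j) \<in> usample p n \<rightarrow>\<^sub>M \<mu> p"
      using that by (auto intro!: measurable_component_singleton)
    then have "(\<lambda>x. x i) \<in> usample p n \<rightarrow>\<^sub>M rvec p" "(\<lambda>x. x j) \<in> usample p n \<rightarrow>\<^sub>M rvec p"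
      by (auto simp: measurable_cong_sets[OF refl sets_unif_sphere])
    then show ?thesis by (rule measurable_dot)
  qed
  note [measurable] = this
  show "(\<lambda>x. sN n * tproc p n t x) \<in> borel_measurable (usample p n)" unfolding tproc_def usum_def by measurable
  fix x
  have "isCont (\<lambda>t. icdf p (sqrt p * t)) t"
    by (rule isCont_o2[where f="\<lambda>t. sqrt p * t", OF _ continuous_icdf[OF p]]) (intro continuous_intros)
  then have "((\<lambda>t. m_unif p t) \<longlongrightarrow> m_unif p t) (at_right t)"
    using p by (simp add: m_unif_eq_icdf isCont_def filterlim_at_split)
  then show "((\<lambda>s. sN n * tproc p n s x) \<longlongrightarrow> sN n * tproc p n t x) (at_right t)"
    unfolding tproc_def usum_def by (intro tendsto_intros indicator_right_continuous)
qed

lemma tset_invariant: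
  assumes v: "v \<in> unit_sphere p" and x: "x \<in> space (usample p n)"
  shows "srefl p n v x \<in> tset p n y \<longleftrightarrow> x \<in> tset p n y"
proof -
  have "tproc p n t (srefl p n v x) = tproc p n t x" for t unfolding tproc_def usum_def
    by (intro arg_cong2[where f="(-)"] arg_cong2[where f="(*)"] sum.cong refl) (auto simp: srefl_def dot_hrefl_hrefl[OF v])
  moreover have "srefl p n v x \<in> space (usample p n)" using measurable_space[OF measurable_srefl[OF v] x] .
  ultimately show ?thesis using x by (simp add: tset_def)
qed

context fvml_bridge
begin

text \<open>\<open>tset\<close> is stated in raw inner products and is therefore invariant under
  reflections. On samples from the sphere, hence almost surely, it coincides with
  \<open>good\<close>, the event of the limit theory.\<close>

lemma measure_FvML_tset:
  assumes p: "p n \<ge> 2" and n: "n \<ge> 2" and \<theta>: "\<theta> \<in> unit_sphere (p n)"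
  shows "measure (PiM {1..n} (\<lambda>_. FvML (p n) (\<kappa> n) \<theta>)) (tset (p n) n y) = measure (alt n) (good n y)"
proof -
  have p0: "p n > 0" using p by simp
  note [measurable] = sets_tset[OF p, of n y] sets_good[OF p n, of y]
  have sq: "\<alpha> \<in> {- sqrt (p n)..sqrt (p n)} \<longleftrightarrow> (\<exists>t\<in>{-1..1}. \<alpha> = sqrt (p n) * t)" for \<alpha>
  proof
    assume "\<alpha> \<in> {- sqrt (p n)..sqrt (p n)}"
    then show "\<exists>t\<in>{-1..1}. \<alpha> = sqrt (p n) * t"
      using p0 by (intro bexI[of _ "\<alpha> / sqrt (p n)"]) (auto simp: divide_le_eq le_divide_eq)
  next
    assume "\<exists>t\<in>{-1..1}. \<alpha> = sqrt (p n) * t"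
    then obtain t where "-1 \<le> t" "t \<le> 1" and \<alpha>: "\<alpha> = sqrt (p n) * t" by auto
    then have "sqrt (p n) * (-1) \<le> sqrt (p n) * t" "sqrt (p n) * t \<le> sqrt (p n) * 1"
      using mult_left_mono[of "-1" t "sqrt (p n)"] mult_left_mono[of t 1 "sqrt (p n)"] by auto
    then show "\<alpha> \<in> {- sqrt (p n)..sqrt (p n)}" by (simp add: \<alpha>)
  qed
  have img: "{- sqrt (p n)..sqrt (p n)} = (\<lambda>t. sqrt (p n) * t) ` {-1..1}" by (rule set_eqI) (simp only: sq image_iff)
  have "measure (PiM {1..n} (\<lambda>_. FvML (p n) (\<kappa> n) \<theta>)) (tset (p n) n y) = (LINT x|U n. indicator (tset (p n) n y) x * L n x)"
    by (rule measure_PiM_FvML_eq_lik[OF \<theta> sets_tset[OF p] tset_invariant])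
  also have "... = (LINT x|U n. indicator (good n y) x * L n x)"
  proof (rule integral_cong_AE)
    show "AE x in U n. indicat_real (tset (p n) n y) x * L n x = indicat_real (good n y) x * L n x" using AE_usample_sphere[OF p0] AE_space
    proof eventually_elim
      fix x assume xs: "x \<in> space (U n)" and x: "\<forall>i\<in>{1..n}. x i \<in> unit_sphere (p n)"
      have "x \<in> tset (p n) n y \<longleftrightarrow> x \<in> good n y"
        unfolding tset_def good_def mem_Collect_eq tproc_eq_ez[OF p0 n x] img by simp
      then show "indicat_real (tset (p n) n y) x * L n x = indicat_real (good n y) x * L n x" by (simp add: indicator_def)
    qed
  qed measurable
  also have "... = measure (alt n) (good n y)" by (rule measure_alt[symmetric]) measurable
  finally show ?thesis .
qed

lemma Y_sup_le_iff:
  assumes \<omega>: "\<omega> \<in> space P"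
  shows "(SUP t\<in>{0..1}. \<bar>Y t \<omega>\<bar>) \<le> y \<longleftrightarrow> (\<forall>t\<in>{0..1}. \<bar>Y t \<omega>\<bar> \<le> y)"
proof -
  have co: "continuous_on {0..1} (\<lambda>t. B t \<omega>)" using bridge \<omega> by (auto simp: brownian_bridge_def)
  then have "bounded ((\<lambda>t. B t \<omega>) ` {0..1})" by (intro compact_imp_bounded compact_continuous_image) auto
  then obtain b where b: "\<And>t. t \<in> {0..1} \<Longrightarrow> \<bar>B t \<omega>\<bar> \<le> b" unfolding bounded_iff by fastforce
  have "bdd_above ((\<lambda>t. \<bar>Y t \<omega>\<bar>) ` {0..1})"
  proof (rule bdd_aboveI2)
    fix t :: real assume t: "t \<in> {0..1}"
    have "\<bar>c * phi_quantile t\<bar> \<le> \<bar>c\<bar>" using phi_quantile_bounds[of t] by (simp add: abs_mult mult_left_le)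
    then show "\<bar>Y t \<omega>\<bar> \<le> b + \<bar>c\<bar>" using b[OF t] unfolding Y_def by linarith
  qed
  then show ?thesis by (subst cSUP_le_iff) auto
qed

lemma measurable_Y_sup: "(\<lambda>\<omega>. SUP t\<in>{0..1}. \<bar>Y t \<omega>\<bar>) \<in> borel_measurable P"
proof (rule borel_measurable_iff_le[THEN iffD2], rule allI)
  fix y
  have "{\<omega> \<in> space P. (SUP t\<in>{0..1}. \<bar>Y t \<omega>\<bar>) \<le> y} = {\<omega> \<in> space P. \<forall>t\<in>{0..1}. \<bar>Y t \<omega>\<bar> \<le> y}"
    using Y_sup_le_iff by blast
  then show "{\<omega> \<in> space P. (SUP t\<in>{0..1}. \<bar>Y t \<omega>\<bar>) \<le> y} \<in> sets P" using sets_Y_sup by simp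
qed

lemma cdf_Y_sup: "cdf (distr P borel (\<lambda>\<omega>. SUP t\<in>{0..1}. \<bar>Y t \<omega>\<bar>)) = G"
proof
  fix y
  have "(\<lambda>\<omega>. SUP t\<in>{0..1}. \<bar>Y t \<omega>\<bar>) -` {..y} \<inter> space P = {\<omega> \<in> space P. \<forall>t\<in>{0..1}. \<bar>Y t \<omega>\<bar> \<le> y}"
    using Y_sup_le_iff by auto
  then show "cdf (distr P borel (\<lambda>\<omega>. SUP t\<in>{0..1}. \<bar>Y t \<omega>\<bar>)) y = G y"
    unfolding cdf_def G_def by (subst measure_distr[OF measurable_Y_sup]) auto
qed

text \<open>For \<open>y < 0\<close> both sides vanish. Otherwise \<open>good_upper\<close> gives
  one half, and \<open>good_lower\<close> at a point slightly below \<open>y\<close>, together with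
  continuity of \<open>G\<close> from the left, gives the other.\<close>

lemma good_tendsto:
  assumes co: "isCont G y"
  shows "(\<lambda>n. measure (alt n) (good n y)) \<longlonglongrightarrow> G y"
proof (cases "y < 0")
  case True
  have "good n y = {}" for n
  proof -
    have "\<not> \<bar>ez (p n) n 0 x\<bar> \<le> y" for x using True by simp
    moreover have "0 \<in> {- sqrt (p n)..sqrt (p n)}" by simp
    ultimately show ?thesis unfolding good_def by blast
  qed
  moreover have "G y = 0"
  proof -
    have "\<not> \<bar>Y 0 \<omega>\<bar> \<le> y" for \<omega> using True by simp
    moreover have "(0::real) \<in> {0..1}" by simp
    ultimately have "{\<omega> \<in> space P. \<forall>t\<in>{0..1}. \<bar>Y t \<omega>\<bar> \<le> y} = {}" by blast
    then show ?thesis unfolding G_def by (simp only: measure_empty)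
  qed
  ultimately show ?thesis by simp
next
  case False
  show ?thesis
  proof (rule tendstoI)
    fix \<epsilon> :: real assume \<epsilon>: "\<epsilon> > 0"
    have up: "\<forall>\<^sub>F n in sequentially. measure (alt n) (good n y) \<le> G y + \<epsilon> / 2"
      using False \<epsilon> by (intro good_upper) auto
    have "(G \<longlongrightarrow> G y) (at_left y)" using co by (simp add: isCont_def filterlim_at_split)
    then have "\<forall>\<^sub>F z in at_left y. G y - \<epsilon> / 2 < G z" using \<epsilon> by (intro order_tendstoD) auto
    then obtain d where d: "d < y" "\<And>z. d < z \<Longrightarrow> z < y \<Longrightarrow> G y - \<epsilon> / 2 < G z"
      unfolding eventually_at_left_field by auto
    \<comment> \<open>The midpoint is placed so that \<open>d < z < y\<close>; for
      \<open>y > 0\<close> it is nonnegative, as \<open>good_lower\<close> demands, and for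
      \<open>y = 0\<close> it is negative, where \<open>G\<close> is 0.\<close>
    define z where "z = (max d (if y = 0 then -1 else 0) + y) / 2"
    have z: "d < z" "z < y" using d(1) False by (auto simp: z_def max_def)
    have Gz: "G y - \<epsilon> / 2 < G z" by (rule d(2)[OF z])
    have low: "\<forall>\<^sub>F n in sequentially. G z - \<epsilon> / 4 \<le> measure (alt n) (good n y)"
    proof (cases "z \<ge> 0")
      case True
      then show ?thesis using z \<epsilon> by (intro good_lower) auto
    next
      case zneg: False
      have "\<not> \<bar>Y 0 \<omega>\<bar> \<le> z" for \<omega> using zneg by simp
      moreover have "(0::real) \<in> {0..1}" by simp
      ultimately have "{\<omega> \<in> space P. \<forall>t\<in>{0..1}. \<bar>Y t \<omega>\<bar> \<le> z} = {}" by blast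
      then have "G z = 0" unfolding G_def by (simp only: measure_empty)
      moreover have "- (\<epsilon> / 4) \<le> measure (alt n) (good n y)" for n using measure_nonneg[of "alt n" "good n y"] \<epsilon> by linarith
      ultimately show ?thesis by simp
    qed
    show "\<forall>\<^sub>F n in sequentially. dist (measure (alt n) (good n y)) (G y) < \<epsilon>"
      using up low by eventually_elim (use Gz \<epsilon> in \<open>simp add: dist_real_def abs_less_iff\<close>)
  qed
qed

end

lemma distr_sample_PiM:
  fixes X :: "nat \<Rightarrow> 'a \<Rightarrow> nat \<Rightarrow> real"
  assumes M: "prob_space M" and n: "n \<ge> 1"
    and indep: "prob_space.indep_vars M (\<lambda>_. rvec p) X {1..n}"
    and law: "\<And>i. i \<in> {1..n} \<Longrightarrow> distr M (rvec p) (X i) = F"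
  shows "(\<lambda>\<omega>. \<lambda>i\<in>{1..n}. X i \<omega>) \<in> M \<rightarrow>\<^sub>M PiM {1..n} (\<lambda>_. rvec p)"
    "distr M (PiM {1..n} (\<lambda>_. rvec p)) (\<lambda>\<omega>. \<lambda>i\<in>{1..n}. X i \<omega>) = PiM {1..n} (\<lambda>_. F)"
proof -
  interpret prob_space M by (rule M)
  have X: "X i \<in> M \<rightarrow>\<^sub>M rvec p" if "i \<in> {1..n}" for i using indep that by (auto simp: indep_vars_def)
  show "(\<lambda>\<omega>. \<lambda>i\<in>{1..n}. X i \<omega>) \<in> M \<rightarrow>\<^sub>M PiM {1..n} (\<lambda>_. rvec p)"
    using X by (intro measurable_restrict) auto
  have ne: "{1..n} \<noteq> {}" using n by auto
  have "distr M (PiM {1..n} (\<lambda>_. rvec p)) (\<lambda>\<omega>. \<lambda>i\<in>{1..n}. X i \<omega>) = PiM {1..n} (\<lambda>i. distr M (rvec p) (X i))"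
    by (rule indep_vars_iff_distr_eq_PiM'[OF ne X, THEN iffD1, OF _ indep])
  also have "... = PiM {1..n} (\<lambda>_. F)" by (rule PiM_cong[OF refl law])
  finally show "distr M (PiM {1..n} (\<lambda>_. rvec p)) (\<lambda>\<omega>. \<lambda>i\<in>{1..n}. X i \<omega>) = PiM {1..n} (\<lambda>_. F)" .
qed

text \<open>The sublevel sets of the scaled statistic are preimages of \<open>tset\<close> under the
  sample vector. This yields at once measurability of a supremum over uncountably many levels and
  its distribution function.\<close>

lemma cdf_scaled_T_stat:
  fixes X :: "nat \<Rightarrow> 'a \<Rightarrow> nat \<Rightarrow> real"
  assumes M: "prob_space M" and n: "n \<ge> 2" and p: "p \<ge> 2"
    and indep: "prob_space.indep_vars M (\<lambda>_. rvec p) X {1..n}"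
    and law: "\<And>i. i \<in> {1..n} \<Longrightarrow> distr M (rvec p) (X i) = F"
  shows "cdf (distr M borel (\<lambda>\<omega>. sN n * T_stat p n (\<lambda>i. X i \<omega>))) y = measure (PiM {1..n} (\<lambda>_. F)) (tset p n y)"
proof -
  have "n \<ge> 1" using n by simp
  let ?V = "\<lambda>\<omega>. \<lambda>i\<in>{1..n}. X i \<omega>"
  have X: "?V \<in> M \<rightarrow>\<^sub>M PiM {1..n} (\<lambda>_. rvec p)" "distr M (PiM {1..n} (\<lambda>_. rvec p)) ?V = PiM {1..n} (\<lambda>_. F)"
    by (rule distr_sample_PiM[OF M \<open>n \<ge> 1\<close> indep law]; assumption)+
  have eq: "sN n * T_stat p n (\<lambda>i. X i \<omega>) \<le> y \<longleftrightarrow> ?V \<omega> \<in> tset p n y" if "\<omega> \<in> space M" for \<omega> y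
  proof -
    have "?V \<omega> \<in> space (usample p n)" using measurable_space[OF X(1) that] by (simp add: sets_eq_imp_space_eq[OF sets_usample])
    moreover have "tproc p n t (\<lambda>i. X i \<omega>) = tproc p n t (?V \<omega>)" for t by (rule tproc_cong) simp
    ultimately show ?thesis unfolding scaled_T_stat_le_iff[OF n] by (simp add: tset_def)
  qed
  have t: "tset p n y \<in> sets (PiM {1..n} (\<lambda>_. rvec p))" for y using sets_tset[OF p] unfolding sets_usample .
  have vim: "{\<omega> \<in> space M. sN n * T_stat p n (\<lambda>i. X i \<omega>) \<le> y} = ?V -` tset p n y \<inter> space M" for y
    using eq by blast
  have meas: "(\<lambda>\<omega>. sN n * T_stat p n (\<lambda>i. X i \<omega>)) \<in> borel_measurable M"
  proof (rule borel_measurable_iff_le[THEN iffD2], rule allI)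
    show "{\<omega> \<in> space M. sN n * T_stat p n (\<lambda>i. X i \<omega>) \<le> y} \<in> sets M" for y
      unfolding vim by (rule measurable_sets[OF X(1) t])
  qed
  have "cdf (distr M borel (\<lambda>\<omega>. sN n * T_stat p n (\<lambda>i. X i \<omega>))) y = measure M {\<omega> \<in> space M. sN n * T_stat p n (\<lambda>i. X i \<omega>) \<le> y}"
    unfolding cdf_def by (subst measure_distr[OF meas]) (auto intro!: arg_cong[where f="measure M"])
  also have "... = measure (PiM {1..n} (\<lambda>_. F)) (tset p n y)" unfolding vim X(2)[symmetric] by (rule measure_distr[OF X(1) t, symmetric])
  finally show ?thesis .
qed

theorem proposition5:
  fixes M :: "nat \<Rightarrow> 'a measure"
    and X :: "nat \<Rightarrow> nat \<Rightarrow> 'a \<Rightarrow> nat \<Rightarrow> real"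
    and p :: "nat \<Rightarrow> nat"
    and \<theta> :: "nat \<Rightarrow> nat \<Rightarrow> real"
    and \<kappa> \<tau>s :: "nat \<Rightarrow> real"
    and \<tau> :: real
    and P :: "'b measure"
    and B :: "real \<Rightarrow> 'b \<Rightarrow> real"
  assumes p_lim: "filterlim p at_top sequentially"
    and tau_lim: "\<tau>s \<longlonglongrightarrow> \<tau>"
    and tau_pos: "\<tau> > 0"
    and kappa: "\<And>n. n \<ge> 1 \<Longrightarrow> \<kappa> n = \<tau>s n * real (p n) powr (3/4) / sqrt (real n)"
    and kappa_pos: "\<And>n. n \<ge> 1 \<Longrightarrow> \<kappa> n > 0"
    and theta: "\<And>n. n \<ge> 1 \<Longrightarrow> \<theta> n \<in> unit_sphere (p n)"
    and prob: "\<And>n. n \<ge> 1 \<Longrightarrow> prob_space (M n)"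
    and indep: "\<And>n. n \<ge> 1 \<Longrightarrow>
      prob_space.indep_vars (M n) (\<lambda>_. rvec (p n)) (X n) {1..n}"
    and law: "\<And>n i. n \<ge> 1 \<Longrightarrow> i \<in> {1..n} \<Longrightarrow>
      distr (M n) (rvec (p n)) (X n i) = FvML (p n) (\<kappa> n) (\<theta> n)"
    and bridge: "brownian_bridge P B"
  shows "weak_conv_m
    (\<lambda>n. distr (M n) borel
       (\<lambda>\<omega>. sqrt (real n * (real n - 1) / 2) * T_stat (p n) n (\<lambda>i. X n i \<omega>)))
    (distr P borel (\<lambda>\<omega>. SUP t\<in>{0..1}. \<bar>B t \<omega> - \<tau>\<^sup>2 / sqrt 2 * phi_quantile t\<bar>))"
proof -
  interpret fvml_bridge p \<tau>s \<kappa> \<tau> P B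
    by unfold_locales (fact p_lim tau_lim tau_pos kappa bridge)+
  have lim: "(\<lambda>\<omega>. SUP t\<in>{0..1}. \<bar>B t \<omega> - \<tau>\<^sup>2 / sqrt 2 * phi_quantile t\<bar>) = (\<lambda>\<omega>. SUP t\<in>{0..1}. \<bar>Y t \<omega>\<bar>)"
    by (simp only: Y_def c_def)
  show ?thesis
    unfolding weak_conv_m_def weak_conv_def lim cdf_Y_sup sN_def[symmetric]
  proof (intro allI impI)
    fix y assume "isCont G y"
    then have "(\<lambda>n. measure (alt n) (good n y)) \<longlonglongrightarrow> G y" by (rule good_tendsto)
    moreover have "\<forall>\<^sub>F n in sequentially. measure (alt n) (good n y)
        = cdf (distr (M n) borel (\<lambda>\<omega>. sN n * T_stat (p n) n (\<lambda>i. X n i \<omega>))) y"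
      using eventually_ge_at_top[of 2] eventually_p_ge[of 2]
    proof eventually_elim
      case (elim n)
      then have n: "n \<ge> 1" by simp
      have "cdf (distr (M n) borel (\<lambda>\<omega>. sN n * T_stat (p n) n (\<lambda>i. X n i \<omega>))) y
          = measure (PiM {1..n} (\<lambda>_. FvML (p n) (\<kappa> n) (\<theta> n))) (tset (p n) n y)"
        by (rule cdf_scaled_T_stat[OF prob[OF n] elim indep[OF n] law[OF n]])
      then show ?case
        using measure_FvML_tset[OF elim(2,1) theta[OF n]] by simp
    qed
    ultimately show "(\<lambda>n. cdf (distr (M n) borel (\<lambda>\<omega>. sN n * T_stat (p n) n (\<lambda>i. X n i \<omega>))) y) \<longlonglongrightarrow> G y"
      by (rule Lim_transform_eventually)
  qed
qed

end
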